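(* Assume (g1), (g2), (g3) and (g4). Then for every $m>0$ the problem $(P_m)$ has a solution $(\mu,u)$ with $\mu>0$ and $u\in H^s_r(\mathbb R^N)$.
   Context: Let $N\ge 2$ and $s\in(0,1)$. $H^s(\mathbb R^N)=\{u\in L^2(\mathbb R^N):\int|\xi|^{2s}|\mathcal F u(\xi)|^2\,d\xi<\infty\}$ with norm $\|u\|_{H^s}^2=\|(-\Delta)^{s/2}u\|_2^2+\|u\|_2^2$, where $\mathcal F$ is the Fourier transform and $(-\Delta)^{s/2}u=\mathcal F^{-1}(|\xi|^{s}\mathcal F u)$; $H^s_r(\mathbb R^N)$ is its closed subspace of radially symmetric functions. Let $g\in C(\mathbb R,\mathbb R)$, $G(t)=\int_0^t g(\tau)\,d\tau$, and $p=1+\frac{4s}{N}$. Hypotheses: (g1) $g$ is continuous and $\lim_{t\to0}g(t)/t=0$; (g2) $\lim_{|t|\to\infty}g(t)/|t|^{p}=0$; (g3) there is $t_0>0$ with $G(t_0)>0$; (g4) $\lim_{t\to0}\frac{g(t)}{|t|^{4s/N}t}=+\infty$. For $m>0$, a solution of problem $(P_m)$ is a pair $(\mu,u)\in\mathbb R\times H^s_r(\mathbb R^N)$ such that $\int_{\mathbb R^N}(-\Delta)^{s/2}u\,(-\Delta)^{s/2}\varphi+\mu u\varphi\,dx=\int_{\mathbb R^N}g(u)\varphi\,dx$ for all $\varphi\in H^s_r(\mathbb R^N)$ and $\int_{\mathbb R^N}u^2\,dx=m$. *)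

theory Defs
  imports "HOL-Analysis.Analysis"
begin

text \<open>Space R^N is modelled by a Euclidean space type 'a with N = DIM('a).
  Fourier transform convention (unitary, angular frequency):
  F u (xi) = (2 pi)^(-N/2) int exp(-i x.xi) u(x) dx, extended to L^2 by
  L^2-limits of transforms of the truncations u * 1_{ball 0 R}, R -> infinity.\<close>

definition L2 :: "('a::euclidean_space \<Rightarrow> complex) \<Rightarrow> bool" where
  "L2 v \<longleftrightarrow> v \<in> borel_measurable lebesgue \<and> integrable lebesgue (\<lambda>x. (cmod (v x))\<^sup>2)"

definition fourier_trunc ::
  "real \<Rightarrow> ('a::euclidean_space \<Rightarrow> complex) \<Rightarrow> real \<Rightarrow> 'a \<Rightarrow> complex" where
  "fourier_trunc sg u R \<xi> =
     complex_of_real ((2 * pi) powr (- real DIM('a) / 2)) *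
     (LINT x|lebesgue. indicator (ball 0 R) x *\<^sub>R
        (exp (complex_of_real sg * \<i> * complex_of_real (x \<bullet> \<xi>)) * u x))"

definition is_L2_transform ::
  "real \<Rightarrow> ('a::euclidean_space \<Rightarrow> complex) \<Rightarrow> ('a \<Rightarrow> complex) \<Rightarrow> bool" where
  "is_L2_transform sg u v \<longleftrightarrow> L2 v \<and>
     ((\<lambda>R. \<integral>\<^sup>+ \<xi>. ennreal ((cmod (v \<xi> - fourier_trunc sg u R \<xi>))\<^sup>2) \<partial>lebesgue)
        \<longlongrightarrow> 0) at_top"

text \<open>Fourier transform and inverse Fourier transform on L^2 (determined a.e.).\<close>
definition fourier :: "('a::euclidean_space \<Rightarrow> complex) \<Rightarrow> 'a \<Rightarrow> complex" where
  "fourier u = (SOME v. is_L2_transform (-1) u v)"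

definition inv_fourier :: "('a::euclidean_space \<Rightarrow> complex) \<Rightarrow> 'a \<Rightarrow> complex" where
  "inv_fourier v = (SOME u. is_L2_transform 1 v u)"

text \<open>(-Delta)^(s/2) u = F^{-1}(|xi|^s F u), for real-valued u (the result is
  real a.e.; we take the real part).\<close>
definition frac_lap_half :: "real \<Rightarrow> ('a::euclidean_space \<Rightarrow> real) \<Rightarrow> 'a \<Rightarrow> real" where
  "frac_lap_half s u = (\<lambda>x. Re (inv_fourier
      (\<lambda>\<xi>. complex_of_real (norm \<xi> powr s) * fourier (\<lambda>y. complex_of_real (u y)) \<xi>) x))"

definition Hs :: "real \<Rightarrow> ('a::euclidean_space \<Rightarrow> real) set" where
  "Hs s = {u. u \<in> borel_measurable lebesgue \<and> integrable lebesgue (\<lambda>x. (u x)\<^sup>2) \<and>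
     integrable lebesgue (\<lambda>\<xi>. norm \<xi> powr (2 * s) *
        (cmod (fourier (\<lambda>y. complex_of_real (u y)) \<xi>))\<^sup>2)}"

definition Hs_r :: "real \<Rightarrow> ('a::euclidean_space \<Rightarrow> real) set" where
  "Hs_r s = {u \<in> Hs s. \<forall>x y. norm x = norm y \<longrightarrow> u x = u y}"

definition solves_Pm ::
  "real \<Rightarrow> (real \<Rightarrow> real) \<Rightarrow> real \<Rightarrow> real \<Rightarrow> ('a::euclidean_space \<Rightarrow> real) \<Rightarrow> bool" where
  "solves_Pm s g m \<mu> u \<longleftrightarrow> u \<in> Hs_r s \<and>
     (\<forall>\<phi> \<in> Hs_r s.
        (LINT x|lebesgue. frac_lap_half s u x * frac_lap_half s \<phi> x + \<mu> * u x * \<phi> x)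
        = (LINT x|lebesgue. g (u x) * \<phi> x)) \<and>
     (LINT x|lebesgue. (u x)\<^sup>2) = m"

end

theory Submission
  imports Defs "HOL-Probability.Probability"
begin

text \<open>
  Write \<open>K(u)\<close> for the squared L2 norm of \<open>(-\<Delta>)^(s/2) u\<close>, \<open>P(u) = \<integral> G(u)\<close> and \<open>J = K/2 - P\<close>. The solution is a
  minimiser of \<open>J\<close> among radial functions of mass \<open>m\<close>, and \<open>\<mu>\<close> is the Lagrange multiplier.

  Plancherel's theorem bounds the Gagliardo seminorm by \<open>K\<close>. If the mass of \<open>u\<close> in the ball \<open>B\<close> of radius \<open>r\<close> around \<open>x\<close>
  is at most \<open>\<epsilon>\<close>, and \<open>r\<close> is chosen so that \<open>\<bar>B\<bar> u(x)^2 = 4 \<epsilon>\<close>, then the increments of \<open>u\<close> at \<open>x\<close> of length below \<open>r\<close>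
  control \<open>\<bar>u(x)\<bar>^(2 + 4s/N)\<close> with a constant of order \<open>\<epsilon>^(2s/N)\<close>. With \<open>\<epsilon> = m\<close> this is the Gagliardo--Nirenberg
  inequality, which makes \<open>J\<close> coercive by (g2). For a radial function the mass of a distant ball is repeated on many
  disjoint balls, so \<open>\<epsilon>\<close> may be taken small far out; this makes the tails of \<open>P\<close> uniformly small. Together with local
  compactness, \<open>J\<close> is lower semicontinuous along a minimising sequence.

  Dilated Gaussians and (g4) give a negative infimum. A dilation that multiplies the mass by \<open>\<theta>\<close> multiplies \<open>P\<close> by \<open>\<theta>\<close>
  and \<open>K\<close> by \<open>\<theta>^(1 - 2s/N)\<close>, so with \<open>\<theta> > 1\<close> it would push \<open>J\<close> below the infimum if the limit had lost mass.
  Differentiating \<open>J\<close> along \<open>u + t \<phi>\<close>, dilated back to mass \<open>m\<close>, gives the equation with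
  \<open>\<mu> = (2/m) ((s/N) K(u) - J(u)) > 0\<close>.
\<close>

section \<open>Square integrable functions\<close>

text \<open>At the exponent \<open>1 + 4s/N\<close> the power term and \<open>K\<close> scale alike
  under mass-preserving dilations, so the Gagliardo-Nirenberg bound is linear in \<open>K\<close>.
  No choice of scale can make one beat the other; only coefficients can. By (g2) the coefficient of
  the power may be taken arbitrarily small, by (g4) arbitrarily large. \<open>g\<close> is not
  homogeneous, so mass is adjusted by dilating \<open>u\<close> rather than by multiplying it: every
  integral of a function of \<open>u\<close> then changes by one known factor. The equation is
  tested only with radial functions, so minimality among radial functions is enough. Of the
  comparison between increments and \<open>K\<close> only one direction enters, and it can be had by
  scaling alone. The formal shape comes from measurability. \<open>fourier\<close> and
  \<open>inv_fourier\<close> are arbitrary choices, Lebesgue measurable and determined up to null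
  sets, whereas Fubini's theorem and composition with \<open>g\<close> want Borel functions. The
  analysis therefore runs on \<open>lborel\<close> with Borel versions and with radiality up to null
  sets; exact representatives return at the end.\<close>

definition n2 :: "('a::euclidean_space \<Rightarrow> 'b::euclidean_space) \<Rightarrow> ennreal" where
  "n2 f = (\<integral>\<^sup>+ x. ennreal ((norm (f x))\<^sup>2) \<partial>lborel)"

lemma n2_lebesgue: "(\<integral>\<^sup>+ x. ennreal ((norm (f x))\<^sup>2) \<partial>lebesgue) = n2 f"
  by (simp add: n2_def nn_integral_completion)

lemma n2_cong_AE: "AE x in lborel. f x = g x \<Longrightarrow> n2 f = n2 g"
  unfolding n2_def by (rule nn_integral_cong_AE) auto

lemma n2_eq_0_iff:
  assumes [measurable]: "f \<in> borel_measurable borel"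
  shows "n2 f = 0 \<longleftrightarrow> (AE x in lborel. f x = 0)"
  unfolding n2_def by (subst nn_integral_0_iff_AE) auto

lemma n2_minus: "n2 (\<lambda>x. - f x) = n2 f"
  by (simp add: n2_def)

lemma n2_diff_commute: "n2 (\<lambda>x. f x - g x) = n2 (\<lambda>x. g x - f x)"
  by (simp add: n2_def norm_minus_commute)

lemma n2_scaleR:
  assumes [measurable]: "f \<in> borel_measurable borel"
  shows "n2 (\<lambda>x. c *\<^sub>R f x) = ennreal (c\<^sup>2) * n2 f"
  unfolding n2_def by (subst nn_integral_cmult[symmetric]) (auto simp: power_mult_distrib ennreal_mult)

lemma n2_mult:
  fixes c :: complex
  assumes [measurable]: "f \<in> borel_measurable borel"
  shows "n2 (\<lambda>x. c * f x) = ennreal ((cmod c)\<^sup>2) * n2 f"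
  unfolding n2_def by (subst nn_integral_cmult[symmetric]) (auto simp: norm_mult power_mult_distrib ennreal_mult)

lemma n2_mono: "(\<And>x. norm (f x) \<le> norm (g x)) \<Longrightarrow> n2 f \<le> n2 g"
  unfolding n2_def by (intro nn_integral_mono ennreal_leI power_mono) auto

lemma norm_add_power2_le:
  fixes a b :: "'b::real_normed_vector"
  shows "(norm (a + b))\<^sup>2 \<le> 2 * (norm a)\<^sup>2 + 2 * (norm b)\<^sup>2"
proof -
  have "(norm (a + b))\<^sup>2 \<le> (norm a + norm b)\<^sup>2"
    by (intro power_mono norm_triangle_ineq) auto
  also have "\<dots> \<le> 2 * (norm a)\<^sup>2 + 2 * (norm b)\<^sup>2"
    using sum_squares_bound[of "norm a" "norm b"] by (simp add: power2_sum)
  finally show ?thesis .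
qed

text \<open>Norms are kept squared and extended-real, so that they can be manipulated before
  finiteness is known. The price is a factor 2 in place of Minkowski's inequality, which is harmless
  for convergence to 0.\<close>

lemma n2_add:
  assumes [measurable]: "f \<in> borel_measurable borel" "g \<in> borel_measurable borel"
  shows "n2 (\<lambda>x. f x + g x) \<le> 2 * n2 f + 2 * n2 g"
proof -
  have "n2 (\<lambda>x. f x + g x) \<le> (\<integral>\<^sup>+ x. 2 * ennreal ((norm (f x))\<^sup>2) + 2 * ennreal ((norm (g x))\<^sup>2) \<partial>lborel)"
    unfolding n2_def
  proof (rule nn_integral_mono)
    fix x
    have "ennreal ((norm (f x + g x))\<^sup>2) \<le> ennreal (2 * (norm (f x))\<^sup>2 + 2 * (norm (g x))\<^sup>2)"
      by (intro ennreal_leI norm_add_power2_le)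
    then show "ennreal ((norm (f x + g x))\<^sup>2) \<le> 2 * ennreal ((norm (f x))\<^sup>2) + 2 * ennreal ((norm (g x))\<^sup>2)"
      by (simp add: ennreal_plus ennreal_mult)
  qed
  also have "\<dots> = 2 * n2 f + 2 * n2 g"
    unfolding n2_def by (simp add: nn_integral_add nn_integral_cmult)
  finally show ?thesis .
qed

lemma n2_diff:
  assumes [measurable]: "f \<in> borel_measurable borel" "g \<in> borel_measurable borel"
  shows "n2 (\<lambda>x. f x - g x) \<le> 2 * n2 f + 2 * n2 g"
  using n2_add[of f "\<lambda>x. - g x"] by (simp add: n2_minus)

lemma n2_triangle:
  assumes [measurable]: "f \<in> borel_measurable borel" "g \<in> borel_measurable borel" "h \<in> borel_measurable borel"
  shows "n2 (\<lambda>x. f x - h x) \<le> 2 * n2 (\<lambda>x. f x - g x) + 2 * n2 (\<lambda>x. g x - h x)"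
  using n2_add[of "\<lambda>x. f x - g x" "\<lambda>x. g x - h x"] by simp

lemma ennreal_two_mult_less_top: "a < top \<Longrightarrow> b < top \<Longrightarrow> 2 * a + 2 * b < (top::ennreal)"
  by (simp add: ennreal_mult_less_top)

lemma n2_add_finite:
  assumes "f \<in> borel_measurable borel" "g \<in> borel_measurable borel" "n2 f < \<infinity>" "n2 g < \<infinity>"
  shows "n2 (\<lambda>x. f x + g x) < \<infinity>"
  using n2_add[OF assms(1,2)] ennreal_two_mult_less_top[of "n2 f" "n2 g"] assms
  by (simp add: order_le_less_trans less_top)

lemma n2_diff_finite:
  assumes "f \<in> borel_measurable borel" "g \<in> borel_measurable borel" "n2 f < \<infinity>" "n2 g < \<infinity>"
  shows "n2 (\<lambda>x. f x - g x) < \<infinity>"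
  using n2_diff[OF assms(1,2)] ennreal_two_mult_less_top[of "n2 f" "n2 g"] assms
  by (simp add: order_le_less_trans less_top)

lemma n2_finite_iff_integrable:
  assumes [measurable]: "f \<in> borel_measurable borel"
  shows "n2 f < \<infinity> \<longleftrightarrow> integrable lborel (\<lambda>x. (norm (f x))\<^sup>2)"
  unfolding n2_def by (simp add: integrable_iff_bounded)

lemma n2_eq_integral:
  assumes "integrable lborel (\<lambda>x. (norm (f x))\<^sup>2)"
  shows "n2 f = ennreal (\<integral>x. (norm (f x))\<^sup>2 \<partial>lborel)"
  unfolding n2_def by (rule nn_integral_eq_integral[OF assms]) auto

lemma n2_tendsto_squeeze:
  assumes "\<And>n. a n \<le> 2 * b n + 2 * (c n :: ennreal)" "b \<longlonglongrightarrow> 0" "c \<longlonglongrightarrow> 0"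
  shows "a \<longlonglongrightarrow> 0"
proof (rule tendsto_sandwich[of "\<lambda>_. 0"])
  have "(\<lambda>n. 2 * b n + 2 * c n) \<longlonglongrightarrow> 2 * 0 + 2 * 0"
    by (intro tendsto_add ennreal_tendsto_cmult assms) auto
  then show "(\<lambda>n. 2 * b n + 2 * c n) \<longlonglongrightarrow> 0" by simp
qed (use assms in auto)

lemma n2_limit_unique:
  assumes [measurable]: "\<And>n. f n \<in> borel_measurable borel" "g \<in> borel_measurable borel" "h \<in> borel_measurable borel"
    and g: "(\<lambda>n. n2 (\<lambda>x. g x - f n x)) \<longlonglongrightarrow> 0"
    and h: "(\<lambda>n. n2 (\<lambda>x. h x - f n x)) \<longlonglongrightarrow> 0"
  shows "AE x in lborel. g x = h x"
proof -
  have "(\<lambda>n. n2 (\<lambda>x. g x - h x)) \<longlonglongrightarrow> 0"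
  proof (rule n2_tendsto_squeeze[OF _ g h])
    fix n show "n2 (\<lambda>x. g x - h x) \<le> 2 * n2 (\<lambda>x. g x - f n x) + 2 * n2 (\<lambda>x. h x - f n x)"
      using n2_triangle[of g "f n" h] by (simp add: n2_diff_commute[of h])
  qed
  then have "n2 (\<lambda>x. g x - h x) = 0" by (simp add: LIMSEQ_const_iff)
  then show ?thesis by (subst (asm) n2_eq_0_iff) auto
qed

text \<open>Young's inequality \<open>2 * y * d \<le> e * y\<^sup>2 + d\<^sup>2 / e\<close> handles
  the cross term. In both directions the small factor \<open>e\<close> falls on \<open>b\<close>,
  which will be the limit: its norm is fixed while that of \<open>a\<close> varies.\<close>

lemma power2_norm_perturb_le:
  fixes a b :: "'b::real_normed_vector"
  assumes e: "e > 0"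
  shows "(norm a)\<^sup>2 \<le> (1 + e) * (norm b)\<^sup>2 + (1 + 1/e) * (norm (a - b))\<^sup>2"
    and "(norm b)\<^sup>2 \<le> (norm a)\<^sup>2 + e * (norm b)\<^sup>2 + (1 + 1/e) * (norm (a - b))\<^sup>2"
proof -
  define x y d where "x = norm a" "y = norm b" "d = norm (a - b)"
  have y0: "y \<ge> 0" "x \<ge> 0" "d \<ge> 0" and xd: "x \<le> y + d" and yd: "y \<le> x + d"
    unfolding x_y_d_def using norm_triangle_sub[of a b] norm_triangle_sub[of b a]
    by (auto simp: norm_minus_commute)
  have yd2: "2 * y * d \<le> e * y\<^sup>2 + d\<^sup>2 / e"
  proof -
    have "0 \<le> (e * y - d)\<^sup>2 / e" using e by simp
    also have "\<dots> = e * y\<^sup>2 + d\<^sup>2 / e - 2 * y * d"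
      using e by (simp add: power2_diff field_simps power2_eq_square)
    finally show ?thesis by simp
  qed
  have "x\<^sup>2 \<le> (y + d)\<^sup>2" using xd y0 by (intro power_mono) auto
  then show "(norm a)\<^sup>2 \<le> (1 + e) * (norm b)\<^sup>2 + (1 + 1/e) * (norm (a - b))\<^sup>2"
    using yd2 unfolding x_y_d_def[symmetric] by (simp add: power2_sum algebra_simps)
  have "y\<^sup>2 - x\<^sup>2 \<le> 2 * y * d + d\<^sup>2"
  proof (cases "y \<le> x")
    case True
    then have "y\<^sup>2 \<le> x\<^sup>2" using y0 by (intro power_mono) auto
    then show ?thesis using y0 by (smt (verit) mult_nonneg_nonneg zero_le_power2)
  next
    case False
    have "y\<^sup>2 - x\<^sup>2 = (y - x) * (y + x)" by (simp add: power2_eq_square algebra_simps)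
    also have "\<dots> \<le> d * (y + y)" using yd y0 False by (intro mult_mono) auto
    finally show ?thesis using y0 by (simp add: algebra_simps) (smt (verit) zero_le_power2)
  qed
  then show "(norm b)\<^sup>2 \<le> (norm a)\<^sup>2 + e * (norm b)\<^sup>2 + (1 + 1/e) * (norm (a - b))\<^sup>2"
    using yd2 unfolding x_y_d_def[symmetric] by (simp add: algebra_simps)
qed

lemma n2_tendsto:
  assumes [measurable]: "\<And>n. f n \<in> borel_measurable borel" "g \<in> borel_measurable borel"
    and g: "n2 g < \<infinity>" and lim: "(\<lambda>n. n2 (\<lambda>x. f n x - g x)) \<longlonglongrightarrow> 0"
  shows "(\<lambda>n. n2 (f n)) \<longlonglongrightarrow> n2 g"
proof -
  define a where "a = n2 g"
  have a: "a < \<infinity>" using g by (simp add: a_def)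
  have up: "n2 (f n) \<le> ennreal (1 + e) * a + ennreal (1 + 1/e) * n2 (\<lambda>x. f n x - g x)"
    and lo: "a \<le> n2 (f n) + ennreal e * a + ennreal (1 + 1/e) * n2 (\<lambda>x. f n x - g x)" if e: "e > 0" for e n
  proof -
    have "n2 (f n) \<le> (\<integral>\<^sup>+ x. ennreal (1 + e) * ennreal ((norm (g x))\<^sup>2) + ennreal (1 + 1/e) * ennreal ((norm (f n x - g x))\<^sup>2) \<partial>lborel)"
      unfolding n2_def
    proof (rule nn_integral_mono)
      fix x
      have "ennreal ((norm (f n x))\<^sup>2) \<le> ennreal ((1 + e) * (norm (g x))\<^sup>2 + (1 + 1/e) * (norm (f n x - g x))\<^sup>2)"
        by (intro ennreal_leI power2_norm_perturb_le e)
      then show "ennreal ((norm (f n x))\<^sup>2) \<le> ennreal (1 + e) * ennreal ((norm (g x))\<^sup>2) + ennreal (1 + 1/e) * ennreal ((norm (f n x - g x))\<^sup>2)"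
        using e by (simp add: ennreal_plus[symmetric] ennreal_mult[symmetric] del: ennreal_plus)
    qed
    then show "n2 (f n) \<le> ennreal (1 + e) * a + ennreal (1 + 1/e) * n2 (\<lambda>x. f n x - g x)"
      unfolding a_def n2_def by (simp add: nn_integral_add nn_integral_cmult)
    have "a \<le> (\<integral>\<^sup>+ x. ennreal ((norm (f n x))\<^sup>2) + ennreal e * ennreal ((norm (g x))\<^sup>2) + ennreal (1 + 1/e) * ennreal ((norm (f n x - g x))\<^sup>2) \<partial>lborel)"
      unfolding n2_def a_def
    proof (rule nn_integral_mono)
      fix x
      have "ennreal ((norm (g x))\<^sup>2) \<le> ennreal ((norm (f n x))\<^sup>2 + e * (norm (g x))\<^sup>2 + (1 + 1/e) * (norm (f n x - g x))\<^sup>2)"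
        by (intro ennreal_leI power2_norm_perturb_le e)
      then show "ennreal ((norm (g x))\<^sup>2) \<le> ennreal ((norm (f n x))\<^sup>2) + ennreal e * ennreal ((norm (g x))\<^sup>2) + ennreal (1 + 1/e) * ennreal ((norm (f n x - g x))\<^sup>2)"
        using e by (simp add: ennreal_plus[symmetric] ennreal_mult[symmetric] del: ennreal_plus)
    qed
    then show "a \<le> n2 (f n) + ennreal e * a + ennreal (1 + 1/e) * n2 (\<lambda>x. f n x - g x)"
      unfolding a_def n2_def by (simp add: nn_integral_add nn_integral_cmult)
  qed
  have small: "\<forall>\<^sub>F n in sequentially. ennreal (1 + 1/e) * n2 (\<lambda>x. f n x - g x) < ennreal \<eta>" if "\<eta> > 0" "e > 0" for \<eta> e :: real
  proof -
    have "(\<lambda>n. ennreal (1 + 1/e) * n2 (\<lambda>x. f n x - g x)) \<longlonglongrightarrow> ennreal (1 + 1/e) * 0"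
      by (intro ennreal_tendsto_cmult lim) auto
    then show ?thesis using that by (intro order_tendstoD(2)) auto
  qed
  obtain A where A: "A \<ge> 0" "a = ennreal A" using a by (cases a) auto
  show ?thesis unfolding a_def[symmetric]
  proof (rule order_tendstoI)
    fix b assume b: "b < a"
    then obtain B where B: "B \<ge> 0" "b = ennreal B" "B < A" using A
      by (cases b) (auto simp: ennreal_less_iff)
    \<comment> \<open>Keeps \<open>e * A\<close> below a third of the gap; \<open>A + 1\<close>
      avoids a zero denominator when \<open>A = 0\<close>.\<close>
    define e where "e = (A - B) / (3 * (A + 1))"
    have e: "e > 0" using B A unfolding e_def by (intro divide_pos_pos) auto
    have "e * (A + 1) = (A - B)/3" using A unfolding e_def by (simp add: divide_simps)
    with e have eA: "e * A \<le> (A - B)/3" by (simp add: algebra_simps)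
    have "(A-B)/3 > 0" using B by simp
    from small[OF this e] show "\<forall>\<^sub>F n in sequentially. b < n2 (f n)"
    proof eventually_elim
      case (elim n)
      show ?case
      proof (rule ccontr)
        assume "\<not> b < n2 (f n)"
        then have "a \<le> b + ennreal e * a + ennreal ((A-B)/3)"
          using lo[OF e, of n] elim by (meson add_mono less_imp_le not_less order_trans order_refl)
        also have "\<dots> = ennreal (B + e * A + (A-B)/3)"
          using A B e by (simp add: ennreal_plus ennreal_mult)
        finally have "A \<le> B + e * A + (A-B)/3" using A B e by (simp add: ennreal_le_iff del: ennreal_plus)
        then show False using eA B by (simp add: field_simps)
      qed
    qed
  next
    fix b assume b: "a < b"
    then obtain B where B: "ennreal B \<le> b" "B > A"
    proof (cases b)
      case (real B)
      then show ?thesis using that[of B] b A by (simp add: ennreal_less_iff)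
    next
      case top
      then show ?thesis using that[of "A + 1"] by simp
    qed
    define e where "e = (B - A) / (3 * (A + 1))"
    have e: "e > 0" using B A unfolding e_def by (intro divide_pos_pos) auto
    have "e * (A + 1) = (B - A)/3" using A unfolding e_def by (simp add: divide_simps)
    with e have eA: "e * A \<le> (B - A)/3" by (simp add: algebra_simps)
    have "(B-A)/3 > 0" using B by simp
    from small[OF this e] show "\<forall>\<^sub>F n in sequentially. n2 (f n) < b"
    proof eventually_elim
      case (elim n)
      have "n2 (f n) \<le> ennreal (1+e) * a + ennreal ((B-A)/3)"
        using up[OF e, of n] elim by (meson add_mono less_imp_le order_trans order_refl)
      also have "\<dots> = ennreal ((1+e) * A + (B-A)/3)"
        using A B e by (simp add: ennreal_plus[symmetric] ennreal_mult[symmetric] del: ennreal_plus)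
      also have "\<dots> < ennreal B"
      proof -
        have "(1+e) * A + (B-A)/3 = A + e * A + (B-A)/3" by (simp add: distrib_right)
        also have "\<dots> < B"
        proof -
          have "A + x + y < B" if "x \<le> y" "3 * y = B - A" for x y :: real using that B(2) by linarith
          from this[OF eA] show ?thesis by simp
        qed
        finally have "(1+e) * A + (B-A)/3 < B" .
        moreover have "0 \<le> (1+e) * A + (B-A)/3" using A e B(2) by (intro add_nonneg_nonneg mult_nonneg_nonneg) auto
        ultimately show ?thesis by (simp only: ennreal_less_iff)
      qed
      finally show ?case using B by simp
    qed
  qed
qed

lemma tendsto_ennrealI0:
  fixes a :: "'c \<Rightarrow> ennreal"
  assumes "\<And>e::real. e > 0 \<Longrightarrow> \<forall>\<^sub>F n in F. a n \<le> ennreal e"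
  shows "(a \<longlongrightarrow> 0) F"
proof (rule order_tendstoI)
  fix b :: ennreal assume "0 < b"
  then obtain e :: real where e: "0 < e" "ennreal e < b"
  proof (cases b)
    case (real r)
    then show ?thesis using that[of "r/2"] \<open>0 < b\<close> by (simp add: ennreal_less_iff)
  next
    case top
    then show ?thesis using that[of 1] by simp
  qed
  show "\<forall>\<^sub>F n in F. a n < b"
    using assms[OF e(1)] by eventually_elim (use e in auto)
qed auto

text \<open>Riesz-Fischer with the a.e. convergent subsequence exposed, because radiality of limits
  and Fatou arguments need pointwise convergence. Fatou along the subsequence bounds the distance of
  each late \<open>f n\<close> from \<open>g\<close>.\<close>

lemma L2_complete:
  fixes f :: "nat \<Rightarrow> 'a::euclidean_space \<Rightarrow> 'b::euclidean_space"
  assumes [measurable]: "\<And>n. f n \<in> borel_measurable borel"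
    and cauchy: "\<And>e. e > 0 \<Longrightarrow> \<exists>M. \<forall>m\<ge>M. \<forall>n\<ge>M. n2 (\<lambda>x. f m x - f n x) \<le> ennreal e"
  obtains g r where "g \<in> borel_measurable borel" "strict_mono (r :: nat \<Rightarrow> nat)"
    "AE x in lborel. (\<lambda>k. f (r k) x) \<longlonglongrightarrow> g x" "(\<lambda>n. n2 (\<lambda>x. f n x - g x)) \<longlonglongrightarrow> 0"
proof -
  \<comment> \<open>Increments of squared norm \<open>8^-k\<close> stay summable after weighting by
    \<open>2^k\<close>. Hence almost everywhere the squared increments are of order
    \<open>2^-k\<close>, and their square roots are summable.\<close>
  define P where "P k N \<longleftrightarrow> (\<forall>m\<ge>N. \<forall>n\<ge>N. n2 (\<lambda>x. f m x - f n x) \<le> ennreal ((1/8)^k))" for k N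
  have exP: "\<exists>N>M. P k N" for k M
  proof -
    obtain N where "\<forall>m\<ge>N. \<forall>n\<ge>N. n2 (\<lambda>x. f m x - f n x) \<le> ennreal ((1/8)^k)"
      using cauchy[of "(1/8)^k"] by auto
    then have "P k (max N (Suc M))" unfolding P_def by auto
    then show ?thesis by (intro exI[of _ "max N (Suc M)"]) auto
  qed
  have "\<exists>r. \<forall>k. P k (r k) \<and> r k < r (Suc k)"
    by (rule dependent_nat_choice) (use exP in blast)+
  then obtain r where r: "\<And>k. P k (r k)" "\<And>k. r k < r (Suc k)" by blast
  have sm: "strict_mono r" using r(2) by (simp add: strict_mono_Suc_iff)
  have rk: "n2 (\<lambda>x. f (r (Suc k)) x - f (r k) x) \<le> ennreal ((1/8)^k)" for k
    using r(1)[of k] r(2)[of k] unfolding P_def by auto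
  define d where "d k x = f (r (Suc k)) x - f (r k) x" for k x
  have [measurable]: "d k \<in> borel_measurable borel" for k unfolding d_def by measurable
  have "(\<integral>\<^sup>+ x. (\<Sum>k. ennreal (2^k * (norm (d k x))\<^sup>2)) \<partial>lborel) = (\<Sum>k. ennreal (2^k) * n2 (d k))"
    unfolding n2_def by (subst nn_integral_suminf) (auto simp: nn_integral_cmult ennreal_mult)
  also have "\<dots> \<le> (\<Sum>k. ennreal (2^k) * ennreal ((1/8)^k))"
    using rk unfolding d_def[abs_def] by (intro suminf_le mult_left_mono) auto
  also have "\<dots> = (\<Sum>k. ennreal ((1/4)^k))"
    by (simp add: ennreal_mult[symmetric] power_mult_distrib[symmetric])
  also have "\<dots> < \<infinity>"
    by (subst suminf_ennreal2) (auto intro: summable_geometric)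
  finally have "AE x in lborel. (\<Sum>k. ennreal (2^k * (norm (d k x))\<^sup>2)) \<noteq> \<infinity>"
    by (intro nn_integral_PInf_AE) auto
  then have conv: "AE x in lborel. convergent (\<lambda>k. f (r k) x)"
  proof eventually_elim
    case (elim x)
    then have "summable (\<lambda>k. 2^k * (norm (d k x))\<^sup>2)"
      by (intro summable_suminf_not_top) (auto simp: top_ennreal_def)
    then have "(\<lambda>k. 2^k * (norm (d k x))\<^sup>2) \<longlonglongrightarrow> 0" by (rule summable_LIMSEQ_zero)
    then have "Bseq (\<lambda>k. 2^k * (norm (d k x))\<^sup>2)" by (intro convergent_imp_Bseq convergentI)
    then obtain C where C: "\<And>k. norm (2^k * (norm (d k x))\<^sup>2) \<le> C" unfolding Bseq_def by blast
    have bd: "norm (d k x) \<le> sqrt C * (1 / sqrt 2)^k" for k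
    proof -
      have "(norm (d k x))\<^sup>2 \<le> C * (1/2)^k" using C[of k] by (simp add: field_simps power_divide)
      then have "norm (d k x) \<le> sqrt (C * (1/2)^k)" by (rule real_le_rsqrt)
      then show ?thesis by (simp add: real_sqrt_mult real_sqrt_power real_sqrt_divide)
    qed
    have "summable (\<lambda>k. sqrt C * (1 / sqrt 2)^k)"
      by (intro summable_mult summable_geometric) auto
    then have "summable (\<lambda>k. d k x)"
      by (rule summable_comparison_test'[where N = 0]) (rule bd)
    then have "convergent (\<lambda>n. \<Sum>k<n. d k x)" by (simp add: summable_iff_convergent)
    also have "(\<lambda>n. \<Sum>k<n. d k x) = (\<lambda>n. f (r n) x - f (r 0) x)"
      unfolding d_def by (rule ext, rule sum_lessThan_telescope)
    finally have "convergent (\<lambda>n. (f (r n) x - f (r 0) x) + f (r 0) x)"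
      by (intro convergent_add convergent_const)
    then show ?case by simp
  qed
  define g where "g x = lim (\<lambda>k. f (r k) x)" for x
  have [measurable]: "g \<in> borel_measurable borel" unfolding g_def by measurable
  have lim: "AE x in lborel. (\<lambda>k. f (r k) x) \<longlonglongrightarrow> g x"
    using conv by eventually_elim (simp add: g_def convergent_LIMSEQ_iff)
  have "(\<lambda>n. n2 (\<lambda>x. f n x - g x)) \<longlonglongrightarrow> 0"
  proof (rule tendsto_ennrealI0)
    fix e :: real assume e: "e > 0"
    obtain M where M: "\<forall>m\<ge>M. \<forall>n\<ge>M. n2 (\<lambda>x. f m x - f n x) \<le> ennreal e" using cauchy[OF e] by blast
    have "n2 (\<lambda>x. f n x - g x) \<le> ennreal e" if n: "n \<ge> M" for n
    proof -
      have "n2 (\<lambda>x. f n x - g x) = (\<integral>\<^sup>+ x. liminf (\<lambda>k. ennreal ((norm (f n x - f (r k) x))\<^sup>2)) \<partial>lborel)"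
        unfolding n2_def
      proof (rule nn_integral_cong_AE)
        show "AE x in lborel. ennreal ((norm (f n x - g x))\<^sup>2) = liminf (\<lambda>k. ennreal ((norm (f n x - f (r k) x))\<^sup>2))"
          using lim
        proof eventually_elim
          case (elim x)
          then have "(\<lambda>k. ennreal ((norm (f n x - f (r k) x))\<^sup>2)) \<longlonglongrightarrow> ennreal ((norm (f n x - g x))\<^sup>2)"
            by (intro tendsto_intros)
          from lim_imp_Liminf[OF _ this] show ?case by simp
        qed
      qed
      also have "\<dots> \<le> liminf (\<lambda>k. n2 (\<lambda>x. f n x - f (r k) x))"
        unfolding n2_def by (rule nn_integral_liminf) measurable
      also have "\<dots> \<le> ennreal e"
      proof (rule Liminf_le)
        show "\<forall>\<^sub>F k in sequentially. n2 (\<lambda>x. f n x - f (r k) x) \<le> ennreal e"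
          using eventually_ge_at_top[of M]
        proof eventually_elim
          case (elim k)
          then have "r k \<ge> M" using sm seq_suble[of r k] by simp
          then show ?case using M n by blast
        qed
      qed simp
      finally show ?thesis .
    qed
    then show "\<forall>\<^sub>F n in sequentially. n2 (\<lambda>x. f n x - g x) \<le> ennreal e"
      unfolding eventually_sequentially by blast
  qed
  then show thesis using that[of g r] sm lim by simp
qed

section \<open>Changes of variables, density and translation continuity\<close>

lemma nn_integral_lborel_affine:
  fixes f :: "'a::euclidean_space \<Rightarrow> ennreal"
  assumes [measurable]: "f \<in> borel_measurable borel" and c: "c \<noteq> 0"
  shows "(\<integral>\<^sup>+ x. f x \<partial>lborel) = ennreal (\<bar>c\<bar> ^ DIM('a)) * (\<integral>\<^sup>+ x. f (t + c *\<^sub>R x) \<partial>lborel)"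
  by (subst lborel_affine[OF c, of t]) (simp add: nn_integral_density nn_integral_distr nn_integral_cmult)

lemma integral_lborel_affine:
  fixes f :: "'a::euclidean_space \<Rightarrow> 'b::{banach, second_countable_topology}"
  assumes [measurable]: "f \<in> borel_measurable borel" and c: "c \<noteq> 0"
  shows "(LBINT x. f x) = \<bar>c\<bar> ^ DIM('a) *\<^sub>R (LBINT x. f (t + c *\<^sub>R x))"
  by (subst lborel_affine[OF c, of t]) (simp add: integral_density integral_distr)

lemma integrable_lborel_affine:
  fixes f :: "'a::euclidean_space \<Rightarrow> 'b::{banach, second_countable_topology}"
  assumes f: "integrable lborel f" and c: "c \<noteq> 0"
  shows "integrable lborel (\<lambda>x. f (t + c *\<^sub>R x))"
proof -
  have [measurable]: "f \<in> borel_measurable borel" using f by auto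
  have "ennreal (\<bar>c\<bar> ^ DIM('a)) * (\<integral>\<^sup>+ x. norm (f (t + c *\<^sub>R x)) \<partial>lborel) < \<infinity>"
    using nn_integral_lborel_affine[of "\<lambda>x. ennreal (norm (f x))" c t] f c
    by (simp add: integrable_iff_bounded)
  then show ?thesis using c
    by (auto simp: integrable_iff_bounded ennreal_mult_less_top)
qed

lemma AE_lborel_affine:
  fixes P :: "'a::euclidean_space \<Rightarrow> bool"
  assumes P: "AE x in lborel. P x" and c: "c \<noteq> 0"
  shows "AE x in lborel. P (t + c *\<^sub>R x)"
proof -
  obtain N where N': "{x \<in> space lborel. \<not> P x} \<subseteq> N" "emeasure lborel N = 0" "N \<in> sets lborel"
    using P by (rule AE_E)
  then have N: "N \<in> null_sets lborel" "{x. \<not> P x} \<subseteq> N" by auto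
  then have [measurable]: "N \<in> sets borel" by auto
  have "0 = ennreal (\<bar>c\<bar> ^ DIM('a)) * (\<integral>\<^sup>+ x. indicator N (t + c *\<^sub>R x) \<partial>lborel)"
    using nn_integral_lborel_affine[of "indicator N" c t] N c by (simp add: null_sets_def)
  then have "(\<integral>\<^sup>+ x. indicator N (t + c *\<^sub>R x) \<partial>lborel) = (0::ennreal)" using c by simp
  then have "AE x in lborel. indicator N (t + c *\<^sub>R x) = (0::ennreal)"
    by (subst (asm) nn_integral_0_iff_AE) auto
  then show ?thesis using N by (auto simp: indicator_def split: if_splits elim!: eventually_mono)
qed

lemma nn_integral_lborel_shift:
  fixes f :: "'a::euclidean_space \<Rightarrow> ennreal"
  assumes [measurable]: "f \<in> borel_measurable borel"
  shows "(\<integral>\<^sup>+ x. f (x + h) \<partial>lborel) = (\<integral>\<^sup>+ x. f x \<partial>lborel)"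
  using nn_integral_lborel_affine[of f 1 h] by (simp add: add.commute)

lemma n2_shift:
  assumes [measurable]: "f \<in> borel_measurable borel"
  shows "n2 (\<lambda>x. f (x + h)) = n2 f"
  unfolding n2_def by (rule nn_integral_lborel_shift[of "\<lambda>x. ennreal ((norm (f x))\<^sup>2)"]) measurable

lemma n2_dilate:
  fixes f :: "'a::euclidean_space \<Rightarrow> 'b::euclidean_space"
  assumes [measurable]: "f \<in> borel_measurable borel" and c: "c > 0"
  shows "n2 (\<lambda>x. f (c *\<^sub>R x)) = ennreal (1 / c ^ DIM('a)) * n2 f"
proof -
  have "n2 f = ennreal (c ^ DIM('a)) * n2 (\<lambda>x. f (c *\<^sub>R x))"
    unfolding n2_def using nn_integral_lborel_affine[of "\<lambda>x. ennreal ((norm (f x))\<^sup>2)" c 0] c by simp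
  then show ?thesis using c by (simp add: mult.assoc[symmetric] ennreal_mult[symmetric])
qed

lemma n2_tendsto_dominated:
  assumes [measurable]: "\<And>n. f n \<in> borel_measurable borel" "g \<in> borel_measurable borel"
      "w \<in> borel_measurable borel"
    and bd: "\<And>n x. norm (f n x) \<le> norm (w x)" and w: "n2 w < \<infinity>"
    and lim: "AE x in lborel. (\<lambda>n. f n x) \<longlonglongrightarrow> g x"
  shows "(\<lambda>n. n2 (\<lambda>x. f n x - g x)) \<longlonglongrightarrow> 0"
proof -
  have "(\<lambda>n. \<integral>\<^sup>+ x. ennreal ((norm (f n x - g x))\<^sup>2) \<partial>lborel) \<longlonglongrightarrow> (\<integral>\<^sup>+ x. 0 \<partial>(lborel::'a measure))"
  proof (rule nn_integral_dominated_convergence[where w = "\<lambda>x. 4 * ennreal ((norm (w x))\<^sup>2)"])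
    show "(\<integral>\<^sup>+ x. 4 * ennreal ((norm (w x))\<^sup>2) \<partial>lborel) < \<infinity>"
      using w by (simp add: nn_integral_cmult n2_def[symmetric] ennreal_mult_less_top)
    show "AE x in lborel. (\<lambda>n. ennreal ((norm (f n x - g x))\<^sup>2)) \<longlonglongrightarrow> 0"
      using lim
    proof eventually_elim
      case (elim x)
      then have "(\<lambda>n. ennreal ((norm (f n x - g x))\<^sup>2)) \<longlonglongrightarrow> ennreal ((norm (g x - g x))\<^sup>2)"
        by (intro tendsto_intros)
      then show ?case by simp
    qed
    fix n
    show "AE x in lborel. ennreal ((norm (f n x - g x))\<^sup>2) \<le> 4 * ennreal ((norm (w x))\<^sup>2)"
      using lim
    proof eventually_elim
      case (elim x)
      have "norm (g x) \<le> norm (w x)"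
        by (rule LIMSEQ_le_const2[OF tendsto_norm[OF elim]]) (use bd in auto)
      then have "norm (f n x - g x) \<le> 2 * norm (w x)"
        using bd[of n x] norm_triangle_ineq4[of "f n x" "g x"] by linarith
      then have "(norm (f n x - g x))\<^sup>2 \<le> (2 * norm (w x))\<^sup>2" by (intro power_mono) auto
      then have "ennreal ((norm (f n x - g x))\<^sup>2) \<le> ennreal (4 * (norm (w x))\<^sup>2)"
        by (intro ennreal_leI) (simp add: power_mult_distrib)
      then show ?case by (simp add: ennreal_mult)
    qed
  qed measurable
  then show ?thesis by (simp add: n2_def)
qed

lemma n2_truncation_tendsto:
  fixes f :: "'a::euclidean_space \<Rightarrow> 'b::euclidean_space"
  assumes [measurable]: "f \<in> borel_measurable borel" and f: "n2 f < \<infinity>"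
  shows "(\<lambda>n. n2 (\<lambda>x. indicator {x. norm x < real n \<and> norm (f x) \<le> real n} x *\<^sub>R f x - f x)) \<longlonglongrightarrow> 0"
proof (rule n2_tendsto_dominated[OF _ _ _ _ f])
  show "AE x in lborel. (\<lambda>n. indicator {x. norm x < real n \<and> norm (f x) \<le> real n} x *\<^sub>R f x) \<longlonglongrightarrow> f x"
  proof (rule AE_I2)
    fix x
    obtain M :: nat where M: "real M > max (norm x) (norm (f x))" using reals_Archimedean2 by blast
    have "\<forall>\<^sub>F n in sequentially. indicator {x. norm x < real n \<and> norm (f x) \<le> real n} x *\<^sub>R f x = f x"
      using eventually_ge_at_top[of M]
    proof eventually_elim
      case (elim n)
      then have "real M \<le> real n" by simp
      then show ?case using M by (auto simp: indicator_def)
    qed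
    then show "(\<lambda>n. indicator {x. norm x < real n \<and> norm (f x) \<le> real n} x *\<^sub>R f x) \<longlonglongrightarrow> f x"
      by (rule tendsto_eventually)
  qed
qed (auto simp: indicator_def)

lemma measurable_indicator_ball_scaleR [measurable]:
  fixes b :: "'b::euclidean_space"
  shows "(\<lambda>x::'a::euclidean_space. indicator (ball 0 r) x *\<^sub>R b) \<in> borel_measurable borel"
  by (intro borel_measurable_scaleR borel_measurable_indicator) auto

lemma n2_indicator_ball:
  fixes b :: "'b::euclidean_space"
  shows "n2 (\<lambda>x::'a::euclidean_space. indicator (ball 0 r) x *\<^sub>R b) < \<infinity>"
proof -
  have "n2 (\<lambda>x::'a. indicator (ball 0 r) x *\<^sub>R b) = nn_integral lborel (\<lambda>x::'a. ennreal ((norm b)\<^sup>2) * indicator (ball 0 r) x)"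
    unfolding n2_def by (intro nn_integral_cong) (auto simp: indicator_def)
  also have "\<dots> < \<infinity>"
    by (subst nn_integral_cmult_indicator)
      (use emeasure_lborel_ball_finite[of "0::'a" r] in \<open>auto simp: ennreal_mult_less_top\<close>)
  finally show ?thesis .
qed

text \<open>After truncation in space and in value, \<open>f\<close> is an a.e. limit of continuous
  functions. These are forced to share one bound and one bounded support, so that dominated
  convergence turns a.e. into L2 convergence.\<close>

lemma L2_continuous_dense:
  fixes f :: "'a::euclidean_space \<Rightarrow> 'b::euclidean_space"
  assumes [measurable]: "f \<in> borel_measurable borel" and f: "n2 f < \<infinity>" and e: "e > 0"
  obtains g B R where "continuous_on UNIV g" "\<And>x. norm (g x) \<le> B" "\<And>x. norm x \<ge> R \<Longrightarrow> g x = 0"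
    "n2 (\<lambda>x. f x - g x) \<le> ennreal e"
proof -
  have "\<forall>\<^sub>F n in sequentially. n2 (\<lambda>x. indicator {x. norm x < real n \<and> norm (f x) \<le> real n} x *\<^sub>R f x - f x) < ennreal (e/4)"
    using e by (intro order_tendstoD(2)[OF n2_truncation_tendsto[OF _ f]]) auto
  then obtain k where k: "n2 (\<lambda>x. indicator {x. norm x < real k \<and> norm (f x) \<le> real k} x *\<^sub>R f x - f x) < ennreal (e/4)"
    by (auto simp: eventually_sequentially)
  define F where "F x = indicator {x. norm x < real k \<and> norm (f x) \<le> real k} x *\<^sub>R f x" for x
  have [measurable]: "F \<in> borel_measurable borel" unfolding F_def by measurable
  have Fk: "norm (F x) \<le> real k" for x by (auto simp: F_def indicator_def)
  have F0: "F x = 0" if "norm x \<ge> real k" for x using that by (auto simp: F_def indicator_def)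
  have "F \<in> borel_measurable lebesgue" by (simp add: measurable_completion)
  then have "F measurable_on UNIV" by (rule lebesgue_measurable_imp_measurable_on) auto
  then obtain N G where N: "negligible N" and G: "\<And>n. continuous_on UNIV (G n)"
    "\<And>x. x \<notin> N \<Longrightarrow> (\<lambda>n. G n x) \<longlonglongrightarrow> F x" unfolding measurable_on_def by simp blast
  have N0: "AE x in lborel. x \<notin> N"
    using AE_not_in[of N lebesgue] N by (simp add: negligible_iff_null_sets AE_completion_iff)
  \<comment> \<open>Projection onto the ball of radius \<open>k\<close> bounds the values, and the
    cutoff makes the support bounded. Neither changes the limit, as \<open>F\<close> takes values in
    that ball and vanishes for \<open>norm x \<ge> k\<close>.\<close>
  define H where "H n x = max 0 (min 1 (real k + 1 - norm x)) *\<^sub>R closest_point (cball 0 (real k)) (G n x)" for n x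
  have cont: "continuous_on UNIV (H n)" for n
  proof -
    have "continuous_on UNIV (closest_point (cball 0 (real k)) :: 'b \<Rightarrow> 'b)"
      by (rule continuous_on_closest_point) auto
    then have "continuous_on UNIV (\<lambda>x. closest_point (cball 0 (real k)) (G n x))"
      by (rule continuous_on_compose2[OF _ G(1)]) simp
    then show ?thesis unfolding H_def by (intro continuous_intros)
  qed
  then have [measurable]: "H n \<in> borel_measurable borel" for n
    by (rule borel_measurable_continuous_onI)
  have cp: "norm (closest_point (cball 0 (real k)) y) \<le> real k" for y :: 'b
    using closest_point_in_set[of "cball 0 (real k)" y] by auto
  have Hb: "norm (H n x) \<le> real k" for n x
    using mult_mono[OF _ cp, of "max 0 (min 1 (real k + 1 - norm x))" 1 "G n x"] by (auto simp: H_def)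
  have H0: "H n x = 0" if "norm x \<ge> real k + 1" for n x using that by (simp add: H_def)
  have "(\<lambda>n. n2 (\<lambda>x. H n x - F x)) \<longlonglongrightarrow> 0"
  proof (rule n2_tendsto_dominated)
    show "n2 (\<lambda>x::'a. indicator (ball 0 (real k + 1)) x *\<^sub>R real k) < \<infinity>" by (rule n2_indicator_ball)
    show "norm (H n x) \<le> norm (indicator (ball 0 (real k + 1)) x *\<^sub>R real k)" for n x
      using Hb[of n x] H0[of x n] by (auto simp: indicator_def)
    show "AE x in lborel. (\<lambda>n. H n x) \<longlonglongrightarrow> F x"
      using N0
    proof eventually_elim
      case (elim x)
      have "(\<lambda>n. closest_point (cball 0 (real k)) (G n x)) \<longlonglongrightarrow> closest_point (cball 0 (real k)) (F x)"
        by (rule isCont_tendsto_compose[OF continuous_at_closest_point G(2)[OF elim]]) auto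
      also have "closest_point (cball 0 (real k)) (F x) = F x"
        using Fk by (intro closest_point_self) auto
      finally have "(\<lambda>n. H n x) \<longlonglongrightarrow> max 0 (min 1 (real k + 1 - norm x)) *\<^sub>R F x"
        unfolding H_def by (intro tendsto_intros)
      also have "max 0 (min 1 (real k + 1 - norm x)) *\<^sub>R F x = F x"
        using F0[of x] by (cases "norm x \<ge> real k") auto
      finally show ?case .
    qed
  qed measurable
  then have "\<forall>\<^sub>F n in sequentially. n2 (\<lambda>x. H n x - F x) < ennreal (e/4)"
    using e by (intro order_tendstoD(2)) auto
  then obtain n where n: "n2 (\<lambda>x. H n x - F x) < ennreal (e/4)" by (auto simp: eventually_sequentially)
  have "n2 (\<lambda>x. f x - H n x) \<le> 2 * n2 (\<lambda>x. f x - F x) + 2 * n2 (\<lambda>x. F x - H n x)"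
    by (rule n2_triangle) measurable
  also have "\<dots> \<le> 2 * ennreal (e/4) + 2 * ennreal (e/4)"
    using n k by (intro add_mono mult_left_mono) (auto simp: F_def n2_diff_commute[of f] n2_diff_commute[of _ "H n"])
  also have "\<dots> = ennreal e"
    using e by (simp add: ennreal_mult'[symmetric] ennreal_plus[symmetric] flip: ennreal_numeral del: ennreal_plus)
  finally show thesis using that[OF cont Hb H0] by blast
qed

lemma n2_shift_tendsto:
  fixes f :: "'a::euclidean_space \<Rightarrow> 'b::euclidean_space"
  assumes [measurable]: "f \<in> borel_measurable borel" and f: "n2 f < \<infinity>" and h: "h \<longlonglongrightarrow> 0"
  shows "(\<lambda>n. n2 (\<lambda>x. f (x + h n) - f x)) \<longlonglongrightarrow> 0"
proof (rule tendsto_ennrealI0)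
  fix e :: real assume e: "e > 0"
  \<comment> \<open>Two nested uses of the triangle inequality with factor 2 give 2/12 + 2 (2/12 +
    2/12) = 10/12.\<close>
  have "e/12 > 0" using e by simp
  from L2_continuous_dense[OF assms(1) f this] obtain g B R where g: "continuous_on UNIV g" "\<And>x. norm (g x) \<le> B"
    "\<And>x. norm x \<ge> R \<Longrightarrow> g x = 0" "n2 (\<lambda>x. f x - g x) \<le> ennreal (e/12)" by metis
  have [measurable]: "g \<in> borel_measurable borel" using g(1) by (rule borel_measurable_continuous_onI)
  have "B \<ge> 0" using g(2)[of 0] norm_ge_zero order_trans by blast
  obtain M where M: "\<And>n. norm (h n) \<le> M"
    using convergent_imp_Bseq[OF convergentI[OF h]] unfolding Bseq_def by blast
  have "(\<lambda>n. n2 (\<lambda>x. g (x + h n) - g x)) \<longlonglongrightarrow> 0"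
  proof (rule n2_tendsto_dominated)
    show "n2 (\<lambda>x::'a. indicator (ball 0 (R + M + 1)) x *\<^sub>R B) < \<infinity>" by (rule n2_indicator_ball)
    show "norm (g (x + h n)) \<le> norm (indicator (ball 0 (R + M + 1)) x *\<^sub>R B)" for n x
    proof (cases "norm x < R + M + 1")
      case True then show ?thesis using g(2)[of "x + h n"] \<open>B \<ge> 0\<close> by (simp add: indicator_def)
    next
      case False
      then have "norm (x + h n) \<ge> R" using M[of n] norm_triangle_ineq4[of "x + h n" "h n"] by simp
      then show ?thesis using g(3) by simp
    qed
    show "AE x in lborel. (\<lambda>n. g (x + h n)) \<longlonglongrightarrow> g x"
    proof (rule AE_I2)
      fix x
      have "(\<lambda>n. x + h n) \<longlonglongrightarrow> x + 0" by (intro tendsto_intros h)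
      then show "(\<lambda>n. g (x + h n)) \<longlonglongrightarrow> g x"
        using g(1) by (intro isCont_tendsto_compose[of x g]) (auto simp: continuous_on_eq_continuous_at)
    qed
  qed measurable
  then have "\<forall>\<^sub>F n in sequentially. n2 (\<lambda>x. g (x + h n) - g x) < ennreal (e/12)"
    using e by (intro order_tendstoD(2)) auto
  then show "\<forall>\<^sub>F n in sequentially. n2 (\<lambda>x. f (x + h n) - f x) \<le> ennreal e"
  proof eventually_elim
    case (elim n)
    have 1: "n2 (\<lambda>x. f (x + h n) - g (x + h n)) \<le> ennreal (e/12)"
      using n2_shift[of "\<lambda>x. f x - g x" "h n"] g(4) by simp
    have "n2 (\<lambda>x. g (x + h n) - f x) \<le> 2 * n2 (\<lambda>x. g (x + h n) - g x) + 2 * n2 (\<lambda>x. g x - f x)"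
      by (rule n2_triangle) measurable
    also have "\<dots> \<le> 2 * ennreal (e/12) + 2 * ennreal (e/12)"
      using elim g(4) by (intro add_mono mult_left_mono) (auto simp: n2_diff_commute[of g])
    finally have 2: "n2 (\<lambda>x. g (x + h n) - f x) \<le> 2 * ennreal (e/12) + 2 * ennreal (e/12)" .
    have "n2 (\<lambda>x. f (x + h n) - f x) \<le> 2 * n2 (\<lambda>x. f (x + h n) - g (x + h n)) + 2 * n2 (\<lambda>x. g (x + h n) - f x)"
      by (rule n2_triangle) measurable
    also have "\<dots> \<le> 2 * ennreal (e/12) + 2 * (2 * ennreal (e/12) + 2 * ennreal (e/12))"
      using 1 2 by (intro add_mono mult_left_mono) auto
    also have "\<dots> = ennreal (2 * (e/12) + 2 * (2 * (e/12) + 2 * (e/12)))"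
      using e by (simp add: ennreal_mult'[symmetric] ennreal_plus[symmetric] flip: ennreal_numeral del: ennreal_plus)
    also have "\<dots> \<le> ennreal e" using e by (intro ennreal_leI) simp
    finally show ?case .
  qed
qed

section \<open>The Fourier integral\<close>

text \<open>Covers both transforms: \<open>sg = -1\<close> is the forward one, \<open>sg = 1\<close>
  the inverse. If \<open>u\<close> is not integrable, the value is the default 0 of the Bochner
  integral.\<close>

definition fourier_int :: "real \<Rightarrow> ('a::euclidean_space \<Rightarrow> complex) \<Rightarrow> 'a \<Rightarrow> complex" where
  "fourier_int sg u \<xi> = complex_of_real ((2 * pi) powr (- real DIM('a) / 2)) *
     (LBINT x. exp (complex_of_real sg * \<i> * complex_of_real (x \<bullet> \<xi>)) * u x)"

text \<open>By its definition \<open>lborel\<close> is the image of a product of one-dimensional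
  measures under the coordinate map, so product functions integrate one coordinate at a
  time.\<close>

lemma integral_lborel_prod:
  fixes f :: "'a::euclidean_space \<Rightarrow> real \<Rightarrow> complex"
  assumes f: "\<And>b. b \<in> Basis \<Longrightarrow> integrable lborel (f b)"
  shows "(LBINT x::'a. (\<Prod>b\<in>Basis. f b (x \<bullet> b))) = (\<Prod>b\<in>Basis. LBINT t. f b t)" (is ?A)
    and "integrable lborel (\<lambda>x::'a. \<Prod>b\<in>Basis. f b (x \<bullet> b))" (is ?B)
proof -
  interpret product_sigma_finite "\<lambda>_::'a. lborel :: real measure" ..
  have lb: "(lborel :: 'a measure) = distr (\<Pi>\<^sub>M b\<in>Basis. lborel) borel (\<lambda>f. \<Sum>b\<in>Basis. f b *\<^sub>R b)"
    unfolding lborel_def[where 'a='a] lborel_eq_real ..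
  have [measurable]: "f b \<in> borel_measurable borel" if "b \<in> Basis" for b using f[OF that] by auto
  have [measurable]: "(\<lambda>x::'a. \<Prod>b\<in>Basis. f b (x \<bullet> b)) \<in> borel_measurable borel" by measurable
  have eq: "(\<Prod>b\<in>Basis. f b ((\<Sum>c\<in>Basis. y c *\<^sub>R c) \<bullet> b)) = (\<Prod>b\<in>Basis. f b (y b))" for y :: "'a \<Rightarrow> real"
    by (intro prod.cong refl) (simp add: inner_sum_left inner_Basis if_distrib sum.If_cases cong: if_cong)
  have T: "(\<lambda>f. \<Sum>b\<in>Basis. f b *\<^sub>R b) \<in> (\<Pi>\<^sub>M b\<in>(Basis::'a set). lborel) \<rightarrow>\<^sub>M (borel::'a measure)" by measurable
  show ?A
    unfolding lb by (subst integral_distr[OF T]) (auto simp: eq product_integral_prod f)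
  show ?B
    unfolding lb by (subst integrable_distr_eq[OF T]) (auto simp: eq intro!: product_integrable_prod f)
qed

text \<open>This is the characteristic function of the standard normal law, freed of its normalising
  constant.\<close>

lemma gaussian_1d:
  "(LBINT x. iexp (t * x) * complex_of_real (exp (- x\<^sup>2 / 2))) = complex_of_real (sqrt (2 * pi) * exp (- t\<^sup>2 / 2))" (is ?A)
  "integrable lborel (\<lambda>x. iexp (t * x) * complex_of_real (exp (- x\<^sup>2 / 2)))" (is ?B)
proof -
  have "complex_of_real (exp (- (t^2)/2)) = (LBINT x. std_normal_density x *\<^sub>R iexp (t * x))"
    using fun_cong[OF char_std_normal_distribution, of t] unfolding char_def
    by (subst (asm) integral_density) auto
  also have "\<dots> = (LBINT x. complex_of_real (1 / sqrt (2 * pi)) * (iexp (t * x) * complex_of_real (exp (- x\<^sup>2 / 2))))"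
    by (intro Bochner_Integration.integral_cong refl) (simp add: std_normal_density_def scaleR_conv_of_real)
  also have "\<dots> = complex_of_real (1 / sqrt (2 * pi)) * (LBINT x. iexp (t * x) * complex_of_real (exp (- x\<^sup>2 / 2)))"
    by (rule integral_mult_right_zero)
  finally show ?A by (simp add: field_simps)
  have "integrable lborel (\<lambda>x. sqrt (2 * pi) * std_normal_density x)"
    using integrable_std_normal_moment[of 0] by (intro integrable_mult_right) simp
  then have "integrable lborel (\<lambda>x::real. exp (- x\<^sup>2 / 2))"
    by (simp add: std_normal_density_def)
  then show ?B
    by (rule Bochner_Integration.integrable_bound) (auto simp: norm_mult)
qed

text \<open>Phase and Gaussian both factor over the coordinates. The constant in
  \<open>fourier_int\<close> is the one that makes the Gaussian a fixed point, for either sign,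
  since \<open>sg\<close> appears squared in the result.\<close>

lemma gaussian_nd:
  fixes \<xi> :: "'a::euclidean_space"
  assumes sg: "sg\<^sup>2 = 1"
  shows "integrable lborel (\<lambda>x::'a. exp (complex_of_real sg * \<i> * complex_of_real (x \<bullet> \<xi>)) * complex_of_real (exp (- (norm x)\<^sup>2 / 2)))"
    and "fourier_int sg (\<lambda>x. complex_of_real (exp (- (norm x)\<^sup>2 / 2))) \<xi> = complex_of_real (exp (- (norm \<xi>)\<^sup>2 / 2))"
proof -
  have sq: "(norm x)\<^sup>2 = (\<Sum>b\<in>Basis. (x \<bullet> b)\<^sup>2)" for x :: 'a
    unfolding power2_norm_eq_inner by (subst euclidean_inner) (simp add: power2_eq_square)
  have eq: "exp (complex_of_real sg * \<i> * complex_of_real (x \<bullet> \<xi>)) * complex_of_real (exp (- (norm x)\<^sup>2 / 2))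
     = (\<Prod>b\<in>Basis. iexp (sg * (\<xi> \<bullet> b) * (x \<bullet> b)) * complex_of_real (exp (- (x \<bullet> b)\<^sup>2 / 2)))" for x :: 'a
  proof -
    have "x \<bullet> \<xi> = (\<Sum>b\<in>Basis. (x \<bullet> b) * (\<xi> \<bullet> b))" by (rule euclidean_inner)
    then show ?thesis
      by (simp add: sq prod.distrib exp_sum[symmetric] sum_distrib_left sum_negf sum_divide_distrib
          exp_of_real[symmetric] mult_ac del: exp_of_real)
  qed
  show "integrable lborel (\<lambda>x::'a. exp (complex_of_real sg * \<i> * complex_of_real (x \<bullet> \<xi>)) * complex_of_real (exp (- (norm x)\<^sup>2 / 2)))"
    unfolding eq by (rule integral_lborel_prod(2)) (rule gaussian_1d(2))
  have "(LBINT x. exp (complex_of_real sg * \<i> * complex_of_real (x \<bullet> \<xi>)) * complex_of_real (exp (- (norm x)\<^sup>2 / 2)))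
    = (\<Prod>b\<in>(Basis::'a set). complex_of_real (sqrt (2 * pi) * exp (- (sg * (\<xi> \<bullet> b))\<^sup>2 / 2)))"
    unfolding eq
    by (subst integral_lborel_prod(1)[of "\<lambda>b x. iexp (sg * (\<xi> \<bullet> b) * x) * complex_of_real (exp (- x\<^sup>2 / 2))"],
        rule gaussian_1d(2), intro prod.cong refl, rule gaussian_1d(1))
  also have "\<dots> = complex_of_real (sqrt (2 * pi) ^ DIM('a) * exp (- (norm \<xi>)\<^sup>2 / 2))"
    using sg by (simp add: prod.distrib sq exp_sum[symmetric] sum_negf sum_divide_distrib power_mult_distrib of_real_prod[symmetric] del: of_real_prod)
  finally have I: "(LBINT x. exp (complex_of_real sg * \<i> * complex_of_real (x \<bullet> \<xi>)) * complex_of_real (exp (- (norm x)\<^sup>2 / 2)))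
    = complex_of_real (sqrt (2 * pi) ^ DIM('a) * exp (- (norm \<xi>)\<^sup>2 / 2))" .
  show "fourier_int sg (\<lambda>x. complex_of_real (exp (- (norm x)\<^sup>2 / 2))) \<xi> = complex_of_real (exp (- (norm \<xi>)\<^sup>2 / 2))"
  proof -
    have "(2 * pi) powr (- real DIM('a) / 2) * sqrt (2 * pi) ^ DIM('a) = 1"
    proof -
      have "sqrt (2 * pi) ^ DIM('a) = (2 * pi) powr (real DIM('a) / 2)"
        by (simp add: powr_half_sqrt[symmetric] powr_realpow[symmetric] powr_powr)
      then show ?thesis by (simp add: powr_add[symmetric] flip: powr_add)
    qed
    then show ?thesis unfolding fourier_int_def I
      by (simp add: mult.assoc[symmetric] of_real_mult[symmetric] del: of_real_mult)
  qed
qed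

abbreviation phase :: "real \<Rightarrow> real \<Rightarrow> complex" where
  "phase sg t \<equiv> exp (complex_of_real sg * \<i> * complex_of_real t)"

abbreviation fourier_const :: "'a::euclidean_space itself \<Rightarrow> real" where
  "fourier_const _ \<equiv> (2 * pi) powr (- real DIM('a) / 2)"

lemma borel_measurable_cnj [measurable (raw)]:
  assumes "f \<in> borel_measurable M"
  shows "(\<lambda>x. cnj (f x)) \<in> borel_measurable M"
  by (rule measurable_compose[OF assms borel_measurable_continuous_onI]) (intro continuous_intros)

lemma phase_add: "phase sg (s + t) = phase sg s * phase sg t"
  by (simp add: exp_add[symmetric] algebra_simps)

lemma L2_mult_integrable:
  fixes f g :: "'a::euclidean_space \<Rightarrow> complex"
  assumes [measurable]: "f \<in> borel_measurable borel" "g \<in> borel_measurable borel"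
    and f: "n2 f < \<infinity>" and g: "n2 g < \<infinity>"
  shows "integrable lborel (\<lambda>x. f x * g x)"
proof (rule Bochner_Integration.integrable_bound)
  show "integrable lborel (\<lambda>x. (norm (f x))\<^sup>2 + (norm (g x))\<^sup>2)"
    by (intro Bochner_Integration.integrable_add) (use f g in \<open>simp_all add: n2_finite_iff_integrable[symmetric]\<close>)
  show "AE x in lborel. norm (f x * g x) \<le> norm ((norm (f x))\<^sup>2 + (norm (g x))\<^sup>2)"
  proof (rule AE_I2)
    fix x
    have "2 * (cmod (f x) * cmod (g x)) \<le> (norm (f x))\<^sup>2 + (norm (g x))\<^sup>2"
      using sum_squares_bound[of "cmod (f x)" "cmod (g x)"] by (simp add: mult.assoc)
    moreover have "0 \<le> cmod (f x) * cmod (g x)" by simp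
    ultimately have "cmod (f x) * cmod (g x) \<le> (norm (f x))\<^sup>2 + (norm (g x))\<^sup>2" by linarith
    then show "norm (f x * g x) \<le> norm ((norm (f x))\<^sup>2 + (norm (g x))\<^sup>2)" by (simp add: norm_mult)
  qed
qed measurable

text \<open>Cauchy-Schwarz in \<open>ennreal\<close>, free of finiteness assumptions: if the product
  is not integrable, the pairing is the default value 0.\<close>

lemma L2_pairing_bound:
  fixes f g :: "'a::euclidean_space \<Rightarrow> complex"
  assumes [measurable]: "f \<in> borel_measurable borel" "g \<in> borel_measurable borel"
  shows "ennreal ((cmod (LBINT x. f x * g x))\<^sup>2) \<le> n2 f * n2 g"
proof (cases "integrable lborel (\<lambda>x. f x * g x)")
  case True
  have "ennreal (cmod (LBINT x. f x * g x)) \<le> (\<integral>\<^sup>+ x. ennreal (norm (f x)) * ennreal (norm (g x)) \<partial>lborel)"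
    using integral_norm_bound_ennreal[OF True] by (simp add: norm_mult ennreal_mult)
  then have "(ennreal (cmod (LBINT x. f x * g x)))\<^sup>2 \<le> (\<integral>\<^sup>+ x. ennreal (norm (f x)) * ennreal (norm (g x)) \<partial>lborel)\<^sup>2"
    by (rule power_mono) simp
  also have "\<dots> \<le> (\<integral>\<^sup>+ x. (ennreal (norm (f x)))\<^sup>2 \<partial>lborel) * (\<integral>\<^sup>+ x. (ennreal (norm (g x)))\<^sup>2 \<partial>lborel)"
    by (rule Cauchy_Schwarz_nn_integral) measurable
  finally show ?thesis by (simp add: n2_def ennreal_power)
next
  case False
  then show ?thesis by (simp add: not_integrable_integral_eq)
qed

lemma L2_pairing_tendsto:
  fixes f :: "nat \<Rightarrow> 'a::euclidean_space \<Rightarrow> complex"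
  assumes [measurable]: "\<And>n. f n \<in> borel_measurable borel" "h \<in> borel_measurable borel" "g \<in> borel_measurable borel"
    and fin: "n2 h < \<infinity>" "n2 g < \<infinity>" "\<And>n. n2 (f n) < \<infinity>" and lim: "(\<lambda>n. n2 (\<lambda>x. f n x - h x)) \<longlonglongrightarrow> 0"
  shows "(\<lambda>n. LBINT x. f n x * g x) \<longlonglongrightarrow> (LBINT x. h x * g x)"
proof -
  have "(\<lambda>n. n2 g * n2 (\<lambda>x. f n x - h x)) \<longlonglongrightarrow> n2 g * 0"
    using fin by (intro ennreal_tendsto_cmult lim) auto
  then have lim0: "(\<lambda>n. n2 (\<lambda>x. f n x - h x) * n2 g) \<longlonglongrightarrow> 0" by (simp add: mult.commute)
  have diff: "(LBINT x. f n x * g x) - (LBINT x. h x * g x) = (LBINT x. (f n x - h x) * g x)" for n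
    using fin by (subst Bochner_Integration.integral_diff[symmetric]) (auto intro!: L2_mult_integrable simp: algebra_simps)
  have "(\<lambda>n. ennreal ((cmod ((LBINT x. f n x * g x) - (LBINT x. h x * g x)))\<^sup>2)) \<longlonglongrightarrow> 0"
    unfolding diff by (rule tendsto_sandwich[OF _ _ tendsto_const lim0]) (auto intro!: always_eventually L2_pairing_bound)
  then have "(\<lambda>n. (cmod ((LBINT x. f n x * g x) - (LBINT x. h x * g x)))\<^sup>2) \<longlonglongrightarrow> 0"
    by (subst (asm) ennreal_0[symmetric], subst (asm) tendsto_ennreal_iff) auto
  then have "(\<lambda>n. sqrt ((cmod ((LBINT x. f n x * g x) - (LBINT x. h x * g x)))\<^sup>2)) \<longlonglongrightarrow> sqrt 0"
    by (intro tendsto_real_sqrt)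
  then show ?thesis by (simp add: tendsto_norm_zero_iff LIM_zero_iff)
qed

lemma integrable_phase_mult:
  assumes "integrable lborel u"
  shows "integrable lborel (\<lambda>x. phase sg (x \<bullet> \<xi>) * u x)"
  by (rule Bochner_Integration.integrable_bound[OF assms]) (use assms in \<open>auto simp: norm_mult\<close>)

lemma measurable_fourier_int [measurable]:
  assumes [measurable]: "u \<in> borel_measurable borel"
  shows "fourier_int sg u \<in> borel_measurable borel"
  unfolding fourier_int_def[abs_def] by measurable

lemma fourier_int_bound:
  fixes u :: "'a::euclidean_space \<Rightarrow> complex"
  shows "cmod (fourier_int sg u \<xi>) \<le> fourier_const TYPE('a) * (LBINT x. cmod (u x))"
proof -
  have "cmod (LBINT x. phase sg (x \<bullet> \<xi>) * u x) \<le> (LBINT x. cmod (phase sg (x \<bullet> \<xi>) * u x))"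
    by (rule integral_norm_bound)
  then show ?thesis by (simp add: fourier_int_def norm_mult mult_left_mono)
qed

lemma fourier_int_diff:
  assumes "integrable lborel u" "integrable lborel v"
  shows "fourier_int sg (\<lambda>x. u x - v x) \<xi> = fourier_int sg u \<xi> - fourier_int sg v \<xi>"
  unfolding fourier_int_def using assms
  by (simp add: right_diff_distrib integrable_phase_mult)

lemma fourier_int_add:
  assumes "integrable lborel u" "integrable lborel v"
  shows "fourier_int sg (\<lambda>x. u x + v x) \<xi> = fourier_int sg u \<xi> + fourier_int sg v \<xi>"
  unfolding fourier_int_def using assms
  by (simp add: distrib_left integrable_phase_mult)

lemma fourier_int_cmult: "fourier_int sg (\<lambda>x. a * u x) \<xi> = a * fourier_int sg u \<xi>"
  unfolding fourier_int_def by (simp add: mult.left_commute[of _ a])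

lemma fourier_int_cnj: "cnj (fourier_int sg u \<xi>) = fourier_int (- sg) (\<lambda>x. cnj (u x)) \<xi>"
  unfolding fourier_int_def
  by (simp add: exp_cnj flip: Bochner_Integration.integral_cnj)

lemma fourier_int_dilate:
  fixes u :: "'a::euclidean_space \<Rightarrow> complex"
  assumes [measurable]: "u \<in> borel_measurable borel" and c: "c > 0"
  shows "fourier_int sg (\<lambda>x. u (c *\<^sub>R x)) \<xi> = fourier_int sg u (\<xi> /\<^sub>R c) / complex_of_real (c ^ DIM('a))"
proof -
  have "(LBINT x. phase sg (x \<bullet> (\<xi> /\<^sub>R c)) * u x) = c ^ DIM('a) *\<^sub>R (LBINT x. phase sg ((0 + c *\<^sub>R x) \<bullet> (\<xi> /\<^sub>R c)) * u (0 + c *\<^sub>R x))"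
    using integral_lborel_affine[of "\<lambda>x. phase sg (x \<bullet> (\<xi> /\<^sub>R c)) * u x" c 0] c by simp
  also have "\<dots> = c ^ DIM('a) *\<^sub>R (LBINT x. phase sg (x \<bullet> \<xi>) * u (c *\<^sub>R x))"
  proof -
    have "(0 + c *\<^sub>R x) \<bullet> (\<xi> /\<^sub>R c) = x \<bullet> \<xi>" for x using c by simp
    then show ?thesis by (simp only: add_0)
  qed
  finally show ?thesis using c by (simp add: fourier_int_def scaleR_conv_of_real)
qed

text \<open>Fubini, since the phase is symmetric in the two variables. This identity does the work
  of Fourier inversion: Plancherel's theorem and the lower semicontinuity of the kinetic energy both
  come from it.\<close>

lemma fourier_int_multiplication:
  fixes u w :: "'a::euclidean_space \<Rightarrow> complex"
  assumes u: "integrable lborel u" and w: "integrable lborel w"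
  shows "(LBINT \<xi>. fourier_int sg u \<xi> * w \<xi>) = (LBINT x. u x * fourier_int sg w x)"
proof -
  have [measurable]: "u \<in> borel_measurable borel" "w \<in> borel_measurable borel" using u w by auto
  define F where "F = (\<lambda>(x::'a, \<xi>::'a). phase sg (x \<bullet> \<xi>) * u x * w \<xi>)"
  have int: "integrable (lborel \<Otimes>\<^sub>M lborel) F"
  proof (rule lborel_pair.Fubini_integrable)
    show "F \<in> borel_measurable (lborel \<Otimes>\<^sub>M lborel)" unfolding F_def by measurable
    have "(\<lambda>x. LBINT y. norm (F (x, y))) = (\<lambda>x. norm (u x) * (LBINT y. norm (w y)))"
      by (simp add: F_def norm_mult)
    then show "integrable lborel (\<lambda>x. LBINT y. norm (F (x, y)))" using u by simp
    show "AE x in lborel. integrable lborel (\<lambda>y. F (x, y))"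
    proof (rule AE_I2)
      fix x
      have "integrable lborel (\<lambda>y. u x * (phase sg (y \<bullet> x) * w y))"
        by (intro integrable_mult_right integrable_phase_mult w)
      then show "integrable lborel (\<lambda>y. F (x, y))" by (simp add: F_def mult_ac inner_commute)
    qed
  qed
  have "fourier_int sg u \<xi> * w \<xi> = fourier_const TYPE('a) * (LBINT x. phase sg (x \<bullet> \<xi>) * u x * w \<xi>)" for \<xi>
    unfolding fourier_int_def by (simp only: integral_mult_left_zero mult.assoc[of "complex_of_real _"])
  then have "(LBINT \<xi>. fourier_int sg u \<xi> * w \<xi>) = fourier_const TYPE('a) * (LBINT \<xi>. LBINT x. phase sg (x \<bullet> \<xi>) * u x * w \<xi>)"
    by (simp only: integral_mult_right_zero)
  also have "(LBINT \<xi>. LBINT x. phase sg (x \<bullet> \<xi>) * u x * w \<xi>) = (LBINT x. LBINT \<xi>. phase sg (x \<bullet> \<xi>) * u x * w \<xi>)"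
    by (rule lborel_pair.Fubini_integral) (use int in \<open>simp add: F_def\<close>)
  also have "(LBINT x. LBINT \<xi>. phase sg (x \<bullet> \<xi>) * u x * w \<xi>) = (LBINT x. u x * (LBINT \<xi>. phase sg (\<xi> \<bullet> x) * w \<xi>))"
  proof (rule Bochner_Integration.integral_cong[OF refl])
    fix x
    have "(LBINT \<xi>. phase sg (x \<bullet> \<xi>) * u x * w \<xi>) = (LBINT \<xi>. u x * (phase sg (\<xi> \<bullet> x) * w \<xi>))"
      by (simp add: mult_ac inner_commute)
    also have "\<dots> = u x * (LBINT \<xi>. phase sg (\<xi> \<bullet> x) * w \<xi>)" by (rule integral_mult_right_zero)
    finally show "(LBINT \<xi>. phase sg (x \<bullet> \<xi>) * u x * w \<xi>) = u x * (LBINT \<xi>. phase sg (\<xi> \<bullet> x) * w \<xi>)" .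
  qed
  also have "complex_of_real (fourier_const TYPE('a)) * \<dots> = (LBINT x. u x * fourier_int sg w x)"
    unfolding fourier_int_def
    by (simp only: mult.left_commute[of _ "complex_of_real (fourier_const TYPE('a))"] integral_mult_right_zero)
  finally show ?thesis .
qed

section \<open>Plancherel's theorem on the intersection of L1 and L2\<close>

lemma gaussian_integral:
  "integrable lborel (\<lambda>z::'a::euclidean_space. fourier_const TYPE('a) * exp (- (norm z)\<^sup>2 / 2))"
  "(LBINT z::'a. fourier_const TYPE('a) * exp (- (norm z)\<^sup>2 / 2)) = 1"
proof -
  have i: "integrable lborel (\<lambda>x::'a. complex_of_real (exp (- (norm x)\<^sup>2 / 2)))"
    using gaussian_nd(1)[of 1 "0::'a"] by simp
  then have "integrable lborel (\<lambda>x::'a. exp (- (norm x)\<^sup>2 / 2))" by (simp only: complex_of_real_integrable_eq)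
  then show "integrable lborel (\<lambda>z::'a::euclidean_space. fourier_const TYPE('a) * exp (- (norm z)\<^sup>2 / 2))"
    by (rule integrable_mult_right)
  have "complex_of_real (LBINT z::'a. fourier_const TYPE('a) * exp (- (norm z)\<^sup>2 / 2)) = 1"
    using gaussian_nd(2)[of 1 "0::'a"] unfolding fourier_int_def by simp
  then show "(LBINT z::'a. fourier_const TYPE('a) * exp (- (norm z)\<^sup>2 / 2)) = 1" by (simp only: of_real_eq_1_iff)
qed

lemma fourier_int_gaussian_dilate:
  fixes x :: "'a::euclidean_space"
  assumes sg: "sg\<^sup>2 = 1" and d: "d > 0"
  shows "integrable lborel (\<lambda>\<xi>::'a. complex_of_real (exp (- (norm (d *\<^sub>R \<xi>))\<^sup>2 / 2)))"
    and "fourier_int sg (\<lambda>\<xi>::'a. complex_of_real (exp (- (norm (d *\<^sub>R \<xi>))\<^sup>2 / 2))) x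
      = complex_of_real (exp (- (norm (x /\<^sub>R d))\<^sup>2 / 2) / d ^ DIM('a))"
proof -
  have "integrable lborel (\<lambda>x::'a. complex_of_real (exp (- (norm x)\<^sup>2 / 2)))"
    using gaussian_nd(1)[of 1 "0::'a"] by simp
  from integrable_lborel_affine[OF this, of d 0] d
  show "integrable lborel (\<lambda>\<xi>::'a. complex_of_real (exp (- (norm (d *\<^sub>R \<xi>))\<^sup>2 / 2)))" by simp
  show "fourier_int sg (\<lambda>\<xi>::'a. complex_of_real (exp (- (norm (d *\<^sub>R \<xi>))\<^sup>2 / 2))) x
      = complex_of_real (exp (- (norm (x /\<^sub>R d))\<^sup>2 / 2) / d ^ DIM('a))"
    by (subst fourier_int_dilate[OF _ d, of "\<lambda>x. complex_of_real (exp (- (norm x)\<^sup>2 / 2))"])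
       (auto simp only: gaussian_nd(2)[OF sg] of_real_divide intro!: borel_measurable_continuous_onI continuous_intros)
qed

text \<open>Regularising by a Gaussian of width \<open>1 / d\<close> in frequency turns the energy of the transform into an
  average of the autocorrelation of \<open>u\<close> at scale \<open>d\<close>.\<close>

lemma fourier_int_regularised_energy:
  fixes u :: "'a::euclidean_space \<Rightarrow> complex"
  assumes u: "integrable lborel u" and u2: "n2 u < \<infinity>" and sg: "sg\<^sup>2 = 1" and d: "d > 0"
  shows "(LBINT \<xi>. fourier_int sg u \<xi> * (cnj (fourier_int sg u \<xi>) * complex_of_real (exp (- (norm (d *\<^sub>R \<xi>))\<^sup>2 / 2))))
    = (LBINT x. u x * (LBINT z. cnj (u (x + d *\<^sub>R z)) * complex_of_real (fourier_const TYPE('a) * exp (- (norm z)\<^sup>2 / 2))))"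
    and "integrable lborel (\<lambda>\<xi>. cnj (fourier_int sg u \<xi>) * complex_of_real (exp (- (norm (d *\<^sub>R \<xi>))\<^sup>2 / 2)))"
proof -
  have [measurable]: "u \<in> borel_measurable borel" using u by auto
  define G where "G \<xi> = complex_of_real (exp (- (norm (d *\<^sub>R \<xi>))\<^sup>2 / 2))" for \<xi> :: 'a
  have G: "integrable lborel G" unfolding G_def by (rule fourier_int_gaussian_dilate(1)[OF sg d])
  then have [measurable]: "G \<in> borel_measurable borel" by auto
  define c where "c = complex_of_real (fourier_const TYPE('a))"
  define psi where "psi \<xi> = cnj (fourier_int sg u \<xi>) * G \<xi>" for \<xi>
  define B where "B = fourier_const TYPE('a) * (LBINT x. cmod (u x))"
  have psi: "integrable lborel psi"
  proof (rule Bochner_Integration.integrable_bound)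
    show "integrable lborel (\<lambda>\<xi>. B * norm (G \<xi>))" using G by (intro integrable_mult_right integrable_norm)
    show "psi \<in> borel_measurable lborel" unfolding psi_def by measurable
    show "AE \<xi> in lborel. norm (psi \<xi>) \<le> norm (B * norm (G \<xi>))"
    proof (rule AE_I2)
      fix \<xi>
      have "cmod (fourier_int sg u \<xi>) \<le> B" unfolding B_def by (rule fourier_int_bound)
      then have "norm (psi \<xi>) \<le> B * norm (G \<xi>)" by (simp add: psi_def norm_mult mult_right_mono)
      then show "norm (psi \<xi>) \<le> norm (B * norm (G \<xi>))" by (simp add: abs_le_iff)
    qed
  qed
  then show "integrable lborel (\<lambda>\<xi>. cnj (fourier_int sg u \<xi>) * complex_of_real (exp (- (norm (d *\<^sub>R \<xi>))\<^sup>2 / 2)))"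
    by (simp add: psi_def[abs_def] G_def)
  have eq: "fourier_int sg psi x = (LBINT z. cnj (u (x + d *\<^sub>R z)) * complex_of_real (fourier_const TYPE('a) * exp (- (norm z)\<^sup>2 / 2)))" for x
  proof -
    have i2: "integrable lborel (\<lambda>\<xi>. phase sg (\<xi> \<bullet> x) * G \<xi>)" by (rule integrable_phase_mult[OF G])
    have i3: "integrable lborel (\<lambda>x. cnj (u x))" using u by simp
    \<comment> \<open>A modulation by \<open>x\<close> on the frequency side becomes a translation:
      the Gaussian is now centred at \<open>x\<close> and has width \<open>d\<close>.\<close>
    have feq: "fourier_int (- sg) (\<lambda>\<xi>. phase sg (\<xi> \<bullet> x) * G \<xi>) y = complex_of_real (exp (- (norm ((x - y) /\<^sub>R d))\<^sup>2 / 2) / d ^ DIM('a))" for y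
    proof -
      have "phase (- sg) (\<xi> \<bullet> y) * (phase sg (\<xi> \<bullet> x) * G \<xi>) = phase sg (\<xi> \<bullet> (x - y)) * G \<xi>" for \<xi>
      proof -
        have "phase (- sg) (\<xi> \<bullet> y) * phase sg (\<xi> \<bullet> x) = phase sg (\<xi> \<bullet> (x - y))"
          by (simp add: exp_add[symmetric] inner_diff_right right_diff_distrib)
        then show ?thesis by (simp only: mult.assoc[symmetric])
      qed
      then have "fourier_int (- sg) (\<lambda>\<xi>. phase sg (\<xi> \<bullet> x) * G \<xi>) y = fourier_int sg G (x - y)"
        unfolding fourier_int_def by (simp only:)
      then show ?thesis unfolding G_def by (simp only: fourier_int_gaussian_dilate(2)[OF sg d])
    qed
    have "fourier_int sg psi x = c * (LBINT \<xi>. fourier_int (- sg) (\<lambda>x. cnj (u x)) \<xi> * (phase sg (\<xi> \<bullet> x) * G \<xi>))"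
      unfolding fourier_int_def[of sg psi] c_def psi_def by (simp add: fourier_int_cnj mult_ac)
    also have "(LBINT \<xi>. fourier_int (- sg) (\<lambda>x. cnj (u x)) \<xi> * (phase sg (\<xi> \<bullet> x) * G \<xi>))
      = (LBINT y. cnj (u y) * fourier_int (- sg) (\<lambda>\<xi>. phase sg (\<xi> \<bullet> x) * G \<xi>) y)"
      by (rule fourier_int_multiplication[OF i3 i2])
    also have "\<dots> = (LBINT y. cnj (u y) * complex_of_real (exp (- (norm ((x - y) /\<^sub>R d))\<^sup>2 / 2) / d ^ DIM('a)))"
      by (simp only: feq)
    \<comment> \<open>The substitution y = x + d z turns the Gaussian centred at \<open>x\<close>
      into a fixed profile; its Jacobian cancels the factor \<open>d ^ DIM('a)\<close>.\<close>
    also have "c * (LBINT y. cnj (u y) * complex_of_real (exp (- (norm ((x - y) /\<^sub>R d))\<^sup>2 / 2) / d ^ DIM('a)))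
       = c * (d ^ DIM('a) *\<^sub>R (LBINT z. cnj (u (x + d *\<^sub>R z)) * complex_of_real (exp (- (norm ((x - (x + d *\<^sub>R z)) /\<^sub>R d))\<^sup>2 / 2) / d ^ DIM('a))))"
      using d by (subst integral_lborel_affine[of _ d x]) auto
    also have "\<dots> = c * (d ^ DIM('a) *\<^sub>R (LBINT z. cnj (u (x + d *\<^sub>R z)) * complex_of_real (exp (- (norm z)\<^sup>2 / 2)) / of_real (d ^ DIM('a))))"
      using d by simp
    also have "\<dots> = c * (LBINT z. cnj (u (x + d *\<^sub>R z)) * complex_of_real (exp (- (norm z)\<^sup>2 / 2)))"
      using d by (simp add: scaleR_conv_of_real)
    also have "\<dots> = (LBINT z. cnj (u (x + d *\<^sub>R z)) * complex_of_real (fourier_const TYPE('a) * exp (- (norm z)\<^sup>2 / 2)))"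
      unfolding c_def by (simp only: of_real_mult mult.left_commute[of _ "complex_of_real (fourier_const TYPE('a))"] integral_mult_right_zero)
    finally show ?thesis .
  qed
  have "(LBINT \<xi>. fourier_int sg u \<xi> * psi \<xi>) = (LBINT x. u x * fourier_int sg psi x)"
    by (rule fourier_int_multiplication[OF u psi])
  then show "(LBINT \<xi>. fourier_int sg u \<xi> * (cnj (fourier_int sg u \<xi>) * complex_of_real (exp (- (norm (d *\<^sub>R \<xi>))\<^sup>2 / 2))))
    = (LBINT x. u x * (LBINT z. cnj (u (x + d *\<^sub>R z)) * complex_of_real (fourier_const TYPE('a) * exp (- (norm z)\<^sup>2 / 2))))"
    unfolding eq by (simp add: psi_def G_def)
qed

text \<open>By Fubini the double integral is the autocorrelation of \<open>u\<close> averaged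
  against a Gaussian of mass one at scale \<open>d n\<close>. The autocorrelation is bounded by the
  squared norm and, because translations are continuous in L2, tends to its value at 0; dominated
  convergence applies.\<close>

lemma autocorrelation_average_tendsto:
  fixes u :: "'a::euclidean_space \<Rightarrow> complex"
  assumes [measurable]: "u \<in> borel_measurable borel" and u2: "n2 u < \<infinity>"
    and d: "d \<longlonglongrightarrow> 0"
  shows "(\<lambda>n. LBINT x. u x * (LBINT z. cnj (u (x + d n *\<^sub>R z)) * complex_of_real (fourier_const TYPE('a) * exp (- (norm z)\<^sup>2 / 2))))
    \<longlonglongrightarrow> (LBINT x. u x * cnj (u x))"
proof -
  define g where "g z = complex_of_real (fourier_const TYPE('a) * exp (- (norm z)\<^sup>2 / 2))" for z :: 'a
  have g: "integrable lborel g" "(LBINT z. g z) = 1"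
    unfolding g_def using gaussian_integral[where 'a='a] by (simp_all only: complex_of_real_integrable_eq integral_complex_of_real of_real_1)
  have [measurable]: "g \<in> borel_measurable borel" using g by auto
  define A where "A h = (LBINT x. cnj (u (x + h)) * u x)" for h
  define N where "N = enn2real (n2 u)"
  have N: "n2 u = ennreal N" "N \<ge> 0" using u2 by (auto simp: N_def)
  have nsh: "n2 (\<lambda>x. cnj (u (x + h))) = n2 u" "n2 (\<lambda>x. cnj (u x)) = n2 u" for h
    using n2_shift[of u h] by (simp_all add: n2_def)
  have Ab: "cmod (A h) \<le> N" for h
  proof -
    have "ennreal ((cmod (A h))\<^sup>2) \<le> n2 (\<lambda>x. cnj (u (x + h))) * n2 u" unfolding A_def by (rule L2_pairing_bound) measurable
    also have "\<dots> = ennreal (N\<^sup>2)" using N by (simp add: nsh ennreal_mult power2_eq_square)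
    finally have "(cmod (A h))\<^sup>2 \<le> N\<^sup>2" by simp
    then show ?thesis using N(2) by (simp add: power2_le_iff_abs_le)
  qed
  have swap: "(LBINT x. u x * (LBINT z. cnj (u (x + c *\<^sub>R z)) * g z)) = (LBINT z. A (c *\<^sub>R z) * g z)" for c
  proof -
    define F where "F = (\<lambda>(z::'a, x::'a). cnj (u (x + c *\<^sub>R z)) * u x * g z)"
    have pr: "integrable lborel (\<lambda>x. cnj (u (x + h)) * u x)" for h
      by (rule L2_mult_integrable) (use nsh u2 in auto)
    have int: "integrable (lborel \<Otimes>\<^sub>M lborel) F"
    proof (rule lborel_pair.Fubini_integrable)
      show [measurable]: "F \<in> borel_measurable (lborel \<Otimes>\<^sub>M lborel)" unfolding F_def by measurable
      show "AE z in lborel. integrable lborel (\<lambda>x. F (z, x))"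
        using pr by (auto simp: F_def)
      show "integrable lborel (\<lambda>z. LBINT x. norm (F (z, x)))"
      proof (rule Bochner_Integration.integrable_bound)
        show "integrable lborel (\<lambda>z. N * norm (g z))" using g by (intro integrable_mult_right integrable_norm)
        show "AE z in lborel. norm (LBINT x. norm (F (z, x))) \<le> norm (N * norm (g z))"
        proof (rule AE_I2)
          fix z
          have "(LBINT x. norm (F (z, x))) = (LBINT x. cmod (u (x + c *\<^sub>R z)) * cmod (u x)) * norm (g z)"
            by (simp add: F_def norm_mult)
          moreover have "(LBINT x. cmod (u (x + c *\<^sub>R z)) * cmod (u x)) \<le> N"
          proof -
            let ?I = "LBINT x. cmod (u (x + c *\<^sub>R z)) * cmod (u x)"
            have "complex_of_real ?I = (LBINT x. complex_of_real (cmod (u (x + c *\<^sub>R z))) * complex_of_real (cmod (u x)))"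
              by (subst integral_complex_of_real[symmetric]) simp
            then have "ennreal ((cmod (complex_of_real ?I))\<^sup>2) \<le> n2 (\<lambda>x. complex_of_real (cmod (u (x + c *\<^sub>R z)))) * n2 (\<lambda>x. complex_of_real (cmod (u x)))"
              by (simp only:) (rule L2_pairing_bound, measurable)
            also have "\<dots> = n2 (\<lambda>x. u (x + c *\<^sub>R z)) * n2 u" by (simp add: n2_def)
            also have "\<dots> = ennreal (N\<^sup>2)" using N by (simp add: n2_shift ennreal_mult power2_eq_square)
            finally have "?I\<^sup>2 \<le> N\<^sup>2" by simp
            then show ?thesis using N(2) by (simp add: power2_le_iff_abs_le)
          qed
          moreover have "(LBINT x. cmod (u (x + c *\<^sub>R z)) * cmod (u x)) \<ge> 0" by simp
          ultimately show "norm (LBINT x. norm (F (z, x))) \<le> norm (N * norm (g z))"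
            using N(2) by (simp add: abs_mult mult_right_mono)
        qed
      qed measurable
    qed
    have "(LBINT z. A (c *\<^sub>R z) * g z) = (LBINT z. LBINT x. cnj (u (x + c *\<^sub>R z)) * u x * g z)"
      unfolding A_def by simp
    also have "\<dots> = (LBINT x. LBINT z. cnj (u (x + c *\<^sub>R z)) * u x * g z)"
      by (rule lborel_pair.Fubini_integral[symmetric]) (use int in \<open>simp add: F_def\<close>)
    also have "\<dots> = (LBINT x. u x * (LBINT z. cnj (u (x + c *\<^sub>R z)) * g z))"
      by (simp add: mult.commute[of _ "u _"] mult.assoc)
    finally show ?thesis ..
  qed
  have "(\<lambda>n. LBINT z. A (d n *\<^sub>R z) * g z) \<longlonglongrightarrow> (LBINT z. A 0 * g z)"
  proof (rule integral_dominated_convergence[where w = "\<lambda>z. N * norm (g z)"])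
    show "integrable lborel (\<lambda>z. N * norm (g z))" using g by (intro integrable_mult_right integrable_norm)
    show "AE z in lborel. norm (A (d n *\<^sub>R z) * g z) \<le> N * norm (g z)" for n
      using Ab by (auto simp: norm_mult mult_right_mono)
    show "AE z in lborel. (\<lambda>n. A (d n *\<^sub>R z) * g z) \<longlonglongrightarrow> A 0 * g z"
    proof (rule AE_I2)
      fix z :: 'a
      have "(\<lambda>n. d n *\<^sub>R z) \<longlonglongrightarrow> 0 *\<^sub>R z" by (intro tendsto_intros d)
      then have h: "(\<lambda>n. d n *\<^sub>R z) \<longlonglongrightarrow> 0" by simp
      have "(\<lambda>n. A (d n *\<^sub>R z)) \<longlonglongrightarrow> A 0"
        unfolding A_def
      proof (rule L2_pairing_tendsto)
        have "(\<lambda>n. n2 (\<lambda>x. u (x + d n *\<^sub>R z) - u x)) \<longlonglongrightarrow> 0" by (rule n2_shift_tendsto[OF _ u2 h]) simp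
        also have "(\<lambda>n. n2 (\<lambda>x. u (x + d n *\<^sub>R z) - u x)) = (\<lambda>n. n2 (\<lambda>x. cnj (u (x + d n *\<^sub>R z)) - cnj (u (x + 0))))"
          unfolding n2_def by (simp add: complex_cnj_diff[symmetric] del: complex_cnj_diff)
        finally show "(\<lambda>n. n2 (\<lambda>x. cnj (u (x + d n *\<^sub>R z)) - cnj (u (x + 0)))) \<longlonglongrightarrow> 0" .
      qed (use nsh u2 in auto)
      then show "(\<lambda>n. A (d n *\<^sub>R z) * g z) \<longlonglongrightarrow> A 0 * g z" by (intro tendsto_intros)
    qed
  qed (unfold A_def, measurable)
  also have "(LBINT z. A 0 * g z) = (LBINT x. u x * cnj (u x))"
    using g(2) by (simp add: A_def mult.commute)
  finally show ?thesis unfolding swap[symmetric] by (simp only: g_def)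
qed

text \<open>The Gaussian regularisation is removed on both sides. On the frequency side the weights
  increase to 1, so monotone convergence works although the transform is not yet known to be square
  integrable; on the other side the autocorrelation average converges to the squared norm of
  \<open>u\<close>.\<close>

theorem plancherel_fourier_int:
  fixes u :: "'a::euclidean_space \<Rightarrow> complex"
  assumes u: "integrable lborel u" and u2: "n2 u < \<infinity>" and sg: "sg\<^sup>2 = 1"
  shows "n2 (fourier_int sg u) = n2 u"
proof -
  have [measurable]: "u \<in> borel_measurable borel" using u by auto
  define d where "d n = 1 / real (Suc n)" for n
  have d: "d n > 0" "d \<longlonglongrightarrow> 0" "decseq d" for n
    using LIMSEQ_inverse_real_of_nat unfolding d_def[abs_def]
    by (auto simp: decseq_def frac_le inverse_eq_divide)
  let ?v = "fourier_int sg u"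
  define E where "E n \<xi> = exp (- (norm (d n *\<^sub>R \<xi>))\<^sup>2 / 2)" for n and \<xi> :: 'a
  have [measurable]: "E n \<in> borel_measurable borel" for n unfolding E_def by measurable
  have E0: "E n \<xi> \<ge> 0" for n \<xi> by (simp add: E_def)
  have lhs: "(\<lambda>n. \<integral>\<^sup>+ \<xi>. ennreal ((cmod (?v \<xi>))\<^sup>2 * E n \<xi>) \<partial>lborel) \<longlonglongrightarrow> n2 ?v"
    unfolding n2_def
  proof (rule nn_integral_LIMSEQ)
    show "incseq (\<lambda>n \<xi>. ennreal ((cmod (?v \<xi>))\<^sup>2 * E n \<xi>))"
    proof (rule incseq_SucI, rule le_funI, rule ennreal_leI, rule mult_left_mono)
      fix n and \<xi> :: 'a
      have "(norm (d (Suc n) *\<^sub>R \<xi>))\<^sup>2 \<le> (norm (d n *\<^sub>R \<xi>))\<^sup>2"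
        using d(1)[of n] d(1)[of "Suc n"] decseq_SucD[OF d(3), of n] by (intro power_mono) (auto intro!: mult_right_mono)
      then show "E n \<xi> \<le> E (Suc n) \<xi>" unfolding E_def by simp
    qed simp
    fix \<xi>
    have "(\<lambda>n. ennreal ((cmod (?v \<xi>))\<^sup>2 * E n \<xi>)) \<longlonglongrightarrow> ennreal ((cmod (?v \<xi>))\<^sup>2 * exp (- (norm (0 *\<^sub>R \<xi>))\<^sup>2 / 2))"
      unfolding E_def by (intro tendsto_intros d) auto
    then show "(\<lambda>n. ennreal ((cmod (?v \<xi>))\<^sup>2 * E n \<xi>)) \<longlonglongrightarrow> ennreal ((cmod (?v \<xi>))\<^sup>2)" by simp
  qed measurable
  have int: "complex_of_real (LBINT \<xi>. (cmod (?v \<xi>))\<^sup>2 * E n \<xi>) = (LBINT x. u x * (LBINT z. cnj (u (x + d n *\<^sub>R z)) * complex_of_real (fourier_const TYPE('a) * exp (- (norm z)\<^sup>2 / 2))))"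
    and int': "integrable lborel (\<lambda>\<xi>. (cmod (?v \<xi>))\<^sup>2 * E n \<xi>)" for n
  proof -
    have eq: "?v \<xi> * (cnj (?v \<xi>) * complex_of_real (E n \<xi>)) = complex_of_real ((cmod (?v \<xi>))\<^sup>2 * E n \<xi>)" for \<xi>
      by (simp add: mult.assoc[symmetric] complex_norm_square[symmetric])
    show "complex_of_real (LBINT \<xi>. (cmod (?v \<xi>))\<^sup>2 * E n \<xi>) = (LBINT x. u x * (LBINT z. cnj (u (x + d n *\<^sub>R z)) * complex_of_real (fourier_const TYPE('a) * exp (- (norm z)\<^sup>2 / 2))))"
      using fourier_int_regularised_energy(1)[OF u u2 sg d(1)[of n]] unfolding E_def[symmetric] eq integral_complex_of_real .
    define B where "B = fourier_const TYPE('a) * (LBINT x. cmod (u x))"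
    have "integrable lborel (\<lambda>\<xi>. B * norm (cnj (?v \<xi>) * complex_of_real (E n \<xi>)))"
      unfolding E_def by (intro integrable_mult_right integrable_norm fourier_int_regularised_energy(2)[OF u u2 sg d(1)[of n]])
    then show "integrable lborel (\<lambda>\<xi>. (cmod (?v \<xi>))\<^sup>2 * E n \<xi>)"
    proof (rule Bochner_Integration.integrable_bound)
      show "AE \<xi> in lborel. norm ((cmod (?v \<xi>))\<^sup>2 * E n \<xi>) \<le> norm (B * norm (cnj (?v \<xi>) * complex_of_real (E n \<xi>)))"
      proof (rule AE_I2)
        fix \<xi>
        have "cmod (?v \<xi>) \<le> B" unfolding B_def by (rule fourier_int_bound)
        moreover have "norm (cnj (?v \<xi>) * complex_of_real (E n \<xi>)) = cmod (?v \<xi>) * E n \<xi>"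
          using E0[of n \<xi>] by (simp add: norm_mult)
        moreover have "cmod (?v \<xi>) * (cmod (?v \<xi>) * E n \<xi>) \<le> B * (cmod (?v \<xi>) * E n \<xi>)"
          using calculation E0[of n \<xi>] by (intro mult_right_mono) auto
        moreover have "norm ((cmod (?v \<xi>))\<^sup>2 * E n \<xi>) = cmod (?v \<xi>) * (cmod (?v \<xi>) * E n \<xi>)"
          using E0[of n \<xi>] by (simp add: power2_eq_square abs_mult mult.assoc)
        moreover have "B * (cmod (?v \<xi>) * E n \<xi>) \<le> norm (B * (cmod (?v \<xi>) * E n \<xi>))" by simp
        ultimately show "norm ((cmod (?v \<xi>))\<^sup>2 * E n \<xi>) \<le> norm (B * norm (cnj (?v \<xi>) * complex_of_real (E n \<xi>)))"
          by simp
      qed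
    qed measurable
  qed
  have "(\<lambda>n. complex_of_real (LBINT \<xi>. (cmod (?v \<xi>))\<^sup>2 * E n \<xi>)) \<longlonglongrightarrow> (LBINT x. u x * cnj (u x))"
    unfolding int by (rule autocorrelation_average_tendsto[OF _ u2 d(2)]) simp
  also have "(LBINT x. u x * cnj (u x)) = complex_of_real (LBINT x. (cmod (u x))\<^sup>2)"
    by (simp only: complex_norm_square[symmetric] integral_complex_of_real)
  finally have "(\<lambda>n. LBINT \<xi>. (cmod (?v \<xi>))\<^sup>2 * E n \<xi>) \<longlonglongrightarrow> (LBINT x. (cmod (u x))\<^sup>2)"
    by (simp only: tendsto_of_real_iff)
  then have "(\<lambda>n. ennreal (LBINT \<xi>. (cmod (?v \<xi>))\<^sup>2 * E n \<xi>)) \<longlonglongrightarrow> ennreal (LBINT x. (cmod (u x))\<^sup>2)"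
    by (rule tendsto_ennrealI)
  also have "ennreal (LBINT x. (cmod (u x))\<^sup>2) = n2 u"
    using u2 by (intro n2_eq_integral[symmetric]) (simp add: n2_finite_iff_integrable[symmetric])
  also have "(\<lambda>n. ennreal (LBINT \<xi>. (cmod (?v \<xi>))\<^sup>2 * E n \<xi>)) = (\<lambda>n. \<integral>\<^sup>+ \<xi>. ennreal ((cmod (?v \<xi>))\<^sup>2 * E n \<xi>) \<partial>lborel)"
    using int' E0 by (intro ext nn_integral_eq_integral[symmetric]) auto
  finally show ?thesis by (rule LIMSEQ_unique[OF lhs])
qed

section \<open>The Fourier transform on L2\<close>

abbreviation trunc :: "('a::euclidean_space \<Rightarrow> complex) \<Rightarrow> real \<Rightarrow> 'a \<Rightarrow> complex" where
  "trunc u R \<equiv> (\<lambda>x. indicator (ball 0 R) x *\<^sub>R u x)"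

lemma measurable_trunc [measurable]:
  assumes [measurable]: "u \<in> borel_measurable borel"
  shows "trunc u R \<in> borel_measurable borel"
  by (intro borel_measurable_scaleR borel_measurable_indicator) auto

lemma n2_trunc_le: "n2 (trunc u R) \<le> n2 u"
  by (rule n2_mono) (auto simp: indicator_def)

lemma trunc_integrable:
  fixes u :: "'a::euclidean_space \<Rightarrow> complex"
  assumes [measurable]: "u \<in> borel_measurable borel" and u: "n2 u < \<infinity>"
  shows "integrable lborel (trunc u R)"
proof -
  have "integrable lborel (\<lambda>x. (indicator (ball 0 R) x *\<^sub>R 1) * u x)"
    using n2_indicator_ball[of R "1::complex"] u by (intro L2_mult_integrable) auto
  then show ?thesis by (simp add: scaleR_conv_of_real)
qed

lemma n2_trunc_diff_mono:
  assumes "R \<le> R'" shows "n2 (\<lambda>x. u x - trunc u R' x) \<le> n2 (\<lambda>x. u x - trunc u R x)"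
  by (rule n2_mono) (use assms in \<open>auto simp: indicator_def\<close>)

lemma n2_trunc_tendsto_seq:
  fixes u :: "'a::euclidean_space \<Rightarrow> complex"
  assumes [measurable]: "u \<in> borel_measurable borel" and u: "n2 u < \<infinity>"
  shows "(\<lambda>n. n2 (\<lambda>x. trunc u (real n) x - u x)) \<longlonglongrightarrow> 0"
proof (rule n2_tendsto_dominated[OF _ _ _ _ u])
  show "AE x in lborel. (\<lambda>n. trunc u (real n) x) \<longlonglongrightarrow> u x"
  proof (rule AE_I2)
    fix x :: 'a
    obtain M :: nat where M: "real M > norm x" using reals_Archimedean2 by blast
    have "\<forall>\<^sub>F n in sequentially. trunc u (real n) x = u x"
      using eventually_ge_at_top[of M]
    proof eventually_elim
      case (elim n)
      then have "real M \<le> real n" by simp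
      then show ?case using M by (auto simp: indicator_def)
    qed
    then show "(\<lambda>n. trunc u (real n) x) \<longlonglongrightarrow> u x" by (rule tendsto_eventually)
  qed
qed (auto simp: indicator_def)

lemma n2_trunc_tendsto:
  fixes u :: "'a::euclidean_space \<Rightarrow> complex"
  assumes [measurable]: "u \<in> borel_measurable borel" and u: "n2 u < \<infinity>"
  shows "((\<lambda>R. n2 (\<lambda>x. u x - trunc u R x)) \<longlongrightarrow> 0) at_top"
proof (rule tendsto_ennrealI0)
  fix e :: real assume "e > 0"
  then have "\<forall>\<^sub>F n in sequentially. n2 (\<lambda>x. trunc u (real n) x - u x) < ennreal e"
    using n2_trunc_tendsto_seq[OF assms] by (intro order_tendstoD(2)) auto
  then obtain n where n: "n2 (\<lambda>x. trunc u (real n) x - u x) < ennreal e"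
    by (auto simp: eventually_sequentially)
  show "\<forall>\<^sub>F R in at_top. n2 (\<lambda>x. u x - trunc u R x) \<le> ennreal e"
    using eventually_ge_at_top[of "real n"]
  proof eventually_elim
    case (elim R)
    show ?case using n2_trunc_diff_mono[OF elim, of u] n by (simp add: n2_diff_commute[of u])
  qed
qed

lemma fourier_trunc_eq:
  fixes u :: "'a::euclidean_space \<Rightarrow> complex"
  assumes [measurable]: "u \<in> borel_measurable borel"
  shows "fourier_trunc sg u R = fourier_int sg (trunc u R)"
proof
  fix \<xi> :: 'a
  have "(LINT x|lebesgue. indicator (ball 0 R) x *\<^sub>R (phase sg (x \<bullet> \<xi>) * u x))
    = (LBINT x. indicator (ball 0 R) x *\<^sub>R (phase sg (x \<bullet> \<xi>) * u x))"
    by (rule integral_completion) (auto intro!: borel_measurable_scaleR borel_measurable_indicator)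
  then show "fourier_trunc sg u R \<xi> = fourier_int sg (trunc u R) \<xi>"
    unfolding fourier_trunc_def fourier_int_def by (simp add: mult_scaleR_right)
qed

lemma fourier_trunc_cong_AE:
  fixes u :: "'a::euclidean_space \<Rightarrow> complex"
  assumes "AE x in lebesgue. u x = v x" "u \<in> borel_measurable lebesgue" "v \<in> borel_measurable lebesgue"
  shows "fourier_trunc sg u R = fourier_trunc sg v R"
proof
  fix \<xi> :: 'a
  have [measurable]: "(\<lambda>x. phase sg (x \<bullet> \<xi>)) \<in> borel_measurable lebesgue" "ball 0 R \<in> sets lebesgue"
    by (auto intro!: measurable_completion)
  note assms(2,3)[measurable]
  have "(LINT x|lebesgue. indicator (ball 0 R) x *\<^sub>R (phase sg (x \<bullet> \<xi>) * u x))
      = (LINT x|lebesgue. indicator (ball 0 R) x *\<^sub>R (phase sg (x \<bullet> \<xi>) * v x))"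
    by (rule integral_cong_AE) (use assms(1) in \<open>auto elim!: eventually_mono\<close>)
  then show "fourier_trunc sg u R \<xi> = fourier_trunc sg v R \<xi>" by (simp add: fourier_trunc_def)
qed

lemma is_L2_transform_cong_AE:
  assumes "AE x in lebesgue. u x = v x" "u \<in> borel_measurable lebesgue" "v \<in> borel_measurable lebesgue"
  shows "is_L2_transform sg u = is_L2_transform sg v"
  unfolding is_L2_transform_def[abs_def] fourier_trunc_cong_AE[OF assms] ..

lemma L2_borel:
  assumes [measurable]: "v \<in> borel_measurable borel" and "n2 v < \<infinity>"
  shows "L2 v"
proof -
  have "integrable lborel (\<lambda>x. (cmod (v x))\<^sup>2)" using assms by (simp add: n2_finite_iff_integrable[symmetric])
  then have "integrable lebesgue (\<lambda>x. (cmod (v x))\<^sup>2)" by (subst integrable_completion) auto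
  then show ?thesis unfolding L2_def by (simp add: measurable_completion)
qed

lemma lebesgue_measurable_borel_version:
  fixes v :: "'a::euclidean_space \<Rightarrow> complex"
  assumes v: "v \<in> borel_measurable lebesgue"
  obtains v' where "v' \<in> borel_measurable borel" "AE x in lebesgue. v x = v' x"
proof -
  obtain a where a: "a \<in> borel_measurable lborel" "AE x in lborel. Re (v x) = a x"
    using completion_ex_borel_measurable_real[of "\<lambda>x. Re (v x)" lborel] v by auto
  obtain b where b: "b \<in> borel_measurable lborel" "AE x in lborel. Im (v x) = b x"
    using completion_ex_borel_measurable_real[of "\<lambda>x. Im (v x)" lborel] v by auto
  note [measurable] = a(1) b(1)
  show thesis
  proof
    have "(\<lambda>x. complex_of_real (a x) + \<i> * complex_of_real (b x)) \<in> borel_measurable borel"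
      using a(1) b(1) by simp
    then show "(\<lambda>x. Complex (a x) (b x)) \<in> borel_measurable borel"
      by (simp only: Complex_eq)
    show "AE x in lebesgue. v x = Complex (a x) (b x)"
      using AE_completion[OF a(2)] AE_completion[OF b(2)] by eventually_elim (simp add: complex_eq_iff)
  qed
qed

text \<open>Truncations lie in both L1 and L2, so Plancherel makes their transforms Cauchy. The
  limit is found along integer radii and then compared with every large real radius, because
  \<open>fourier\<close> is defined by a limit over real radii.\<close>

lemma L2_transform_exists:
  fixes u :: "'a::euclidean_space \<Rightarrow> complex"
  assumes [measurable]: "u \<in> borel_measurable borel" and u: "n2 u < \<infinity>" and sg: "sg\<^sup>2 = 1"
  shows "\<exists>v. v \<in> borel_measurable borel \<and> n2 v < \<infinity> \<and> ((\<lambda>R. n2 (\<lambda>x. v x - fourier_int sg (trunc u R) x)) \<longlongrightarrow> 0) at_top"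
proof -
  define f where "f n = fourier_int sg (trunc u (real n))" for n
  have [measurable]: "f n \<in> borel_measurable borel" for n unfolding f_def by measurable
  have tf: "n2 (trunc u R) < \<infinity>" for R using n2_trunc_le[of R u] u by (rule order_le_less_trans)
  have dfin: "n2 (\<lambda>x. trunc u R x - trunc u S x) < \<infinity>" for R S
    using tf by (intro n2_diff_finite) auto
  have fdiff: "n2 (\<lambda>x. fourier_int sg (trunc u R) x - fourier_int sg (trunc u S) x) = n2 (\<lambda>x. trunc u R x - trunc u S x)" for R S
  proof -
    have "n2 (fourier_int sg (\<lambda>x. trunc u R x - trunc u S x)) = n2 (\<lambda>x. trunc u R x - trunc u S x)"
      by (rule plancherel_fourier_int[OF _ dfin sg]) (intro Bochner_Integration.integrable_diff trunc_integrable u, measurable)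
    moreover have "fourier_int sg (\<lambda>x. trunc u R x - trunc u S x) = (\<lambda>x. fourier_int sg (trunc u R) x - fourier_int sg (trunc u S) x)"
      by (intro ext fourier_int_diff trunc_integrable u) auto
    ultimately show ?thesis by (simp only:)
  qed
  have tri: "n2 (\<lambda>x. trunc u R x - trunc u S x) \<le> 2 * n2 (\<lambda>x. u x - trunc u R x) + 2 * n2 (\<lambda>x. u x - trunc u S x)" for R S
    using n2_triangle[of "trunc u R" u "trunc u S"] by (simp add: n2_diff_commute[of _ u])
  obtain v r where v[measurable]: "v \<in> borel_measurable borel" and lim: "(\<lambda>n. n2 (\<lambda>x. f n x - v x)) \<longlonglongrightarrow> 0"
  proof (rule L2_complete[of f])
    fix e :: real assume e: "e > 0"
    have "\<forall>\<^sub>F R in at_top. n2 (\<lambda>x. u x - trunc u R x) < ennreal (e/4)"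
      using n2_trunc_tendsto[OF assms(1) u] e by (intro order_tendstoD(2)) auto
    then obtain R0 where R0: "\<And>R. R \<ge> R0 \<Longrightarrow> n2 (\<lambda>x. u x - trunc u R x) < ennreal (e/4)"
      by (auto simp: eventually_at_top_linorder)
    obtain M :: nat where M: "real M \<ge> R0" using real_arch_simple by blast
    have "n2 (\<lambda>x. f m x - f n x) \<le> ennreal e" if "m \<ge> M" "n \<ge> M" for m n
    proof -
      have mn: "real m \<ge> R0" "real n \<ge> R0" using that M by linarith+
      have "n2 (\<lambda>x. f m x - f n x) \<le> 2 * n2 (\<lambda>x. u x - trunc u (real m) x) + 2 * n2 (\<lambda>x. u x - trunc u (real n) x)"
        unfolding f_def fdiff by (rule tri)
      also have "\<dots> \<le> 2 * ennreal (e/4) + 2 * ennreal (e/4)"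
        using R0[OF mn(1)] R0[OF mn(2)] by (intro add_mono mult_left_mono) auto
      also have "\<dots> = ennreal e"
        using e by (simp add: ennreal_mult'[symmetric] ennreal_plus[symmetric] flip: ennreal_numeral del: ennreal_plus)
      finally show ?thesis .
    qed
    then show "\<exists>M. \<forall>m\<ge>M. \<forall>n\<ge>M. n2 (\<lambda>x. f m x - f n x) \<le> ennreal e" by blast
  qed (use that in auto)
  have "n2 v < \<infinity>"
  proof -
    have "\<forall>\<^sub>F n in sequentially. n2 (\<lambda>x. f n x - v x) < 1" using lim by (intro order_tendstoD(2)) auto
    then obtain n where n: "n2 (\<lambda>x. f n x - v x) < 1" by (auto simp: eventually_sequentially)
    have "n2 (f n) < \<infinity>" unfolding f_def using tf by (subst plancherel_fourier_int) (auto intro: trunc_integrable u sg)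
    then have "n2 (\<lambda>x. f n x - (f n x - v x)) < \<infinity>"
      using n2_diff_finite[of "f n" "\<lambda>x. f n x - v x"] order_less_trans[OF n, of \<infinity>] by simp
    then show ?thesis by simp
  qed
  moreover have "((\<lambda>R. n2 (\<lambda>x. v x - fourier_int sg (trunc u R) x)) \<longlongrightarrow> 0) at_top"
  proof (rule tendsto_ennrealI0)
    fix e :: real assume e: "e > 0"
    have "\<forall>\<^sub>F R in at_top. n2 (\<lambda>x. u x - trunc u R x) < ennreal (e/12)"
      using n2_trunc_tendsto[OF assms(1) u] e by (intro order_tendstoD(2)) auto
    then obtain R0 where R0: "\<And>R. R \<ge> R0 \<Longrightarrow> n2 (\<lambda>x. u x - trunc u R x) < ennreal (e/12)"
      by (auto simp: eventually_at_top_linorder)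
    have "\<forall>\<^sub>F n in sequentially. n2 (\<lambda>x. f n x - v x) < ennreal (e/12)"
      using lim e by (intro order_tendstoD(2)) auto
    then obtain M where M: "\<And>n. n \<ge> M \<Longrightarrow> n2 (\<lambda>x. f n x - v x) < ennreal (e/12)"
      by (auto simp: eventually_sequentially)
    obtain M' :: nat where M': "real M' \<ge> R0" using real_arch_simple by blast
    define n where "n = max M M'"
    have n: "n2 (\<lambda>x. v x - f n x) < ennreal (e/12)" "real n \<ge> R0"
      using M[of n] M' by (auto simp: n_def n2_diff_commute[of v])
    show "\<forall>\<^sub>F R in at_top. n2 (\<lambda>x. v x - fourier_int sg (trunc u R) x) \<le> ennreal e"
      using eventually_ge_at_top[of R0]
    proof eventually_elim
      case (elim R)
      have "n2 (\<lambda>x. v x - fourier_int sg (trunc u R) x) \<le> 2 * n2 (\<lambda>x. v x - f n x) + 2 * n2 (\<lambda>x. f n x - fourier_int sg (trunc u R) x)"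
        by (rule n2_triangle) measurable
      also have "n2 (\<lambda>x. f n x - fourier_int sg (trunc u R) x) \<le> 2 * n2 (\<lambda>x. u x - trunc u (real n) x) + 2 * n2 (\<lambda>x. u x - trunc u R x)"
        unfolding f_def fdiff by (rule tri)
      also have "2 * n2 (\<lambda>x. v x - f n x) + 2 * (2 * n2 (\<lambda>x. u x - trunc u (real n) x) + 2 * n2 (\<lambda>x. u x - trunc u R x))
        \<le> 2 * ennreal (e/12) + 2 * (2 * ennreal (e/12) + 2 * ennreal (e/12))"
        using n R0[OF elim] R0[OF n(2)] by (intro add_mono mult_left_mono) auto
      also have "\<dots> = ennreal (2 * (e/12) + 2 * (2 * (e/12) + 2 * (e/12)))"
        using e by (simp add: ennreal_mult'[symmetric] ennreal_plus[symmetric] flip: ennreal_numeral del: ennreal_plus)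
      also have "\<dots> \<le> ennreal e" using e by (intro ennreal_leI) simp
      finally show ?case by (auto simp: mult_left_mono add_left_mono)
    qed
  qed
  ultimately show ?thesis using v by blast
qed

text \<open>A Borel measurable version of \<^const>\<open>fourier\<close> (for \<open>sg = -1\<close>) and \<^const>\<open>inv_fourier\<close> (for \<open>sg = 1\<close>),
  which are only Lebesgue measurable; Fubini's theorem needs the former.\<close>

definition L2F :: "real \<Rightarrow> ('a::euclidean_space \<Rightarrow> complex) \<Rightarrow> 'a \<Rightarrow> complex" where
  "L2F sg u = (SOME v. v \<in> borel_measurable borel \<and> n2 v < \<infinity> \<and>
     ((\<lambda>R. n2 (\<lambda>x. v x - fourier_int sg (trunc u R) x)) \<longlongrightarrow> 0) at_top)"

text \<open>Only \<open>sg\<^sup>2 = 1\<close> enters, so the forward and the inverse transform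
  share every proof.\<close>

locale L2_fun =
  fixes sg :: real
  assumes sg: "sg\<^sup>2 = 1"
begin

abbreviation sq :: "('a::euclidean_space \<Rightarrow> complex) \<Rightarrow> bool" where
  "sq u \<equiv> u \<in> borel_measurable borel \<and> n2 u < \<infinity>"

lemma L2F:
  assumes "sq u"
  shows measurable_L2F: "L2F sg u \<in> borel_measurable borel"
    and n2_L2F_finite: "n2 (L2F sg u) < \<infinity>"
    and L2F_trunc: "((\<lambda>R. n2 (\<lambda>x. L2F sg u x - fourier_int sg (trunc u R) x)) \<longlongrightarrow> 0) at_top"
  using someI_ex[OF L2_transform_exists[OF conjunct1[OF assms] conjunct2[OF assms] sg]]
  unfolding L2F_def[symmetric] by blast+

lemma L2F_trunc_seq:
  assumes "sq u"
  shows "(\<lambda>n. n2 (\<lambda>x. L2F sg u x - fourier_int sg (trunc u (real n)) x)) \<longlonglongrightarrow> 0"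
  by (rule filterlim_compose[OF L2F_trunc[OF assms] filterlim_real_sequentially])

lemma sq_trunc: "sq u \<Longrightarrow> sq (trunc u R)"
  using order_le_less_trans[OF n2_trunc_le] by auto

lemma fourier_int_n2_diff:
  assumes "integrable lborel u" "integrable lborel w" "n2 u < \<infinity>" "n2 w < \<infinity>"
  shows "n2 (\<lambda>x. fourier_int sg u x - fourier_int sg w x) = n2 (\<lambda>x. u x - w x)"
proof -
  have "n2 (fourier_int sg (\<lambda>x. u x - w x)) = n2 (\<lambda>x. u x - w x)"
    using assms by (intro plancherel_fourier_int sg n2_diff_finite) auto
  then show ?thesis by (simp add: fourier_int_diff[OF assms(1,2)] n2_def)
qed

text \<open>By Plancherel the transforms of any two integrable approximations of \<open>u\<close>
  are asymptotically equal. The truncations in the definition may thus be exchanged for approximants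
  suited to the operation at hand, such as translated or dilated truncations.\<close>

lemma L2F_eqI:
  assumes "sq u" "v \<in> borel_measurable borel"
    and w: "\<And>n. integrable lborel (w n)" "\<And>n. n2 (w n) < \<infinity>" "(\<lambda>n. n2 (\<lambda>x. u x - w n x)) \<longlonglongrightarrow> 0"
    and v: "(\<lambda>n. n2 (\<lambda>x. v x - fourier_int sg (w n) x)) \<longlonglongrightarrow> 0"
  shows "AE x in lborel. v x = L2F sg u x"
proof -
  note [measurable] = measurable_L2F[OF assms(1)] assms(2) conjunct1[OF assms(1)]
  have [measurable]: "w n \<in> borel_measurable borel" for n using w(1)[of n] by auto
  have u2: "n2 u < \<infinity>" using assms(1) by simp
  have 1: "(\<lambda>n. n2 (\<lambda>x. trunc u (real n) x - w n x)) \<longlonglongrightarrow> 0"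
  proof (rule n2_tendsto_squeeze[OF _ n2_trunc_tendsto_seq[OF _ u2] w(3)])
    show "n2 (\<lambda>x. trunc u (real n) x - w n x) \<le> 2 * n2 (\<lambda>x. trunc u (real n) x - u x) + 2 * n2 (\<lambda>x. u x - w n x)" for n
      by (rule n2_triangle) measurable
  qed measurable
  have "(\<lambda>n. n2 (\<lambda>x. L2F sg u x - fourier_int sg (w n) x)) \<longlonglongrightarrow> 0"
  proof (rule n2_tendsto_squeeze[OF _ L2F_trunc_seq[OF assms(1)] 1])
    fix n
    have "n2 (\<lambda>x. L2F sg u x - fourier_int sg (w n) x)
      \<le> 2 * n2 (\<lambda>x. L2F sg u x - fourier_int sg (trunc u (real n)) x) + 2 * n2 (\<lambda>x. fourier_int sg (trunc u (real n)) x - fourier_int sg (w n) x)"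
      by (rule n2_triangle) measurable
    also have "n2 (\<lambda>x. fourier_int sg (trunc u (real n)) x - fourier_int sg (w n) x) = n2 (\<lambda>x. trunc u (real n) x - w n x)"
      using sq_trunc[OF assms(1)] w u2 by (intro fourier_int_n2_diff trunc_integrable) auto
    finally show "n2 (\<lambda>x. L2F sg u x - fourier_int sg (w n) x)
      \<le> 2 * n2 (\<lambda>x. L2F sg u x - fourier_int sg (trunc u (real n)) x) + 2 * n2 (\<lambda>x. trunc u (real n) x - w n x)" .
  qed
  from n2_limit_unique[OF _ _ _ v this] show ?thesis by simp
qed

lemma L2F_integrable:
  assumes "integrable lborel u" "n2 u < \<infinity>"
  shows "AE x in lborel. fourier_int sg u x = L2F sg u x"
  using assms by (intro L2F_eqI[where w = "\<lambda>_. u"]) (auto simp: n2_def)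

lemma n2_L2F:
  assumes u: "sq u" shows "n2 (L2F sg u) = n2 u"
proof -
  note [measurable] = measurable_L2F[OF u] conjunct1[OF u]
  have 1: "(\<lambda>n. n2 (fourier_int sg (trunc u (real n)))) \<longlonglongrightarrow> n2 (L2F sg u)"
    using L2F_trunc_seq[OF u] n2_L2F_finite[OF u]
    by (intro n2_tendsto) (auto simp: n2_diff_commute[of "L2F sg u"])
  have 2: "(\<lambda>n. n2 (trunc u (real n))) \<longlonglongrightarrow> n2 u"
    using u n2_trunc_tendsto_seq[of u] by (intro n2_tendsto) auto
  have "n2 (fourier_int sg (trunc u (real n))) = n2 (trunc u (real n))" for n
    using sq_trunc[OF u] u by (intro plancherel_fourier_int sg trunc_integrable) auto
  then show ?thesis using 1 2 by (simp add: LIMSEQ_unique)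
qed

lemma L2F_add:
  assumes u: "sq u" and w: "sq w"
  shows "AE x in lborel. L2F sg u x + L2F sg w x = L2F sg (\<lambda>x. u x + w x) x"
proof (rule L2F_eqI[where w = "\<lambda>n x. trunc u (real n) x + trunc w (real n) x"])
  note [measurable] = measurable_L2F[OF u] conjunct1[OF u] measurable_L2F[OF w] conjunct1[OF w]
  show "sq (\<lambda>x. u x + w x)" using u w n2_add_finite[of u w] by auto
  show "(\<lambda>x. L2F sg u x + L2F sg w x) \<in> borel_measurable borel" by measurable
  show "integrable lborel (\<lambda>x. trunc u (real n) x + trunc w (real n) x)" for n
    using u w by (intro Bochner_Integration.integrable_add trunc_integrable) auto
  show "n2 (\<lambda>x. trunc u (real n) x + trunc w (real n) x) < \<infinity>" for n
    using sq_trunc[OF u] sq_trunc[OF w] by (intro n2_add_finite) auto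
  show "(\<lambda>n. n2 (\<lambda>x. u x + w x - (trunc u (real n) x + trunc w (real n) x))) \<longlonglongrightarrow> 0"
  proof (rule n2_tendsto_squeeze)
    show "n2 (\<lambda>x. u x + w x - (trunc u (real n) x + trunc w (real n) x)) \<le>
      2 * n2 (\<lambda>x. trunc u (real n) x - u x) + 2 * n2 (\<lambda>x. trunc w (real n) x - w x)" for n
      using n2_add[of "\<lambda>x. u x - trunc u (real n) x" "\<lambda>x. w x - trunc w (real n) x"]
      by (simp add: n2_diff_commute[of _ u] n2_diff_commute[of _ w] algebra_simps)
  qed (use u w n2_trunc_tendsto_seq[of u] n2_trunc_tendsto_seq[of w] in auto)
  show "(\<lambda>n. n2 (\<lambda>x. L2F sg u x + L2F sg w x - fourier_int sg (\<lambda>x. trunc u (real n) x + trunc w (real n) x) x)) \<longlonglongrightarrow> 0"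
  proof (rule n2_tendsto_squeeze[OF _ L2F_trunc_seq[OF u] L2F_trunc_seq[OF w]])
    fix n
    have "n2 (\<lambda>x. L2F sg u x + L2F sg w x - fourier_int sg (\<lambda>x. trunc u (real n) x + trunc w (real n) x) x)
      = n2 (\<lambda>x. (L2F sg u x - fourier_int sg (trunc u (real n)) x) + (L2F sg w x - fourier_int sg (trunc w (real n)) x))"
      unfolding n2_def using u w by (simp add: fourier_int_add trunc_integrable algebra_simps)
    also have "\<dots> \<le> 2 * n2 (\<lambda>x. L2F sg u x - fourier_int sg (trunc u (real n)) x) + 2 * n2 (\<lambda>x. L2F sg w x - fourier_int sg (trunc w (real n)) x)"
      by (rule n2_add) measurable
    finally show "n2 (\<lambda>x. L2F sg u x + L2F sg w x - fourier_int sg (\<lambda>x. trunc u (real n) x + trunc w (real n) x) x)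
      \<le> 2 * n2 (\<lambda>x. L2F sg u x - fourier_int sg (trunc u (real n)) x) + 2 * n2 (\<lambda>x. L2F sg w x - fourier_int sg (trunc w (real n)) x)" .
  qed
qed

lemma sq_cmult: "sq u \<Longrightarrow> sq (\<lambda>x. a * u x)"
  by (auto simp: n2_mult ennreal_mult_less_top)

lemma L2F_cmult:
  assumes u: "sq u"
  shows "AE x in lborel. a * L2F sg u x = L2F sg (\<lambda>x. a * u x) x"
proof (rule L2F_eqI[where w = "\<lambda>n x. a * trunc u (real n) x"])
  note [measurable] = measurable_L2F[OF u] conjunct1[OF u]
  have scale: "(\<lambda>n. n2 (\<lambda>x. a * f n x)) \<longlonglongrightarrow> 0" if "\<And>n. f n \<in> borel_measurable borel" "(\<lambda>n. n2 (f n)) \<longlonglongrightarrow> 0" for f :: "nat \<Rightarrow> 'a \<Rightarrow> complex"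
  proof -
    have "(\<lambda>n. ennreal ((cmod a)\<^sup>2) * n2 (f n)) \<longlonglongrightarrow> ennreal ((cmod a)\<^sup>2) * 0"
      by (intro ennreal_tendsto_cmult that) auto
    then show ?thesis using that(1) by (simp add: n2_mult)
  qed
  show "sq (\<lambda>x. a * u x)" by (rule sq_cmult[OF u])
  show "(\<lambda>x. a * L2F sg u x) \<in> borel_measurable borel" by measurable
  show "integrable lborel (\<lambda>x. a * trunc u (real n) x)" for n
    using u by (intro integrable_mult_right trunc_integrable) auto
  show "n2 (\<lambda>x. a * trunc u (real n) x) < \<infinity>" for n
    using sq_cmult[OF sq_trunc[OF u]] by auto
  have "(\<lambda>n. n2 (\<lambda>x. a * (u x - trunc u (real n) x))) \<longlonglongrightarrow> 0"
    using n2_trunc_tendsto_seq[of u] u by (intro scale) (auto simp: n2_diff_commute[of u])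
  then show "(\<lambda>n. n2 (\<lambda>x. a * u x - a * trunc u (real n) x)) \<longlonglongrightarrow> 0"
    by (simp only: right_diff_distrib)
  have "(\<lambda>n. n2 (\<lambda>x. a * (L2F sg u x - fourier_int sg (trunc u (real n)) x))) \<longlonglongrightarrow> 0"
    using L2F_trunc_seq[OF u] by (intro scale) auto
  then show "(\<lambda>n. n2 (\<lambda>x. a * L2F sg u x - fourier_int sg (\<lambda>x. a * trunc u (real n) x) x)) \<longlonglongrightarrow> 0"
    by (simp only: right_diff_distrib fourier_int_cmult)
qed

lemma L2F_shift:
  assumes u: "sq u"
  shows "AE \<xi> in lborel. phase (- sg) (h \<bullet> \<xi>) * L2F sg u \<xi> = L2F sg (\<lambda>x. u (x + h)) \<xi>"
proof (rule L2F_eqI[where w = "\<lambda>n x. trunc u (real n) (x + h)"])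
  note [measurable] = measurable_L2F[OF u] conjunct1[OF u]
  show "sq (\<lambda>x. u (x + h))" using u n2_shift[of u h] by auto
  show "(\<lambda>\<xi>. phase (- sg) (h \<bullet> \<xi>) * L2F sg u \<xi>) \<in> borel_measurable borel" by measurable
  show int: "integrable lborel (\<lambda>x. trunc u (real n) (x + h))" for n
    using integrable_lborel_affine[OF trunc_integrable[of u "real n"], of 1 h] u by (simp add: add.commute)
  show "n2 (\<lambda>x. trunc u (real n) (x + h)) < \<infinity>" for n
    using sq_trunc[OF u] by (subst n2_shift) auto
  show "(\<lambda>n. n2 (\<lambda>x. u (x + h) - trunc u (real n) (x + h))) \<longlonglongrightarrow> 0"
    using n2_trunc_tendsto_seq[of u] u n2_shift[of "\<lambda>x. u x - trunc u (real _) x" h]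
    by (simp add: n2_diff_commute[of u])
  have eq: "fourier_int sg (\<lambda>x. trunc u (real n) (x + h)) \<xi> = phase (- sg) (h \<bullet> \<xi>) * fourier_int sg (trunc u (real n)) \<xi>" for n \<xi>
  proof -
    have "(LBINT x. phase sg (x \<bullet> \<xi>) * trunc u (real n) x) = (LBINT x. phase sg ((h + 1 *\<^sub>R x) \<bullet> \<xi>) * trunc u (real n) (h + 1 *\<^sub>R x))"
      using integral_lborel_affine[of "\<lambda>x. phase sg (x \<bullet> \<xi>) * trunc u (real n) x" 1 h] by simp
    also have "\<dots> = (LBINT x. phase sg (h \<bullet> \<xi>) * (phase sg (x \<bullet> \<xi>) * trunc u (real n) (x + h)))"
    proof -
      have ph: "phase sg ((h + 1 *\<^sub>R x) \<bullet> \<xi>) = phase sg (h \<bullet> \<xi>) * phase sg (x \<bullet> \<xi>)" for x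
        by (simp only: inner_add_left phase_add scaleR_one)
      show ?thesis unfolding ph by (simp only: mult.assoc add.commute[of _ h] scaleR_one)
    qed
    also have "\<dots> = phase sg (h \<bullet> \<xi>) * (LBINT x. phase sg (x \<bullet> \<xi>) * trunc u (real n) (x + h))"
      by (rule integral_mult_right_zero)
    finally have *: "(LBINT x. phase sg (x \<bullet> \<xi>) * trunc u (real n) x) = phase sg (h \<bullet> \<xi>) * (LBINT x. phase sg (x \<bullet> \<xi>) * trunc u (real n) (x + h))" .
    have "phase (- sg) (h \<bullet> \<xi>) * phase sg (h \<bullet> \<xi>) = 1" by (simp add: exp_add[symmetric])
    moreover have "p * (c * (q * y)) = c * ((p * q) * y)" for p q c y :: complex by (simp only: mult_ac)
    ultimately show ?thesis unfolding fourier_int_def * by (simp only: mult_1)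
  qed
  have "n2 (\<lambda>\<xi>. phase (- sg) (h \<bullet> \<xi>) * L2F sg u \<xi> - fourier_int sg (\<lambda>x. trunc u (real n) (x + h)) \<xi>)
     = n2 (\<lambda>\<xi>. L2F sg u \<xi> - fourier_int sg (trunc u (real n)) \<xi>)" for n
    unfolding eq right_diff_distrib[symmetric] n2_def norm_mult by simp
  then show "(\<lambda>n. n2 (\<lambda>\<xi>. phase (- sg) (h \<bullet> \<xi>) * L2F sg u \<xi> - fourier_int sg (\<lambda>x. trunc u (real n) (x + h)) \<xi>)) \<longlonglongrightarrow> 0"
    using L2F_trunc_seq[OF u] by simp
qed

lemma L2F_dilate:
  fixes u :: "'a::euclidean_space \<Rightarrow> complex"
  assumes u: "sq u" and c: "c > 0"
  shows "AE \<xi> in lborel. L2F sg u (\<xi> /\<^sub>R c) / complex_of_real (c ^ DIM('a)) = L2F sg (\<lambda>x. u (c *\<^sub>R x)) \<xi>"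
proof (rule L2F_eqI[where w = "\<lambda>n x. trunc u (real n) (c *\<^sub>R x)"])
  note [measurable] = measurable_L2F[OF u] conjunct1[OF u]
  have scale: "(\<lambda>n. ennreal a * b n) \<longlonglongrightarrow> 0" if "b \<longlonglongrightarrow> 0" for a and b :: "nat \<Rightarrow> ennreal"
    using ennreal_tendsto_cmult[OF _ that, of "ennreal a"] by simp
  show "sq (\<lambda>x. u (c *\<^sub>R x))" using u c by (auto simp: n2_dilate ennreal_mult_less_top)
  show "(\<lambda>\<xi>. L2F sg u (\<xi> /\<^sub>R c) / complex_of_real (c ^ DIM('a))) \<in> borel_measurable borel" by measurable
  show "integrable lborel (\<lambda>x. trunc u (real n) (c *\<^sub>R x))" for n
    using integrable_lborel_affine[OF trunc_integrable[of u "real n"], of c 0] u c by simp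
  show "n2 (\<lambda>x. trunc u (real n) (c *\<^sub>R x)) < \<infinity>" for n
    using sq_trunc[OF u] c by (subst n2_dilate) (auto simp: ennreal_mult_less_top)
  have "n2 (\<lambda>x. u (c *\<^sub>R x) - trunc u (real n) (c *\<^sub>R x)) = ennreal (1 / c ^ DIM('a)) * n2 (\<lambda>x. u x - trunc u (real n) x)" for n
    using n2_dilate[of "\<lambda>x. u x - trunc u (real n) x" c] c by simp
  then show "(\<lambda>n. n2 (\<lambda>x. u (c *\<^sub>R x) - trunc u (real n) (c *\<^sub>R x))) \<longlonglongrightarrow> 0"
    using n2_trunc_tendsto_seq[of u] u by (simp only:) (intro scale, simp add: n2_diff_commute[of u])
  have "n2 (\<lambda>\<xi>. L2F sg u (\<xi> /\<^sub>R c) / complex_of_real (c ^ DIM('a)) - fourier_int sg (\<lambda>x. trunc u (real n) (c *\<^sub>R x)) \<xi>)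
    = ennreal ((cmod (1 / complex_of_real (c ^ DIM('a))))\<^sup>2) * (ennreal (1 / (1/c) ^ DIM('a)) * n2 (\<lambda>\<xi>. L2F sg u \<xi> - fourier_int sg (trunc u (real n)) \<xi>))" for n
  proof -
    have "n2 (\<lambda>\<xi>. L2F sg u (\<xi> /\<^sub>R c) / complex_of_real (c ^ DIM('a)) - fourier_int sg (\<lambda>x. trunc u (real n) (c *\<^sub>R x)) \<xi>)
      = n2 (\<lambda>\<xi>. 1 / complex_of_real (c ^ DIM('a)) * (L2F sg u ((1/c) *\<^sub>R \<xi>) - fourier_int sg (trunc u (real n)) ((1/c) *\<^sub>R \<xi>)))"
      using c by (subst fourier_int_dilate) (auto simp: diff_divide_distrib divide_inverse_commute right_diff_distrib)
    also have "\<dots> = ennreal ((cmod (1 / complex_of_real (c ^ DIM('a))))\<^sup>2) * n2 (\<lambda>\<xi>. L2F sg u ((1/c) *\<^sub>R \<xi>) - fourier_int sg (trunc u (real n)) ((1/c) *\<^sub>R \<xi>))"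
      by (rule n2_mult) measurable
    also have "n2 (\<lambda>\<xi>. L2F sg u ((1/c) *\<^sub>R \<xi>) - fourier_int sg (trunc u (real n)) ((1/c) *\<^sub>R \<xi>))
       = ennreal (1 / (1/c) ^ DIM('a)) * n2 (\<lambda>\<xi>. L2F sg u \<xi> - fourier_int sg (trunc u (real n)) \<xi>)"
      using c by (intro n2_dilate) auto
    finally show ?thesis .
  qed
  then show "(\<lambda>n. n2 (\<lambda>\<xi>. L2F sg u (\<xi> /\<^sub>R c) / complex_of_real (c ^ DIM('a)) - fourier_int sg (\<lambda>x. trunc u (real n) (c *\<^sub>R x)) \<xi>)) \<longlonglongrightarrow> 0"
    using L2F_trunc_seq[OF u] by (simp only:) (intro scale)
qed

text \<open>The identity for integrable functions is extended by two limits in turn: first in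
  \<open>w\<close>, with \<open>u\<close> still truncated, then in \<open>u\<close>. Each is the
  limit of a pairing of L2 functions.\<close>

lemma L2F_multiplication:
  assumes u: "sq u" and w: "sq w"
  shows "(LBINT \<xi>. L2F sg u \<xi> * w \<xi>) = (LBINT x. u x * L2F sg w x)"
proof -
  note [measurable] = measurable_L2F[OF u] conjunct1[OF u] measurable_L2F[OF w] conjunct1[OF w]
  have fin: "n2 (fourier_int sg (trunc z R)) < \<infinity>" if "sq z" for z R
    using sq_trunc[OF that] that by (subst plancherel_fourier_int) (auto intro: trunc_integrable sg)
  have step: "(LBINT \<xi>. fourier_int sg (trunc u (real n)) \<xi> * w \<xi>) = (LBINT x. trunc u (real n) x * L2F sg w x)" for n
  proof (rule LIMSEQ_unique)
    show "(\<lambda>k. LBINT \<xi>. trunc w (real k) \<xi> * fourier_int sg (trunc u (real n)) \<xi>) \<longlonglongrightarrow> (LBINT \<xi>. fourier_int sg (trunc u (real n)) \<xi> * w \<xi>)"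
      unfolding mult.commute[of "fourier_int _ _ _" "w _"]
      using u w sq_trunc[OF w] fin[OF u] by (intro L2_pairing_tendsto n2_trunc_tendsto_seq) auto
    have "(LBINT \<xi>. trunc w (real k) \<xi> * fourier_int sg (trunc u (real n)) \<xi>) = (LBINT x. fourier_int sg (trunc w (real k)) x * trunc u (real n) x)" for k
      using u w by (intro fourier_int_multiplication[symmetric] trunc_integrable) auto
    moreover have "(\<lambda>k. LBINT x. fourier_int sg (trunc w (real k)) x * trunc u (real n) x) \<longlonglongrightarrow> (LBINT x. L2F sg w x * trunc u (real n) x)"
      using sq_trunc[OF u] fin[OF w] n2_L2F_finite[OF w] L2F_trunc_seq[OF w]
      by (intro L2_pairing_tendsto) (auto simp: n2_diff_commute[of _ "L2F sg w"])
    ultimately show "(\<lambda>k. LBINT \<xi>. trunc w (real k) \<xi> * fourier_int sg (trunc u (real n)) \<xi>) \<longlonglongrightarrow> (LBINT x. trunc u (real n) x * L2F sg w x)"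
      by (simp add: mult.commute[of "L2F _ _ _"])
  qed
  show ?thesis
  proof (rule LIMSEQ_unique)
    show "(\<lambda>n. LBINT \<xi>. fourier_int sg (trunc u (real n)) \<xi> * w \<xi>) \<longlonglongrightarrow> (LBINT \<xi>. L2F sg u \<xi> * w \<xi>)"
      using w fin[OF u] n2_L2F_finite[OF u] L2F_trunc_seq[OF u]
      by (intro L2_pairing_tendsto) (auto simp: n2_diff_commute[of _ "L2F sg u"])
    show "(\<lambda>n. LBINT \<xi>. fourier_int sg (trunc u (real n)) \<xi> * w \<xi>) \<longlonglongrightarrow> (LBINT x. u x * L2F sg w x)"
      unfolding step using u n2_L2F_finite[OF w] sq_trunc[OF u] by (intro L2_pairing_tendsto n2_trunc_tendsto_seq) auto
  qed
qed

end

section \<open>The fractional Laplacian on real functions\<close>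

interpretation Fwd: L2_fun "-1" by unfold_locales simp
interpretation Inv: L2_fun 1 by unfold_locales simp

lemma n2_cong_lebesgue: "AE x in lebesgue. f x = g x \<Longrightarrow> n2 f = n2 g"
  by (rule n2_cong_AE) (simp add: AE_completion_iff)

lemma fourier_int_cong_AE:
  assumes "AE x in lborel. u x = v x" "u \<in> borel_measurable borel" "v \<in> borel_measurable borel"
  shows "fourier_int sg u = fourier_int sg v"
proof
  fix \<xi> :: 'a
  note assms(2,3)[measurable]
  have "(LBINT x. phase sg (x \<bullet> \<xi>) * u x) = (LBINT x. phase sg (x \<bullet> \<xi>) * v x)"
    by (rule integral_cong_AE) (use assms(1) in \<open>auto elim!: eventually_mono\<close>)
  then show "fourier_int sg u \<xi> = fourier_int sg v \<xi>" by (simp add: fourier_int_def)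
qed

lemma L2F_cong_AE:
  assumes "AE x in lborel. u x = v x" and [measurable]: "u \<in> borel_measurable borel" "v \<in> borel_measurable borel"
  shows "L2F sg u = L2F sg v"
proof -
  have "fourier_int sg (trunc u R) = fourier_int sg (trunc v R)" for R
    by (rule fourier_int_cong_AE) (use assms(1) in \<open>auto elim!: eventually_mono intro!: measurable_trunc\<close>)
  then show ?thesis by (simp add: L2F_def)
qed

lemma (in L2_fun) is_L2_transform_L2F:
  assumes u: "sq u" shows "is_L2_transform sg u (L2F sg u)"
  unfolding is_L2_transform_def using L2F[OF u] u
  by (simp add: n2_lebesgue fourier_trunc_eq L2_borel)

text \<open>\<open>fourier\<close> and \<open>inv_fourier\<close> pick a transform by Hilbert
  choice. Passing to a Borel version and using uniqueness of L2 limits identifies every possible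
  pick with \<open>L2F\<close> almost everywhere.\<close>

lemma (in L2_fun) is_L2_transform_unique:
  assumes u: "sq u" and v: "is_L2_transform sg u v"
  shows "AE x in lebesgue. v x = L2F sg u x"
proof -
  note [measurable] = measurable_L2F[OF u] conjunct1[OF u]
  have "v \<in> borel_measurable lebesgue" using v by (simp add: is_L2_transform_def L2_def)
  then obtain w where w[measurable]: "w \<in> borel_measurable borel" and vw: "AE x in lebesgue. v x = w x"
    by (rule lebesgue_measurable_borel_version)
  have "((\<lambda>R. n2 (\<lambda>x. v x - fourier_int sg (trunc u R) x)) \<longlongrightarrow> 0) at_top"
    using v u by (simp add: is_L2_transform_def n2_lebesgue fourier_trunc_eq)
  also have "(\<lambda>R. n2 (\<lambda>x. v x - fourier_int sg (trunc u R) x)) = (\<lambda>R. n2 (\<lambda>x. w x - fourier_int sg (trunc u R) x))"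
    by (intro ext n2_cong_lebesgue) (use vw in \<open>auto elim!: eventually_mono\<close>)
  finally have "(\<lambda>n. n2 (\<lambda>x. w x - fourier_int sg (trunc u (real n)) x)) \<longlonglongrightarrow> 0"
    by (rule filterlim_compose[OF _ filterlim_real_sequentially])
  from n2_limit_unique[OF _ _ _ this L2F_trunc_seq[OF u]] have "AE x in lborel. w x = L2F sg u x" by simp
  then have "AE x in lebesgue. w x = L2F sg u x" by (simp add: AE_completion_iff)
  with vw show ?thesis by eventually_elim simp
qed

lemma fourier_AE_L2F:
  assumes "Fwd.sq u"
  shows "AE x in lebesgue. fourier u x = L2F (-1) u x" and "fourier u \<in> borel_measurable lebesgue"
proof -
  have *: "is_L2_transform (-1) u (fourier u)"
    unfolding fourier_def using Fwd.is_L2_transform_L2F[OF assms] by (rule someI[of "is_L2_transform (-1) u"])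
  then show "AE x in lebesgue. fourier u x = L2F (-1) u x" by (rule Fwd.is_L2_transform_unique[OF assms])
  show "fourier u \<in> borel_measurable lebesgue" using * by (simp add: is_L2_transform_def L2_def)
qed

lemma inv_fourier_AE_L2F:
  assumes "Inv.sq u"
  shows "AE x in lebesgue. inv_fourier u x = L2F 1 u x" and "inv_fourier u \<in> borel_measurable lebesgue"
proof -
  have *: "is_L2_transform 1 u (inv_fourier u)"
    unfolding inv_fourier_def using Inv.is_L2_transform_L2F[OF assms] by (rule someI[of "is_L2_transform 1 u"])
  then show "AE x in lebesgue. inv_fourier u x = L2F 1 u x" by (rule Inv.is_L2_transform_unique[OF assms])
  show "inv_fourier u \<in> borel_measurable lebesgue" using * by (simp add: is_L2_transform_def L2_def)
qed

lemma n2_reflect: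
  fixes f :: "'a::euclidean_space \<Rightarrow> 'b::euclidean_space"
  assumes [measurable]: "f \<in> borel_measurable borel"
  shows "n2 (\<lambda>x. f (- x)) = n2 f"
  unfolding n2_def using nn_integral_lborel_affine[of "\<lambda>x. ennreal ((norm (f x))\<^sup>2)" "-1" 0] by simp

lemma fourier_int_reflect:
  assumes [measurable]: "u \<in> borel_measurable borel"
  shows "fourier_int sg (\<lambda>x. u (- x)) \<xi> = fourier_int (- sg) u \<xi>"
    and "fourier_int sg u (- \<xi>) = fourier_int (- sg) u \<xi>"
proof -
  have "(LBINT x. phase (- sg) (x \<bullet> \<xi>) * u x) = (LBINT x. phase (- sg) ((0 + (-1) *\<^sub>R x) \<bullet> \<xi>) * u (0 + (-1) *\<^sub>R x))"
    using integral_lborel_affine[of "\<lambda>x. phase (- sg) (x \<bullet> \<xi>) * u x" "-1" 0] by simp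
  then show "fourier_int sg (\<lambda>x. u (- x)) \<xi> = fourier_int (- sg) u \<xi>"
    unfolding fourier_int_def by simp
  show "fourier_int sg u (- \<xi>) = fourier_int (- sg) u \<xi>"
    unfolding fourier_int_def by simp
qed

lemma n2_cnj: "n2 (\<lambda>x. cnj (f x)) = n2 f"
  by (simp add: n2_def)

lemma L2F_real_hermitian:
  fixes u :: "'a::euclidean_space \<Rightarrow> complex"
  assumes u: "Fwd.sq u" and re: "\<And>x. cnj (u x) = u x"
  shows "AE \<xi> in lborel. cnj (L2F (-1) u (- \<xi>)) = L2F (-1) u \<xi>"
proof -
  note [measurable] = Fwd.measurable_L2F[OF u] conjunct1[OF u]
  let ?f = "\<lambda>n::nat. fourier_int (-1) (trunc u (real n))"
  have "cnj (?f n (- \<xi>)) = ?f n \<xi>" for n \<xi>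
    by (simp add: fourier_int_cnj fourier_int_reflect(2) re complex_cnj_scaleR)
  then have "n2 (\<lambda>\<xi>. cnj (L2F (-1) u (- \<xi>)) - ?f n \<xi>) = n2 (\<lambda>\<xi>. cnj (L2F (-1) u (- \<xi>) - ?f n (- \<xi>)))" for n
    by simp
  also have "n2 (\<lambda>\<xi>. cnj (L2F (-1) u (- \<xi>) - ?f n (- \<xi>))) = n2 (\<lambda>\<xi>. L2F (-1) u \<xi> - ?f n \<xi>)" for n
    unfolding n2_cnj by (rule n2_reflect[of "\<lambda>\<xi>. L2F (-1) u \<xi> - ?f n \<xi>"]) measurable
  finally have "(\<lambda>n. n2 (\<lambda>\<xi>. cnj (L2F (-1) u (- \<xi>)) - ?f n \<xi>)) \<longlonglongrightarrow> 0"
    using Fwd.L2F_trunc_seq[OF u] by simp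
  from n2_limit_unique[OF _ _ _ this Fwd.L2F_trunc_seq[OF u]] show ?thesis by simp
qed

text \<open>Balls around 0 are symmetric, so the truncations of \<open>h\<close> inherit the
  symmetry and already their transforms are real. For the symbol of a real function this means that
  the real part taken in \<open>frac_lap_half\<close> discards nothing.\<close>

lemma L2F_hermitian_real:
  fixes h :: "'a::euclidean_space \<Rightarrow> complex"
  assumes h: "Inv.sq h" and herm: "AE x in lborel. cnj (h (- x)) = h x"
  shows "AE x in lborel. complex_of_real (Re (L2F 1 h x)) = L2F 1 h x"
proof -
  note [measurable] = Inv.measurable_L2F[OF h] conjunct1[OF h]
  let ?f = "\<lambda>n::nat. fourier_int 1 (trunc h (real n))"
  have "cnj (?f n \<xi>) = ?f n \<xi>" for n \<xi>
  proof -
    have "cnj (?f n \<xi>) = fourier_int (- 1) (\<lambda>x. cnj (trunc h (real n) x)) \<xi>" by (rule fourier_int_cnj)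
    also have "\<dots> = fourier_int 1 (\<lambda>x. cnj (trunc h (real n) (- x))) \<xi>"
      using fourier_int_reflect(1)[of "\<lambda>x. cnj (trunc h (real n) x)" 1 \<xi>] by simp
    also have "fourier_int 1 (\<lambda>x. cnj (trunc h (real n) (- x))) = ?f n"
      by (rule fourier_int_cong_AE) (use herm in \<open>auto elim!: eventually_mono simp: indicator_def\<close>)
    finally show ?thesis .
  qed
  then have "n2 (\<lambda>\<xi>. cnj (L2F 1 h \<xi>) - ?f n \<xi>) = n2 (\<lambda>\<xi>. cnj (L2F 1 h \<xi> - ?f n \<xi>))" for n
    by simp
  then have "(\<lambda>n. n2 (\<lambda>\<xi>. cnj (L2F 1 h \<xi>) - ?f n \<xi>)) \<longlonglongrightarrow> 0"
    using Inv.L2F_trunc_seq[OF h] by (simp only: n2_cnj)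
  from n2_limit_unique[OF _ _ _ this Inv.L2F_trunc_seq[OF h]]
  have "AE x in lborel. cnj (L2F 1 h x) = L2F 1 h x" by simp
  then show ?thesis by eventually_elim (simp add: complex_eq_iff)
qed

section \<open>Half Laplacian and kinetic energy of real Borel functions\<close>

abbreviation (input) cx :: "('a \<Rightarrow> real) \<Rightarrow> 'a \<Rightarrow> complex" where
  "cx u \<equiv> (\<lambda>x. complex_of_real (u x))"

text \<open>For Borel \<open>u\<close>, \<open>fdiff s u\<close> is a version of \<^term>\<open>frac_lap_half s u\<close>, \<open>fsymb s u\<close> is its Fourier transform, and
  \<open>kin s u\<close> is its squared norm in \<open>[0, \<infinity>]\<close> (\<open>kinr s u\<close> when finite).\<close>

definition fsymb :: "real \<Rightarrow> ('a::euclidean_space \<Rightarrow> real) \<Rightarrow> 'a \<Rightarrow> complex" where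
  "fsymb s u \<xi> = complex_of_real (norm \<xi> powr s) * L2F (-1) (cx u) \<xi>"

definition kin :: "real \<Rightarrow> ('a::euclidean_space \<Rightarrow> real) \<Rightarrow> ennreal" where
  "kin s u = n2 (fsymb s u)"

text \<open>The Borel measurable members of \<open>H^s\<close>.\<close>

definition hsp :: "real \<Rightarrow> ('a::euclidean_space \<Rightarrow> real) \<Rightarrow> bool" where
  "hsp s u \<longleftrightarrow> u \<in> borel_measurable borel \<and> n2 u < \<infinity> \<and> kin s u < \<infinity>"

definition fdiff :: "real \<Rightarrow> ('a::euclidean_space \<Rightarrow> real) \<Rightarrow> 'a \<Rightarrow> real" where
  "fdiff s u x = Re (L2F 1 (fsymb s u) x)"

lemma n2_cx [simp]: "n2 (cx u) = n2 u"
  by (simp add: n2_def)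

lemma sq_cx: "u \<in> borel_measurable borel \<Longrightarrow> n2 u < \<infinity> \<Longrightarrow> Fwd.sq (cx u)"
  by simp

lemma measurable_fsymb:
  assumes "u \<in> borel_measurable borel" "n2 u < \<infinity>"
  shows "fsymb s u \<in> borel_measurable borel"
  unfolding fsymb_def[abs_def] using Fwd.measurable_L2F[OF sq_cx[OF assms]] by measurable

lemma powr_half_square: "(norm x powr s)\<^sup>2 = norm x powr (2 * s)"
  by (simp add: power2_eq_square powr_add[symmetric])

lemma kin_alt: "kin s u = (\<integral>\<^sup>+ \<xi>. ennreal (norm \<xi> powr (2 * s) * (cmod (L2F (-1) (cx u) \<xi>))\<^sup>2) \<partial>lborel)"
  unfolding kin_def n2_def fsymb_def by (simp add: norm_mult power_mult_distrib powr_half_square)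

lemma fsymb_sq: "hsp s u \<Longrightarrow> Inv.sq (fsymb s u)"
  using measurable_fsymb[of u s] by (auto simp: hsp_def kin_def)

lemma fdiff_complex:
  assumes u: "hsp s u"
  shows "AE x in lborel. complex_of_real (fdiff s u x) = L2F 1 (fsymb s u) x"
proof -
  have u': "Fwd.sq (cx u)" using u by (auto simp: hsp_def)
  have "AE \<xi> in lborel. cnj (fsymb s u (- \<xi>)) = fsymb s u \<xi>"
    using L2F_real_hermitian[OF u'] by (auto simp: fsymb_def elim!: eventually_mono)
  then show ?thesis unfolding fdiff_def by (intro L2F_hermitian_real fsymb_sq u)
qed

lemma measurable_fdiff: "hsp s u \<Longrightarrow> fdiff s u \<in> borel_measurable borel"
  unfolding fdiff_def[abs_def] using Inv.measurable_L2F[OF fsymb_sq] by measurable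

lemma n2_fdiff: "hsp s u \<Longrightarrow> n2 (fdiff s u) = kin s u"
proof -
  assume u: "hsp s u"
  have "n2 (fdiff s u) = n2 (cx (fdiff s u))" by simp
  also have "\<dots> = n2 (L2F 1 (fsymb s u))" by (rule n2_cong_AE) (rule fdiff_complex[OF u])
  also have "\<dots> = kin s u" using Inv.n2_L2F[OF fsymb_sq[OF u]] by (simp add: kin_def)
  finally show ?thesis .
qed

lemma fsymb_lincomb:
  assumes u: "u \<in> borel_measurable borel" "n2 u < \<infinity>" and w: "w \<in> borel_measurable borel" "n2 w < \<infinity>"
  shows "AE \<xi> in lborel. fsymb s u \<xi> + complex_of_real t * fsymb s w \<xi> = fsymb s (\<lambda>x. u x + t * w x) \<xi>"
  using Fwd.L2F_add[OF sq_cx[OF u] Fwd.sq_cmult[OF sq_cx[OF w], of "complex_of_real t"]] Fwd.L2F_cmult[OF sq_cx[OF w], of "complex_of_real t"]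
proof eventually_elim
  case (elim \<xi>)
  then have "L2F (-1) (cx (\<lambda>x. u x + t * w x)) \<xi> = L2F (-1) (cx u) \<xi> + complex_of_real t * L2F (-1) (cx w) \<xi>"
    by simp
  then show ?case unfolding fsymb_def by (simp only: distrib_left mult.left_commute)
qed

lemma n2_real_cmult:
  assumes "w \<in> borel_measurable borel"
  shows "n2 (\<lambda>x. t * w x :: real) = ennreal (t\<^sup>2) * n2 w"
  using n2_scaleR[OF assms, of t] by simp

lemma n2_lincomb_finite:
  fixes u w :: "'a::euclidean_space \<Rightarrow> real"
  assumes "u \<in> borel_measurable borel" "n2 u < \<infinity>" "w \<in> borel_measurable borel" "n2 w < \<infinity>"
  shows "n2 (\<lambda>x. u x + t * w x) < \<infinity>"
  using assms by (intro n2_add_finite) (auto simp: n2_real_cmult ennreal_mult_less_top)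

lemma hsp_lincomb:
  assumes u: "hsp s u" and w: "hsp s w"
  shows "hsp s (\<lambda>x. u x + t * w x)"
proof -
  have u': "u \<in> borel_measurable borel" "n2 u < \<infinity>" and w': "w \<in> borel_measurable borel" "n2 w < \<infinity>" using u w by (auto simp: hsp_def)
  note [measurable] = u'(1) w'(1) measurable_fsymb[OF u', of s] measurable_fsymb[OF w', of s]
  have "kin s (\<lambda>x. u x + t * w x) = n2 (\<lambda>\<xi>. fsymb s u \<xi> + complex_of_real t * fsymb s w \<xi>)"
    unfolding kin_def by (rule n2_cong_AE) (use fsymb_lincomb[OF u' w', of s t] in \<open>auto elim: eventually_mono\<close>)
  also have "\<dots> < \<infinity>"
    using fsymb_sq[OF u] Inv.sq_cmult[OF fsymb_sq[OF w], of "complex_of_real t"]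
    by (intro n2_add_finite) auto
  finally show ?thesis using n2_lincomb_finite[OF u' w'] unfolding hsp_def by simp
qed

lemma fdiff_lincomb:
  assumes u: "hsp s u" and w: "hsp s w"
  shows "AE x in lborel. fdiff s (\<lambda>x. u x + t * w x) x = fdiff s u x + t * fdiff s w x"
proof -
  have u': "u \<in> borel_measurable borel" "n2 u < \<infinity>" and w': "w \<in> borel_measurable borel" "n2 w < \<infinity>" using u w by (auto simp: hsp_def)
  note [measurable] = u'(1) w'(1) measurable_fsymb[OF u', of s] measurable_fsymb[OF w', of s]
  have eq: "L2F 1 (fsymb s (\<lambda>x. u x + t * w x)) = L2F 1 (\<lambda>\<xi>. fsymb s u \<xi> + complex_of_real t * fsymb s w \<xi>)"
  proof (rule L2F_cong_AE)
    show "fsymb s (\<lambda>x. u x + t * w x) \<in> borel_measurable borel"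
      using hsp_lincomb[OF u w, of t] by (intro measurable_fsymb) (auto simp: hsp_def)
  qed (use fsymb_lincomb[OF u' w', of s t] in \<open>auto elim: eventually_mono\<close>)
  show ?thesis
    using Inv.L2F_add[OF fsymb_sq[OF u] Inv.sq_cmult[OF fsymb_sq[OF w], of "complex_of_real t"]] Inv.L2F_cmult[OF fsymb_sq[OF w], of "complex_of_real t"]
    unfolding fdiff_def eq
  proof eventually_elim
    case (elim x)
    show ?case unfolding elim(1)[symmetric] elim(2)[symmetric] by simp
  qed
qed

definition kinr :: "real \<Rightarrow> ('a::euclidean_space \<Rightarrow> real) \<Rightarrow> real" where
  "kinr s u = (LBINT x. (fdiff s u x)\<^sup>2)"

lemma fdiff_square_integrable: "hsp s u \<Longrightarrow> integrable lborel (\<lambda>x. (fdiff s u x)\<^sup>2)"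
  using n2_fdiff[of s u] n2_finite_iff_integrable[OF measurable_fdiff[of s u]] by (simp add: hsp_def)

lemma kin_eq_kinr: "hsp s u \<Longrightarrow> kin s u = ennreal (kinr s u)"
  using n2_eq_integral[of "fdiff s u"] fdiff_square_integrable[of s u] n2_fdiff[of s u] by (simp add: kinr_def)

lemma kinr_nonneg: "kinr s u \<ge> 0"
  by (simp add: kinr_def)

lemma real_L2_mult_integrable:
  fixes f g :: "'a::euclidean_space \<Rightarrow> real"
  assumes "f \<in> borel_measurable borel" "n2 f < \<infinity>" "g \<in> borel_measurable borel" "n2 g < \<infinity>"
  shows "integrable lborel (\<lambda>x. f x * g x)"
proof -
  have "integrable lborel (\<lambda>x. cx f x * cx g x)" using assms by (intro L2_mult_integrable) auto
  then show ?thesis by (simp only: of_real_mult[symmetric] complex_of_real_integrable_eq)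
qed

lemma kinr_lincomb:
  assumes u: "hsp s u" and w: "hsp s w"
  shows "kinr s (\<lambda>x. u x + t * w x) = kinr s u + 2 * t * (LBINT x. fdiff s u x * fdiff s w x) + t\<^sup>2 * kinr s w"
proof -
  note [measurable] = measurable_fdiff[OF u] measurable_fdiff[OF w] measurable_fdiff[OF hsp_lincomb[OF u w, of t]]
  have i: "integrable lborel (\<lambda>x. fdiff s u x * fdiff s w x)"
    using u w n2_fdiff[OF u] n2_fdiff[OF w] by (intro real_L2_mult_integrable) (auto simp: hsp_def)
  have "kinr s (\<lambda>x. u x + t * w x) = (LBINT x. (fdiff s u x + t * fdiff s w x)\<^sup>2)"
    unfolding kinr_def by (rule integral_cong_AE) (use fdiff_lincomb[OF u w, of t] in \<open>auto elim!: eventually_mono\<close>)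
  also have "\<dots> = (LBINT x. (fdiff s u x)\<^sup>2 + (2 * t) * (fdiff s u x * fdiff s w x) + t\<^sup>2 * (fdiff s w x)\<^sup>2)"
    by (intro Bochner_Integration.integral_cong refl) (simp add: power2_sum power_mult_distrib algebra_simps)
  also have "\<dots> = kinr s u + 2 * t * (LBINT x. fdiff s u x * fdiff s w x) + t\<^sup>2 * kinr s w"
    using i fdiff_square_integrable[OF u] fdiff_square_integrable[OF w] by (simp add: kinr_def)
  finally show ?thesis .
qed

text \<open>The exponent collects \<open>2 * s\<close> from the weight, -2N from the squared
  amplitude of the dilated transform and +N from the change of variables.\<close>

lemma kin_dilate:
  fixes u :: "'a::euclidean_space \<Rightarrow> real"
  assumes u: "u \<in> borel_measurable borel" "n2 u < \<infinity>" and c: "c > 0"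
  shows "kin s (\<lambda>x. u (c *\<^sub>R x)) = ennreal (c powr (2 * s - DIM('a))) * kin s u"
proof -
  note [measurable] = u(1) measurable_fsymb[OF u, of s]
  let ?k = "complex_of_real (c powr s / c ^ DIM('a))"
  have pt: "norm \<xi> powr s = c powr s * norm ((1/c) *\<^sub>R \<xi>) powr s" for \<xi> :: 'a
    using c by (subst powr_mult[symmetric]) auto
  have "AE \<xi> in lborel. fsymb s (\<lambda>x. u (c *\<^sub>R x)) \<xi> = ?k * fsymb s u ((1/c) *\<^sub>R \<xi>)"
    using Fwd.L2F_dilate[OF sq_cx[OF u] c]
  proof eventually_elim
    case (elim \<xi>)
    then show ?case unfolding fsymb_def pt[of \<xi>] by (simp add: divide_inverse_commute mult_ac)
  qed
  then have "kin s (\<lambda>x. u (c *\<^sub>R x)) = n2 (\<lambda>\<xi>. ?k * fsymb s u ((1/c) *\<^sub>R \<xi>))"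
    unfolding kin_def by (rule n2_cong_AE)
  also have "\<dots> = ennreal ((cmod ?k)\<^sup>2) * n2 (\<lambda>\<xi>. fsymb s u ((1/c) *\<^sub>R \<xi>))" by (rule n2_mult) measurable
  also have "n2 (\<lambda>\<xi>. fsymb s u ((1/c) *\<^sub>R \<xi>)) = ennreal (1 / (1/c) ^ DIM('a)) * kin s u"
    unfolding kin_def using c by (intro n2_dilate) auto
  also have "ennreal ((cmod ?k)\<^sup>2) * (ennreal (1 / (1/c) ^ DIM('a)) * kin s u) = ennreal ((cmod ?k)\<^sup>2 * (1 / (1/c) ^ DIM('a))) * kin s u"
  proof -
    have "ennreal a * (ennreal b * k) = ennreal (a * b) * k" if "0 \<le> a" "0 \<le> b" for a b k
      using that by (simp add: ennreal_mult mult.assoc)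
    then show ?thesis using c by (auto simp del: norm_of_real)
  qed
  also have "(cmod ?k)\<^sup>2 * (1 / (1/c) ^ DIM('a)) = c powr (2 * s - DIM('a))"
  proof -
    have "(c powr s)\<^sup>2 = c powr (2 * s)" by (simp add: power2_eq_square powr_add[symmetric])
    then show ?thesis using c
      by (simp only: norm_of_real power_abs power2_abs power_divide) (simp add: powr_diff powr_realpow power_divide power2_eq_square)
  qed
  finally show ?thesis .
qed

text \<open>The Gaussian is its own transform. As \<open>s < 1\<close>, the weight is at most
  \<open>1 + norm \<xi> ^ 2\<close>, and one of the two Gaussian factors in the square absorbs
  that.\<close>

lemma gaussian_hsp:
  fixes s :: real
  assumes s: "0 < s" "s < 1"
  shows "hsp s (\<lambda>x::'a::euclidean_space. exp (- (norm x)\<^sup>2 / 2))"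
proof -
  let ?w = "\<lambda>x::'a. exp (- (norm x)\<^sup>2 / 2)"
  have m[measurable]: "?w \<in> borel_measurable borel" by measurable
  have i: "integrable lborel (cx ?w)"
    using gaussian_nd(1)[of 1 "0::'a"] by simp
  then have i': "integrable lborel ?w" by (simp only: complex_of_real_integrable_eq)
  have "integrable lborel (\<lambda>x. (norm (?w x))\<^sup>2)"
    by (rule Bochner_Integration.integrable_bound[OF i']) (auto simp: power2_eq_square mult_le_one)
  then have n: "n2 ?w < \<infinity>" using n2_finite_iff_integrable[OF m] by blast
  have "AE \<xi> in lborel. L2F (-1) (cx ?w) \<xi> = cx ?w \<xi>"
    using Fwd.L2F_integrable[OF i] n gaussian_nd(2)[of "-1", where 'a='a] by (auto elim!: eventually_mono)
  then have "kin s ?w = (\<integral>\<^sup>+ \<xi>. ennreal (norm \<xi> powr (2 * s) * (?w \<xi>)\<^sup>2) \<partial>lborel)"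
    unfolding kin_alt by (intro nn_integral_cong_AE) (auto elim!: eventually_mono)
  also have "\<dots> \<le> (\<integral>\<^sup>+ \<xi>. ennreal (2 * ?w \<xi>) \<partial>lborel)"
  proof (intro nn_integral_mono ennreal_leI)
    fix \<xi> :: 'a
    let ?r = "norm \<xi>"
    have "?r powr (2 * s) \<le> 1 + ?r\<^sup>2"
    proof (cases "?r \<le> 1")
      case True
      then have "?r powr (2 * s) \<le> 1" using s by (intro powr_le1) auto
      then show ?thesis using zero_le_power2[of ?r] by linarith
    next
      case False
      then have "?r powr (2 * s) \<le> ?r powr 2" using s by (intro powr_mono) auto
      then show ?thesis using False by simp
    qed
    also have "\<dots> \<le> 2 * exp (?r\<^sup>2 / 2)" using exp_ge_add_one_self[of "?r\<^sup>2 / 2"] by linarith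
    finally have "?r powr (2 * s) * (?w \<xi>)\<^sup>2 \<le> (2 * exp (?r\<^sup>2 / 2)) * (?w \<xi>)\<^sup>2" by (intro mult_right_mono) auto
    also have "\<dots> = 2 * ?w \<xi>" by (simp add: power2_eq_square exp_minus field_simps)
    finally show "?r powr (2 * s) * (?w \<xi>)\<^sup>2 \<le> 2 * ?w \<xi>" .
  qed
  also have "\<dots> < \<infinity>"
    using integrable_mult_right[OF i', of 2] unfolding integrable_iff_bounded by simp
  finally show ?thesis using n m by (simp add: hsp_def)
qed

section \<open>Agreement of \<open>Hs\<close> and \<open>frac_lap_half\<close> with their Borel
  counterparts\<close>

lemma borel_Hs_iff:
  fixes u :: "'a::euclidean_space \<Rightarrow> real"
  assumes u: "u \<in> borel_measurable borel"
  shows "u \<in> Hs s \<longleftrightarrow> hsp s u"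
proof (cases "n2 u < \<infinity>")
  case True
  have 1: "integrable lebesgue (\<lambda>x. (u x)\<^sup>2)"
    using True n2_finite_iff_integrable[OF u] u by (simp add: integrable_completion)
  note F = fourier_AE_L2F[OF sq_cx[OF u True]]
  note [measurable] = Fwd.measurable_L2F[OF sq_cx[OF u True]] F(2)
  have [measurable]: "(\<lambda>\<xi>::'a. norm \<xi>) \<in> borel_measurable lebesgue" by (rule measurable_completion) simp
  have "(\<integral>\<^sup>+ \<xi>. ennreal (norm (norm \<xi> powr (2 * s) * (cmod (fourier (cx u) \<xi>))\<^sup>2)) \<partial>lebesgue)
     = (\<integral>\<^sup>+ \<xi>. ennreal (norm \<xi> powr (2 * s) * (cmod (L2F (-1) (cx u) \<xi>))\<^sup>2) \<partial>lebesgue)"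
    by (rule nn_integral_cong_AE) (use F(1) in \<open>auto elim!: eventually_mono\<close>)
  also have "\<dots> = kin s u" by (simp add: kin_alt nn_integral_completion)
  finally have "integrable lebesgue (\<lambda>\<xi>. norm \<xi> powr (2 * s) * (cmod (fourier (cx u) \<xi>))\<^sup>2) \<longleftrightarrow> kin s u < \<infinity>"
    by (simp add: integrable_iff_bounded)
  then show ?thesis using 1 True u by (simp add: Hs_def hsp_def measurable_completion)
next
  case False
  then have "\<not> integrable lebesgue (\<lambda>x. (u x)\<^sup>2)"
    using n2_finite_iff_integrable[OF u] u by (simp add: integrable_completion)
  then show ?thesis using False by (simp add: Hs_def hsp_def)
qed

text \<open>Equality holds at every point, not just almost everywhere: functions equal a.e. define
  the same predicate under \<open>SOME\<close>, hence the same choice.\<close>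

lemma fourier_cong_AE:
  assumes "AE x in lebesgue. u x = v x" "u \<in> borel_measurable lebesgue" "v \<in> borel_measurable lebesgue"
  shows "fourier (cx u) = fourier (cx v)"
  unfolding fourier_def
  by (subst is_L2_transform_cong_AE[of "cx u" "cx v"]) (use assms in auto)

lemma frac_lap_half_cong_AE:
  assumes "AE x in lebesgue. u x = v x" "u \<in> borel_measurable lebesgue" "v \<in> borel_measurable lebesgue"
  shows "frac_lap_half s u = frac_lap_half s v"
  unfolding frac_lap_half_def fourier_cong_AE[OF assms] ..

lemma Hs_cong_AE:
  assumes "AE x in lebesgue. u x = v x" "u \<in> borel_measurable lebesgue" "v \<in> borel_measurable lebesgue"
  shows "u \<in> Hs s \<longleftrightarrow> v \<in> Hs s"
proof -
  have "integrable lebesgue (\<lambda>x. (u x)\<^sup>2) \<longleftrightarrow> integrable lebesgue (\<lambda>x. (v x)\<^sup>2)"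
    by (rule integrable_cong_AE) (use assms in \<open>auto elim!: eventually_mono\<close>)
  then show ?thesis using assms(2,3) by (simp add: Hs_def fourier_cong_AE[OF assms])
qed

lemma frac_lap_half_AE:
  fixes u :: "'a::euclidean_space \<Rightarrow> real"
  assumes u: "hsp s u"
  shows "AE x in lebesgue. frac_lap_half s u x = fdiff s u x"
proof -
  have u': "u \<in> borel_measurable borel" "n2 u < \<infinity>" using u by (auto simp: hsp_def)
  note F = fourier_AE_L2F[OF sq_cx[OF u']]
  note [measurable] = F(2)
  have [measurable]: "(\<lambda>\<xi>::'a. norm \<xi>) \<in> borel_measurable lebesgue" by (rule measurable_completion) simp
  have eq: "is_L2_transform 1 (\<lambda>\<xi>. complex_of_real (norm \<xi> powr s) * fourier (cx u) \<xi>) = is_L2_transform 1 (fsymb s u)"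
  proof (rule is_L2_transform_cong_AE)
    show "fsymb s u \<in> borel_measurable lebesgue" using measurable_fsymb[OF u'] by (simp add: measurable_completion)
    show "AE x in lebesgue. complex_of_real (norm x powr s) * fourier (cx u) x = fsymb s u x"
      using F(1) by eventually_elim (simp add: fsymb_def)
  qed measurable
  then have "inv_fourier (\<lambda>\<xi>. complex_of_real (norm \<xi> powr s) * fourier (cx u) \<xi>) = inv_fourier (fsymb s u)"
    by (simp add: inv_fourier_def)
  then show ?thesis
    using inv_fourier_AE_L2F(1)[OF fsymb_sq[OF u]] unfolding frac_lap_half_def fdiff_def
    by (auto elim!: eventually_mono)
qed

section \<open>Weak lower semicontinuity of the kinetic energy\<close>

lemma indicator_measurable_ball [measurable]: "(\<lambda>x::'a::euclidean_space. indicator (ball a r) x :: real) \<in> borel_measurable borel"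
  by (intro borel_measurable_indicator) auto

text \<open>The tail is cut off the fixed function \<open>p\<close> and not off \<open>d n\<close>:
  far out only the uniform bound \<open>B\<close> on \<open>d n\<close> is used, and inside a ball
  the local convergence.\<close>

lemma L2_local_weak_tendsto:
  fixes d :: "nat \<Rightarrow> 'a::euclidean_space \<Rightarrow> complex"
  assumes d[measurable]: "\<And>n. d n \<in> borel_measurable borel" and bd: "\<And>n. n2 (d n) \<le> ennreal B"
    and loc: "\<And>R. (\<lambda>n. n2 (trunc (d n) R)) \<longlonglongrightarrow> 0"
    and p[measurable]: "p \<in> borel_measurable borel" and p2: "n2 p < \<infinity>"
  shows "(\<lambda>n. LBINT x. d n x * p x) \<longlonglongrightarrow> 0"
proof -
  have dfin: "n2 (d n) < \<infinity>" for n using order_le_less_trans[OF bd[of n], of \<infinity>] by simp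
  have tfin: "n2 (trunc f R) < \<infinity>" if "n2 f < \<infinity>" for f :: "'a \<Rightarrow> complex" and R
    using order_le_less_trans[OF n2_trunc_le that] .
  have key: "ennreal ((cmod (LBINT x. d n x * p x))\<^sup>2) \<le> 2 * (n2 (trunc (d n) R) * n2 p) + 2 * (ennreal B * n2 (\<lambda>x. p x - trunc p R x))" for n R
  proof -
    have pfin: "n2 (\<lambda>x. p x - trunc p R x) < \<infinity>" using tfin[OF p2, of R] p2 by (intro n2_diff_finite) auto
    have i1: "integrable lborel (\<lambda>x. trunc (d n) R x * p x)"
      by (rule L2_mult_integrable) (use tfin[OF dfin] p2 in auto)
    have i2: "integrable lborel (\<lambda>x. d n x * (p x - trunc p R x))"
      by (rule L2_mult_integrable) (use dfin[of n] pfin in auto)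
    have "(LBINT x. d n x * p x) = (LBINT x. trunc (d n) R x * p x + d n x * (p x - trunc p R x))"
      by (intro Bochner_Integration.integral_cong refl) (auto simp: indicator_def)
    also have "\<dots> = (LBINT x. trunc (d n) R x * p x) + (LBINT x. d n x * (p x - trunc p R x))"
      by (rule Bochner_Integration.integral_add[OF i1 i2])
    finally have "(cmod (LBINT x. d n x * p x))\<^sup>2 \<le> 2 * (cmod (LBINT x. trunc (d n) R x * p x))\<^sup>2 + 2 * (cmod (LBINT x. d n x * (p x - trunc p R x)))\<^sup>2"
      using norm_add_power2_le by (simp only:)
    then have "ennreal ((cmod (LBINT x. d n x * p x))\<^sup>2) \<le> 2 * ennreal ((cmod (LBINT x. trunc (d n) R x * p x))\<^sup>2) + 2 * ennreal ((cmod (LBINT x. d n x * (p x - trunc p R x)))\<^sup>2)"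
      by (simp add: ennreal_plus[symmetric] ennreal_mult'[symmetric] ennreal_leI flip: ennreal_numeral del: ennreal_plus)
    also have "\<dots> \<le> 2 * (n2 (trunc (d n) R) * n2 p) + 2 * (n2 (d n) * n2 (\<lambda>x. p x - trunc p R x))"
      by (intro add_mono mult_left_mono L2_pairing_bound) auto
    also have "\<dots> \<le> 2 * (n2 (trunc (d n) R) * n2 p) + 2 * (ennreal B * n2 (\<lambda>x. p x - trunc p R x))"
      by (intro add_mono mult_left_mono mult_right_mono bd) auto
    finally show ?thesis .
  qed
  have "(\<lambda>n. ennreal ((cmod (LBINT x. d n x * p x))\<^sup>2)) \<longlonglongrightarrow> 0"
  proof (rule tendsto_ennrealI0)
    fix e :: real assume e: "e > 0"
    have "((\<lambda>R. ennreal B * n2 (\<lambda>x. p x - trunc p R x)) \<longlongrightarrow> ennreal B * 0) at_top"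
      by (intro ennreal_tendsto_cmult n2_trunc_tendsto p p2) auto
    then have "\<forall>\<^sub>F R in at_top. ennreal B * n2 (\<lambda>x. p x - trunc p R x) < ennreal (e/4)"
      using e by (intro order_tendstoD(2)) auto
    then obtain R where R: "ennreal B * n2 (\<lambda>x. p x - trunc p R x) < ennreal (e/4)"
      by (auto simp: eventually_at_top_linorder)
    have "(\<lambda>n. n2 p * n2 (trunc (d n) R)) \<longlonglongrightarrow> n2 p * 0"
      using p2 by (intro ennreal_tendsto_cmult loc) auto
    then have "\<forall>\<^sub>F n in sequentially. n2 p * n2 (trunc (d n) R) < ennreal (e/4)"
      using e by (intro order_tendstoD(2)) auto
    then show "\<forall>\<^sub>F n in sequentially. ennreal ((cmod (LBINT x. d n x * p x))\<^sup>2) \<le> ennreal e"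
    proof eventually_elim
      case (elim n)
      have "ennreal ((cmod (LBINT x. d n x * p x))\<^sup>2) \<le> 2 * ennreal (e/4) + 2 * ennreal (e/4)"
        using elim R by (intro order_trans[OF key[of n R]] add_mono mult_left_mono) (auto simp: mult.commute)
      also have "\<dots> = ennreal e"
        using e by (simp add: ennreal_mult'[symmetric] ennreal_plus[symmetric] flip: ennreal_numeral del: ennreal_plus)
      finally show ?case .
    qed
  qed
  then have "(\<lambda>n. (cmod (LBINT x. d n x * p x))\<^sup>2) \<longlonglongrightarrow> 0"
    by (subst (asm) ennreal_0[symmetric], subst (asm) tendsto_ennreal_iff) auto
  then have "(\<lambda>n. sqrt ((cmod (LBINT x. d n x * p x))\<^sup>2)) \<longlonglongrightarrow> sqrt 0"
    by (intro tendsto_real_sqrt)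
  then show ?thesis by (simp add: tendsto_norm_zero_iff)
qed

lemma trunc_weight_sq:
  fixes v :: "'a::euclidean_space \<Rightarrow> complex"
  assumes [measurable]: "v \<in> borel_measurable borel" and v: "n2 v < \<infinity>" and s: "s \<ge> 0"
  shows "(\<lambda>\<xi>. indicator (ball 0 R) \<xi> *\<^sub>R (complex_of_real (norm \<xi> powr s) * v \<xi>)) \<in> borel_measurable borel"
    and "n2 (\<lambda>\<xi>. indicator (ball 0 R) \<xi> *\<^sub>R (complex_of_real (norm \<xi> powr s) * v \<xi>)) < \<infinity>"
proof -
  show "(\<lambda>\<xi>. indicator (ball 0 R) \<xi> *\<^sub>R (complex_of_real (norm \<xi> powr s) * v \<xi>)) \<in> borel_measurable borel" by measurable
  have "n2 (\<lambda>\<xi>. indicator (ball 0 R) \<xi> *\<^sub>R (complex_of_real (norm \<xi> powr s) * v \<xi>)) \<le> n2 (\<lambda>\<xi>. complex_of_real (R powr s) * v \<xi>)"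
  proof (rule n2_mono)
    fix \<xi> :: 'a
    show "norm (indicator (ball 0 R) \<xi> *\<^sub>R (complex_of_real (norm \<xi> powr s) * v \<xi>)) \<le> norm (complex_of_real (R powr s) * v \<xi>)"
      using s by (cases "norm \<xi> < R") (auto simp: norm_mult intro!: mult_right_mono powr_mono2)
  qed
  also have "\<dots> < \<infinity>" using v by (auto simp: n2_mult ennreal_mult_less_top)
  finally show "n2 (\<lambda>\<xi>. indicator (ball 0 R) \<xi> *\<^sub>R (complex_of_real (norm \<xi> powr s) * v \<xi>)) < \<infinity>" .
qed

text \<open>Weak convergence of \<open>un n - u\<close> is carried to the frequency side by the
  multiplication formula, without inversion. For the symbols \<open>a n\<close> and \<open>b\<close>
  restricted to a ball, \<open>\<bar>b\<bar>^2 + 2 Re ((a n - b) cnj b)\<close> is at most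
  \<open>\<bar>a n\<bar>^2\<close> pointwise, and the integral of the cross term tends to 0. Letting
  the ball grow recovers all of \<open>kin s u\<close>.\<close>

theorem kin_lower_semicontinuous:
  fixes u :: "'a::euclidean_space \<Rightarrow> real"
  assumes un[measurable]: "\<And>n. un n \<in> borel_measurable borel" and bd: "\<And>n. n2 (un n) \<le> ennreal B"
    and u[measurable]: "u \<in> borel_measurable borel" and u2: "n2 u \<le> ennreal B" and s: "s \<ge> 0"
    and loc: "\<And>R. (\<lambda>n. n2 (\<lambda>x. indicator (ball 0 R) x *\<^sub>R (un n x - u x))) \<longlonglongrightarrow> 0"
  shows "kin s u \<le> liminf (\<lambda>n. kin s (un n))"
proof -
  have fin: "n2 u < \<infinity>" "n2 (un n) < \<infinity>" for n
    using order_le_less_trans[OF u2, of \<infinity>] order_le_less_trans[OF bd[of n], of \<infinity>] by auto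
  define d where "d n x = complex_of_real (un n x - u x)" for n x
  have [measurable]: "d n \<in> borel_measurable borel" for n unfolding d_def by measurable
  define v vn where "v = L2F (-1) (cx u)" "vn n = L2F (-1) (cx (un n))" for n
  have sqs: "Fwd.sq (cx u)" "Fwd.sq (cx (un n))" for n using fin by auto
  have [measurable]: "v \<in> borel_measurable borel" "vn n \<in> borel_measurable borel" for n
    unfolding v_vn_def by (intro Fwd.measurable_L2F sqs)+
  have vfin: "n2 v < \<infinity>" "n2 (vn n) < \<infinity>" for n
    unfolding v_vn_def by (intro Fwd.n2_L2F_finite sqs)+
  have dB: "n2 (d n) \<le> ennreal (4 * max B 0)" for n
  proof -
    have "n2 (d n) = n2 (\<lambda>x. un n x - u x)" unfolding d_def by (rule n2_cx)
    also have "\<dots> \<le> 2 * n2 (un n) + 2 * n2 u" by (rule n2_diff) measurable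
    also have "\<dots> \<le> 2 * ennreal (max B 0) + 2 * ennreal (max B 0)"
      by (intro add_mono mult_left_mono order_trans[OF bd] order_trans[OF u2] ennreal_leI) auto
    also have "\<dots> = ennreal (4 * max B 0)"
    proof -
      have "2 * ennreal b + 2 * ennreal b = ennreal (4 * b)" if "b \<ge> 0" for b
        using that by (simp add: ennreal_plus[symmetric] ennreal_mult'[symmetric] flip: ennreal_numeral del: ennreal_plus)
      from this[of "max B 0"] show ?thesis by (simp only: max.cobounded2)
    qed
    finally show ?thesis .
  qed
  have sqd: "Fwd.sq (d n)" for n using order_le_less_trans[OF dB[of n], of \<infinity>] by auto
  have Ld: "AE \<xi> in lborel. vn n \<xi> - v \<xi> = L2F (-1) (d n) \<xi>" for n
  proof -
    have "AE \<xi> in lborel. vn n \<xi> + L2F (-1) (\<lambda>x. (-1) * cx u x) \<xi> = L2F (-1) (\<lambda>x. cx (un n) x + (-1) * cx u x) \<xi>"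
      unfolding v_vn_def by (rule Fwd.L2F_add[OF sqs(2) Fwd.sq_cmult[OF sqs(1)]])
    moreover have "AE \<xi> in lborel. (-1) * v \<xi> = L2F (-1) (\<lambda>x. (-1) * cx u x) \<xi>"
      unfolding v_vn_def by (rule Fwd.L2F_cmult[OF sqs(1)])
    ultimately show ?thesis
    proof eventually_elim
      case (elim \<xi>)
      have "(\<lambda>x. cx (un n) x + (-1) * cx u x) = d n" by (simp add: d_def fun_eq_iff)
      then have e1: "vn n \<xi> + L2F (-1) (\<lambda>x. (-1) * cx u x) \<xi> = L2F (-1) (d n) \<xi>"
        using elim(1) by (simp only:)
      have e2: "L2F (-1) (\<lambda>x. (-1) * cx u x) \<xi> = - v \<xi>" using elim(2) by simp
      show ?case using e1 unfolding e2 by simp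
    qed
  qed
  have main: "n2 (trunc (fsymb s u) R) \<le> liminf (\<lambda>n. kin s (un n))" for R
  proof -
    define a b where "a n = trunc (fsymb s (un n)) R" "b = trunc (fsymb s u) R" for n
    have ab: "a n \<in> borel_measurable borel" "n2 (a n) < \<infinity>" "b \<in> borel_measurable borel" "n2 b < \<infinity>" for n
      unfolding a_b_def fsymb_def v_vn_def[symmetric] by (intro trunc_weight_sq s vfin, measurable)+
    note [measurable] = ab(1,3)
    \<comment> \<open>The extra weight and the conjugate are chosen so that the transform of
      \<open>d n\<close> paired with \<open>p\<close> gives the integral of
      \<open>(a n - b) * cnj b\<close>. The restriction to a ball bounds the weight and keeps
      \<open>p\<close> in L2.\<close>
    define p where "p \<xi> = indicator (ball 0 R) \<xi> *\<^sub>R (complex_of_real (norm \<xi> powr s) * cnj (b \<xi>))" for \<xi>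
    have p: "p \<in> borel_measurable borel" "n2 p < \<infinity>"
      unfolding p_def by (intro trunc_weight_sq s; use ab(4) in \<open>simp add: n2_cnj\<close>)+
    have Lp: "Fwd.sq (L2F (-1) p)" using Fwd.measurable_L2F Fwd.n2_L2F_finite p by blast
    have "(\<lambda>n. LBINT x. d n x * L2F (-1) p x) \<longlonglongrightarrow> 0"
    proof (rule L2_local_weak_tendsto[OF _ dB])
      show "(\<lambda>n. n2 (trunc (d n) R)) \<longlonglongrightarrow> 0" for R
      proof -
        have "n2 (trunc (d n) R) = n2 (\<lambda>x. indicator (ball 0 R) x *\<^sub>R (un n x - u x))" for n
          by (simp add: n2_def d_def power_mult_distrib del: of_real_diff)
        then show ?thesis using loc[of R] by simp
      qed
    qed (use Lp in auto)
    moreover have "(LBINT x. d n x * L2F (-1) p x) = (LBINT \<xi>. (a n \<xi> - b \<xi>) * cnj (b \<xi>))" for n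
    proof -
      have "(LBINT x. d n x * L2F (-1) p x) = (LBINT \<xi>. L2F (-1) (d n) \<xi> * p \<xi>)"
        using Fwd.L2F_multiplication[OF sqd, of p n] p by simp
      also have "\<dots> = (LBINT \<xi>. (a n \<xi> - b \<xi>) * cnj (b \<xi>))"
      proof (rule integral_cong_AE)
        show "(\<lambda>\<xi>. L2F (-1) (d n) \<xi> * p \<xi>) \<in> borel_measurable lborel"
          using Fwd.measurable_L2F[OF sqd, of n] p(1) by simp
        show "AE \<xi> in lborel. L2F (-1) (d n) \<xi> * p \<xi> = (a n \<xi> - b \<xi>) * cnj (b \<xi>)"
          using Ld[of n]
        proof eventually_elim
          case (elim \<xi>)
          show ?case
            unfolding elim[symmetric] p_def a_b_def fsymb_def v_vn_def[symmetric]
            by (auto simp: indicator_def algebra_simps)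
        qed
      qed measurable
      finally show ?thesis .
    qed
    ultimately have lim: "(\<lambda>n. LBINT \<xi>. (a n \<xi> - b \<xi>) * cnj (b \<xi>)) \<longlonglongrightarrow> 0" by simp
    define N where "N = (LBINT \<xi>. (cmod (b \<xi>))\<^sup>2)"
    have bi: "integrable lborel (\<lambda>\<xi>. (cmod (b \<xi>))\<^sup>2)" and ai: "integrable lborel (\<lambda>\<xi>. (cmod (a n \<xi>))\<^sup>2)" for n
      using ab(2)[of n] ab(4) by (simp_all add: n2_finite_iff_integrable[symmetric])
    have N: "n2 b = ennreal N" unfolding N_def by (rule n2_eq_integral[OF bi])
    have ci: "integrable lborel (\<lambda>\<xi>. (a n \<xi> - b \<xi>) * cnj (b \<xi>))" for n
      using n2_diff_finite[OF ab(1) ab(3) ab(2) ab(4), of n] ab(4) by (intro L2_mult_integrable) (auto simp: n2_cnj)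
    have low: "ennreal (N + 2 * Re (LBINT \<xi>. (a n \<xi> - b \<xi>) * cnj (b \<xi>))) \<le> kin s (un n)" for n
    proof -
      have "N + 2 * Re (LBINT \<xi>. (a n \<xi> - b \<xi>) * cnj (b \<xi>)) = (LBINT \<xi>. (cmod (b \<xi>))\<^sup>2 + 2 * Re ((a n \<xi> - b \<xi>) * cnj (b \<xi>)))"
        unfolding N_def using bi ci[of n] by (simp only: integral_Re[symmetric] Bochner_Integration.integral_add integrable_mult_right integrable_Re integral_mult_right_zero)
      also have "\<dots> \<le> (LBINT \<xi>. (cmod (a n \<xi>))\<^sup>2)"
      proof (rule integral_mono)
        show "integrable lborel (\<lambda>\<xi>. (cmod (b \<xi>))\<^sup>2 + 2 * Re ((a n \<xi> - b \<xi>) * cnj (b \<xi>)))"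
          using bi ci[of n] by (intro Bochner_Integration.integrable_add integrable_mult_right integrable_Re)
        fix \<xi> :: 'a
        have "0 \<le> (Re (a n \<xi>) - Re (b \<xi>))\<^sup>2 + (Im (a n \<xi>) - Im (b \<xi>))\<^sup>2" by simp
        then show "(cmod (b \<xi>))\<^sup>2 + 2 * Re ((a n \<xi> - b \<xi>) * cnj (b \<xi>)) \<le> (cmod (a n \<xi>))\<^sup>2"
          unfolding cmod_power2 by (simp add: power2_eq_square algebra_simps)
      qed (rule ai)
      finally have "ennreal (N + 2 * Re (LBINT \<xi>. (a n \<xi> - b \<xi>) * cnj (b \<xi>))) \<le> n2 (a n)"
        unfolding n2_eq_integral[OF ai] by (rule ennreal_leI)
      also have "\<dots> \<le> kin s (un n)" unfolding a_b_def kin_def by (rule n2_trunc_le)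
      finally show ?thesis .
    qed
    have "(\<lambda>n. ennreal (N + 2 * Re (LBINT \<xi>. (a n \<xi> - b \<xi>) * cnj (b \<xi>)))) \<longlonglongrightarrow> ennreal (N + 2 * Re 0)"
      by (intro tendsto_intros lim)
    then have "ennreal N = liminf (\<lambda>n. ennreal (N + 2 * Re (LBINT \<xi>. (a n \<xi> - b \<xi>) * cnj (b \<xi>))))"
      by (subst lim_imp_Liminf) auto
    also have "\<dots> \<le> liminf (\<lambda>n. kin s (un n))" by (intro Liminf_mono always_eventually allI low)
    finally show ?thesis using N by (simp add: a_b_def)
  qed
  have "(\<lambda>k. n2 (trunc (fsymb s u) (real k))) \<longlonglongrightarrow> kin s u"
    unfolding kin_def n2_def
  proof (rule nn_integral_LIMSEQ)
    note [measurable] = measurable_fsymb[OF u fin(1), of s]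
    show "incseq (\<lambda>k x. ennreal ((norm (trunc (fsymb s u) (real k) x))\<^sup>2))"
      by (auto simp: incseq_def le_fun_def indicator_def)
    show "(\<lambda>x. ennreal ((norm (trunc (fsymb s u) (real k) x))\<^sup>2)) \<in> borel_measurable lborel" for k by measurable
    fix x :: 'a
    obtain M :: nat where M: "real M > norm x" using reals_Archimedean2 by blast
    have "\<forall>\<^sub>F n in sequentially. ennreal ((norm (trunc (fsymb s u) (real n) x))\<^sup>2) = ennreal ((norm (fsymb s u x))\<^sup>2)"
      using eventually_ge_at_top[of M]
    proof eventually_elim
      case (elim n)
      then have "real M \<le> real n" by simp
      then show ?case using M by (auto simp: indicator_def)
    qed
    then show "(\<lambda>k. ennreal ((norm (trunc (fsymb s u) (real k) x))\<^sup>2)) \<longlonglongrightarrow> ennreal ((norm (fsymb s u x))\<^sup>2)"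
      by (rule tendsto_eventually)
  qed
  then show ?thesis by (rule LIMSEQ_le_const2) (use main in auto)
qed

section \<open>The Gagliardo seminorm\<close>

definition gag_kernel :: "real \<Rightarrow> 'a::euclidean_space \<Rightarrow> real" where
  "gag_kernel s h = norm h powr (- (real DIM('a) + 2 * s))"

text \<open>The inner integral of the Gagliardo double integral, written in the increment. It is
  kept as a function of \<open>x\<close> because the decisive estimate compares it with a power of
  \<open>u x\<close> pointwise.\<close>

definition gag_density :: "real \<Rightarrow> ('a::euclidean_space \<Rightarrow> real) \<Rightarrow> 'a \<Rightarrow> ennreal" where
  "gag_density s u x = (\<integral>\<^sup>+ h. ennreal ((u (x + h) - u x)\<^sup>2 * gag_kernel s h) \<partial>lborel)"

lemma measurable_gag_kernel [measurable]: "gag_kernel s \<in> borel_measurable borel"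
  unfolding gag_kernel_def[abs_def] by measurable

lemma gag_kernel_nonneg [simp]: "gag_kernel s h \<ge> 0"
  by (simp add: gag_kernel_def)

lemma ex_dyadic:
  fixes t :: real assumes "t \<ge> 1"
  shows "\<exists>n::nat. 2 ^ n \<le> t \<and> t < 2 ^ Suc n"
proof -
  obtain n where n: "t < 2 ^ n" using real_arch_pow[of 2 t] by auto
  define k where "k = (LEAST n. t < 2 ^ n)"
  have k: "t < 2 ^ k" unfolding k_def by (rule LeastI[of "\<lambda>n. t < 2 ^ n", OF n])
  have "k \<noteq> 0" using k assms by (intro notI) simp
  then obtain j where j: "k = Suc j" by (cases k) auto
  have "\<not> t < 2 ^ j" using not_less_Least[of j "\<lambda>n. t < 2 ^ n"] j unfolding k_def by simp
  then show ?thesis using k j by (intro exI[of _ j]) auto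
qed

lemma term_le_suminf:
  fixes f :: "nat \<Rightarrow> ennreal"
  shows "f n \<le> (\<Sum>n. f n)"
  using sum_le_suminf[of f "{n}"] by simp

text \<open>Dyadic decomposition. At distance about \<open>2^n\<close> the contribution is of order
  \<open>2^(-2sn)\<close>, summable because \<open>s > 0\<close>; at distance about
  \<open>2^-n\<close> it is of order \<open>2^(-(2-2s)n)\<close>, summable because
  \<open>s < 1\<close>. Full balls in place of shells cost only a constant.\<close>

lemma gag_kernel_integral_finite:
  assumes s: "0 < s" "s < 1"
  shows "nn_integral lborel (\<lambda>h::'a::euclidean_space. ennreal (min 4 ((norm h)\<^sup>2) * gag_kernel s h)) < \<infinity>"
proof -
  let ?N = "real DIM('a)" and ?w = "unit_ball_vol (real DIM('a))"
  define p where "p = ?N + 2 * s"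
  have p: "p > 0" using s by (simp add: p_def)
  define A where "A n = 4 * (2 ^ n) powr (- p)" for n :: nat
  define B where "B n = ((1/2) ^ n)\<^sup>2 * ((1/2) ^ Suc n) powr (- p)" for n :: nat
  have nonneg: "A n \<ge> 0" "B n \<ge> 0" for n by (auto simp: A_def B_def)
  have pt: "ennreal (min 4 ((norm h)\<^sup>2) * gag_kernel s h)
    \<le> (\<Sum>n. ennreal (A n) * indicator (ball 0 (2 ^ Suc n)) h) + (\<Sum>n. ennreal (B n) * indicator (ball 0 (2 * (1/2) ^ n)) h)" for h :: 'a
  proof (cases "norm h \<ge> 1")
    case True
    then obtain n where n: "2 ^ n \<le> norm h" "norm h < 2 ^ Suc n" using ex_dyadic by blast
    have "gag_kernel s h \<le> (2 ^ n) powr (- p)"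
      unfolding gag_kernel_def p_def[symmetric] using n p by (intro powr_mono2') auto
    then have "min 4 ((norm h)\<^sup>2) * gag_kernel s h \<le> A n"
      unfolding A_def by (intro mult_mono) auto
    then have "ennreal (min 4 ((norm h)\<^sup>2) * gag_kernel s h) \<le> ennreal (A n) * indicator (ball 0 (2 ^ Suc n)) h"
      using n by (simp add: ennreal_leI)
    also have "\<dots> \<le> (\<Sum>n. ennreal (A n) * indicator (ball 0 (2 ^ Suc n)) h)"
      by (rule term_le_suminf)
    finally show ?thesis by (simp add: add_increasing2)
  next
    case False
    show ?thesis
    proof (cases "h = 0")
      case False
      then have "1 / norm h \<ge> 1" using \<open>\<not> norm h \<ge> 1\<close> by simp
      then obtain n where n: "2 ^ n \<le> 1 / norm h" "1 / norm h < 2 ^ Suc n" using ex_dyadic by blast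
      have n': "norm h \<le> (1/2) ^ n" "(1/2) ^ Suc n < norm h"
        using n False by (auto simp: power_divide field_simps)
      have "gag_kernel s h \<le> ((1/2) ^ Suc n) powr (- p)"
        unfolding gag_kernel_def p_def[symmetric] using n' p by (intro powr_mono2') auto
      moreover have "min 4 ((norm h)\<^sup>2) \<le> ((1/2) ^ n)\<^sup>2" using n' by (intro min.coboundedI2 power_mono) auto
      ultimately have "min 4 ((norm h)\<^sup>2) * gag_kernel s h \<le> B n"
        unfolding B_def by (intro mult_mono) auto
      moreover have "norm h < 2 * (1/2) ^ n"
        using n'(1) zero_less_power[of "1/2::real" n] by linarith
      ultimately have "ennreal (min 4 ((norm h)\<^sup>2) * gag_kernel s h) \<le> ennreal (B n) * indicator (ball 0 (2 * (1/2) ^ n)) h"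
        by (simp add: ennreal_leI)
      also have "\<dots> \<le> (\<Sum>n. ennreal (B n) * indicator (ball 0 (2 * (1/2) ^ n)) h)"
        by (rule term_le_suminf)
      finally show ?thesis by (simp add: add_increasing)
    qed simp
  qed
  have "nn_integral lborel (\<lambda>h::'a. ennreal (min 4 ((norm h)\<^sup>2) * gag_kernel s h))
    \<le> nn_integral lborel (\<lambda>h::'a. (\<Sum>n. ennreal (A n) * indicator (ball 0 (2 ^ Suc n)) h) + (\<Sum>n. ennreal (B n) * indicator (ball 0 (2 * (1/2) ^ n)) h))"
    by (intro nn_integral_mono pt)
  also have "\<dots> = (\<Sum>n. ennreal (A n) * emeasure lborel (ball (0::'a) (2 ^ Suc n))) + (\<Sum>n. ennreal (B n) * emeasure lborel (ball (0::'a) (2 * (1/2) ^ n)))"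
  proof -
    have m: "(\<lambda>h::'a. ennreal c * indicator (ball 0 r) h) \<in> borel_measurable borel" for r c
      by (intro borel_measurable_times_ennreal borel_measurable_const borel_measurable_indicator) auto
    have i: "nn_integral lborel (\<lambda>h::'a. \<Sum>n. ennreal (C n) * indicator (ball 0 (r n)) h)
        = (\<Sum>n. ennreal (C n) * emeasure lborel (ball (0::'a) (r n)))" for C r :: "nat \<Rightarrow> real"
      using m by (subst nn_integral_suminf) (auto simp: nn_integral_cmult_indicator)
    show ?thesis
      unfolding i[symmetric] by (rule nn_integral_add) (use m in \<open>auto intro!: borel_measurable_suminf_order\<close>)
  qed
  also have "\<dots> < \<infinity>"
  proof -
    have "ennreal (A n) * emeasure lborel (ball (0::'a) (2 ^ Suc n)) = ennreal (4 * 2 powr ?N * ?w * (2 powr (- 2 * s)) ^ n)" for n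
    proof -
      have "A n * (?w * (2 ^ Suc n) ^ DIM('a)) = 4 * 2 powr ?N * ?w * (2 powr (- 2 * s)) ^ n"
        unfolding A_def p_def by (simp add: powr_realpow[symmetric] powr_powr powr_add[symmetric] algebra_simps)
      then show ?thesis using nonneg[of n] by (simp add: emeasure_ball ennreal_mult[symmetric] del: power_Suc)
    qed
    moreover have "summable (\<lambda>n. 4 * 2 powr ?N * ?w * (2 powr (- 2 * s)) ^ n)"
      using s by (intro summable_mult summable_geometric) (simp add: powr_less_one)
    ultimately have 1: "(\<Sum>n. ennreal (A n) * emeasure lborel (ball (0::'a) (2 ^ Suc n))) < \<infinity>"
      by (simp add: suminf_ennreal2)
    have "ennreal (B n) * emeasure lborel (ball (0::'a) (2 * (1/2) ^ n)) = ennreal (2 powr (?N + p) * ?w * (2 powr (2 * s - 2)) ^ n)" for n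
    proof -
      have h: "(1/2 :: real) ^ k = 2 powr (- real k)" for k by (simp add: powr_minus powr_realpow power_divide inverse_eq_divide)
      have "B n * (?w * (2 * (1/2) ^ n) ^ DIM('a)) = 2 powr (?N + p) * ?w * (2 powr (2 * s - 2)) ^ n"
        unfolding B_def h p_def by (simp add: powr_realpow[symmetric] powr_powr powr_mult powr_add[symmetric] algebra_simps)
      then show ?thesis using nonneg[of n] by (simp add: emeasure_ball ennreal_mult[symmetric])
    qed
    moreover have "summable (\<lambda>n. 2 powr (?N + p) * ?w * (2 powr (2 * s - 2)) ^ n)"
      using s by (intro summable_mult summable_geometric) (simp add: powr_less_one)
    ultimately have 2: "(\<Sum>n. ennreal (B n) * emeasure lborel (ball (0::'a) (2 * (1/2) ^ n))) < \<infinity>"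
      by (simp add: suminf_ennreal2)
    from 1 2 show ?thesis by simp
  qed
  finally show ?thesis .
qed

lemma cmod_phase_minus_1_le: "(cmod (phase 1 t - 1))\<^sup>2 \<le> min 4 (t\<^sup>2)"
proof -
  have "cmod (phase 1 t - 1) \<le> \<bar>t\<bar>" using iexp_approx1[of t 0] by simp
  then have "(cmod (phase 1 t - 1))\<^sup>2 \<le> \<bar>t\<bar>\<^sup>2" by (intro power_mono) auto
  moreover have "cmod (phase 1 t - 1) \<le> 2" using norm_triangle_ineq4[of "phase 1 t" 1] by simp
  then have "(cmod (phase 1 t - 1))\<^sup>2 \<le> 2\<^sup>2" by (intro power_mono) auto
  ultimately show ?thesis by simp
qed

text \<open>A translation multiplies the transform by a phase, so Plancherel turns the increment
  into the multiplier phase minus one, which is at most 2 and at most its angle.\<close>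

lemma n2_increment_le:
  fixes u :: "'a::euclidean_space \<Rightarrow> real"
  assumes [measurable]: "u \<in> borel_measurable borel" and u2: "n2 u < \<infinity>"
  shows "n2 (\<lambda>x. u (x + h) - u x)
    \<le> (\<integral>\<^sup>+ \<xi>. ennreal (min 4 ((norm h * norm \<xi>)\<^sup>2)) * ennreal ((cmod (L2F (-1) (cx u) \<xi>))\<^sup>2) \<partial>lborel)"
proof -
  have sq: "Fwd.sq (cx u)" "Fwd.sq (\<lambda>x. cx u (x + h))" using u2 n2_shift[of "cx u" h] by auto
  let ?v = "L2F (-1) (cx u)"
  note [measurable] = Fwd.measurable_L2F[OF sq(1)]
  have sqd: "Fwd.sq (\<lambda>x. cx u (x + h) + (-1) * cx u x)"
    using n2_add_finite[OF _ _ conjunct2[OF sq(2)] conjunct2[OF Fwd.sq_cmult[OF sq(1), of "-1"]]] by auto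
  have AE: "AE \<xi> in lborel. L2F (-1) (\<lambda>x. cx u (x + h) + (-1) * cx u x) \<xi> = (phase 1 (h \<bullet> \<xi>) - 1) * ?v \<xi>"
    using Fwd.L2F_add[OF sq(2) Fwd.sq_cmult[OF sq(1), of "-1"]] Fwd.L2F_cmult[OF sq(1), of "-1"] Fwd.L2F_shift[OF sq(1), of h]
  proof eventually_elim
    case (elim \<xi>)
    show ?case unfolding elim(1)[symmetric] elim(2)[symmetric] elim(3)[symmetric] by (simp add: algebra_simps)
  qed
  have "n2 (\<lambda>x. u (x + h) - u x) = n2 (\<lambda>x. cx u (x + h) + (-1) * cx u x)"
    by (simp add: n2_def cmod_def)
  also have "\<dots> = n2 (L2F (-1) (\<lambda>x. cx u (x + h) + (-1) * cx u x))"
    by (rule Fwd.n2_L2F[OF sqd, symmetric])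
  also have "\<dots> = n2 (\<lambda>\<xi>. (phase 1 (h \<bullet> \<xi>) - 1) * ?v \<xi>)" by (rule n2_cong_AE[OF AE])
  also have "\<dots> \<le> (\<integral>\<^sup>+ \<xi>. ennreal (min 4 ((norm h * norm \<xi>)\<^sup>2)) * ennreal ((cmod (?v \<xi>))\<^sup>2) \<partial>lborel)"
    unfolding n2_def
  proof (rule nn_integral_mono)
    fix \<xi> :: 'a
    have "(h \<bullet> \<xi>)\<^sup>2 \<le> (norm h * norm \<xi>)\<^sup>2"
      using Cauchy_Schwarz_ineq2[of h \<xi>] by (metis abs_ge_zero power2_abs power_mono)
    then have "(cmod (phase 1 (h \<bullet> \<xi>) - 1))\<^sup>2 \<le> min 4 ((norm h * norm \<xi>)\<^sup>2)"
      using cmod_phase_minus_1_le[of "h \<bullet> \<xi>"] by linarith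
    then have "ennreal ((cmod (phase 1 (h \<bullet> \<xi>) - 1))\<^sup>2 * (cmod (?v \<xi>))\<^sup>2) \<le> ennreal (min 4 ((norm h * norm \<xi>)\<^sup>2) * (cmod (?v \<xi>))\<^sup>2)"
      by (intro ennreal_leI mult_right_mono) auto
    then show "ennreal ((norm ((phase 1 (h \<bullet> \<xi>) - 1) * ?v \<xi>))\<^sup>2) \<le> ennreal (min 4 ((norm h * norm \<xi>)\<^sup>2)) * ennreal ((cmod (?v \<xi>))\<^sup>2)"
      by (simp only: norm_mult power_mult_distrib) (simp add: ennreal_mult)
  qed
  finally show ?thesis .
qed

lemma measurable_gag_density [measurable]:
  assumes [measurable]: "u \<in> borel_measurable borel"
  shows "gag_density s u \<in> borel_measurable borel"
  unfolding gag_density_def[abs_def] by measurable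

text \<open>The integrand sees \<xi> only through its norm, so dividing \<open>h\<close> by
  \<open>norm \<xi>\<close> is enough and no rotation is required. This is what replacing the phase
  by the bound \<open>min 4\<close> has bought.\<close>

lemma gag_kernel_scaling:
  fixes \<xi> :: "'a::euclidean_space"
  assumes s: "s > 0"
  shows "nn_integral lborel (\<lambda>h::'a. ennreal (min 4 ((norm h * norm \<xi>)\<^sup>2) * gag_kernel s h))
    = ennreal (norm \<xi> powr (2 * s)) * nn_integral lborel (\<lambda>h::'a. ennreal (min 4 ((norm h)\<^sup>2) * gag_kernel s h))"
proof (cases "\<xi> = 0")
  case False
  let ?N = "real DIM('a)"
  define c where "c = 1 / norm \<xi>"
  have c: "c > 0" using False by (simp add: c_def)
  have "nn_integral lborel (\<lambda>h::'a. ennreal (min 4 ((norm h * norm \<xi>)\<^sup>2) * gag_kernel s h))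
     = ennreal (c ^ DIM('a)) * nn_integral lborel (\<lambda>h::'a. ennreal (min 4 ((norm (c *\<^sub>R h) * norm \<xi>)\<^sup>2) * gag_kernel s (c *\<^sub>R h)))"
    using nn_integral_lborel_affine[of "\<lambda>h::'a. ennreal (min 4 ((norm h * norm \<xi>)\<^sup>2) * gag_kernel s h)" c 0] c by simp
  also have "(\<lambda>h::'a. ennreal (min 4 ((norm (c *\<^sub>R h) * norm \<xi>)\<^sup>2) * gag_kernel s (c *\<^sub>R h)))
     = (\<lambda>h::'a. ennreal (c powr (- (?N + 2 * s))) * ennreal (min 4 ((norm h)\<^sup>2) * gag_kernel s h))"
  proof
    fix h :: 'a
    have 1: "norm (c *\<^sub>R h) * norm \<xi> = norm h" using False by (simp add: c_def)
    have 2: "gag_kernel s (c *\<^sub>R h) = c powr (- (?N + 2 * s)) * gag_kernel s h"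
      unfolding gag_kernel_def using c by (simp add: powr_mult)
    show "ennreal (min 4 ((norm (c *\<^sub>R h) * norm \<xi>)\<^sup>2) * gag_kernel s (c *\<^sub>R h)) = ennreal (c powr (- (?N + 2 * s))) * ennreal (min 4 ((norm h)\<^sup>2) * gag_kernel s h)"
      unfolding 1 2 by (simp add: ennreal_mult[symmetric] mult_ac)
  qed
  also have "nn_integral lborel (\<lambda>h::'a. ennreal (c powr (- (?N + 2 * s))) * ennreal (min 4 ((norm h)\<^sup>2) * gag_kernel s h))
     = ennreal (c powr (- (?N + 2 * s))) * nn_integral lborel (\<lambda>h::'a. ennreal (min 4 ((norm h)\<^sup>2) * gag_kernel s h))"
    by (rule nn_integral_cmult) measurable
  also have "ennreal (c ^ DIM('a)) * (ennreal (c powr (- (?N + 2 * s))) * nn_integral lborel (\<lambda>h::'a. ennreal (min 4 ((norm h)\<^sup>2) * gag_kernel s h)))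
     = ennreal (c ^ DIM('a) * c powr (- (?N + 2 * s))) * nn_integral lborel (\<lambda>h::'a. ennreal (min 4 ((norm h)\<^sup>2) * gag_kernel s h))"
    using c by (simp add: ennreal_mult mult.assoc)
  also have "c ^ DIM('a) * c powr (- (?N + 2 * s)) = norm \<xi> powr (2 * s)"
    using c False by (simp add: powr_realpow[symmetric] powr_add[symmetric]) (simp add: c_def powr_minus powr_divide inverse_eq_divide)
  finally show ?thesis .
qed simp

text \<open>With the increment bound inserted, Tonelli lets the integration in \<open>h\<close> come
  first, and by scaling it produces exactly the weight in \<open>kin\<close>.\<close>

theorem gag_le_kin:
  assumes s: "0 < s" "s < 1"
  obtains C where "C > 0" "\<And>u::'a::euclidean_space \<Rightarrow> real. hsp s u \<Longrightarrow> (\<integral>\<^sup>+ x. gag_density s u x \<partial>lborel) \<le> ennreal C * kin s u"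
proof -
  define I where "I = nn_integral lborel (\<lambda>h::'a. ennreal (min 4 ((norm h)\<^sup>2) * gag_kernel s h))"
  have "I < \<infinity>" unfolding I_def by (rule gag_kernel_integral_finite[OF s])
  then have I: "I \<le> ennreal (enn2real I + 1)" by (cases I) (auto intro: ennreal_leI)
  have main: "(\<integral>\<^sup>+ x. gag_density s u x \<partial>lborel) \<le> I * kin s u" if u: "hsp s u" for u :: "'a \<Rightarrow> real"
  proof -
    have u': "u \<in> borel_measurable borel" "n2 u < \<infinity>" using u by (auto simp: hsp_def)
    note [measurable] = u'(1) Fwd.measurable_L2F[OF sq_cx[OF u']]
    let ?v = "L2F (-1) (cx u)"
    have "(\<integral>\<^sup>+ x. gag_density s u x \<partial>lborel) = (\<integral>\<^sup>+ h. (\<integral>\<^sup>+ x. ennreal ((u (x + h) - u x)\<^sup>2 * gag_kernel s h) \<partial>lborel) \<partial>lborel)"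
      unfolding gag_density_def by (rule lborel_pair.Fubini'[symmetric]) measurable
    also have "\<dots> = (\<integral>\<^sup>+ h. n2 (\<lambda>x. u (x + h) - u x) * ennreal (gag_kernel s h) \<partial>lborel)"
      unfolding n2_def by (simp add: ennreal_mult nn_integral_multc)
    also have "\<dots> \<le> (\<integral>\<^sup>+ h. (\<integral>\<^sup>+ \<xi>. ennreal (min 4 ((norm (h::'a) * norm \<xi>)\<^sup>2)) * ennreal ((cmod (?v \<xi>))\<^sup>2) \<partial>lborel) * ennreal (gag_kernel s h) \<partial>lborel)"
      by (intro nn_integral_mono mult_right_mono n2_increment_le u') auto
    also have "\<dots> = (\<integral>\<^sup>+ h. (\<integral>\<^sup>+ \<xi>. ennreal ((cmod (?v \<xi>))\<^sup>2) * ennreal (min 4 ((norm (h::'a) * norm \<xi>)\<^sup>2) * gag_kernel s h) \<partial>lborel) \<partial>lborel)"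
      by (simp add: nn_integral_cmult[symmetric] ennreal_mult mult_ac)
    also have "\<dots> = (\<integral>\<^sup>+ \<xi>. (\<integral>\<^sup>+ h. ennreal ((cmod (?v \<xi>))\<^sup>2) * ennreal (min 4 ((norm (h::'a) * norm \<xi>)\<^sup>2) * gag_kernel s h) \<partial>lborel) \<partial>lborel)"
      by (rule lborel_pair.Fubini'[symmetric]) measurable
    also have "\<dots> = (\<integral>\<^sup>+ \<xi>. ennreal ((cmod (?v \<xi>))\<^sup>2) * (ennreal (norm \<xi> powr (2 * s)) * I) \<partial>lborel)"
      by (subst nn_integral_cmult) (auto simp: gag_kernel_scaling[OF s(1)] I_def)
    also have "\<dots> = (\<integral>\<^sup>+ \<xi>. I * ennreal (norm \<xi> powr (2 * s) * (cmod (?v \<xi>))\<^sup>2) \<partial>lborel)"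
      by (simp add: ennreal_mult mult_ac)
    also have "\<dots> = I * kin s u" unfolding kin_alt by (rule nn_integral_cmult) measurable
    finally show ?thesis .
  qed
  show thesis
  proof (rule that[of "enn2real I + 1"])
    show "enn2real I + 1 > 0" by (simp add: add_nonneg_pos)
    show "(\<integral>\<^sup>+ x. gag_density s u x \<partial>lborel) \<le> ennreal (enn2real I + 1) * kin s u" if "hsp s u" for u :: "'a \<Rightarrow> real"
      using order_trans[OF main[OF that] mult_right_mono[OF I]] by simp
  qed
qed

text \<open>On the ball of radius \<open>r\<close> the kernel is at least
  \<open>r powr (- (N + 2 * s))\<close>. At \<open>h = 0\<close>, where \<open>powr\<close> gives
  the kernel the value 0, the increment vanishes.\<close>

lemma local_increment_le:
  fixes u :: "'a::euclidean_space \<Rightarrow> real"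
  assumes [measurable]: "u \<in> borel_measurable borel" and r: "r > 0" and s: "s > 0"
  shows "(\<integral>\<^sup>+ h. ennreal ((u (x + h) - u x)\<^sup>2) * indicator (ball 0 r) h \<partial>lborel)
    \<le> ennreal (r powr (real DIM('a) + 2 * s)) * gag_density s u x"
proof -
  let ?p = "real DIM('a) + 2 * s"
  have "(\<integral>\<^sup>+ h. ennreal ((u (x + h) - u x)\<^sup>2) * indicator (ball 0 r) h \<partial>lborel)
    \<le> (\<integral>\<^sup>+ h. ennreal (r powr ?p) * ennreal ((u (x + h) - u x)\<^sup>2 * gag_kernel s h) \<partial>lborel)"
  proof (rule nn_integral_mono)
    fix h :: 'a
    show "ennreal ((u (x + h) - u x)\<^sup>2) * indicator (ball 0 r) h \<le> ennreal (r powr ?p) * ennreal ((u (x + h) - u x)\<^sup>2 * gag_kernel s h)"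
    proof (cases "h \<noteq> 0 \<and> norm h < r")
      case True
      have "1 = norm h powr ?p * gag_kernel s h"
        using True by (simp add: gag_kernel_def powr_add[symmetric])
      also have "\<dots> \<le> r powr ?p * gag_kernel s h"
        using True s by (intro mult_right_mono powr_mono2) auto
      finally have "(u (x + h) - u x)\<^sup>2 * 1 \<le> (u (x + h) - u x)\<^sup>2 * (r powr ?p * gag_kernel s h)"
        by (intro mult_left_mono) auto
      then have "ennreal ((u (x + h) - u x)\<^sup>2) \<le> ennreal (r powr ?p * ((u (x + h) - u x)\<^sup>2 * gag_kernel s h))"
        by (intro ennreal_leI) (simp add: mult_ac)
      then show ?thesis using True by (simp add: ennreal_mult)
    next
      case False
      then show ?thesis by (cases "h = 0") auto
    qed
  qed
  also have "\<dots> = ennreal (r powr ?p) * gag_density s u x"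
    unfolding gag_density_def by (rule nn_integral_cmult) measurable
  finally show ?thesis .
qed

section \<open>A pointwise Gagliardo--Nirenberg inequality\<close>

text \<open>If \<open>r\<close> is so large that the mean of \<open>u\<^sup>2\<close> over the ball of radius \<open>r\<close> around \<open>x\<close> is at most a quarter
  of \<open>u(x)\<^sup>2\<close>, then \<open>u(x)\<^sup>2\<close> is controlled by increments of length below \<open>r\<close>.\<close>

lemma pointwise_gn:
  fixes u :: "'a::euclidean_space \<Rightarrow> real"
  assumes [measurable]: "u \<in> borel_measurable borel" and s: "s > 0" and eps: "\<epsilon> > 0" and ux: "u x \<noteq> 0"
    and r: "r > 0" "unit_ball_vol (real DIM('a)) * r ^ DIM('a) * (u x)\<^sup>2 = 4 * \<epsilon>"
    and mass: "(\<integral>\<^sup>+ y. ennreal ((u y)\<^sup>2) * indicator (ball x r) y \<partial>lborel) \<le> ennreal \<epsilon>"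
  shows "ennreal (\<bar>u x\<bar> powr (2 + 4 * s / real DIM('a)))
    \<le> ennreal (4 / unit_ball_vol (real DIM('a)) * (4 * \<epsilon> / unit_ball_vol (real DIM('a))) powr (2 * s / real DIM('a))) * gag_density s u x"
proof -
  let ?N = "real DIM('a)" and ?w = "unit_ball_vol (real DIM('a))"
  have w: "?w > 0" by simp
  then have wn: "?w \<noteq> 0" by (metis less_irrefl)
  let ?J = "\<integral>\<^sup>+ h. ennreal ((u (x + h) - u x)\<^sup>2) * indicator (ball 0 r) h \<partial>lborel"
  have [measurable]: "(\<lambda>h::'a. indicator (ball a t) h :: ennreal) \<in> borel_measurable borel" for a t
    by (intro borel_measurable_indicator) auto
  have mass': "(\<integral>\<^sup>+ h. ennreal ((u (x + h))\<^sup>2) * indicator (ball 0 r) h \<partial>lborel) \<le> ennreal \<epsilon>"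
  proof -
    have "(\<integral>\<^sup>+ h. ennreal ((u (x + h))\<^sup>2) * indicator (ball 0 r) h \<partial>lborel) = (\<integral>\<^sup>+ h. ennreal ((u (x + h))\<^sup>2) * indicator (ball x r) (x + h) \<partial>lborel)"
      by (intro nn_integral_cong) (auto simp: indicator_def dist_norm)
    also have "\<dots> = (\<integral>\<^sup>+ y. ennreal ((u y)\<^sup>2) * indicator (ball x r) y \<partial>lborel)"
      using nn_integral_lborel_shift[of "\<lambda>y. ennreal ((u y)\<^sup>2) * indicator (ball x r) y" x] by (simp add: add.commute)
    finally show ?thesis using mass by simp
  qed
  \<comment> \<open>Integrate \<open>u(x)^2 \<le> 2 (u(x+h) - u(x))^2 + 2 u(x+h)^2\<close> over the
    ball. The left side becomes \<open>4 * \<epsilon>\<close> by the choice of \<open>r\<close>, the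
    mass takes at most \<open>2 * \<epsilon>\<close>, so the increments must supply at least
    \<epsilon>.\<close>
  have "ennreal (4 * \<epsilon>) = ennreal ((u x)\<^sup>2) * emeasure lborel (ball (0::'a) r)"
    using r w by (simp add: emeasure_ball ennreal_mult[symmetric] mult_ac)
  also have "\<dots> = (\<integral>\<^sup>+ h. ennreal ((u x)\<^sup>2) * indicator (ball (0::'a) r) h \<partial>lborel)"
    by (simp add: nn_integral_cmult_indicator)
  also have "\<dots> \<le> (\<integral>\<^sup>+ h. 2 * (ennreal ((u (x + h) - u x)\<^sup>2) * indicator (ball 0 r) h) + 2 * (ennreal ((u (x + h))\<^sup>2) * indicator (ball 0 r) h) \<partial>lborel)"
  proof (rule nn_integral_mono)
    fix h :: 'a
    have "(u x)\<^sup>2 \<le> 2 * (u (x + h) - u x)\<^sup>2 + 2 * (u (x + h))\<^sup>2"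
      using norm_add_power2_le[of "u x - u (x + h)" "u (x + h)"] by (simp add: power2_commute)
    then have "ennreal ((u x)\<^sup>2) \<le> ennreal (2 * (u (x + h) - u x)\<^sup>2 + 2 * (u (x + h))\<^sup>2)" by (rule ennreal_leI)
    then have "ennreal ((u x)\<^sup>2) \<le> 2 * ennreal ((u (x + h) - u x)\<^sup>2) + 2 * ennreal ((u (x + h))\<^sup>2)"
      by (simp add: ennreal_plus ennreal_mult)
    then show "ennreal ((u x)\<^sup>2) * indicator (ball (0::'a) r) h \<le> 2 * (ennreal ((u (x + h) - u x)\<^sup>2) * indicator (ball 0 r) h) + 2 * (ennreal ((u (x + h))\<^sup>2) * indicator (ball 0 r) h)"
      by (simp add: indicator_def)
  qed
  also have "\<dots> = 2 * ?J + 2 * (\<integral>\<^sup>+ h. ennreal ((u (x + h))\<^sup>2) * indicator (ball 0 r) h \<partial>lborel)"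
    by (simp add: nn_integral_add nn_integral_cmult)
  also have "\<dots> \<le> 2 * ?J + 2 * ennreal \<epsilon>" by (intro add_mono mult_left_mono mass') auto
  finally have J: "ennreal (4 * \<epsilon>) \<le> 2 * ?J + 2 * ennreal \<epsilon>" .
  have eJ: "ennreal \<epsilon> \<le> ?J"
  proof (cases ?J)
    case (real j)
    have "ennreal (4 * \<epsilon>) \<le> ennreal (2 * j + 2 * \<epsilon>)"
      using J real eps by (simp add: ennreal_plus ennreal_mult')
    then have "4 * \<epsilon> \<le> 2 * j + 2 * \<epsilon>" using real eps by (simp add: ennreal_le_iff del: ennreal_plus)
    then show ?thesis unfolding real by (intro ennreal_leI) simp
  qed simp
  have "ennreal \<epsilon> \<le> ennreal (r powr (?N + 2 * s)) * gag_density s u x"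
    using order_trans[OF eJ local_increment_le[OF _ r(1) s]] by simp
  then have "ennreal (\<bar>u x\<bar> powr (2 + 4 * s / ?N) / \<epsilon>) * ennreal \<epsilon> \<le> ennreal (\<bar>u x\<bar> powr (2 + 4 * s / ?N) / \<epsilon>) * (ennreal (r powr (?N + 2 * s)) * gag_density s u x)"
    by (rule mult_left_mono) simp
  then have "ennreal (\<bar>u x\<bar> powr (2 + 4 * s / ?N)) \<le> ennreal (\<bar>u x\<bar> powr (2 + 4 * s / ?N) / \<epsilon> * r powr (?N + 2 * s)) * gag_density s u x"
    using eps by (simp add: ennreal_mult[symmetric] mult.assoc[symmetric])
  \<comment> \<open>Elimination of \<open>r\<close>: since \<open>u(x)^2\<close> is a constant times
    \<open>r^(-N)\<close>, its power \<open>1 + 2s/N\<close> cancels \<open>r^(N + 2s)\<close>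
    exactly. The critical exponent is the one for which this happens, and a factor of order
    \<open>\<epsilon>^(2s/N)\<close> remains.\<close>
  also have "\<bar>u x\<bar> powr (2 + 4 * s / ?N) / \<epsilon> * r powr (?N + 2 * s) = 4 / ?w * (4 * \<epsilon> / ?w) powr (2 * s / ?N)"
  proof -
    have u2: "(u x)\<^sup>2 = 4 * \<epsilon> / ?w * r powr (- ?N)"
      using r wn by (simp add: powr_minus powr_realpow field_simps)
    have "\<bar>u x\<bar> powr (2 + 4 * s / ?N) = ((u x)\<^sup>2) powr (1 + 2 * s / ?N)"
    proof -
      have sq: "(u x)\<^sup>2 = \<bar>u x\<bar> powr 2" using ux by simp
      show ?thesis unfolding sq powr_powr by (simp add: algebra_simps)
    qed
    also have "\<dots> = (4 * \<epsilon> / ?w) powr (1 + 2 * s / ?N) * r powr (- ?N * (1 + 2 * s / ?N))"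
      unfolding u2 using r w eps by (subst powr_mult) (auto simp: powr_powr)
    also have "- ?N * (1 + 2 * s / ?N) = - (?N + 2 * s)" by (simp add: algebra_simps)
    finally have "\<bar>u x\<bar> powr (2 + 4 * s / ?N) * r powr (?N + 2 * s) = (4 * \<epsilon> / ?w) powr (1 + 2 * s / ?N) * (r powr (- (?N + 2 * s)) * r powr (?N + 2 * s))"
      by (simp only: mult.assoc)
    also have "r powr (- (?N + 2 * s)) * r powr (?N + 2 * s) = 1" using r by (simp add: powr_add[symmetric])
    also have "(4 * \<epsilon> / ?w) powr (1 + 2 * s / ?N) * 1 = 4 * \<epsilon> / ?w * (4 * \<epsilon> / ?w) powr (2 * s / ?N)"
      using w eps by (simp add: powr_add)
    finally show ?thesis using eps by (simp add: field_simps)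
  qed
  finally show ?thesis .
qed

text \<open>The radius in the hypothesis is the solution \<open>r\<close> of the relation required
  by \<open>pointwise_gn\<close>. The set \<open>S\<close> is left free: it is the whole space for
  Gagliardo-Nirenberg, and a far superlevel set of \<open>\<bar>u\<bar>\<close> for the
  tails.\<close>

lemma gn_on_set:
  fixes u :: "'a::euclidean_space \<Rightarrow> real"
  assumes [measurable]: "u \<in> borel_measurable borel" and s: "s > 0" and eps: "\<epsilon> > 0" and [measurable]: "S \<in> sets borel"
    and mass: "\<And>x. x \<in> S \<Longrightarrow> u x \<noteq> 0 \<Longrightarrow>
      (\<integral>\<^sup>+ y. ennreal ((u y)\<^sup>2) * indicator (ball x ((4 * \<epsilon> / (unit_ball_vol (real DIM('a)) * (u x)\<^sup>2)) powr (1 / real DIM('a)))) y \<partial>lborel) \<le> ennreal \<epsilon>"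
  shows "(\<integral>\<^sup>+ x. ennreal (\<bar>u x\<bar> powr (2 + 4 * s / real DIM('a))) * indicator S x \<partial>lborel)
    \<le> ennreal (4 / unit_ball_vol (real DIM('a)) * (4 * \<epsilon> / unit_ball_vol (real DIM('a))) powr (2 * s / real DIM('a))) * (\<integral>\<^sup>+ x. gag_density s u x \<partial>lborel)"
proof -
  let ?N = "real DIM('a)" and ?w = "unit_ball_vol (real DIM('a))"
  have w: "?w > 0" by simp
  then have wn: "?w \<noteq> 0" by (metis less_irrefl)
  have "(\<integral>\<^sup>+ x. ennreal (\<bar>u x\<bar> powr (2 + 4 * s / ?N)) * indicator S x \<partial>lborel)
    \<le> (\<integral>\<^sup>+ x. ennreal (4 / ?w * (4 * \<epsilon> / ?w) powr (2 * s / ?N)) * gag_density s u x \<partial>lborel)"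
  proof (rule nn_integral_mono)
    fix x :: 'a
    show "ennreal (\<bar>u x\<bar> powr (2 + 4 * s / ?N)) * indicator S x \<le> ennreal (4 / ?w * (4 * \<epsilon> / ?w) powr (2 * s / ?N)) * gag_density s u x"
    proof (cases "x \<in> S \<and> u x \<noteq> 0")
      case True
      define t where "t = 4 * \<epsilon> / (?w * (u x)\<^sup>2)"
      have t: "t > 0" using True eps w by (simp add: t_def)
      have "(t powr (1 / ?N)) ^ DIM('a) = t"
        using t by (simp add: powr_realpow[symmetric] powr_powr)
      then have "?w * (t powr (1 / ?N)) ^ DIM('a) * (u x)\<^sup>2 = 4 * \<epsilon>"
        using True wn by (simp add: t_def)
      from pointwise_gn[OF assms(1) s eps _ _ this mass[of x, folded t_def]] True t
      show ?thesis by simp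
    qed auto
  qed
  also have "\<dots> = ennreal (4 / ?w * (4 * \<epsilon> / ?w) powr (2 * s / ?N)) * (\<integral>\<^sup>+ x. gag_density s u x \<partial>lborel)"
    by (rule nn_integral_cmult) measurable
  finally show ?thesis .
qed

section \<open>Local compactness\<close>

lemma diagonal_convergent_subseq:
  fixes a :: "nat \<Rightarrow> nat \<Rightarrow> real"
  assumes bd: "\<And>j n. \<bar>a j n\<bar> \<le> M j"
  obtains r where "strict_mono (r :: nat \<Rightarrow> nat)" "\<And>j. convergent (\<lambda>n. a j (r n))"
proof -
  interpret D: subseqs "\<lambda>j s. convergent (\<lambda>k. a j (s k))"
  proof (unfold convergent_def, unfold subseqs_def, auto)
    fix j :: nat and s :: "nat \<Rightarrow> nat" assume s: "strict_mono s"
    have "\<And>k. a j (s k) \<in> {- M j .. M j}" using bd by (simp add: abs_le_iff minus_le_iff)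
    then have "\<exists>l s'. strict_mono s' \<and> ((\<lambda>k. a j (s k)) \<circ> s') \<longlonglongrightarrow> l"
      using compact_Icc compact_imp_seq_compact seq_compactE by metis
    then show "\<exists>s'. strict_mono (s'::nat\<Rightarrow>nat) \<and> (\<exists>l. (\<lambda>k. a j (s (s' k))) \<longlonglongrightarrow> l)"
      by (auto simp: comp_def)
  qed
  show thesis
  proof (rule that[of D.diagseq])
    show "strict_mono D.diagseq" by (rule D.subseq_diagseq)
    fix j
    have Pn: "convergent (\<lambda>k. a j (D.seqseq (Suc j) k))" by (rule D.seqseq_holds)
    have 1: "(\<lambda>k. a j ((D.seqseq (Suc j) \<circ> (\<lambda>k. D.fold_reduce (Suc j) k (Suc j + k))) k))
      = (\<lambda>k. a j (D.seqseq (Suc j) k)) \<circ> (\<lambda>k. D.fold_reduce (Suc j) k (Suc j + k))"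
      by auto
    have "convergent (\<lambda>k. a j ((D.diagseq \<circ> ((+) (Suc j))) k))"
      unfolding D.diagseq_seqseq 1
      by (intro convergent_subseq_convergent Pn D.subseq_diagonal_rest)
    then obtain L where "(\<lambda>k. a j (D.diagseq (k + Suc j))) \<longlonglongrightarrow> L"
      by (auto simp: add.commute dest: convergentD)
    then have "(\<lambda>k. a j (D.diagseq k)) \<longlonglongrightarrow> L" by (rule LIMSEQ_offset)
    then show "convergent (\<lambda>k. a j (D.diagseq k))" by (auto simp: convergent_def)
  qed
qed

definition ball_mean :: "('a::euclidean_space \<Rightarrow> real) \<Rightarrow> 'a \<Rightarrow> real \<Rightarrow> real" where
  "ball_mean u q r = (LBINT y. indicator (ball q r) y * u y) / (unit_ball_vol (real DIM('a)) * r ^ DIM('a))"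

lemma indicator_ball_L2:
  fixes q :: "'a::euclidean_space"
  assumes r: "r > 0"
  shows "n2 (indicator (ball q r) :: 'a \<Rightarrow> real) = ennreal (unit_ball_vol (real DIM('a)) * r ^ DIM('a))"
proof -
  have "n2 (indicator (ball q r) :: 'a \<Rightarrow> real) = nn_integral lborel (indicator (ball q r))"
    unfolding n2_def by (intro nn_integral_cong) (auto simp: indicator_def)
  also have "\<dots> = emeasure lborel (ball q r)" by (rule nn_integral_indicator) auto
  finally show ?thesis using r by (simp add: emeasure_ball)
qed

lemma real_L2_pairing_bound:
  fixes f g :: "'a::euclidean_space \<Rightarrow> real"
  assumes "f \<in> borel_measurable borel" "g \<in> borel_measurable borel"
  shows "ennreal ((LBINT x. f x * g x)\<^sup>2) \<le> n2 f * n2 g"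
proof -
  have "ennreal ((cmod (LBINT x. cx f x * cx g x))\<^sup>2) \<le> n2 (cx f) * n2 (cx g)"
    using assms by (intro L2_pairing_bound) auto
  moreover have "(LBINT x. cx f x * cx g x) = complex_of_real (LBINT x. f x * g x)"
    by (simp only: of_real_mult[symmetric] integral_complex_of_real)
  ultimately show ?thesis by simp
qed

lemma ball_mean_bound:
  fixes u :: "'a::euclidean_space \<Rightarrow> real"
  assumes [measurable]: "u \<in> borel_measurable borel" and m: "n2 u \<le> ennreal m" "m \<ge> 0" and r: "r > 0"
  shows "\<bar>ball_mean u q r\<bar> \<le> sqrt (m / (unit_ball_vol (real DIM('a)) * r ^ DIM('a)))"
proof -
  let ?V = "unit_ball_vol (real DIM('a)) * r ^ DIM('a)"
  have V: "?V > 0" using r by simp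
  have "ennreal ((LBINT y. indicator (ball q r) y * u y)\<^sup>2) \<le> n2 (indicator (ball q r) :: 'a \<Rightarrow> real) * n2 u"
    by (rule real_L2_pairing_bound) auto
  also have "\<dots> \<le> ennreal ?V * ennreal m" unfolding indicator_ball_L2[OF r] by (intro mult_left_mono m) auto
  also have "\<dots> = ennreal (?V * m)" using V m by (simp only: ennreal_mult less_imp_le)
  finally have le: "(LBINT y. indicator (ball q r) y * u y)\<^sup>2 \<le> ?V * m" using V m by (simp add: ennreal_le_iff)
  have "(ball_mean u q r)\<^sup>2 = (LBINT y. indicator (ball q r) y * u y)\<^sup>2 / ?V\<^sup>2"
    by (simp add: ball_mean_def power_divide)
  also have "\<dots> \<le> ?V * m / ?V\<^sup>2" by (intro divide_right_mono le) auto
  also have "\<dots> = m / ?V" using V by (simp add: power2_eq_square)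
  finally have "sqrt ((ball_mean u q r)\<^sup>2) \<le> sqrt (m / ?V)" by (rule real_sqrt_le_mono)
  then show ?thesis by simp
qed

text \<open>The ball around \<open>q\<close> lies in the ball of radius \<open>2 * r\<close> around
  \<open>x\<close>, so Cauchy-Schwarz bounds the deviation from the mean by increments of length
  below \<open>2 * r\<close>. Division by the volume leaves a factor of order
  \<open>r powr (2 * s)\<close>, which is small for small balls.\<close>

lemma ball_mean_error:
  fixes u :: "'a::euclidean_space \<Rightarrow> real"
  assumes [measurable]: "u \<in> borel_measurable borel" and fin: "n2 u < \<infinity>" and r: "r > 0" and s: "s > 0" and d: "dist x q < r"
  shows "ennreal ((u x - ball_mean u q r)\<^sup>2)
    \<le> ennreal ((2 * r) powr (real DIM('a) + 2 * s) / (unit_ball_vol (real DIM('a)) * r ^ DIM('a))) * gag_density s u x"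
proof -
  let ?V = "unit_ball_vol (real DIM('a)) * r ^ DIM('a)"
  let ?I = "indicator (ball q r) :: 'a \<Rightarrow> real"
  have V: "?V > 0" using r by simp
  have nI: "n2 ?I < \<infinity>" unfolding indicator_ball_L2[OF r] by simp
  have i1: "integrable lborel (\<lambda>y. ?I y * u y)" by (rule real_L2_mult_integrable) (use fin nI in auto)
  have i2: "integrable lborel (\<lambda>y. ?I y * ?I y)" by (rule real_L2_mult_integrable) (use nI in auto)
  have II: "(\<lambda>y. ?I y * ?I y) = ?I" by (auto simp: indicator_def)
  have V': "(LBINT y. ?I y) = ?V" using r by (simp add: measure_def emeasure_ball)
  have Vn: "?V \<noteq> 0" using V by (metis less_irrefl)
  have "(u x - ball_mean u q r) * ?V = (LBINT y. ?I y * u x) - (LBINT y. ?I y * u y)"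
    using Vn V' by (simp add: ball_mean_def left_diff_distrib)
  also have "\<dots> = (LBINT y. ?I y * u x - ?I y * u y)"
    using i1 i2 by (intro Bochner_Integration.integral_diff[symmetric]) (auto simp: II)
  also have "\<dots> = (LBINT y. ?I y * (?I y * (u x - u y)))"
    by (intro Bochner_Integration.integral_cong refl) (auto simp: indicator_def)
  finally have eq: "(u x - ball_mean u q r) * ?V = (LBINT y. ?I y * (?I y * (u x - u y)))" .
  have "ennreal ((u x - ball_mean u q r)\<^sup>2 * ?V\<^sup>2) \<le> n2 ?I * n2 (\<lambda>y. ?I y * (u x - u y))"
    unfolding power_mult_distrib[symmetric] eq by (rule real_L2_pairing_bound) auto
  also have "n2 (\<lambda>y. ?I y * (u x - u y)) \<le> (\<integral>\<^sup>+ y. ennreal ((u y - u x)\<^sup>2) * indicator (ball 0 (2 * r)) (y - x) \<partial>lborel)"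
    unfolding n2_def
  proof (rule nn_integral_mono)
    fix y :: 'a
    show "ennreal ((norm (?I y * (u x - u y)))\<^sup>2) \<le> ennreal ((u y - u x)\<^sup>2) * indicator (ball 0 (2 * r)) (y - x)"
    proof (cases "y \<in> ball q r")
      case True
      then have "norm (y - x) < 2 * r"
        using d dist_triangle[of y x q] by (simp add: dist_norm norm_minus_commute)
      then show ?thesis using True by (simp add: power2_commute)
    qed simp
  qed
  also have "(\<integral>\<^sup>+ y. ennreal ((u y - u x)\<^sup>2) * indicator (ball 0 (2 * r)) (y - x) \<partial>lborel)
     = (\<integral>\<^sup>+ h. ennreal ((u (x + h) - u x)\<^sup>2) * indicator (ball 0 (2 * r)) h \<partial>lborel)"
  proof -
    have "(\<lambda>y. indicator (ball 0 (2 * r)) (y - x) :: ennreal) \<in> borel_measurable borel"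
      by (rule measurable_compose[of "\<lambda>y. y - x" borel borel "indicator (ball 0 (2 * r))"])
        (auto intro!: borel_measurable_indicator)
    then show ?thesis
      using nn_integral_lborel_shift[of "\<lambda>y. ennreal ((u y - u x)\<^sup>2) * indicator (ball 0 (2 * r)) (y - x)" x] by (simp add: add.commute)
  qed
  also have "\<dots> \<le> ennreal ((2 * r) powr (real DIM('a) + 2 * s)) * gag_density s u x"
    using r s by (intro local_increment_le) auto
  finally have "ennreal ((u x - ball_mean u q r)\<^sup>2 * ?V\<^sup>2) \<le> ennreal ?V * (ennreal ((2 * r) powr (real DIM('a) + 2 * s)) * gag_density s u x)"
    unfolding indicator_ball_L2[OF r] by (auto simp: mult_left_mono)
  then have "ennreal (1 / ?V\<^sup>2) * ennreal ((u x - ball_mean u q r)\<^sup>2 * ?V\<^sup>2)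
    \<le> ennreal (1 / ?V\<^sup>2) * (ennreal ?V * (ennreal ((2 * r) powr (real DIM('a) + 2 * s)) * gag_density s u x))"
    by (rule mult_left_mono) simp
  also have "ennreal (1 / ?V\<^sup>2) * ennreal ((u x - ball_mean u q r)\<^sup>2 * ?V\<^sup>2) = ennreal ((u x - ball_mean u q r)\<^sup>2)"
    using Vn by (subst ennreal_mult[symmetric]) auto
  also have "ennreal (1 / ?V\<^sup>2) * (ennreal ?V * (ennreal ((2 * r) powr (real DIM('a) + 2 * s)) * gag_density s u x))
    = ennreal (1 / ?V\<^sup>2 * ?V * (2 * r) powr (real DIM('a) + 2 * s)) * gag_density s u x"
    using V by (subst ennreal_mult, simp, simp, subst ennreal_mult) (auto simp: mult.assoc)
  also have "1 / ?V\<^sup>2 * ?V * (2 * r) powr (real DIM('a) + 2 * s) = (2 * r) powr (real DIM('a) + 2 * s) / ?V"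
    using V by (simp add: power2_eq_square)
  finally show ?thesis .
qed

text \<open>Countably many centres, with the least admissible index chosen at each point. The
  selection is measurable, and a diagonal argument over the centres becomes possible.\<close>

lemma ex_dense_selection:
  fixes r :: real
  assumes r: "r > 0"
  obtains q :: "nat \<Rightarrow> 'a::euclidean_space" and j :: "'a \<Rightarrow> nat"
  where "j \<in> borel \<rightarrow>\<^sub>M count_space UNIV" "\<And>x. dist x (q (j x)) < r"
proof -
  obtain D :: "'a set" where D: "countable D" "\<And>X. open X \<Longrightarrow> X \<noteq> {} \<Longrightarrow> \<exists>d\<in>D. d \<in> X"
    using countable_dense_setE by blast
  have "D \<noteq> {}" using D(2)[of UNIV] by auto
  define q where "q = from_nat_into D"
  have ex: "\<exists>n. dist x (q n) < r" for x
  proof -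
    obtain d where d: "d \<in> D" "d \<in> ball x r" using D(2)[of "ball x r"] r by auto
    then obtain n where "q n = d" using from_nat_into_surj[OF D(1)] unfolding q_def by blast
    then show ?thesis using d by auto
  qed
  define j where "j x = (LEAST n. dist x (q n) < r)" for x
  show thesis
  proof
    show "j \<in> borel \<rightarrow>\<^sub>M count_space UNIV" unfolding j_def[abs_def] by measurable
    show "dist x (q (j x)) < r" for x unfolding j_def using ex by (rule LeastI_ex)
  qed
qed

text \<open>Each \<open>u n\<close> is replaced by its means over small balls with countably many
  centres. Bounded real numbers converge along a diagonal subsequence, and the replacement error is
  of order \<open>\<rho> k powr (2 * s) * G\<close>, uniformly in \<open>n\<close>. This makes the
  weighted sequence \<open>f\<close> Cauchy in L2.\<close>

theorem fractional_rellich: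
  fixes u :: "nat \<Rightarrow> 'a::euclidean_space \<Rightarrow> real"
  assumes u[measurable]: "\<And>n. u n \<in> borel_measurable borel" and m: "\<And>n. n2 (u n) \<le> ennreal m" "m \<ge> 0"
    and G: "\<And>n. (\<integral>\<^sup>+ x. gag_density s (u n) x \<partial>lborel) \<le> ennreal G" "G \<ge> 0" and s: "s > 0"
  obtains v r where "v \<in> borel_measurable borel" "strict_mono (r :: nat \<Rightarrow> nat)"
    "AE x in lborel. (\<lambda>n. u (r n) x) \<longlonglongrightarrow> v x"
    "\<And>R. (\<lambda>n. n2 (\<lambda>x. indicator (ball 0 R) x *\<^sub>R (u (r n) x - v x))) \<longlonglongrightarrow> 0"
proof -
  let ?w0 = "unit_ball_vol (real DIM('a))"
  have w0: "?w0 > 0" by simp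
  \<comment> \<open>A Gaussian weight makes the bounded means square integrable on the whole space,
    so one dominated convergence serves all radii. It is positive everywhere and is divided out
    again at the end.\<close>
  define w where "w x = exp (- (norm x)\<^sup>2 / 2)" for x :: 'a
  have w[measurable]: "w \<in> borel_measurable borel" unfolding w_def by measurable
  have w01: "0 < w x" "w x \<le> 1" for x by (auto simp: w_def)
  have w2: "n2 w < \<infinity>" using gaussian_hsp[of "1/2", where 'a='a] unfolding hsp_def w_def by auto
  have ufin: "n2 (u n) < \<infinity>" for n using order_le_less_trans[OF m(1)[of n], of \<infinity>] by simp
  define \<rho> where "\<rho> k = 1 / real (Suc k)" for k
  have rho: "\<rho> k > 0" for k by (simp add: \<rho>_def)
  have "\<exists>q j. j \<in> borel \<rightarrow>\<^sub>M count_space UNIV \<and> (\<forall>x::'a. dist x (q (j x :: nat)) < \<rho> k)" for k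
    using ex_dense_selection[OF rho[of k], where 'a='a] by metis
  then obtain q j where j[measurable]: "\<And>k. j k \<in> borel \<rightarrow>\<^sub>M count_space (UNIV :: nat set)" and qj: "\<And>k (x::'a). dist x (q k (j k x)) < \<rho> k"
    by metis
  \<comment> \<open>All scales \<open>k\<close> and all centres \<open>l\<close> are enumerated by
    one index, so a single diagonal extraction suffices.\<close>
  define a where "a i n = (case prod_decode i of (k, l) \<Rightarrow> ball_mean (u n) (q k l) (\<rho> k))" for i n
  define M where "M k = sqrt (m / (?w0 * \<rho> k ^ DIM('a)))" for k
  have aM: "\<bar>ball_mean (u n) z (\<rho> k)\<bar> \<le> M k" for n z k
    unfolding M_def by (rule ball_mean_bound[OF u m rho])
  obtain r0 where r0: "strict_mono (r0 :: nat \<Rightarrow> nat)" "\<And>i. convergent (\<lambda>n. a i (r0 n))"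
  proof (rule diagonal_convergent_subseq[of a "\<lambda>i. M (fst (prod_decode i))"])
    show "\<bar>a i n\<bar> \<le> M (fst (prod_decode i))" for i n
      using aM by (simp add: a_def split: prod.split)
  qed (use that in blast)
  define A where "A k n x = ball_mean (u (r0 n)) (q k (j k x)) (\<rho> k)" for k n x
  have [measurable]: "A k n \<in> borel_measurable borel" for k n
    unfolding A_def[abs_def] by (rule measurable_compose[OF j, of "\<lambda>l. ball_mean (u (r0 n)) (q k l) (\<rho> k)"]) simp
  have conv: "convergent (\<lambda>n. A k n x)" for k x
    using r0(2)[of "prod_encode (k, j k x)"] by (simp add: a_def A_def)
  define L where "L k x = lim (\<lambda>n. A k n x)" for k x
  have [measurable]: "L k \<in> borel_measurable borel" for k unfolding L_def[abs_def] by measurable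
  have AL: "(\<lambda>n. A k n x) \<longlonglongrightarrow> L k x" for k x using conv[of k x] by (simp add: L_def convergent_LIMSEQ_iff)
  define f where "f n x = w x * u (r0 n) x" for n x
  have [measurable]: "f n \<in> borel_measurable borel" for n unfolding f_def by measurable
  have err: "n2 (\<lambda>x. f n x - w x * A k n x) \<le> ennreal (2 powr (real DIM('a) + 2 * s) / ?w0 * \<rho> k powr (2 * s) * G)" for n k
  proof -
    let ?c = "(2 * \<rho> k) powr (real DIM('a) + 2 * s) / (?w0 * \<rho> k ^ DIM('a))"
    have "n2 (\<lambda>x. f n x - w x * A k n x) \<le> (\<integral>\<^sup>+ x. ennreal ?c * gag_density s (u (r0 n)) x \<partial>lborel)"
      unfolding n2_def
    proof (rule nn_integral_mono)
      fix x :: 'a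
      have "norm (f n x - w x * A k n x) \<le> 1 * norm (u (r0 n) x - A k n x)"
        unfolding f_def right_diff_distrib[symmetric] norm_mult using w01[of x] by (intro mult_right_mono) auto
      then have "(norm (f n x - w x * A k n x))\<^sup>2 \<le> (norm (u (r0 n) x - A k n x))\<^sup>2" by (intro power_mono) auto
      then have "ennreal ((norm (f n x - w x * A k n x))\<^sup>2) \<le> ennreal ((u (r0 n) x - A k n x)\<^sup>2)"
        by (intro ennreal_leI) simp
      also have "\<dots> \<le> ennreal ?c * gag_density s (u (r0 n)) x"
        unfolding A_def by (rule ball_mean_error[OF u ufin rho s qj])
      finally show "ennreal ((norm (f n x - w x * A k n x))\<^sup>2) \<le> ennreal ?c * gag_density s (u (r0 n)) x" .
    qed
    also have "\<dots> = ennreal ?c * (\<integral>\<^sup>+ x. gag_density s (u (r0 n)) x \<partial>lborel)" by (rule nn_integral_cmult) measurable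
    also have "\<dots> \<le> ennreal ?c * ennreal G" by (intro mult_left_mono G) auto
    also have "\<dots> = ennreal (?c * G)" using G rho[of k] w0 by (subst ennreal_mult) auto
    also have "?c = 2 powr (real DIM('a) + 2 * s) / ?w0 * \<rho> k powr (2 * s)"
      using rho[of k] by (simp add: powr_mult powr_add powr_realpow)
    finally show ?thesis .
  qed
  have mid: "(\<lambda>n. n2 (\<lambda>x. w x * A k n x - w x * L k x)) \<longlonglongrightarrow> 0" for k
  proof (rule n2_tendsto_dominated)
    show "norm (w x * A k n x) \<le> norm (M k * w x)" for n x
      unfolding norm_mult A_def using aM[of "r0 n" "q k (j k x)" k] by (subst mult.commute) (auto intro!: mult_right_mono)
    show "n2 (\<lambda>x. M k * w x) < \<infinity>" using w2 by (simp add: n2_real_cmult ennreal_mult_less_top)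
    show "AE x in lborel. (\<lambda>n. w x * A k n x) \<longlonglongrightarrow> w x * L k x" by (intro AE_I2 tendsto_intros AL)
  qed measurable
  have errlim: "(\<lambda>k. 2 powr (real DIM('a) + 2 * s) / ?w0 * \<rho> k powr (2 * s) * G) \<longlonglongrightarrow> 0"
  proof -
    have "\<rho> \<longlonglongrightarrow> 0" unfolding \<rho>_def[abs_def] using LIMSEQ_inverse_real_of_nat by (simp add: inverse_eq_divide)
    then have "(\<lambda>k. \<rho> k powr (2 * s)) \<longlonglongrightarrow> 0 powr (2 * s)"
      using s rho by (intro tendsto_powr' tendsto_const) (auto simp: less_imp_le)
    then have "(\<lambda>k. 2 powr (real DIM('a) + 2 * s) / ?w0 * \<rho> k powr (2 * s) * G) \<longlonglongrightarrow> 2 powr (real DIM('a) + 2 * s) / ?w0 * 0 powr (2 * s) * G"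
      by (intro tendsto_mult tendsto_const)
    then show ?thesis by simp
  qed
  obtain g r1 where g[measurable]: "g \<in> borel_measurable borel" and r1: "strict_mono (r1 :: nat \<Rightarrow> nat)"
    and gAE: "AE x in lborel. (\<lambda>k. f (r1 k) x) \<longlonglongrightarrow> g x" and gl: "(\<lambda>n. n2 (\<lambda>x. f n x - g x)) \<longlonglongrightarrow> 0"
  proof (rule L2_complete[of f])
    show "f n \<in> borel_measurable borel" for n by measurable
  next
    fix e :: real assume e: "e > 0"
    have "\<forall>\<^sub>F k in sequentially. 2 powr (real DIM('a) + 2 * s) / ?w0 * \<rho> k powr (2 * s) * G < e/16"
      using errlim e by (intro order_tendstoD(2)) auto
    then obtain k where k: "2 powr (real DIM('a) + 2 * s) / ?w0 * \<rho> k powr (2 * s) * G < e/16"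
      by (auto simp: eventually_sequentially)
    have "\<forall>\<^sub>F n in sequentially. n2 (\<lambda>x. w x * A k n x - w x * L k x) < ennreal (e/16)"
      using mid[of k] e by (intro order_tendstoD(2)) auto
    then obtain N where N: "\<And>n. n \<ge> N \<Longrightarrow> n2 (\<lambda>x. w x * A k n x - w x * L k x) < ennreal (e/16)"
      by (auto simp: eventually_sequentially)
    have fL: "n2 (\<lambda>x. f n x - w x * L k x) \<le> ennreal (e/4)" if n: "n \<ge> N" for n
    proof -
      have "n2 (\<lambda>x. f n x - w x * L k x) \<le> 2 * n2 (\<lambda>x. f n x - w x * A k n x) + 2 * n2 (\<lambda>x. w x * A k n x - w x * L k x)"
        by (rule n2_triangle) measurable
      also have "\<dots> \<le> 2 * ennreal (e/16) + 2 * ennreal (e/16)"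
        using N[OF n] k by (intro add_mono mult_left_mono order_trans[OF err] ennreal_leI) auto
      also have "\<dots> = ennreal (e/4)"
        using e by (simp add: ennreal_mult'[symmetric] ennreal_plus[symmetric] flip: ennreal_numeral del: ennreal_plus)
      finally show ?thesis .
    qed
    have "n2 (\<lambda>x. f n x - f n' x) \<le> ennreal e" if "n \<ge> N" "n' \<ge> N" for n n'
    proof -
      have "n2 (\<lambda>x. f n x - f n' x) \<le> 2 * n2 (\<lambda>x. f n x - w x * L k x) + 2 * n2 (\<lambda>x. f n' x - w x * L k x)"
        using n2_triangle[of "f n" "\<lambda>x. w x * L k x" "f n'"] by (simp add: n2_diff_commute[of "f n'"])
      also have "\<dots> \<le> 2 * ennreal (e/4) + 2 * ennreal (e/4)"
        using that by (intro add_mono mult_left_mono fL) auto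
      also have "\<dots> = ennreal e"
        using e by (simp add: ennreal_mult'[symmetric] ennreal_plus[symmetric] flip: ennreal_numeral del: ennreal_plus)
      finally show ?thesis .
    qed
    then show "\<exists>N. \<forall>n\<ge>N. \<forall>n'\<ge>N. n2 (\<lambda>x. f n x - f n' x) \<le> ennreal e" by blast
  qed (use that in blast)
  define v where "v x = g x / w x" for x
  show thesis
  proof (rule that[of v "r0 \<circ> r1"])
    show "v \<in> borel_measurable borel" unfolding v_def by measurable
    show "strict_mono (r0 \<circ> r1)" using r0 r1 by (intro strict_mono_o)
    show "AE x in lborel. (\<lambda>n. u ((r0 \<circ> r1) n) x) \<longlonglongrightarrow> v x"
      using gAE
    proof eventually_elim
      case (elim x)
      then have "(\<lambda>k. f (r1 k) x / w x) \<longlonglongrightarrow> g x / w x" using w01(1)[of x] by (intro tendsto_intros) auto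
      then show ?case using w01(1)[of x] by (simp add: f_def v_def less_imp_neq[symmetric])
    qed
    fix R
    have lim1: "(\<lambda>n. n2 (\<lambda>x. f (r1 n) x - g x)) \<longlonglongrightarrow> 0"
      using LIMSEQ_subseq_LIMSEQ[OF gl r1] by (simp add: comp_def)
    \<comment> \<open>Inside the ball of radius \<open>R\<close> the inverse weight
      \<open>1 / w\<close> is at most \<open>exp (R\<^sup>2 / 2)\<close>.\<close>
    have "(\<lambda>n. ennreal ((exp (R\<^sup>2 / 2))\<^sup>2) * n2 (\<lambda>x. f (r1 n) x - g x)) \<longlonglongrightarrow> ennreal ((exp (R\<^sup>2 / 2))\<^sup>2) * 0"
      by (intro ennreal_tendsto_cmult lim1) auto
    then have lim: "(\<lambda>n. ennreal ((exp (R\<^sup>2 / 2))\<^sup>2) * n2 (\<lambda>x. f (r1 n) x - g x)) \<longlonglongrightarrow> 0" by simp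
    show "(\<lambda>n. n2 (\<lambda>x. indicator (ball 0 R) x *\<^sub>R (u ((r0 \<circ> r1) n) x - v x))) \<longlonglongrightarrow> 0"
    proof (rule tendsto_sandwich[OF _ _ tendsto_const lim])
      have "n2 (\<lambda>x. indicator (ball 0 R) x *\<^sub>R (u ((r0 \<circ> r1) n) x - v x)) \<le> n2 (\<lambda>x. exp (R\<^sup>2 / 2) *\<^sub>R (f (r1 n) x - g x))" for n
      proof (rule n2_mono)
        fix x :: 'a
        show "norm (indicator (ball 0 R) x *\<^sub>R (u ((r0 \<circ> r1) n) x - v x)) \<le> norm (exp (R\<^sup>2 / 2) *\<^sub>R (f (r1 n) x - g x))"
        proof (cases "norm x < R")
          case True
          have e: "u ((r0 \<circ> r1) n) x - v x = exp ((norm x)\<^sup>2 / 2) * (f (r1 n) x - g x)"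
            by (simp add: f_def v_def w_def exp_minus field_simps)
          have "exp ((norm x)\<^sup>2 / 2) \<le> exp (R\<^sup>2 / 2)" using True by (simp add: power_mono)
          then show ?thesis using True unfolding e by (simp add: abs_mult mult_right_mono)
        qed (simp add: indicator_def)
      qed
      then show "\<forall>\<^sub>F n in sequentially. n2 (\<lambda>x. indicator (ball 0 R) x *\<^sub>R (u ((r0 \<circ> r1) n) x - v x)) \<le> ennreal ((exp (R\<^sup>2 / 2))\<^sup>2) * n2 (\<lambda>x. f (r1 n) x - g x)"
        by (intro always_eventually allI) (simp add: n2_real_cmult)
    qed simp
  qed
qed

section \<open>Reflections and radial functions\<close>

text \<open>Invariance under a linear isometric involution from translations alone, without
  determinants. The reflected function is smeared with the indicator of the unit ball, which
  \<sigma> leaves invariant; by Tonelli and the shift by \<open>\<sigma> w\<close>, the variable of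
  \<open>f\<close> is then moved by a translation only.\<close>

lemma nn_integral_lborel_involution:
  fixes f :: "'a::euclidean_space \<Rightarrow> ennreal"
  assumes [measurable]: "f \<in> borel_measurable borel" and lin: "linear \<sigma>"
    and nrm: "\<And>x. norm (\<sigma> x) = norm x" and inv: "\<And>x. \<sigma> (\<sigma> x) = x"
  shows "(\<integral>\<^sup>+ x. f (\<sigma> x) \<partial>lborel) = (\<integral>\<^sup>+ x. f x \<partial>lborel)"
proof -
  have [measurable]: "\<sigma> \<in> borel_measurable borel"
    using lin by (intro borel_measurable_continuous_onI linear_continuous_on) (simp add: linear_conv_bounded_linear)
  let ?B = "indicator (ball (0::'a) 1) :: 'a \<Rightarrow> ennreal"
  have B[measurable]: "?B \<in> borel_measurable borel" by (intro borel_measurable_indicator) auto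
  define \<omega> where "\<omega> = emeasure lborel (ball (0::'a) 1)"
  have om: "\<omega> \<noteq> 0" "\<omega> \<noteq> top" "(\<integral>\<^sup>+ z. ?B z \<partial>lborel) = \<omega>"
  proof -
    have "0 < ennreal (unit_ball_vol (real DIM('a)))" using unit_ball_vol_pos[of "real DIM('a)"] by (simp only: ennreal_less_zero_iff of_nat_0_le_iff)
    moreover have "\<omega> = ennreal (unit_ball_vol (real DIM('a)))" by (simp add: \<omega>_def emeasure_ball)
    ultimately show "\<omega> \<noteq> 0" by (metis less_irrefl)
    show "\<omega> \<noteq> top" by (simp add: \<omega>_def emeasure_ball)
    show "(\<integral>\<^sup>+ z. ?B z \<partial>lborel) = \<omega>" by (simp add: \<omega>_def)
  qed
  have mB: "(\<integral>\<^sup>+ w. ?B (a - w) \<partial>lborel) = \<omega>" for a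
    using nn_integral_lborel_affine[of ?B "-1" a] om(3) by simp
  have add: "\<sigma> (x + y) = \<sigma> x + \<sigma> y" for x y using lin by (rule linear_add)
  have B\<sigma>: "?B (\<sigma> x) = ?B x" for x by (simp add: indicator_def nrm)
  have "(\<integral>\<^sup>+ x. f (\<sigma> x) \<partial>lborel) * \<omega> = (\<integral>\<^sup>+ x. f (\<sigma> x) * (\<integral>\<^sup>+ w. ?B (\<sigma> x - w) \<partial>lborel) \<partial>lborel)"
    unfolding mB by (rule nn_integral_multc[symmetric]) measurable
  also have "\<dots> = (\<integral>\<^sup>+ x. (\<integral>\<^sup>+ w. f (\<sigma> x) * ?B (\<sigma> x - w) \<partial>lborel) \<partial>lborel)"
    by (intro nn_integral_cong nn_integral_cmult[symmetric]) measurable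
  also have "\<dots> = (\<integral>\<^sup>+ w. (\<integral>\<^sup>+ x. f (\<sigma> x) * ?B (\<sigma> x - w) \<partial>lborel) \<partial>lborel)"
    by (rule lborel_pair.Fubini'[symmetric]) measurable
  also have "\<dots> = (\<integral>\<^sup>+ w. (\<integral>\<^sup>+ x. f (\<sigma> x + w) * ?B x \<partial>lborel) \<partial>lborel)"
  proof (rule nn_integral_cong)
    fix w :: 'a
    have "(\<integral>\<^sup>+ x. f (\<sigma> x) * ?B (\<sigma> x - w) \<partial>lborel) = (\<integral>\<^sup>+ x. f (\<sigma> (x + \<sigma> w)) * ?B (\<sigma> (x + \<sigma> w) - w) \<partial>lborel)"
      by (rule nn_integral_lborel_shift[symmetric]) measurable
    also have "\<dots> = (\<integral>\<^sup>+ x. f (\<sigma> x + w) * ?B x \<partial>lborel)"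
      by (simp add: add inv B\<sigma>)
    finally show "(\<integral>\<^sup>+ x. f (\<sigma> x) * ?B (\<sigma> x - w) \<partial>lborel) = (\<integral>\<^sup>+ x. f (\<sigma> x + w) * ?B x \<partial>lborel)" .
  qed
  also have "\<dots> = (\<integral>\<^sup>+ x. (\<integral>\<^sup>+ w. f (\<sigma> x + w) * ?B x \<partial>lborel) \<partial>lborel)"
    by (rule lborel_pair.Fubini'[symmetric]) measurable
  also have "\<dots> = (\<integral>\<^sup>+ x. (\<integral>\<^sup>+ w. f w \<partial>lborel) * ?B x \<partial>lborel)"
  proof (rule nn_integral_cong)
    fix x :: 'a
    have "(\<integral>\<^sup>+ w. f (\<sigma> x + w) * ?B x \<partial>lborel) = (\<integral>\<^sup>+ w. f (w + \<sigma> x) \<partial>lborel) * ?B x"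
      by (subst nn_integral_multc) (auto simp: add.commute)
    then show "(\<integral>\<^sup>+ w. f (\<sigma> x + w) * ?B x \<partial>lborel) = (\<integral>\<^sup>+ w. f w \<partial>lborel) * ?B x"
      by (simp add: nn_integral_lborel_shift)
  qed
  also have "\<dots> = (\<integral>\<^sup>+ w. f w \<partial>lborel) * \<omega>"
    using om(3) by (simp add: nn_integral_cmult)
  finally show ?thesis using om by (metis mult_divide_eq_ennreal)
qed

text \<open>Reflections supply all the isometries that are needed: one of them exchanges any two
  points of equal norm. For \<open>e = 0\<close> the formula gives the identity.\<close>

definition hyperplane_reflection :: "'a::euclidean_space \<Rightarrow> 'a \<Rightarrow> 'a" where
  "hyperplane_reflection e x = x - (2 * (x \<bullet> e) / (e \<bullet> e)) *\<^sub>R e"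

lemma hyperplane_reflection:
  shows linear_hyperplane_reflection: "linear (hyperplane_reflection e)"
    and hyperplane_reflection_inner: "hyperplane_reflection e x \<bullet> hyperplane_reflection e y = x \<bullet> y"
    and hyperplane_reflection_norm: "norm (hyperplane_reflection e x) = norm x"
    and hyperplane_reflection_involution: "hyperplane_reflection e (hyperplane_reflection e x) = x"
proof -
  show "linear (hyperplane_reflection e)"
    unfolding hyperplane_reflection_def
    by (rule linearI) (simp_all add: inner_add_left distrib_left add_divide_distrib scaleR_add_left scaleR_diff_right mult.left_commute)
  show i: "hyperplane_reflection e x \<bullet> hyperplane_reflection e y = x \<bullet> y" for x y
  proof (cases "e = 0")
    case False
    define c d where "c = 2 * (x \<bullet> e) / (e \<bullet> e)" and "d = 2 * (y \<bullet> e) / (e \<bullet> e)"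
    have "c * (d * (e \<bullet> e)) = 2 * (c * (y \<bullet> e))" "d * (x \<bullet> e) = c * (y \<bullet> e)"
      using False by (simp_all add: c_def d_def)
    moreover have "(x - c *\<^sub>R e) \<bullet> (y - d *\<^sub>R e) = x \<bullet> y - d * (x \<bullet> e) - (c * (y \<bullet> e) - c * (d * (e \<bullet> e)))"
      by (simp add: inner_diff_left inner_diff_right inner_commute[of e y] algebra_simps)
    ultimately have "(x - c *\<^sub>R e) \<bullet> (y - d *\<^sub>R e) = x \<bullet> y" by linarith
    then show ?thesis unfolding hyperplane_reflection_def c_def d_def .
  qed (simp add: hyperplane_reflection_def)
  show "norm (hyperplane_reflection e x) = norm x"
    unfolding norm_eq_sqrt_inner i ..
  have "hyperplane_reflection e x \<bullet> e = - (x \<bullet> e)"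
    unfolding hyperplane_reflection_def by (cases "e = 0") (simp_all add: inner_diff_left)
  then show "hyperplane_reflection e (hyperplane_reflection e x) = x"
    unfolding hyperplane_reflection_def[of e "hyperplane_reflection e x"]
    by (simp add: hyperplane_reflection_def[of e x])
qed

lemma hyperplane_reflection_swap:
  assumes "norm x = norm y"
  shows "hyperplane_reflection (x - y) x = y"
proof (cases "x = y")
  case False
  have "x \<bullet> x = y \<bullet> y" using assms by (simp add: norm_eq)
  then have "(x - y) \<bullet> (x - y) = 2 * (x \<bullet> (x - y))"
    by (simp add: inner_diff_left inner_diff_right inner_commute)
  moreover have "(x - y) \<bullet> (x - y) \<noteq> 0" by (metis False eq_iff_diff_eq_0 inner_eq_zero_iff)
  ultimately have "2 * (x \<bullet> (x - y)) / ((x - y) \<bullet> (x - y)) = 1" by (metis divide_self)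
  then show ?thesis unfolding hyperplane_reflection_def by (simp only: scaleR_one) simp
qed (simp add: hyperplane_reflection_def)

lemma AE_lborel_reflection:
  fixes P :: "'a::euclidean_space \<Rightarrow> bool"
  assumes P: "AE x in lborel. P x"
  shows "AE x in lborel. P (hyperplane_reflection e x)"
proof -
  obtain N where N': "{x \<in> space lborel. \<not> P x} \<subseteq> N" "emeasure lborel N = 0" "N \<in> sets lborel"
    using P by (rule AE_E)
  then have [measurable]: "N \<in> sets borel" by auto
  have [measurable]: "hyperplane_reflection e \<in> borel_measurable borel"
    using linear_hyperplane_reflection[of e]
    by (intro borel_measurable_continuous_onI linear_continuous_on) (simp add: linear_conv_bounded_linear)
  have "(\<integral>\<^sup>+ x. indicator N (hyperplane_reflection e x) \<partial>lborel) = (\<integral>\<^sup>+ x. indicator N x \<partial>(lborel :: 'a measure))"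
    by (rule nn_integral_lborel_involution)
      (auto simp: hyperplane_reflection_norm hyperplane_reflection_involution linear_hyperplane_reflection)
  then have "(\<integral>\<^sup>+ x. indicator N (hyperplane_reflection e x) \<partial>lborel) = (0::ennreal)" using N' by simp
  then have "AE x in lborel. indicator N (hyperplane_reflection e x) = (0::ennreal)"
    by (subst (asm) nn_integral_0_iff_AE) auto
  then show ?thesis using N' by (auto simp: indicator_def split: if_splits elim!: eventually_mono)
qed

text \<open>\<open>Hs_r\<close> demands equality at every pair of points of equal norm, but a Borel
  version of such a function agrees with it only almost everywhere. The radial representative is
  therefore allowed to be merely Lebesgue measurable.\<close>

definition ae_radial :: "('a::euclidean_space \<Rightarrow> real) \<Rightarrow> bool" where
  "ae_radial u \<longleftrightarrow> (\<exists>w. w \<in> borel_measurable lebesgue \<and> (\<forall>x y. norm x = norm y \<longrightarrow> w x = w y) \<and>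
     (AE x in lebesgue. u x = w x))"

lemma ae_radial_lincomb:
  assumes "ae_radial u" "ae_radial v"
  shows "ae_radial (\<lambda>x. u x + t * v x)"
proof -
  obtain w where w: "w \<in> borel_measurable lebesgue" "\<And>x y. norm x = norm y \<Longrightarrow> w x = w y" "AE x in lebesgue. u x = w x"
    using assms(1) unfolding ae_radial_def by blast
  obtain w' where w': "w' \<in> borel_measurable lebesgue" "\<And>x y. norm x = norm y \<Longrightarrow> w' x = w' y" "AE x in lebesgue. v x = w' x"
    using assms(2) unfolding ae_radial_def by blast
  show ?thesis unfolding ae_radial_def
  proof (intro exI[of _ "\<lambda>x. w x + t * w' x"] conjI allI impI)
    show "(\<lambda>x. w x + t * w' x) \<in> borel_measurable lebesgue" using w(1) w'(1) by measurable
    show "w x + t * w' x = w y + t * w' y" if "norm x = norm y" for x y using w(2)[OF that] w'(2)[OF that] by simp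
    show "AE x in lebesgue. u x + t * v x = w x + t * w' x" using w(3) w'(3) by eventually_elim simp
  qed
qed

lemma ae_radial_borel:
  assumes "u \<in> borel_measurable borel" "\<And>x y. norm x = norm y \<Longrightarrow> u x = u y"
  shows "ae_radial u"
  unfolding ae_radial_def
proof (intro exI[of _ u] conjI allI impI)
  show "u \<in> borel_measurable lebesgue" using assms(1) by (simp add: measurable_completion)
  show "u x = u y" if "norm x = norm y" for x y using that by (rule assms(2))
qed simp

lemma ae_radial_dilate:
  fixes u :: "'a::euclidean_space \<Rightarrow> real"
  assumes u: "ae_radial u" "u \<in> borel_measurable borel" and c: "c \<noteq> 0"
  shows "ae_radial (\<lambda>x. u (c *\<^sub>R x))"
proof -
  obtain w where w: "w \<in> borel_measurable lebesgue" "\<And>x y. norm x = norm y \<Longrightarrow> w x = w y" "AE x in lebesgue. u x = w x"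
    using u unfolding ae_radial_def by blast
  have AE: "AE x in lebesgue. u (c *\<^sub>R x) = w (c *\<^sub>R x)"
    using AE_lborel_affine[OF w(3)[unfolded AE_completion_iff] c, of 0] by (simp add: AE_completion_iff)
  have "(\<lambda>x. u (c *\<^sub>R x)) \<in> borel_measurable borel" using u(2) by measurable
  then have "(\<lambda>x. u (c *\<^sub>R x)) \<in> borel_measurable lebesgue" by (simp add: measurable_completion)
  then have "(\<lambda>x. w (c *\<^sub>R x)) \<in> borel_measurable lebesgue"
    using AE by (rule borel_measurable_AE)
  moreover have "w (c *\<^sub>R x) = w (c *\<^sub>R y)" if "norm x = norm y" for x y
    using that by (intro w(2)) simp
  ultimately show ?thesis unfolding ae_radial_def using AE
    by (intro exI[of _ "\<lambda>x. w (c *\<^sub>R x)"]) blast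
qed

lemma ae_radial_limit:
  assumes "\<And>n. ae_radial (u n)" and lim: "AE x in lborel. (\<lambda>n. u n x) \<longlonglongrightarrow> v x"
  shows "ae_radial v"
proof -
  obtain w where w: "\<And>n. w n \<in> borel_measurable lebesgue" "\<And>n x y. norm x = norm y \<Longrightarrow> w n x = w n y" "\<And>n. AE x in lebesgue. u n x = w n x"
    using assms(1) unfolding ae_radial_def by metis
  show ?thesis unfolding ae_radial_def
  proof (intro exI[of _ "\<lambda>x. lim (\<lambda>n. w n x)"] conjI allI impI)
    show "(\<lambda>x. lim (\<lambda>n. w n x)) \<in> borel_measurable lebesgue"
      using w(1) by measurable
    \<comment> \<open>The two sequences coincide term by term, so \<open>lim\<close> returns the
      same value even where they diverge and it is arbitrary.\<close>
    show "lim (\<lambda>n. w n x) = lim (\<lambda>n. w n y)" if "norm x = norm y" for x y using w(2)[OF that] by simp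
    have "AE x in lebesgue. \<forall>n. u n x = w n x" using w(3) by (simp add: AE_all_countable)
    moreover have "AE x in lebesgue. (\<lambda>n. u n x) \<longlonglongrightarrow> v x" using lim by (simp add: AE_completion_iff)
    ultimately show "AE x in lebesgue. v x = lim (\<lambda>n. w n x)"
      by eventually_elim (simp add: limI)
  qed
qed

lemma ae_radial_reflection:
  assumes "ae_radial u"
  shows "AE x in lborel. u (hyperplane_reflection e x) = u x"
proof -
  obtain w where w: "\<And>x y. norm x = norm y \<Longrightarrow> w x = w y" "AE x in lborel. u x = w x"
    using assms unfolding ae_radial_def AE_completion_iff by blast
  from w(2) AE_lborel_reflection[OF w(2), of e] show ?thesis
    by eventually_elim (simp add: w(1)[OF hyperplane_reflection_norm])
qed

text \<open>The mass of a ball far from the origin is repeated on many disjoint balls at the same distance.\<close>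

lemma radial_local_mass_decay:
  fixes u :: "'a::euclidean_space \<Rightarrow> real"
  assumes u[measurable]: "u \<in> borel_measurable borel" and rad: "ae_radial u" and N: "DIM('a) \<ge> 2"
    and k: "k > 0" and \<rho>: "\<rho> > 0" and x: "norm x \<ge> 2 * \<rho> * real k"
  shows "of_nat k * (\<integral>\<^sup>+ y. ennreal ((u y)\<^sup>2) * indicator (ball x \<rho>) y \<partial>lborel) \<le> n2 u"
proof -
  have [measurable]: "(\<lambda>h::'a. indicator (ball a t) h :: ennreal) \<in> borel_measurable borel" for a t
    by (intro borel_measurable_indicator) auto
  obtain b1 b2 :: 'a where b: "b1 \<in> Basis" "b2 \<in> Basis" "b1 \<noteq> b2"
  proof -
    obtain b1 :: 'a where b1: "b1 \<in> Basis" using nonempty_Basis by blast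
    have "Basis - {b1} \<noteq> {}"
    proof
      assume "Basis - {b1} = {}"
      then have "DIM('a) \<le> card {b1}" by (intro card_mono) auto
      then show False using N by simp
    qed
    then show thesis using b1 that by blast
  qed
  have bb: "b1 \<bullet> b1 = 1" "b2 \<bullet> b2 = 1" "b1 \<bullet> b2 = 0" "b2 \<bullet> b1 = 0"
    using b by (auto simp: inner_Basis)
  \<comment> \<open>The centres are spread evenly in the direction \<open>b1\<close>, at steps of
    \<open>norm x / k \<ge> 2 * \<rho>\<close>, which already separates the balls. The second
    direction, available since \<open>DIM('a) \<ge> 2\<close>, puts them back on the sphere through
    \<open>x\<close>.\<close>
  define t where "t i = real i / real k" for i
  define z where "z i = norm x *\<^sub>R (t i *\<^sub>R b1 + sqrt (1 - (t i)\<^sup>2) *\<^sub>R b2)" for i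
  have t: "0 \<le> t i" "(t i)\<^sup>2 \<le> 1" if "i < k" for i
    using that by (auto simp: t_def abs_square_le_1)
  have nz: "norm (z i) = norm x" if "i < k" for i
  proof -
    have "(norm (c *\<^sub>R b1 + d *\<^sub>R b2))\<^sup>2 = c\<^sup>2 + d\<^sup>2" for c d
      unfolding power2_norm_eq_inner by (simp add: inner_add_left inner_add_right bb power2_eq_square)
    then have "(norm (t i *\<^sub>R b1 + sqrt (1 - (t i)\<^sup>2) *\<^sub>R b2))\<^sup>2 = 1\<^sup>2" using t[OF that] by simp
    then have "norm (t i *\<^sub>R b1 + sqrt (1 - (t i)\<^sup>2) *\<^sub>R b2) = 1" by (rule power2_eq_imp_eq) simp_all
    then show ?thesis by (simp add: z_def)
  qed
  have dz: "dist (z i) (z j) \<ge> 2 * \<rho>" if "i \<noteq> j" for i j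
  proof -
    have "(z i - z j) \<bullet> b1 = norm x * (t i - t j)"
      by (simp add: z_def inner_diff_left inner_add_left bb algebra_simps)
    then have "norm x * \<bar>t i - t j\<bar> \<le> dist (z i) (z j)"
      using Basis_le_norm[OF b(1), of "z i - z j"] by (simp add: abs_mult dist_norm)
    moreover have "\<bar>t i - t j\<bar> \<ge> 1 / real k"
    proof -
      have "\<bar>real i - real j\<bar> \<ge> 1" using that by linarith
      then show ?thesis using k by (simp add: t_def diff_divide_distrib[symmetric] abs_divide divide_right_mono)
    qed
    then have "norm x * \<bar>t i - t j\<bar> \<ge> (2 * \<rho> * real k) * (1 / real k)"
      using x \<rho> by (intro mult_mono) auto
    ultimately show ?thesis using k by simp
  qed
  have eq: "(\<integral>\<^sup>+ y. ennreal ((u y)\<^sup>2) * indicator (ball (z i) \<rho>) y \<partial>lborel) = (\<integral>\<^sup>+ y. ennreal ((u y)\<^sup>2) * indicator (ball x \<rho>) y \<partial>lborel)" if "i < k" for i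
  proof -
    let ?s = "hyperplane_reflection (x - z i)"
    have sx: "?s x = z i" using nz[OF that] by (intro hyperplane_reflection_swap) simp
    have "(\<integral>\<^sup>+ y. ennreal ((u y)\<^sup>2) * indicator (ball (z i) \<rho>) y \<partial>lborel) = (\<integral>\<^sup>+ y. ennreal ((u (?s y))\<^sup>2) * indicator (ball (z i) \<rho>) (?s y) \<partial>lborel)"
      by (rule nn_integral_lborel_involution[symmetric])
        (auto simp: hyperplane_reflection_norm hyperplane_reflection_involution linear_hyperplane_reflection)
    also have "\<dots> = (\<integral>\<^sup>+ y. ennreal ((u y)\<^sup>2) * indicator (ball x \<rho>) y \<partial>lborel)"
    proof (rule nn_integral_cong_AE)
      have "dist (?s x) (?s y) = dist x y" for y
        unfolding dist_norm linear_diff[OF linear_hyperplane_reflection, symmetric] hyperplane_reflection_norm ..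
      then have "dist (z i) (?s y) = dist x y" for y unfolding sx .
      then show "AE y in lborel. ennreal ((u (?s y))\<^sup>2) * indicator (ball (z i) \<rho>) (?s y) = ennreal ((u y)\<^sup>2) * indicator (ball x \<rho>) y"
        using ae_radial_reflection[OF rad, of "x - z i"] by (auto simp: indicator_def elim!: eventually_mono)
    qed
    finally show ?thesis .
  qed
  have "of_nat k * (\<integral>\<^sup>+ y. ennreal ((u y)\<^sup>2) * indicator (ball x \<rho>) y \<partial>lborel) = (\<Sum>i<k. \<integral>\<^sup>+ y. ennreal ((u y)\<^sup>2) * indicator (ball (z i) \<rho>) y \<partial>lborel)"
    using eq by simp
  also have "\<dots> = (\<integral>\<^sup>+ y. (\<Sum>i<k. ennreal ((u y)\<^sup>2) * indicator (ball (z i) \<rho>) y) \<partial>lborel)"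
    by (rule nn_integral_sum[symmetric]) measurable
  also have "\<dots> \<le> n2 u"
    unfolding n2_def
  proof (rule nn_integral_mono)
    fix y :: 'a
    show "(\<Sum>i<k. ennreal ((u y)\<^sup>2) * indicator (ball (z i) \<rho>) y) \<le> ennreal ((norm (u y))\<^sup>2)"
    proof (cases "\<exists>i<k. y \<in> ball (z i) \<rho>")
      case True
      then obtain i where i: "i < k" "y \<in> ball (z i) \<rho>" by blast
      have "indicator (ball (z j) \<rho>) y = (0::ennreal)" if "j \<noteq> i" for j
        using dz[OF that] i(2) dist_triangle[of "z j" "z i" y] by (auto simp: indicator_def dist_commute)
      then have "(\<Sum>j\<in>{..<k}. ennreal ((u y)\<^sup>2) * indicator (ball (z j) \<rho>) y) = (\<Sum>j\<in>{i}. ennreal ((u y)\<^sup>2) * indicator (ball (z j) \<rho>) y)"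
        using i by (intro sum.mono_neutral_right) auto
      also have "\<dots> = ennreal ((u y)\<^sup>2) * indicator (ball (z i) \<rho>) y" by (subst sum.insert) auto
      also have "\<dots> = ennreal ((norm (u y))\<^sup>2)" using i(2) by simp
      finally show ?thesis by (simp only: order_refl)
    next
      case False
      then have "(\<Sum>i<k. ennreal ((u y)\<^sup>2) * indicator (ball (z i) \<rho>) y) = 0"
        by (intro sum.neutral) auto
      then show ?thesis by (simp only: zero_le)
    qed
  qed
  finally show ?thesis .
qed

section \<open>The nonlinearity\<close>

text \<open>The primitive enters through its derivative, so that bounds on \<open>G\<close> follow
  from the mean value theorem and not from integrals.\<close>

locale l2_subcritical =
  fixes g G :: "real \<Rightarrow> real" and p :: real
  assumes p: "p > 1" and cont: "continuous_on UNIV g"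
    and g1: "((\<lambda>t. g t / t) \<longlongrightarrow> 0) (at 0)"
    and g2: "((\<lambda>t. g t / \<bar>t\<bar> powr p) \<longlongrightarrow> 0) at_infinity"
    and g4: "filterlim (\<lambda>t. g t / (\<bar>t\<bar> powr (p - 1) * t)) at_top (at 0)"
    and G: "\<And>t. (G has_real_derivative g t) (at t)" and G0 [simp]: "G 0 = 0"
begin

lemma g0 [simp]: "g 0 = 0"
proof (rule tendsto_unique[of "at (0::real)" g])
  show "(g \<longlongrightarrow> g 0) (at 0)"
    using cont by (simp add: continuous_on_eq_continuous_at isCont_def)
  have "((\<lambda>t. g t / t * t) \<longlongrightarrow> 0 * 0) (at 0)" by (intro tendsto_intros g1)
  then have "((\<lambda>t. g t / t * t) \<longlongrightarrow> 0) (at 0)" by simp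
  then show "(g \<longlongrightarrow> 0) (at 0)"
    by (rule Lim_transform_eventually) (auto simp: eventually_at intro!: exI[of _ 1])
qed simp

lemma G_mean_value: "\<exists>\<xi>. \<bar>\<xi>\<bar> \<le> \<bar>t\<bar> \<and> G t = t * g \<xi>"
proof -
  consider "t = 0" | "t > 0" | "t < 0" by linarith
  then show ?thesis
  proof cases
    case 2
    then obtain z where "0 < z" "z < t" "G t - G 0 = (t - 0) * g z" using MVT2[of 0 t G g] G by blast
    then show ?thesis by (intro exI[of _ z]) auto
  next
    case 3
    then obtain z where z: "t < z" "z < 0" "G 0 - G t = (0 - t) * g z" using MVT2[of t 0 G g] G by blast
    then show ?thesis by (intro exI[of _ z]) auto
  qed (auto intro!: exI[of _ 0])
qed

text \<open>Three zones: near 0 (g1) gives \<open>\<bar>g t\<bar> < \<bar>t\<bar>\<close> for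
  \<open>t \<noteq> 0\<close>; on the compact middle zone a constant bound \<open>M\<close> is at
  most \<open>M / d * \<bar>t\<bar>\<close>; far out (g2) gives the power with the prescribed small
  \<delta>.\<close>

lemma g_growth:
  assumes \<delta>: "\<delta> > 0"
  obtains C where "C \<ge> 0" "\<And>t. \<bar>g t\<bar> \<le> C * \<bar>t\<bar> + \<delta> * \<bar>t\<bar> powr p"
proof -
  have "\<forall>\<^sub>F t in at_infinity. \<bar>g t / \<bar>t\<bar> powr p\<bar> < \<delta>"
    using tendstoD[OF g2 \<delta>] by (simp add: dist_norm)
  then obtain T where T: "\<And>t. T \<le> \<bar>t\<bar> \<Longrightarrow> \<bar>g t / \<bar>t\<bar> powr p\<bar> < \<delta>"
    unfolding eventually_at_infinity by auto
  have "\<forall>\<^sub>F t in at 0. \<bar>g t / t\<bar> < 1" using tendstoD[OF g1, of 1] by (simp add: dist_norm)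
  then obtain d where d: "d > 0" "\<And>t. t \<noteq> 0 \<Longrightarrow> \<bar>t\<bar> < d \<Longrightarrow> \<bar>g t / t\<bar> < 1"
    unfolding eventually_at by (auto simp: dist_norm)
  have "bounded (g ` cball 0 \<bar>T\<bar>)"
    using cont by (intro compact_imp_bounded compact_continuous_image) (auto intro: continuous_on_subset)
  then obtain M0 where M0: "\<forall>y \<in> g ` cball 0 \<bar>T\<bar>. norm y \<le> M0" unfolding bounded_iff by blast
  define M where "M = max M0 0"
  have M: "\<bar>g t\<bar> \<le> M" if "\<bar>t\<bar> \<le> \<bar>T\<bar>" for t
    using bspec[OF M0, of "g t"] that by (auto simp: M_def)
  have M: "\<And>t. \<bar>t\<bar> \<le> \<bar>T\<bar> \<Longrightarrow> \<bar>g t\<bar> \<le> M" "M \<ge> 0" using M by (auto simp: M_def)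
  show thesis
  proof
    show "1 + M / d \<ge> 0" using M d by simp
    fix t
    have nn: "\<delta> * \<bar>t\<bar> powr p \<ge> 0" "M / d * \<bar>t\<bar> \<ge> 0" using \<delta> M d by auto
    consider "t = 0" | "t \<noteq> 0" "\<bar>t\<bar> < d" | "\<bar>t\<bar> \<ge> d" "\<bar>t\<bar> \<le> \<bar>T\<bar>" | "t \<noteq> 0" "\<bar>t\<bar> > \<bar>T\<bar>" by linarith
    then show "\<bar>g t\<bar> \<le> (1 + M / d) * \<bar>t\<bar> + \<delta> * \<bar>t\<bar> powr p"
    proof cases
      case 2
      then have "\<bar>g t\<bar> < \<bar>t\<bar>" using d(2)[of t] by (simp add: abs_divide divide_less_eq)
      then show ?thesis using nn by (simp add: distrib_right)
    next
      case 3
      have "M = M / d * d" using d by simp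
      also have "\<dots> \<le> M / d * \<bar>t\<bar>" using 3 M d by (intro mult_left_mono) auto
      finally show ?thesis using M(1)[OF 3(2)] nn by (simp add: distrib_right)
    next
      case 4
      then have "\<bar>g t\<bar> / \<bar>t\<bar> powr p < \<delta>" using T[of t] by (simp add: abs_divide)
      then have "\<bar>g t\<bar> < \<delta> * \<bar>t\<bar> powr p" using 4 by (simp add: divide_less_eq)
      then show ?thesis using nn by (simp add: distrib_right)
    qed simp
  qed
qed

lemma G_growth:
  assumes \<delta>: "\<delta> > 0"
  obtains C where "C \<ge> 0" "\<And>t. \<bar>G t\<bar> \<le> C * t\<^sup>2 + \<delta> * \<bar>t\<bar> powr (p + 1)"
proof -
  obtain C where C: "C \<ge> 0" "\<And>t. \<bar>g t\<bar> \<le> C * \<bar>t\<bar> + \<delta> * \<bar>t\<bar> powr p" using g_growth[OF \<delta>] by blast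
  show thesis
  proof (rule that[OF C(1)])
    fix t
    obtain \<xi> where x: "\<bar>\<xi>\<bar> \<le> \<bar>t\<bar>" "G t = t * g \<xi>" using G_mean_value by blast
    have "\<bar>g \<xi>\<bar> \<le> C * \<bar>\<xi>\<bar> + \<delta> * \<bar>\<xi>\<bar> powr p" by (rule C(2))
    also have "\<dots> \<le> C * \<bar>t\<bar> + \<delta> * \<bar>t\<bar> powr p"
      using x C \<delta> p by (intro add_mono mult_left_mono powr_mono2) auto
    finally have "\<bar>t\<bar> * \<bar>g \<xi>\<bar> \<le> \<bar>t\<bar> * (C * \<bar>t\<bar> + \<delta> * \<bar>t\<bar> powr p)" by (rule mult_left_mono) simp
    also have "\<dots> = C * t\<^sup>2 + \<delta> * \<bar>t\<bar> powr (p + 1)"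
      by (cases "t = 0") (auto simp: algebra_simps power2_eq_square powr_add abs_mult_self_eq)
    finally show "\<bar>G t\<bar> \<le> C * t\<^sup>2 + \<delta> * \<bar>t\<bar> powr (p + 1)" using x by (simp add: abs_mult)
  qed
qed

lemma G_small:
  assumes \<delta>: "\<delta> > 0"
  obtains a where "a > 0" "\<And>t. \<bar>t\<bar> \<le> a \<Longrightarrow> \<bar>G t\<bar> \<le> \<delta> * t\<^sup>2"
proof -
  have "\<forall>\<^sub>F t in at 0. \<bar>g t / t\<bar> < \<delta>" using tendstoD[OF g1 \<delta>] by (simp add: dist_norm)
  then obtain d where d: "d > 0" "\<And>t. t \<noteq> 0 \<Longrightarrow> \<bar>t\<bar> < d \<Longrightarrow> \<bar>g t / t\<bar> < \<delta>"
    unfolding eventually_at by (auto simp: dist_norm)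
  show thesis
  proof (rule that[of "d / 2"])
    fix t assume t: "\<bar>t\<bar> \<le> d / 2"
    obtain \<xi> where x: "\<bar>\<xi>\<bar> \<le> \<bar>t\<bar>" "G t = t * g \<xi>" using G_mean_value by blast
    have "\<bar>g \<xi>\<bar> \<le> \<delta> * \<bar>\<xi>\<bar>"
    proof (cases "\<xi> = 0")
      case False
      then have "\<bar>g \<xi>\<bar> / \<bar>\<xi>\<bar> < \<delta>" using d(1) d(2)[of \<xi>] x(1) t by (simp add: abs_divide)
      then show ?thesis using False by (simp add: divide_less_eq)
    qed simp
    also have "\<dots> \<le> \<delta> * \<bar>t\<bar>" using x \<delta> by simp
    finally have "\<bar>t\<bar> * \<bar>g \<xi>\<bar> \<le> \<bar>t\<bar> * (\<delta> * \<bar>t\<bar>)" by (rule mult_left_mono) simp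
    then show "\<bar>G t\<bar> \<le> \<delta> * t\<^sup>2" using x by (simp add: abs_mult power2_eq_square mult.left_commute)
  qed (use d in simp)
qed

text \<open>On the lower half of the interval from 0 to \<open>t\<close> only
  \<open>g \<ge> 0\<close> is used; on the upper half \<open>g\<close> is at least
  \<open>A' * (t/2) powr p\<close>. The factor \<open>2 powr (p + 1)\<close> in \<open>A'\<close>
  undoes both halvings.\<close>

lemma G_lower:
  assumes A: "A \<ge> 0"
  obtains a where "a > 0" "\<And>t. 0 \<le> t \<Longrightarrow> t \<le> a \<Longrightarrow> G t \<ge> A * t powr (p + 1)"
proof -
  define A' where "A' = A * 2 powr (p + 1)"
  have A': "A' \<ge> 0" using A by (simp add: A'_def)
  have "\<forall>\<^sub>F t in at 0. A' \<le> g t / (\<bar>t\<bar> powr (p - 1) * t)" using g4 by (simp add: filterlim_at_top)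
  then obtain d where d: "d > 0" "\<And>t. t \<noteq> 0 \<Longrightarrow> \<bar>t\<bar> < d \<Longrightarrow> A' \<le> g t / (\<bar>t\<bar> powr (p - 1) * t)"
    unfolding eventually_at by (auto simp: dist_norm)
  have gl: "A' * t powr p \<le> g t" if "0 < t" "t < d" for t
  proof -
    have "t powr (p - 1) * t = t powr p" using that by (simp add: powr_diff)
    then have "A' \<le> g t / t powr p" using d(2)[of t] that by simp
    then show ?thesis using that by (simp add: le_divide_eq)
  qed
  show thesis
  proof (rule that[of "d / 2"])
    fix t assume t: "0 \<le> t" "t \<le> d / 2"
    show "G t \<ge> A * t powr (p + 1)"
    proof (cases "t = 0")
      case False
      then have t0: "t > 0" using t by simp
      obtain z where z: "0 < z" "z < t / 2" "G (t/2) - G 0 = (t/2 - 0) * g z" using MVT2[of 0 "t/2" G g] G t0 by auto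
      have "g z \<ge> 0" using gl[of z] z t d A' by (smt (verit) mult_nonneg_nonneg powr_ge_zero field_sum_of_halves)
      moreover have "G (t/2) = (t/2) * g z" using z(3) by simp
      ultimately have h1: "G (t/2) \<ge> 0" using t0 by (simp only: mult_nonneg_nonneg half_gt_zero_iff less_imp_le)
      obtain y where y: "t/2 < y" "y < t" "G t - G (t/2) = (t - t/2) * g y" using MVT2[of "t/2" t G g] G t0 by auto
      have "A' * (t/2) powr p \<le> A' * y powr p" using y t0 p A' by (intro mult_left_mono powr_mono2) auto
      also have "\<dots> \<le> g y" using gl[of y] y t t0 d by auto
      finally have "(t/2) * (A' * (t/2) powr p) \<le> (t/2) * g y" using t0 by (intro mult_left_mono) auto
      moreover have "(t/2) * (A' * (t/2) powr p) = A * t powr (p + 1)"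
        using t0 by (simp add: A'_def powr_divide powr_add field_simps)
      moreover have "G t = G (t/2) + (t/2) * g y" using y(3) by simp
      ultimately show ?thesis using h1 by linarith
    qed simp
  qed (use d in simp)
qed

lemma G_measurable [measurable]: "G \<in> borel_measurable borel"
  using G by (intro borel_measurable_continuous_onI) (auto simp: continuous_on_eq_continuous_at intro: DERIV_isCont)

lemma g_measurable [measurable]: "g \<in> borel_measurable borel"
  using cont by (rule borel_measurable_continuous_onI)

end

section \<open>Integrability, Gagliardo-Nirenberg inequality and uniform tails at the critical
  exponent\<close>

locale mass_problem = l2_subcritical g G "1 + 4 * s / real DIM('a)"
  for g G :: "real \<Rightarrow> real" and s :: real and ty :: "'a::euclidean_space itself" +
  assumes N2: "DIM('a) \<ge> 2" and s: "0 < s" "s < 1"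
begin

lemma exponent_eq: "1 + 4 * s / real DIM('a) + 1 = 2 + 4 * s / real DIM('a)"
  by simp

lemma exponent_gt_2: "2 + 4 * s / real DIM('a) > 2" "4 * s / real DIM('a) > 0"
  using s by auto

text \<open>Combines the set version of the pointwise estimate with the bound of the Gagliardo
  seminorm. \<open>K\<close> is quantified outside, so that \<epsilon> and \<open>S\<close> may be
  chosen afterwards, the latter depending on \<open>u\<close>.\<close>

lemma Lq_on_set:
  "\<exists>K. K > 0 \<and> (\<forall>(u :: 'a \<Rightarrow> real) \<epsilon> S. hsp s u \<longrightarrow> \<epsilon> > 0 \<longrightarrow> S \<in> sets borel \<longrightarrow>
     (\<forall>x. x \<in> S \<longrightarrow> u x \<noteq> 0 \<longrightarrow>
      (\<integral>\<^sup>+ y. ennreal ((u y)\<^sup>2) * indicator (ball x ((4 * \<epsilon> / (unit_ball_vol (real DIM('a)) * (u x)\<^sup>2)) powr (1 / real DIM('a)))) y \<partial>lborel) \<le> ennreal \<epsilon>) \<longrightarrow>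
     (\<integral>\<^sup>+ x. ennreal (\<bar>u x\<bar> powr (2 + 4 * s / real DIM('a))) * indicator S x \<partial>lborel) \<le> ennreal (K * \<epsilon> powr (2 * s / real DIM('a)) * kinr s u))"
proof -
  let ?N = "real DIM('a)" and ?w = "unit_ball_vol (real DIM('a))"
  obtain C where C: "C > 0" "\<And>u::'a \<Rightarrow> real. hsp s u \<Longrightarrow> (\<integral>\<^sup>+ x. gag_density s u x \<partial>lborel) \<le> ennreal C * kin s u"
    using gag_le_kin[OF s] by blast
  have w: "?w > 0" by simp
  define K where "K = 4 / ?w * (4 / ?w) powr (2 * s / ?N) * C"
  have w4: "4 / ?w > 0" using w by (rule divide_pos_pos[rotated]) simp
  have K: "K > 0" unfolding K_def using w4 by (intro mult_pos_pos w4 C) (metis less_irrefl powr_gt_zero)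
  show ?thesis
  proof (intro exI[of _ K] conjI allI impI K)
    fix u :: "'a \<Rightarrow> real" and \<epsilon> :: real and S
    assume u: "hsp s u" and e: "\<epsilon> > 0" and S: "S \<in> sets borel"
      and mass: "\<forall>x. x \<in> S \<longrightarrow> u x \<noteq> 0 \<longrightarrow>
      (\<integral>\<^sup>+ y. ennreal ((u y)\<^sup>2) * indicator (ball x ((4 * \<epsilon> / (?w * (u x)\<^sup>2)) powr (1 / ?N))) y \<partial>lborel) \<le> ennreal \<epsilon>"
    have um: "u \<in> borel_measurable borel" using u by (simp add: hsp_def)
    let ?c = "4 / ?w * (4 * \<epsilon> / ?w) powr (2 * s / ?N)"
    have c0: "?c \<ge> 0" using w4 by simp
    have "(\<integral>\<^sup>+ x. ennreal (\<bar>u x\<bar> powr (2 + 4 * s / real DIM('a))) * indicator S x \<partial>lborel) \<le> ennreal ?c * (\<integral>\<^sup>+ x. gag_density s u x \<partial>lborel)"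
      by (rule gn_on_set[OF um s(1) e S]) (use mass in blast)
    also have "\<dots> \<le> ennreal ?c * (ennreal C * kin s u)" by (intro mult_left_mono C u) auto
    also have "\<dots> = ennreal (?c * (C * kinr s u))"
      unfolding kin_eq_kinr[OF u] using c0 C kinr_nonneg[of s u] by (simp only: ennreal_mult[symmetric] mult_nonneg_nonneg less_imp_le)
    also have "(4 * \<epsilon> / ?w) powr (2 * s / ?N) = (4 / ?w) powr (2 * s / ?N) * \<epsilon> powr (2 * s / ?N)"
      using w4 e by (subst powr_mult[symmetric]) auto
    finally show "(\<integral>\<^sup>+ x. ennreal (\<bar>u x\<bar> powr (2 + 4 * s / real DIM('a))) * indicator S x \<partial>lborel) \<le> ennreal (K * \<epsilon> powr (2 * s / ?N) * kinr s u)"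
      by (simp add: K_def mult_ac)
  qed
qed

text \<open>The case \<open>S = UNIV\<close> and \<open>\<epsilon> = M\<close>: no ball carries more
  than the whole mass. The bound is linear in \<open>kinr\<close>, so a small coefficient suffices
  to absorb the power term.\<close>

lemma gagliardo_nirenberg:
  "\<exists>K. K > 0 \<and> (\<forall>(u :: 'a \<Rightarrow> real) M. hsp s u \<longrightarrow> M > 0 \<longrightarrow> n2 u \<le> ennreal M \<longrightarrow>
     integrable lborel (\<lambda>x. \<bar>u x\<bar> powr (2 + 4 * s / real DIM('a))) \<and> (LBINT x. \<bar>u x\<bar> powr (2 + 4 * s / real DIM('a))) \<le> K * M powr (2 * s / real DIM('a)) * kinr s u)"
proof -
  from Lq_on_set obtain K where K': "K > 0 \<and> (\<forall>(u :: 'a \<Rightarrow> real) \<epsilon> S. hsp s u \<longrightarrow> \<epsilon> > 0 \<longrightarrow> S \<in> sets borel \<longrightarrow>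
     (\<forall>x. x \<in> S \<longrightarrow> u x \<noteq> 0 \<longrightarrow>
      (\<integral>\<^sup>+ y. ennreal ((u y)\<^sup>2) * indicator (ball x ((4 * \<epsilon> / (unit_ball_vol (real DIM('a)) * (u x)\<^sup>2)) powr (1 / real DIM('a)))) y \<partial>lborel) \<le> ennreal \<epsilon>) \<longrightarrow>
     (\<integral>\<^sup>+ x. ennreal (\<bar>u x\<bar> powr (2 + 4 * s / real DIM('a))) * indicator S x \<partial>lborel) \<le> ennreal (K * \<epsilon> powr (2 * s / real DIM('a)) * kinr s u))" ..
  note K = conjunct1[OF K'] conjunct2[OF K', rule_format]
  show ?thesis
  proof (intro exI[of _ K] conjI[OF K(1)] allI impI)
    fix u :: "'a \<Rightarrow> real" and M :: real
    assume u: "hsp s u" and M: "M > 0" "n2 u \<le> ennreal M"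
    have [measurable]: "u \<in> borel_measurable borel" using u by (simp add: hsp_def)
    let ?b = "K * M powr (2 * s / real DIM('a)) * kinr s u"
    have b: "?b \<ge> 0" using K(1) kinr_nonneg[of s u] by simp
    have "(\<integral>\<^sup>+ y. ennreal ((u y)\<^sup>2) * indicator (ball x r) y \<partial>lborel) \<le> ennreal M" for x r
    proof -
      have "(\<integral>\<^sup>+ y. ennreal ((u y)\<^sup>2) * indicator (ball x r) y \<partial>lborel) \<le> n2 u"
        unfolding n2_def by (intro nn_integral_mono) (auto simp: indicator_def)
      then show ?thesis using M by simp
    qed
    then have "(\<integral>\<^sup>+ x. ennreal (\<bar>u x\<bar> powr (2 + 4 * s / real DIM('a))) * indicator UNIV x \<partial>lborel) \<le> ennreal ?b"
      by (intro K(2) u M) auto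
    then have le: "(\<integral>\<^sup>+ x. ennreal (\<bar>u x\<bar> powr (2 + 4 * s / real DIM('a))) \<partial>lborel) \<le> ennreal ?b" by simp
    then have "(\<integral>\<^sup>+ x. ennreal (norm (\<bar>u x\<bar> powr (2 + 4 * s / real DIM('a)))) \<partial>lborel) < \<infinity>" by (simp add: order_le_less_trans)
    then have i: "integrable lborel (\<lambda>x. \<bar>u x\<bar> powr (2 + 4 * s / real DIM('a)))" by (intro integrableI_bounded) auto
    have "ennreal (LBINT x. \<bar>u x\<bar> powr (2 + 4 * s / real DIM('a))) \<le> ennreal ?b"
      using le nn_integral_eq_integral[OF i] by simp
    then show "integrable lborel (\<lambda>x. \<bar>u x\<bar> powr (2 + 4 * s / real DIM('a))) \<and> (LBINT x. \<bar>u x\<bar> powr (2 + 4 * s / real DIM('a))) \<le> ?b"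
      using i b by (simp add: ennreal_le_iff)
  qed
qed

lemma square_integrable: "hsp s (u :: 'a \<Rightarrow> real) \<Longrightarrow> integrable lborel (\<lambda>x. (u x)\<^sup>2)"
  using n2_finite_iff_integrable[of u] by (simp add: hsp_def)

lemma n2_hsp: "hsp s (u :: 'a \<Rightarrow> real) \<Longrightarrow> n2 u = ennreal (LBINT x. (u x)\<^sup>2)"
  using n2_eq_integral[of u] square_integrable[of u] by simp

lemma Lq_integrable:
  assumes "hsp s (u :: 'a \<Rightarrow> real)" shows "integrable lborel (\<lambda>x. \<bar>u x\<bar> powr (2 + 4 * s / real DIM('a)))"
proof -
  let ?M = "(LBINT x. (u x)\<^sup>2) + 1"
  have M1: "?M > 0" by (simp add: add_nonneg_pos)
  have M2: "n2 u \<le> ennreal ?M" unfolding n2_hsp[OF assms] by (intro ennreal_leI) simp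
  from gagliardo_nirenberg obtain K where K: "K > 0 \<and> (\<forall>(u :: 'a \<Rightarrow> real) M. hsp s u \<longrightarrow> M > 0 \<longrightarrow> n2 u \<le> ennreal M \<longrightarrow>
     integrable lborel (\<lambda>x. \<bar>u x\<bar> powr (2 + 4 * s / real DIM('a))) \<and> (LBINT x. \<bar>u x\<bar> powr (2 + 4 * s / real DIM('a))) \<le> K * M powr (2 * s / real DIM('a)) * kinr s u)" ..
  show ?thesis using conjunct2[OF K, rule_format, OF assms M1 M2] by (rule conjunct1)
qed

lemma G_integrable:
  assumes u: "hsp s (u :: 'a \<Rightarrow> real)" shows "integrable lborel (\<lambda>x. G (u x))"
proof -
  have [measurable]: "u \<in> borel_measurable borel" using u by (simp add: hsp_def)
  obtain C where C: "C \<ge> 0" "\<And>t. \<bar>G t\<bar> \<le> C * t\<^sup>2 + 1 * \<bar>t\<bar> powr (2 + 4 * s / real DIM('a))" using G_growth[OF zero_less_one, unfolded exponent_eq] by blast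
  show ?thesis
  proof (rule Bochner_Integration.integrable_bound)
    show "integrable lborel (\<lambda>x. C * (u x)\<^sup>2 + 1 * \<bar>u x\<bar> powr (2 + 4 * s / real DIM('a)))"
      by (intro Bochner_Integration.integrable_add integrable_mult_right square_integrable Lq_integrable u)
    show "AE x in lborel. norm (G (u x)) \<le> norm (C * (u x)\<^sup>2 + 1 * \<bar>u x\<bar> powr (2 + 4 * s / real DIM('a)))"
      unfolding real_norm_def by (intro AE_I2) (rule order_trans[OF C(2) abs_ge_self])
  qed measurable
qed

definition P :: "('a \<Rightarrow> real) \<Rightarrow> real" where "P u = (LBINT x. G (u x))"

definition J :: "('a \<Rightarrow> real) \<Rightarrow> real" where "J u = kinr s u / 2 - P u"

lemma indicator_mult_integrable:
  fixes f :: "'a \<Rightarrow> real"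
  assumes "integrable lborel f" and S: "S \<in> sets borel"
  shows "integrable lborel (\<lambda>x. indicator S x * f x)"
  using integrable_mult_indicator[of S lborel f] assms by simp

text \<open>Small and large values of \<open>u\<close> are treated apart. Where
  \<open>\<bar>u\<bar> \<le> a\<close>, (g1) bounds \<open>\<bar>G\<bar>\<close> by a small multiple
  of the mass density. Where \<open>\<bar>u\<bar> > a\<close>, the balls in \<open>Lq_on_set\<close>
  have radius at most the fixed \<rho>, and far from the origin radiality makes their mass at most
  \<epsilon>.\<close>

lemma uniform_tail:
  assumes \<delta>: "\<delta> > 0" and m: "m > 0" and \<kappa>: "\<kappa> \<ge> 0"
  obtains R where "\<And>u :: 'a \<Rightarrow> real. hsp s u \<Longrightarrow> ae_radial u \<Longrightarrow> n2 u \<le> ennreal m \<Longrightarrow> kinr s u \<le> \<kappa> \<Longrightarrow>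
    (LBINT x. indicator (- ball 0 R) x * \<bar>G (u x)\<bar>) \<le> \<delta>"
proof -
  let ?N = "real DIM('a)" and ?w = "unit_ball_vol (real DIM('a))"
  have w: "?w > 0" by simp
  define \<delta>1 where "\<delta>1 = \<delta> / (2 * m)"
  have d1: "\<delta>1 > 0" using \<delta> m by (simp add: \<delta>1_def)
  obtain a where a: "a > 0" "\<And>t. \<bar>t\<bar> \<le> a \<Longrightarrow> \<bar>G t\<bar> \<le> \<delta>1 * t\<^sup>2" using G_small[OF d1] by blast
  obtain C where C: "C \<ge> 0" "\<And>t. \<bar>G t\<bar> \<le> C * t\<^sup>2 + 1 * \<bar>t\<bar> powr (2 + 4 * s / real DIM('a))" using G_growth[OF zero_less_one, unfolded exponent_eq] by blast
  define C' where "C' = C * a powr (2 - (2 + 4 * s / real DIM('a))) + 1"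
  have C'0: "C' > 0" using C(1) by (simp add: C'_def add_nonneg_pos)
  have C': "\<bar>G t\<bar> \<le> C' * \<bar>t\<bar> powr (2 + 4 * s / real DIM('a))" if "\<bar>t\<bar> > a" for t
  proof -
    have "t\<^sup>2 = \<bar>t\<bar> powr (2 - (2 + 4 * s / real DIM('a))) * \<bar>t\<bar> powr (2 + 4 * s / real DIM('a))" using that a by (simp add: powr_add[symmetric])
    also have "\<dots> \<le> a powr (2 - (2 + 4 * s / real DIM('a))) * \<bar>t\<bar> powr (2 + 4 * s / real DIM('a))"
      using that a exponent_gt_2 by (intro mult_right_mono powr_mono2') auto
    finally have "C * t\<^sup>2 \<le> C * (a powr (2 - (2 + 4 * s / real DIM('a))) * \<bar>t\<bar> powr (2 + 4 * s / real DIM('a)))" using C(1) by (rule mult_left_mono)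
    then show ?thesis using C(2)[of t] by (simp add: C'_def algebra_simps)
  qed
  from Lq_on_set obtain K where K': "K > 0 \<and> (\<forall>(u :: 'a \<Rightarrow> real) \<epsilon> S. hsp s u \<longrightarrow> \<epsilon> > 0 \<longrightarrow> S \<in> sets borel \<longrightarrow>
     (\<forall>x. x \<in> S \<longrightarrow> u x \<noteq> 0 \<longrightarrow>
      (\<integral>\<^sup>+ y. ennreal ((u y)\<^sup>2) * indicator (ball x ((4 * \<epsilon> / (?w * (u x)\<^sup>2)) powr (1 / ?N))) y \<partial>lborel) \<le> ennreal \<epsilon>) \<longrightarrow>
     (\<integral>\<^sup>+ x. ennreal (\<bar>u x\<bar> powr (2 + 4 * s / real DIM('a))) * indicator S x \<partial>lborel) \<le> ennreal (K * \<epsilon> powr (2 * s / ?N) * kinr s u))" ..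
  note K = conjunct1[OF K'] conjunct2[OF K', rule_format]
  \<comment> \<open>The value of \<open>\<epsilon> powr (2 * s / N)\<close> for which the large
    values of \<open>u\<close> contribute at most \<open>\<delta> / 2\<close>; \<epsilon> is then
    recovered by inverting the power. Using \<open>\<kappa> + 1\<close> covers
    \<open>\<kappa> = 0\<close>.\<close>
  define b where "b = \<delta> / (2 * C' * K * (\<kappa> + 1))"
  have b: "b > 0" unfolding b_def using \<delta> C'0 K(1) \<kappa> by (intro divide_pos_pos mult_pos_pos) auto
  define \<epsilon> where "\<epsilon> = b powr (?N / (2 * s))"
  have e: "\<epsilon> > 0" using b by (simp add: \<epsilon>_def)
  have eb: "\<epsilon> powr (2 * s / ?N) = b" using b s by (simp add: \<epsilon>_def powr_powr)
  have small: "C' * (K * \<epsilon> powr (2 * s / ?N) * \<kappa>) \<le> \<delta> / 2"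
  proof -
    have Z0: "C' * K * (\<kappa> + 1) > 0" using C'0 K(1) \<kappa> by (intro mult_pos_pos) auto
    have "Z * (\<delta> / (2 * Z)) = \<delta> / 2" if "Z > 0" for Z using that by simp
    from this[OF Z0] have "C' * K * (\<kappa> + 1) * b = \<delta> / 2" unfolding b_def by (simp only: mult.assoc)
    moreover have "C' * K * \<kappa> * b \<le> C' * K * (\<kappa> + 1) * b" using C'0 K(1) b by (intro mult_right_mono mult_left_mono) auto
    moreover have "C' * (K * b * \<kappa>) = C' * K * \<kappa> * b" by (simp only: mult_ac)
    ultimately show ?thesis unfolding eb by linarith
  qed
  \<comment> \<open>The radius belonging to the threshold \<open>a\<close>. Larger values of
    \<open>\<bar>u\<bar>\<close> need smaller balls.\<close>
  define \<rho> where "\<rho> = (4 * \<epsilon> / (?w * a\<^sup>2)) powr (1 / ?N)"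
  have wa: "?w * a\<^sup>2 > 0" using w a by (intro mult_pos_pos) auto
  have rho: "\<rho> > 0" unfolding \<rho>_def proof -
    have "4 * \<epsilon> / (?w * a\<^sup>2) > 0" using wa e by (intro divide_pos_pos) auto
    then show "(4 * \<epsilon> / (?w * a\<^sup>2)) powr (1 / ?N) > 0" by (metis less_irrefl powr_gt_zero)
  qed
  obtain k0 :: nat where k0: "m / \<epsilon> \<le> real k0" using real_arch_simple by blast
  define k where "k = Suc k0"
  have k: "k > 0" "m \<le> real k * \<epsilon>" using k0 e by (auto simp: k_def divide_le_eq algebra_simps)
  show thesis
  \<comment> \<open>From this distance on there is room for \<open>k\<close> disjoint copies of a
    ball of radius \<rho>, and \<open>m \<le> k * \<epsilon>\<close>, so none of them can carry more
    than \<epsilon>.\<close>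
  proof (rule that[of "2 * \<rho> * real k"])
    fix u :: "'a \<Rightarrow> real"
    assume u: "hsp s u" and rad: "ae_radial u" and um: "n2 u \<le> ennreal m" and uk: "kinr s u \<le> \<kappa>"
    let ?R = "2 * \<rho> * real k"
    have [measurable]: "u \<in> borel_measurable borel" using u by (simp add: hsp_def)
    define S where "S = {x. norm x \<ge> ?R \<and> \<bar>u x\<bar> > a}"
    have S[measurable]: "S \<in> sets borel" unfolding S_def by measurable
    have "(\<integral>\<^sup>+ x. ennreal (\<bar>u x\<bar> powr (2 + 4 * s / real DIM('a))) * indicator S x \<partial>lborel) \<le> ennreal (K * \<epsilon> powr (2 * s / ?N) * kinr s u)"
    proof (rule K(2)[OF u e S])
      fix x assume x: "x \<in> S" "u x \<noteq> 0"
      let ?r = "(4 * \<epsilon> / (?w * (u x)\<^sup>2)) powr (1 / ?N)"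
      have "a\<^sup>2 \<le> (u x)\<^sup>2" using x(1) a by (intro power2_le_iff_abs_le[THEN iffD2] abs_le_square_iff[THEN iffD1]) (auto simp: S_def)
      then have "4 * \<epsilon> / (?w * (u x)\<^sup>2) \<le> 4 * \<epsilon> / (?w * a\<^sup>2)"
        using wa w e by (intro divide_left_mono mult_left_mono mult_pos_pos) (auto simp: x(2))
      then have r: "?r \<le> \<rho>" unfolding \<rho>_def using e w by (intro powr_mono2 divide_nonneg_nonneg mult_nonneg_nonneg) auto
      define I where "I = (\<integral>\<^sup>+ y. ennreal ((u y)\<^sup>2) * indicator (ball x \<rho>) y \<partial>lborel)"
      have "of_nat k * I \<le> n2 u" unfolding I_def
        by (rule radial_local_mass_decay[OF _ rad N2 k(1) rho]) (use x(1) in \<open>auto simp: S_def\<close>)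
      also have "\<dots> \<le> ennreal (real k * \<epsilon>)" using um k(2) order_trans ennreal_leI by blast
      also have "\<dots> = of_nat k * ennreal \<epsilon>" using e by (simp add: ennreal_mult ennreal_of_nat_eq_real_of_nat)
      finally have "(of_nat k * I) / of_nat k \<le> (of_nat k * ennreal \<epsilon>) / of_nat k" by (rule divide_right_mono_ennreal)
      then have "I \<le> ennreal \<epsilon>" using k(1) by (simp add: mult_divide_eq_ennreal mult.commute[of "of_nat k"])
      moreover have "(\<integral>\<^sup>+ y. ennreal ((u y)\<^sup>2) * indicator (ball x ?r) y \<partial>lborel) \<le> I"
        unfolding I_def by (intro nn_integral_mono mult_left_mono) (use r in \<open>auto simp: indicator_def\<close>)
      ultimately show "(\<integral>\<^sup>+ y. ennreal ((u y)\<^sup>2) * indicator (ball x ?r) y \<partial>lborel) \<le> ennreal \<epsilon>" by simp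
    qed
    moreover have "integrable lborel (\<lambda>x. indicator S x * \<bar>u x\<bar> powr (2 + 4 * s / real DIM('a)))" by (intro indicator_mult_integrable Lq_integrable u S)
    then have "(\<integral>\<^sup>+ x. ennreal (indicator S x * \<bar>u x\<bar> powr (2 + 4 * s / real DIM('a))) \<partial>lborel) = ennreal (LBINT x. indicator S x * \<bar>u x\<bar> powr (2 + 4 * s / real DIM('a)))"
      by (intro nn_integral_eq_integral) auto
    moreover have "(\<integral>\<^sup>+ x. ennreal (indicator S x * \<bar>u x\<bar> powr (2 + 4 * s / real DIM('a))) \<partial>lborel) = (\<integral>\<^sup>+ x. ennreal (\<bar>u x\<bar> powr (2 + 4 * s / real DIM('a))) * indicator S x \<partial>lborel)"
      by (intro nn_integral_cong) (auto simp: indicator_def)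
    ultimately have "ennreal (LBINT x. indicator S x * \<bar>u x\<bar> powr (2 + 4 * s / real DIM('a))) \<le> ennreal (K * \<epsilon> powr (2 * s / ?N) * kinr s u)" by simp
    then have SL: "(LBINT x. indicator S x * \<bar>u x\<bar> powr (2 + 4 * s / real DIM('a))) \<le> K * \<epsilon> powr (2 * s / ?N) * kinr s u"
      using K(1) kinr_nonneg[of s u] by (subst (asm) ennreal_le_iff) auto
    have mL: "(LBINT x. (u x)\<^sup>2) \<le> m" using um m unfolding n2_hsp[OF u] by (simp add: ennreal_le_iff)
    have "(LBINT x. indicator (- ball 0 ?R) x * \<bar>G (u x)\<bar>) \<le> (LBINT x. \<delta>1 * (u x)\<^sup>2 + C' * (indicator S x * \<bar>u x\<bar> powr (2 + 4 * s / real DIM('a))))"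
    proof (rule integral_mono)
      show "integrable lborel (\<lambda>x. indicator (- ball 0 ?R) x * \<bar>G (u x)\<bar>)"
        by (intro indicator_mult_integrable integrable_abs G_integrable u) auto
      show "integrable lborel (\<lambda>x. \<delta>1 * (u x)\<^sup>2 + C' * (indicator S x * \<bar>u x\<bar> powr (2 + 4 * s / real DIM('a))))"
        by (intro Bochner_Integration.integrable_add integrable_mult_right square_integrable indicator_mult_integrable Lq_integrable u S)
      fix x :: 'a
      have n: "0 \<le> \<delta>1 * (u x)\<^sup>2" "0 \<le> C' * \<bar>u x\<bar> powr (2 + 4 * s / real DIM('a))" using d1 C'0 by auto
      show "indicator (- ball 0 ?R) x * \<bar>G (u x)\<bar> \<le> \<delta>1 * (u x)\<^sup>2 + C' * (indicator S x * \<bar>u x\<bar> powr (2 + 4 * s / real DIM('a)))"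
        using a(2)[of "u x"] C'[of "u x"] n by (cases "norm x \<ge> ?R"; cases "\<bar>u x\<bar> > a") (auto simp: S_def indicator_def)
    qed
    also have "\<dots> = \<delta>1 * (LBINT x. (u x)\<^sup>2) + C' * (LBINT x. indicator S x * \<bar>u x\<bar> powr (2 + 4 * s / real DIM('a)))"
    proof (subst Bochner_Integration.integral_add)
      show "integrable lborel (\<lambda>x. \<delta>1 * (u x)\<^sup>2)" by (intro integrable_mult_right square_integrable u)
      show "integrable lborel (\<lambda>x. C' * (indicator S x * \<bar>u x\<bar> powr (2 + 4 * s / real DIM('a))))"
        by (intro integrable_mult_right indicator_mult_integrable Lq_integrable u S)
    qed (simp only: integral_mult_right_zero)
    also have "\<dots> \<le> \<delta>1 * m + C' * (K * \<epsilon> powr (2 * s / ?N) * \<kappa>)"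
      using mL d1 C'0 SL K(1) uk by (intro add_mono mult_left_mono order_trans[OF SL]) auto
    also have "\<dots> \<le> \<delta>" using small m by (simp add: \<delta>1_def)
    finally show "(LBINT x. indicator (- ball 0 ?R) x * \<bar>G (u x)\<bar>) \<le> \<delta>" .
  qed
qed

end

section \<open>Minimisation at fixed mass\<close>

text \<open>Fatou's lemma for real integrals in epsilon form. Since \<open>ennreal\<close> sends
  negative numbers to 0, a negative lower bound is treated apart, where it is trivial.\<close>

lemma fatou_eventually:
  fixes f :: "nat \<Rightarrow> 'b \<Rightarrow> real"
  assumes f: "\<And>n. integrable M (f n)" and F: "integrable M F" and nn: "\<And>n x. f n x \<ge> 0"
    and lim: "AE x in M. (\<lambda>n. f n x) \<longlonglongrightarrow> F x" and e: "e > 0"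
  shows "\<forall>\<^sub>F n in sequentially. (\<integral>x. F x \<partial>M) - e < (\<integral>x. f n x \<partial>M)"
proof (cases "(\<integral>x. F x \<partial>M) - e < 0")
  case True
  have "0 \<le> (\<integral>x. f n x \<partial>M)" for n using nn by simp
  then have "(\<integral>x. F x \<partial>M) - e < (\<integral>x. f n x \<partial>M)" for n by (rule order_less_le_trans[OF True])
  then show ?thesis by (intro always_eventually allI)
next
  case False
  have F0: "AE x in M. F x \<ge> 0"
    using lim by eventually_elim (use nn in \<open>auto intro: LIMSEQ_le_const\<close>)
  have "ennreal (\<integral>x. F x \<partial>M) = (\<integral>\<^sup>+ x. ennreal (F x) \<partial>M)"
    using nn_integral_eq_integral[OF F F0] by simp
  also have "\<dots> = (\<integral>\<^sup>+ x. liminf (\<lambda>n. ennreal (f n x)) \<partial>M)"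
  proof (rule nn_integral_cong_AE)
    show "AE x in M. ennreal (F x) = liminf (\<lambda>n. ennreal (f n x))"
      using lim
    proof eventually_elim
      case (elim x)
      have "(\<lambda>n. ennreal (f n x)) \<longlonglongrightarrow> ennreal (F x)" using elim by (rule tendsto_ennrealI)
      from lim_imp_Liminf[OF _ this] show ?case by simp
    qed
  qed
  also have "\<dots> \<le> liminf (\<lambda>n. \<integral>\<^sup>+ x. ennreal (f n x) \<partial>M)"
    using f by (intro nn_integral_liminf) auto
  also have "(\<lambda>n. \<integral>\<^sup>+ x. ennreal (f n x) \<partial>M) = (\<lambda>n. ennreal (\<integral>x. f n x \<partial>M))"
    using f nn by (intro ext nn_integral_eq_integral) auto
  finally have le: "ennreal (\<integral>x. F x \<partial>M) \<le> liminf (\<lambda>n. ennreal (\<integral>x. f n x \<partial>M))" .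
  have "ennreal ((\<integral>x. F x \<partial>M) - e) < ennreal (\<integral>x. F x \<partial>M)"
    using False e by (subst ennreal_less_iff) auto
  then have "ennreal ((\<integral>x. F x \<partial>M) - e) < liminf (\<lambda>n. ennreal (\<integral>x. f n x \<partial>M))" using le by (rule order_less_le_trans)
  then have "\<forall>\<^sub>F n in sequentially. ennreal ((\<integral>x. F x \<partial>M) - e) < ennreal (\<integral>x. f n x \<partial>M)" by (rule less_LiminfD)
  then show ?thesis
    by eventually_elim (use False in \<open>simp add: ennreal_less_iff\<close>)
qed

lemma hsp_cmult:
  assumes u: "hsp s u" shows "hsp s (\<lambda>x. c * u x)" and "kinr s (\<lambda>x. c * u x) = c\<^sup>2 * kinr s u"
proof -
  have eq: "(\<lambda>x. c * u x) = (\<lambda>x. u x + (c - 1) * u x)" by (simp add: fun_eq_iff algebra_simps)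
  show "hsp s (\<lambda>x. c * u x)" unfolding eq by (rule hsp_lincomb[OF u u])
  have "kinr s (\<lambda>x. u x + (c - 1) * u x) = kinr s u + 2 * (c - 1) * kinr s u + (c - 1)\<^sup>2 * kinr s u"
    using kinr_lincomb[OF u u, of "c - 1"] by (simp add: kinr_def power2_eq_square)
  then show "kinr s (\<lambda>x. c * u x) = c\<^sup>2 * kinr s u" unfolding eq by (simp add: power2_eq_square algebra_simps)
qed

lemma hsp_dilate:
  fixes u :: "'a::euclidean_space \<Rightarrow> real"
  assumes u: "hsp s u" and c: "c > 0"
  shows "hsp s (\<lambda>x. u (c *\<^sub>R x))" and "kinr s (\<lambda>x. u (c *\<^sub>R x)) = c powr (2 * s - real DIM('a)) * kinr s u"
proof -
  have u': "u \<in> borel_measurable borel" "n2 u < \<infinity>" "kin s u < \<infinity>" using u by (auto simp: hsp_def)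
  have k: "kin s (\<lambda>x. u (c *\<^sub>R x)) = ennreal (c powr (2 * s - real DIM('a)) * kinr s u)"
    unfolding kin_dilate[OF u'(1,2) c] kin_eq_kinr[OF u] using kinr_nonneg[of s u] by (simp add: ennreal_mult)
  have n: "n2 (\<lambda>x. u (c *\<^sub>R x)) < \<infinity>" using u' c by (simp add: n2_dilate ennreal_mult_less_top)
  have m: "(\<lambda>x. u (c *\<^sub>R x)) \<in> borel_measurable borel" using u'(1) by measurable
  show h: "hsp s (\<lambda>x. u (c *\<^sub>R x))" using k n m by (simp add: hsp_def)
  show "kinr s (\<lambda>x. u (c *\<^sub>R x)) = c powr (2 * s - real DIM('a)) * kinr s u"
    using k kinr_nonneg[of s u] kinr_nonneg[of s "\<lambda>x. u (c *\<^sub>R x)"] unfolding kin_eq_kinr[OF h] by simp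
qed

lemma integral_dilate:
  fixes f :: "'a::euclidean_space \<Rightarrow> real"
  assumes "f \<in> borel_measurable borel" and c: "c > 0"
  shows "(LBINT x. f (c *\<^sub>R x)) = c powr (- real DIM('a)) * (LBINT x. f x)"
proof -
  have "(LBINT x. f x) = c ^ DIM('a) * (LBINT x. f (c *\<^sub>R x))"
    using integral_lborel_affine[OF assms(1), of c 0] c by simp
  then show ?thesis using c by (simp add: powr_minus powr_realpow)
qed

section \<open>Semicontinuity of \<open>P\<close>, coercivity and negative energy\<close>

context mass_problem
begin

text \<open>Outside a large ball \<open>uniform_tail\<close> applies. Inside, Fatou is applied to
  \<open>C u^2 + \<delta> \<bar>u\<bar>^q - G(u)\<close>, which is nonnegative by the growth bound;
  the quadratic part converges by local L2 convergence. The critical power need not converge, but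
  its integral is bounded and its coefficient small.\<close>

lemma P_upper_semicontinuous:
  fixes un :: "nat \<Rightarrow> 'a \<Rightarrow> real"
  assumes un: "\<And>n. hsp s (un n)" "\<And>n. ae_radial (un n)" "\<And>n. n2 (un n) \<le> ennreal m" "\<And>n. kinr s (un n) \<le> \<kappa>"
    and v: "hsp s v" "ae_radial v" "n2 v \<le> ennreal m" "kinr s v \<le> \<kappa>" and m: "m > 0" and \<kappa>: "\<kappa> \<ge> 0"
    and AE: "AE x in lborel. (\<lambda>n. un n x) \<longlonglongrightarrow> v x"
    and loc: "\<And>R. (\<lambda>n. n2 (\<lambda>x. indicator (ball 0 R) x *\<^sub>R (un n x - v x))) \<longlonglongrightarrow> 0" and \<eta>: "\<eta> > 0"
  shows "\<forall>\<^sub>F n in sequentially. P (un n) \<le> P v + \<eta>"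
proof -
  have vm[measurable]: "v \<in> borel_measurable borel" and unm[measurable]: "\<And>n. un n \<in> borel_measurable borel"
    using v un by (auto simp: hsp_def)
  have e8: "\<eta> / 8 > 0" using \<eta> by simp
  obtain R where R: "\<And>u :: 'a \<Rightarrow> real. hsp s u \<Longrightarrow> ae_radial u \<Longrightarrow> n2 u \<le> ennreal m \<Longrightarrow> kinr s u \<le> \<kappa> \<Longrightarrow>
    (LBINT x. indicator (- ball 0 R) x * \<bar>G (u x)\<bar>) \<le> \<eta> / 8"
    using uniform_tail[OF e8 m \<kappa>] by metis
  define I where "I = (indicator (ball 0 R) :: 'a \<Rightarrow> real)"
  have I01: "0 \<le> I x" "I x \<le> 1" "I x * I x = I x" for x by (auto simp: I_def indicator_def)
  have ii: "integrable lborel (\<lambda>x. I x * f x)" if "integrable lborel f" for f :: "'a \<Rightarrow> real"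
    unfolding I_def using that by (rule indicator_mult_integrable) simp
  have split: "\<bar>P u - (LBINT x. I x * G (u x))\<bar> \<le> \<eta> / 8" if u: "hsp s u" "ae_radial u" "n2 u \<le> ennreal m" "kinr s u \<le> \<kappa>" for u
  proof -
    have "P u - (LBINT x. I x * G (u x)) = (LBINT x. G (u x) - I x * G (u x))"
      unfolding P_def
      by (rule Bochner_Integration.integral_diff[symmetric, OF G_integrable[OF u(1)] ii[OF G_integrable[OF u(1)]]])
    also have "\<dots> = (LBINT x. indicator (- ball 0 R) x * G (u x))"
      by (intro Bochner_Integration.integral_cong refl) (auto simp: I_def indicator_def)
    also have "\<bar>\<dots>\<bar> \<le> (LBINT x. \<bar>indicator (- ball 0 R) x * G (u x)\<bar>)" by (rule integral_abs_bound)
    also have "\<dots> = (LBINT x. indicator (- ball 0 R) x * \<bar>G (u x)\<bar>)"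
      by (intro Bochner_Integration.integral_cong) (auto simp: indicator_def)
    finally show ?thesis using R[OF u] by simp
  qed
  from gagliardo_nirenberg obtain K where K: "K > 0 \<and> (\<forall>(u :: 'a \<Rightarrow> real) M. hsp s u \<longrightarrow> M > 0 \<longrightarrow> n2 u \<le> ennreal M \<longrightarrow>
     integrable lborel (\<lambda>x. \<bar>u x\<bar> powr (2 + 4 * s / real DIM('a))) \<and> (LBINT x. \<bar>u x\<bar> powr (2 + 4 * s / real DIM('a))) \<le> K * M powr (2 * s / real DIM('a)) * kinr s u)" ..
  define Q where "Q = K * m powr (2 * s / real DIM('a)) * \<kappa>"
  have Q0: "Q \<ge> 0" using K \<kappa> by (simp add: Q_def)
  have Qb: "(LBINT x. I x * \<bar>un n x\<bar> powr (2 + 4 * s / real DIM('a))) \<le> Q" for n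
  proof -
    have "(LBINT x. I x * \<bar>un n x\<bar> powr (2 + 4 * s / real DIM('a))) \<le> (LBINT x. \<bar>un n x\<bar> powr (2 + 4 * s / real DIM('a)))"
      by (intro integral_mono ii Lq_integrable un) (use I01 in \<open>auto intro: mult_left_le_one_le\<close>)
    also have "\<dots> \<le> K * m powr (2 * s / real DIM('a)) * kinr s (un n)"
      using conjunct2[OF K, rule_format, OF un(1) m un(3)] by blast
    also have "\<dots> \<le> Q" unfolding Q_def using K un(4) by (intro mult_left_mono) auto
    finally show ?thesis .
  qed
  \<comment> \<open>Makes the critical term cost at most \<open>\<eta> / 8\<close>. With two tails,
    the Fatou error and the quadratic part the total is five eighths of \<eta>.\<close>
  define \<delta> where "\<delta> = \<eta> / (8 * (Q + 1))"
  have d: "\<delta> > 0" "\<delta> * Q \<le> \<eta> / 8"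
    using \<eta> Q0 by (auto simp: \<delta>_def field_simps)
  obtain C where C: "C \<ge> 0" "\<And>t. \<bar>G t\<bar> \<le> C * t\<^sup>2 + \<delta> * \<bar>t\<bar> powr (2 + 4 * s / real DIM('a))"
    using G_growth[OF d(1), unfolded exponent_eq] by blast
  define h where "h u x = I x * (C * (u x)\<^sup>2 + \<delta> * \<bar>u x\<bar> powr (2 + 4 * s / real DIM('a)) - G (u x))" for u :: "'a \<Rightarrow> real" and x
  have hi: "integrable lborel (h u)" if "hsp s u" for u
    unfolding h_def[abs_def]
    by (intro ii Bochner_Integration.integrable_diff Bochner_Integration.integrable_add integrable_mult_right square_integrable Lq_integrable G_integrable that)
  have hint: "(LBINT x. h u x) = C * (LBINT x. I x * (u x)\<^sup>2) + \<delta> * (LBINT x. I x * \<bar>u x\<bar> powr (2 + 4 * s / real DIM('a))) - (LBINT x. I x * G (u x))" if "hsp s u" for u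
  proof -
    note i = ii[OF square_integrable[OF that]] ii[OF Lq_integrable[OF that]] ii[OF G_integrable[OF that]]
    have "(LBINT x. h u x) = (LBINT x. C * (I x * (u x)\<^sup>2) + \<delta> * (I x * \<bar>u x\<bar> powr (2 + 4 * s / real DIM('a))) - I x * G (u x))"
      by (intro Bochner_Integration.integral_cong refl) (simp only: h_def right_diff_distrib distrib_left mult.left_commute)
    also have "\<dots> = (LBINT x. C * (I x * (u x)\<^sup>2) + \<delta> * (I x * \<bar>u x\<bar> powr (2 + 4 * s / real DIM('a)))) - (LBINT x. I x * G (u x))"
      by (intro Bochner_Integration.integral_diff Bochner_Integration.integrable_add integrable_mult_right i)
    also have "(LBINT x. C * (I x * (u x)\<^sup>2) + \<delta> * (I x * \<bar>u x\<bar> powr (2 + 4 * s / real DIM('a)))) = (LBINT x. C * (I x * (u x)\<^sup>2)) + (LBINT x. \<delta> * (I x * \<bar>u x\<bar> powr (2 + 4 * s / real DIM('a))))"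
      by (intro Bochner_Integration.integral_add integrable_mult_right i)
    finally show ?thesis by (simp only: integral_mult_right_zero)
  qed
  have hnn: "h u x \<ge> 0" for u x
    using I01(1)[of x] C(2)[of "u x"] unfolding h_def by (intro mult_nonneg_nonneg) (auto simp: abs_le_iff)
  have Gc: "continuous_on UNIV G" using G by (auto simp: continuous_on_eq_continuous_at intro: DERIV_isCont)
  have hlim: "AE x in lborel. (\<lambda>n. h (un n) x) \<longlonglongrightarrow> h v x"
    using AE
  proof eventually_elim
    case (elim x)
    have "(\<lambda>n. G (un n x)) \<longlonglongrightarrow> G (v x)"
      using isCont_tendsto_compose[OF DERIV_isCont[OF G] elim] .
    moreover have "(\<lambda>n. \<bar>un n x\<bar> powr (2 + 4 * s / real DIM('a))) \<longlonglongrightarrow> \<bar>v x\<bar> powr (2 + 4 * s / real DIM('a))"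
      using exponent_gt_2(1) by (intro tendsto_powr' tendsto_rabs elim tendsto_const) auto
    ultimately show ?case unfolding h_def by (intro tendsto_mult tendsto_diff tendsto_add tendsto_const tendsto_power elim)
  qed
  have ev1: "\<forall>\<^sub>F n in sequentially. (LBINT x. h v x) - \<eta> / 8 < (LBINT x. h (un n) x)"
    by (rule fatou_eventually[OF hi[OF un(1)] hi[OF v(1)] hnn hlim e8])
  have Isq: "n2 (\<lambda>x. I x * u x) = ennreal (LBINT x. I x * (u x)\<^sup>2)" if "hsp s u" for u
  proof -
    have "(norm (I x * u x))\<^sup>2 = (I x * I x) * (u x)\<^sup>2" for x
      unfolding real_norm_def power2_abs by (simp only: power2_eq_square mult_ac)
    then have "(norm (I x * u x))\<^sup>2 = I x * (u x)\<^sup>2" for x by (simp only: I01(3))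
    then show ?thesis using n2_eq_integral[of "\<lambda>x. I x * u x"] ii[OF square_integrable[OF that]] by simp
  qed
  have "(\<lambda>n. n2 (\<lambda>x. I x * un n x)) \<longlonglongrightarrow> n2 (\<lambda>x. I x * v x)"
  proof (rule n2_tendsto)
    show "(\<lambda>x. I x * un n x) \<in> borel_measurable borel" "(\<lambda>x. I x * v x) \<in> borel_measurable borel" for n
      unfolding I_def by measurable
    show "n2 (\<lambda>x. I x * v x) < \<infinity>" unfolding Isq[OF v(1)] by simp
    show "(\<lambda>n. n2 (\<lambda>x. I x * un n x - I x * v x)) \<longlonglongrightarrow> 0"
      using loc[of R] by (simp add: I_def right_diff_distrib)
  qed
  then have "(\<lambda>n. LBINT x. I x * (un n x)\<^sup>2) \<longlonglongrightarrow> (LBINT x. I x * (v x)\<^sup>2)"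
    unfolding Isq[OF v(1)] Isq[OF un(1)] using I01(1) by (subst (asm) tendsto_ennreal_iff) auto
  then have "(\<lambda>n. C * (LBINT x. I x * (un n x)\<^sup>2)) \<longlonglongrightarrow> C * (LBINT x. I x * (v x)\<^sup>2)" by (intro tendsto_mult tendsto_const)
  then have ev2: "\<forall>\<^sub>F n in sequentially. C * (LBINT x. I x * (un n x)\<^sup>2) < C * (LBINT x. I x * (v x)\<^sup>2) + \<eta> / 8"
    using e8 by (intro order_tendstoD(2)) auto
  show ?thesis
    using ev1 ev2
  proof eventually_elim
    case (elim n)
    have "\<delta> * (LBINT x. I x * \<bar>un n x\<bar> powr (2 + 4 * s / real DIM('a))) \<le> \<eta> / 8"
      using order_trans[OF mult_left_mono[OF Qb, of \<delta>] d(2)] d(1) by simp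
    moreover have "\<delta> * (LBINT x. I x * \<bar>v x\<bar> powr (2 + 4 * s / real DIM('a))) \<ge> 0"
      using d(1) I01(1) by (intro mult_nonneg_nonneg Bochner_Integration.integral_nonneg) auto
    ultimately show ?case
      using elim hint[OF un(1), of n] hint[OF v(1)] split[OF un(1) un(2) un(3) un(4), of n] split[OF v] by linarith
  qed
qed

lemma J_coercive:
  assumes m: "m > 0"
  shows "\<exists>C. \<forall>u :: 'a \<Rightarrow> real. hsp s u \<longrightarrow> n2 u \<le> ennreal m \<longrightarrow> kinr s u / 4 - C \<le> J u"
proof -
  from gagliardo_nirenberg obtain K where K: "K > 0 \<and> (\<forall>(u :: 'a \<Rightarrow> real) M. hsp s u \<longrightarrow> M > 0 \<longrightarrow> n2 u \<le> ennreal M \<longrightarrow>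
     integrable lborel (\<lambda>x. \<bar>u x\<bar> powr (2 + 4 * s / real DIM('a))) \<and> (LBINT x. \<bar>u x\<bar> powr (2 + 4 * s / real DIM('a))) \<le> K * M powr (2 * s / real DIM('a)) * kinr s u)" ..
  define L where "L = K * m powr (2 * s / real DIM('a))"
  have L: "L > 0" using K m by (simp add: L_def)
  \<comment> \<open>With this coefficient in the growth bound the critical term is at most
    \<open>kinr s u / 4\<close>, half of the kinetic part of \<open>J\<close>.\<close>
  have d: "1 / (4 * L) > 0" using L by simp
  obtain C where C: "C \<ge> 0" "\<And>t. \<bar>G t\<bar> \<le> C * t\<^sup>2 + 1 / (4 * L) * \<bar>t\<bar> powr (2 + 4 * s / real DIM('a))"
    using G_growth[OF d, unfolded exponent_eq] by blast
  show ?thesis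
  proof (intro exI[of _ "C * m"] allI impI)
    fix u :: "'a \<Rightarrow> real" assume u: "hsp s u" and um: "n2 u \<le> ennreal m"
    have mL: "(LBINT x. (u x)\<^sup>2) \<le> m" using um m unfolding n2_hsp[OF u] by (simp add: ennreal_le_iff)
    have b: "(LBINT x. \<bar>u x\<bar> powr (2 + 4 * s / real DIM('a))) \<le> L * kinr s u"
      using conjunct2[OF K, rule_format, OF u m um] by (simp add: L_def)
    have "P u \<le> (LBINT x. C * (u x)\<^sup>2 + 1 / (4 * L) * \<bar>u x\<bar> powr (2 + 4 * s / real DIM('a)))"
      unfolding P_def
    proof (rule integral_mono)
      show "integrable lborel (\<lambda>x. G (u x))" by (rule G_integrable[OF u])
      show "integrable lborel (\<lambda>x. C * (u x)\<^sup>2 + 1 / (4 * L) * \<bar>u x\<bar> powr (2 + 4 * s / real DIM('a)))"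
        by (intro Bochner_Integration.integrable_add integrable_mult_right square_integrable Lq_integrable u)
      show "G (u x) \<le> C * (u x)\<^sup>2 + 1 / (4 * L) * \<bar>u x\<bar> powr (2 + 4 * s / real DIM('a))" for x
        by (rule order_trans[OF abs_ge_self C(2)])
    qed
    also have "\<dots> = (LBINT x. C * (u x)\<^sup>2) + (LBINT x. 1 / (4 * L) * \<bar>u x\<bar> powr (2 + 4 * s / real DIM('a)))"
      by (intro Bochner_Integration.integral_add integrable_mult_right square_integrable Lq_integrable u)
    also have "\<dots> = C * (LBINT x. (u x)\<^sup>2) + 1 / (4 * L) * (LBINT x. \<bar>u x\<bar> powr (2 + 4 * s / real DIM('a)))"
      by (simp only: integral_mult_right_zero)
    also have "\<dots> \<le> C * m + 1 / (4 * L) * (L * kinr s u)"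
      using C(1) mL d b by (intro add_mono mult_left_mono) auto
    also have "1 / (4 * L) * (L * kinr s u) = kinr s u / 4" using L by simp
    finally show "kinr s u / 4 - C * m \<le> J u" unfolding J_def by simp
  qed
qed

definition admissible :: "real \<Rightarrow> ('a \<Rightarrow> real) set" where
  "admissible m = {u. hsp s u \<and> ae_radial u \<and> (LBINT x. (u x)\<^sup>2) = m}"

lemma admissible_n2: "u \<in> admissible m \<Longrightarrow> n2 u = ennreal m"
  using n2_hsp[of u] by (simp add: admissible_def)

lemma dilate_admissible:
  assumes u: "hsp s u" "ae_radial u" and \<theta>: "\<theta> > 0" and M: "(LBINT x. (u x)\<^sup>2) = m / \<theta>"
  shows "(\<lambda>x. u (\<theta> powr (- 1 / real DIM('a)) *\<^sub>R x)) \<in> admissible m"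
    and "J (\<lambda>x. u (\<theta> powr (- 1 / real DIM('a)) *\<^sub>R x)) = \<theta> powr (1 - 2 * s / real DIM('a)) * kinr s u / 2 - \<theta> * P u"
proof -
  let ?N = "real DIM('a)"
  define c where "c = \<theta> powr (- 1 / ?N)"
  have c: "c > 0" using \<theta> by (simp add: c_def)
  have um[measurable]: "u \<in> borel_measurable borel" using u by (simp add: hsp_def)
  have cN: "c powr (- ?N) = \<theta>" using \<theta> by (simp add: c_def powr_powr)
  have cs: "c powr (2 * s - ?N) = \<theta> powr (1 - 2 * s / ?N)"
  proof -
    have "(- 1 / ?N) * (2 * s - ?N) = 1 - 2 * s / ?N" by (simp add: field_simps)
    then show ?thesis unfolding c_def powr_powr by (simp only:)
  qed
  have "(LBINT x. (u (c *\<^sub>R x))\<^sup>2) = m"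
    using integral_dilate[of "\<lambda>x. (u x)\<^sup>2" c] c M \<theta> by (simp add: cN)
  then show "(\<lambda>x. u (\<theta> powr (- 1 / ?N) *\<^sub>R x)) \<in> admissible m"
    unfolding admissible_def c_def[symmetric] using hsp_dilate(1)[OF u(1) c] ae_radial_dilate[OF u(2) um, of c] c by simp
  have "P (\<lambda>x. u (c *\<^sub>R x)) = \<theta> * P u"
    unfolding P_def using integral_dilate[of "\<lambda>x. G (u x)" c] c by (simp add: cN)
  then show "J (\<lambda>x. u (\<theta> powr (- 1 / ?N) *\<^sub>R x)) = \<theta> powr (1 - 2 * s / ?N) * kinr s u / 2 - \<theta> * P u"
    unfolding J_def c_def[symmetric] hsp_dilate(2)[OF u(1) c] cs by simp
qed

text \<open>The functions \<open>a t^(N/2) w(t x)\<close> all have mass \<open>m\<close>, and both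
  their kinetic energy and the integral of their critical power are proportional to
  \<open>t^(2s)\<close>. So \<open>t\<close> cannot decide the sign; it serves to make the amplitude
  small, where (g4) provides a coefficient \<open>A\<close> as large as desired.\<close>

lemma exists_negative_energy:
  assumes m: "m > 0"
  shows "\<exists>u \<in> admissible m. J u < 0"
proof -
  let ?N = "real DIM('a)" and ?q = "2 + 4 * s / real DIM('a)"
  define w where "w x = exp (- (norm x)\<^sup>2 / 2)" for x :: 'a
  have hw: "hsp s w" unfolding w_def[abs_def] by (rule gaussian_hsp[OF s])
  have wm[measurable]: "w \<in> borel_measurable borel" using hw by (simp add: hsp_def)
  have w01: "0 < w x" "w x \<le> 1" for x by (auto simp: w_def)
  have wr: "ae_radial w" by (rule ae_radial_borel[OF wm]) (simp add: w_def)
  have pos: "(LBINT x. f (w x)) > 0" if i: "integrable lborel (\<lambda>x. f (w x))" and f: "\<And>x. f (w x) > 0" for f :: "real \<Rightarrow> real"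
  proof -
    have "(LBINT x. f (w x)) \<noteq> 0"
    proof
      assume "(LBINT x. f (w x)) = 0"
      then have "AE x in lborel. f (w x) = 0"
        using f integral_nonneg_eq_0_iff_AE[OF i] by (simp add: less_imp_le)
      then have "AE x in (lborel :: 'a measure). False" by eventually_elim (metis f less_irrefl)
      then have "emeasure (lborel :: 'a measure) UNIV = 0" by (simp add: eventually_False ae_filter_eq_bot_iff)
      then show False by simp
    qed
    moreover have "(LBINT x. f (w x)) \<ge> 0" using f by (intro Bochner_Integration.integral_nonneg) (simp add: less_imp_le)
    ultimately show ?thesis by simp
  qed
  define M0 where "M0 = (LBINT x. (w x)\<^sup>2)"
  have M0: "M0 > 0" unfolding M0_def using w01(1) by (intro pos square_integrable hw) (simp add: less_imp_neq[symmetric])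
  define Q0 where "Q0 = (LBINT x. \<bar>w x\<bar> powr ?q)"
  have Q0: "Q0 > 0" unfolding Q0_def using w01(1) by (intro pos Lq_integrable hw) (simp add: less_imp_neq[symmetric])
  define a where "a = sqrt (m / M0)"
  have a: "a > 0" "a\<^sup>2 = m / M0" using m M0 by (auto simp: a_def)
  \<comment> \<open>Solves \<open>A * a^q * Q0 = a^2 * kinr s w / 2 + 1\<close>, so that the power
    term exceeds the kinetic one and the final energy is at most
    \<open>- (t powr (2 * s))\<close>.\<close>
  define A where "A = (a\<^sup>2 * kinr s w / 2 + 1) / (a powr ?q * Q0)"
  have aq: "a powr ?q * Q0 > 0" using a Q0 by (intro mult_pos_pos) (auto simp: less_imp_neq[symmetric])
  have A: "A \<ge> 0" unfolding A_def using aq kinr_nonneg[of s w] by (intro divide_nonneg_pos add_nonneg_nonneg) auto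
  have AQ: "A * (a powr ?q * Q0) = a\<^sup>2 * kinr s w / 2 + 1"
  proof -
    have "a powr ?q * Q0 \<noteq> 0" using aq by (metis less_irrefl)
    from nonzero_divide_eq_eq[OF this, THEN iffD1, OF A_def[symmetric]] show ?thesis by (rule sym)
  qed
  obtain \<alpha> where al: "\<alpha> > 0" "\<And>t. 0 \<le> t \<Longrightarrow> t \<le> \<alpha> \<Longrightarrow> A * t powr ?q \<le> G t" using G_lower[OF A, unfolded exponent_eq] by blast
  \<comment> \<open>Chosen so that the amplitude \<open>a * t powr (N / 2)\<close> equals \<alpha>;
    as the Gaussian is at most 1, all values of \<open>f\<close> lie where the lower bound on
    \<open>G\<close> holds.\<close>
  define t where "t = (\<alpha> / a) powr (2 / ?N)"
  have t: "t > 0" unfolding t_def using al a by (metis divide_pos_pos less_irrefl powr_gt_zero)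
  have tN: "a * t powr (?N / 2) = \<alpha>" unfolding t_def powr_powr using al a by simp
  define b where "b = a * t powr (?N / 2)"
  have b: "b > 0" "b = \<alpha>" using tN al by (auto simp: b_def)
  define f where "f x = b * w (t *\<^sub>R x)" for x
  have hd: "hsp s (\<lambda>x. w (t *\<^sub>R x))" by (rule hsp_dilate(1)[OF hw t])
  have hf: "hsp s f" unfolding f_def[abs_def] by (rule hsp_cmult(1)[OF hd])
  have fr: "ae_radial f"
    by (rule ae_radial_borel) (use hf in \<open>auto simp: hsp_def f_def w_def\<close>)
  have b2: "b\<^sup>2 = a\<^sup>2 * t powr ?N"
    unfolding b_def power_mult_distrib by (simp add: power2_eq_square powr_add[symmetric])
  have kf: "kinr s f = a\<^sup>2 * t powr (2 * s) * kinr s w"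
    unfolding f_def[abs_def] hsp_cmult(2)[OF hd] hsp_dilate(2)[OF hw t] b2
    by (simp add: mult.assoc[symmetric] powr_add[symmetric])
  have mf: "(LBINT x. (f x)\<^sup>2) = m"
  proof -
    have "(LBINT x. (f x)\<^sup>2) = b\<^sup>2 * (LBINT x. (w (t *\<^sub>R x))\<^sup>2)" unfolding f_def power_mult_distrib by simp
    also have "\<dots> = b\<^sup>2 * (t powr (- ?N) * M0)" using integral_dilate[of "\<lambda>x. (w x)\<^sup>2" t] t by (simp add: M0_def)
    also have "\<dots> = a\<^sup>2 * (t powr ?N * t powr (- ?N)) * M0" unfolding b2 by (simp only: mult_ac)
    also have "\<dots> = m" using a M0 t by (simp add: powr_add[symmetric])
    finally show ?thesis .
  qed
  have Pf: "P f \<ge> A * (a powr ?q * t powr (2 * s) * Q0)"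
  proof -
    have fq: "\<bar>f x\<bar> powr ?q = b powr ?q * \<bar>w (t *\<^sub>R x)\<bar> powr ?q" for x
      using b w01(1)[of "t *\<^sub>R x"] by (simp add: f_def abs_mult powr_mult)
    have bq: "b powr ?q = a powr ?q * t powr (?N + 2 * s)"
    proof -
      have "b powr ?q = a powr ?q * t powr (?N / 2 * ?q)" unfolding b_def using a t by (simp add: powr_mult powr_powr)
      also have "?N / 2 * ?q = ?N + 2 * s" by (simp add: field_simps)
      finally show ?thesis .
    qed
    have "A * (LBINT x. \<bar>f x\<bar> powr ?q) \<le> P f"
      unfolding P_def integral_mult_right_zero[symmetric]
    proof (rule integral_mono)
      show "A * \<bar>f x\<bar> powr ?q \<le> G (f x)" for x
      proof -
        have "0 \<le> f x" "f x \<le> b * 1" unfolding f_def using b w01[of "t *\<^sub>R x"] by (auto intro!: mult_left_mono)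
        then show ?thesis using al(2)[of "f x"] b(2) by simp
      qed
    qed (intro integrable_mult_right Lq_integrable G_integrable hf)+
    moreover have "(LBINT x. \<bar>f x\<bar> powr ?q) = a powr ?q * t powr (2 * s) * Q0"
    proof -
      have "(LBINT x. \<bar>f x\<bar> powr ?q) = b powr ?q * (LBINT x. \<bar>w (t *\<^sub>R x)\<bar> powr ?q)" unfolding fq by (rule integral_mult_right_zero)
      also have "(LBINT x. \<bar>w (t *\<^sub>R x)\<bar> powr ?q) = t powr (- ?N) * Q0"
        using integral_dilate[of "\<lambda>x. \<bar>w x\<bar> powr ?q" t] t by (simp add: Q0_def)
      also have "b powr ?q * (t powr (- ?N) * Q0) = a powr ?q * (t powr (?N + 2 * s) * t powr (- ?N)) * Q0" unfolding bq by (simp only: mult_ac)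
      also have "t powr (?N + 2 * s) * t powr (- ?N) = t powr (2 * s)" by (simp add: powr_add[symmetric])
      finally show ?thesis .
    qed
    ultimately show ?thesis by simp
  qed
  have "J f < 0"
  proof -
    have "A * (a powr ?q * t powr (2 * s) * Q0) = t powr (2 * s) * (a\<^sup>2 * kinr s w / 2 + 1)"
      unfolding AQ[symmetric] by (simp only: mult_ac)
    with Pf have "t powr (2 * s) * (a\<^sup>2 * kinr s w / 2 + 1) \<le> P f" by (simp only:)
    then have "J f \<le> a\<^sup>2 * t powr (2 * s) * kinr s w / 2 - t powr (2 * s) * (a\<^sup>2 * kinr s w / 2 + 1)"
      unfolding J_def kf by linarith
    also have "\<dots> = - (t powr (2 * s))" by (simp add: algebra_simps)
    also have "\<dots> < 0" using t by simp
    finally show ?thesis .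
  qed
  moreover have "f \<in> admissible m" using hf fr mf by (simp add: admissible_def)
  ultimately show ?thesis by blast
qed

end

section \<open>Attainment of the infimum\<close>

context mass_problem
begin

theorem exists_minimiser:
  assumes m: "m > 0"
  shows "\<exists>u \<in> admissible m. J u < 0 \<and> (\<forall>w \<in> admissible m. J u \<le> J w)"
proof -
  obtain C where C: "\<And>u :: 'a \<Rightarrow> real. hsp s u \<Longrightarrow> n2 u \<le> ennreal m \<Longrightarrow> kinr s u / 4 - C \<le> J u"
    using J_coercive[OF m] by blast
  have lowJ: "- C \<le> J u" if "u \<in> admissible m" for u
    using C[of u] that kinr_nonneg[of s u] admissible_n2[OF that] by (simp add: admissible_def)
  obtain u0 where u0: "u0 \<in> admissible m" "J u0 < 0" using exists_negative_energy[OF m] by blast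
  define E where "E = Inf (J ` admissible m)"
  have bdd: "bdd_below (J ` admissible m)" using lowJ by (rule bdd_belowI2[where m = "- C"])
  have E_le: "E \<le> J u" if "u \<in> admissible m" for u unfolding E_def using bdd that by (intro cInf_lower) auto
  have E0: "E < 0" using E_le[OF u0(1)] u0(2) by simp
  have "\<exists>u \<in> admissible m. J u < E + 1 / real (Suc n)" for n
  proof -
    have "Inf (J ` admissible m) < E + 1 / real (Suc n)" unfolding E_def by simp
    then obtain y where "y \<in> J ` admissible m" "y < E + 1 / real (Suc n)"
      using cInf_lessD[of "J ` admissible m"] u0(1) by blast
    then show ?thesis by blast
  qed
  then obtain un where un: "\<And>n. un n \<in> admissible m" "\<And>n. J (un n) < E + 1 / real (Suc n)" by metis
  have unH: "hsp s (un n)" "ae_radial (un n)" "n2 (un n) \<le> ennreal m" for n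
    using un(1)[of n] admissible_n2[OF un(1)[of n]] by (auto simp: admissible_def)
  define \<kappa> where "\<kappa> = max 0 (4 * (E + 1 + C))"
  have unk: "kinr s (un n) \<le> \<kappa>" for n
  proof -
    have "1 / real (Suc n) \<le> 1" by simp
    then have "kinr s (un n) / 4 - C \<le> E + 1" using C[OF unH(1) unH(3), of n] un(2)[of n] by linarith
    then have "kinr s (un n) \<le> 4 * (E + 1 + C)" by (simp add: field_simps)
    then show ?thesis unfolding \<kappa>_def by (rule max.coboundedI2)
  qed
  have k0: "\<kappa> \<ge> 0" by (simp add: \<kappa>_def)
  obtain D where D: "D > 0" "\<And>u::'a \<Rightarrow> real. hsp s u \<Longrightarrow> (\<integral>\<^sup>+ x. gag_density s u x \<partial>lborel) \<le> ennreal D * kin s u"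
    using gag_le_kin[OF s] by blast
  have gag: "(\<integral>\<^sup>+ x. gag_density s (un n) x \<partial>lborel) \<le> ennreal (D * \<kappa>)" for n
  proof -
    have "(\<integral>\<^sup>+ x. gag_density s (un n) x \<partial>lborel) \<le> ennreal D * kin s (un n)" by (rule D(2)[OF unH(1)])
    also have "\<dots> \<le> ennreal D * ennreal \<kappa>"
      unfolding kin_eq_kinr[OF unH(1)] by (intro mult_left_mono ennreal_leI unk) auto
    finally show ?thesis using D k0 by (simp add: ennreal_mult)
  qed
  have unm: "un n \<in> borel_measurable borel" for n using unH(1)[of n] by (simp add: hsp_def)
  obtain v r where v: "v \<in> borel_measurable borel" and r: "strict_mono (r :: nat \<Rightarrow> nat)"
    and AE: "AE x in lborel. (\<lambda>n. un (r n) x) \<longlonglongrightarrow> v x"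
    and loc: "\<And>R. (\<lambda>n. n2 (\<lambda>x. indicator (ball 0 R) x *\<^sub>R (un (r n) x - v x))) \<longlonglongrightarrow> 0"
    using fractional_rellich[of un m s "D * \<kappa>", OF unm unH(3) _ gag _ s(1)] m D(1) k0 by auto
  note [measurable] = v unm
  have vn2: "n2 v \<le> ennreal m"
  proof -
    have "n2 v = (\<integral>\<^sup>+ x. liminf (\<lambda>n. ennreal ((norm (un (r n) x))\<^sup>2)) \<partial>lborel)"
      unfolding n2_def
    proof (rule nn_integral_cong_AE)
      show "AE x in lborel. ennreal ((norm (v x))\<^sup>2) = liminf (\<lambda>n. ennreal ((norm (un (r n) x))\<^sup>2))"
        using AE
      proof eventually_elim
        case (elim x)
        have "(\<lambda>n. ennreal ((norm (un (r n) x))\<^sup>2)) \<longlonglongrightarrow> ennreal ((norm (v x))\<^sup>2)" by (intro tendsto_intros elim)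
        from lim_imp_Liminf[OF _ this] show ?case by simp
      qed
    qed
    also have "\<dots> \<le> liminf (\<lambda>n. n2 (un (r n)))" unfolding n2_def by (rule nn_integral_liminf) measurable
    also have "\<dots> \<le> ennreal m" by (rule Liminf_le) (use unH(3) in auto)
    finally show ?thesis .
  qed
  have klim: "kin s v \<le> liminf (\<lambda>n. kin s (un (r n)))"
    using s(1) by (intro kin_lower_semicontinuous[OF unm unH(3) v vn2 _ loc]) simp
  also have "\<dots> \<le> ennreal \<kappa>"
    by (rule Liminf_le) (simp_all add: kin_eq_kinr[OF unH(1)] ennreal_leI[OF unk])
  finally have kv: "kin s v \<le> ennreal \<kappa>" .
  have vH: "hsp s v"
    using v order_le_less_trans[OF vn2, of \<infinity>] order_le_less_trans[OF kv, of \<infinity>] by (simp add: hsp_def)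
  have vk: "kinr s v \<le> \<kappa>" using kv k0 unfolding kin_eq_kinr[OF vH] by (simp add: ennreal_le_iff)
  have vr: "ae_radial v" by (rule ae_radial_limit[OF unH(2) AE])
  \<comment> \<open>At this stage the mass of \<open>v\<close> is only known to be at most
    \<open>m\<close>, so \<open>v\<close> need not be admissible and this is not yet
    minimality.\<close>
  have JE: "J v \<le> E"
  proof (rule field_le_epsilon)
    fix \<eta> :: real assume \<eta>: "\<eta> > 0"
    then have e3: "\<eta> / 3 > 0" by simp
    have 1: "\<forall>\<^sub>F n in sequentially. P (un (r n)) \<le> P v + \<eta> / 3"
      by (rule P_upper_semicontinuous[OF unH unk vH vr vn2 vk m k0 AE loc e3])
    have 2: "\<forall>\<^sub>F n in sequentially. kinr s v - \<eta> / 3 \<le> kinr s (un (r n))"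
    proof (cases "kinr s v - \<eta> / 3 < 0")
      case True
      then have "kinr s v - \<eta> / 3 \<le> kinr s (un (r n))" for n using kinr_nonneg[of s "un (r n)"] by linarith
      then show ?thesis by simp
    next
      case False
      have "ennreal (kinr s v - \<eta> / 3) < ennreal (kinr s v)" using False e3 by (subst ennreal_less_iff) auto
      also have "\<dots> \<le> liminf (\<lambda>n. kin s (un (r n)))" using klim unfolding kin_eq_kinr[OF vH] .
      finally have "\<forall>\<^sub>F n in sequentially. ennreal (kinr s v - \<eta> / 3) < kin s (un (r n))" by (rule less_LiminfD)
      then show ?thesis
        by eventually_elim (use False in \<open>simp add: kin_eq_kinr[OF unH(1)] ennreal_less_iff\<close>)
    qed
    have "(\<lambda>n. 1 / real (Suc n)) \<longlonglongrightarrow> 0" using LIMSEQ_inverse_real_of_nat by (simp add: inverse_eq_divide)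
    then have "(\<lambda>n. 1 / real (Suc (r n))) \<longlonglongrightarrow> 0" using LIMSEQ_subseq_LIMSEQ[OF _ r] by (fastforce simp: comp_def)
    then have 3: "\<forall>\<^sub>F n in sequentially. 1 / real (Suc (r n)) < \<eta> / 3" using e3 by (rule order_tendstoD(2))
    have "\<forall>\<^sub>F n in sequentially. J v \<le> E + \<eta>"
      using 1 2 3
    proof eventually_elim
      case (elim n)
      have "J (un (r n)) < E + 1 / real (Suc (r n))" by (rule un(2))
      then show ?case using elim \<eta> unfolding J_def by linarith
    qed
    then show "J v \<le> E + \<eta>" by simp
  qed
  define Mv where "Mv = (LBINT x. (v x)\<^sup>2)"
  have Mvm: "Mv \<le> m" using vn2 m unfolding n2_hsp[OF vH] Mv_def by (simp add: ennreal_le_iff)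
  \<comment> \<open>A vanishing limit would have \<open>P v = 0\<close>, because
    \<open>G 0 = 0\<close>, and hence nonnegative energy, against \<open>E < 0\<close>.\<close>
  have "Mv \<noteq> 0"
  proof
    assume "Mv = 0"
    then have "AE x in lborel. (v x)\<^sup>2 = 0"
      unfolding Mv_def by (subst (asm) integral_nonneg_eq_0_iff_AE[OF square_integrable[OF vH]]) auto
    then have "P v = (LBINT x::'a. 0)"
      unfolding P_def by (intro integral_cong_AE) (auto elim!: eventually_mono)
    then have "J v \<ge> 0" using kinr_nonneg[of s v] by (simp add: J_def)
    then show False using JE E0 by simp
  qed
  moreover have "Mv \<ge> 0" unfolding Mv_def by simp
  ultimately have Mv: "Mv > 0" by simp
  define \<theta> where "\<theta> = m / Mv"
  have th: "\<theta> \<ge> 1" "(LBINT x. (v x)\<^sup>2) = m / \<theta>" using Mv Mvm m by (auto simp: \<theta>_def Mv_def[symmetric])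
  have th0: "\<theta> > 0" using th by simp
  \<comment> \<open>Dilated to mass \<open>m\<close>, \<open>v\<close> becomes a competitor. Since
    \<open>\<theta> \<ge> 1\<close>, its kinetic factor is at most \<theta>, so its energy is at
    most \<open>\<theta> * J v \<le> \<theta> * E\<close>. As \<open>E\<close> is negative, this
    forces \<open>\<theta> = 1\<close>.\<close>
  have "E \<le> \<theta> powr (1 - 2 * s / real DIM('a)) * kinr s v / 2 - \<theta> * P v"
    using E_le[OF dilate_admissible(1)[OF vH vr th0 th(2)]] unfolding dilate_admissible(2)[OF vH vr th0 th(2)] .
  also have "\<dots> \<le> \<theta> * (kinr s v / 2 - P v)"
  proof -
    have "\<theta> powr (1 - 2 * s / real DIM('a)) \<le> \<theta> powr 1" using th s by (intro powr_mono) auto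
    then have "\<theta> powr (1 - 2 * s / real DIM('a)) * kinr s v \<le> \<theta> * kinr s v"
      using kinr_nonneg[of s v] th0 by (intro mult_right_mono) auto
    then show ?thesis by (simp add: right_diff_distrib)
  qed
  also have "\<dots> \<le> \<theta> * E" using JE th0 unfolding J_def by (intro mult_left_mono) auto
  finally have "(\<theta> - 1) * E \<ge> 0" by (simp add: algebra_simps)
  then have "\<theta> \<le> 1" using E0 by (simp add: zero_le_mult_iff)
  then have "\<theta> = 1" using th by simp
  then have "Mv = m" using th(2) by (simp add: Mv_def)
  then have adm: "v \<in> admissible m" using vH vr by (simp add: admissible_def Mv_def)
  show ?thesis
  proof (intro bexI[OF _ adm] conjI ballI)
    show "J v < 0" using JE E0 by simp
    show "J v \<le> J w" if "w \<in> admissible m" for w using JE E_le[OF that] by simp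
  qed
qed

section \<open>The Euler--Lagrange equation\<close>

lemma G_increment_bound:
  assumes C: "C \<ge> 0" "\<And>t. \<bar>g t\<bar> \<le> C * \<bar>t\<bar> + \<bar>t\<bar> powr (1 + 4 * s / real DIM('a))"
    and ab: "\<bar>a\<bar> \<le> w" "\<bar>b\<bar> \<le> w"
  shows "\<bar>G b - G a\<bar> \<le> \<bar>b - a\<bar> * (C * w + w powr (1 + 4 * s / real DIM('a)))"
proof -
  have gb: "\<bar>g z\<bar> \<le> C * w + w powr (1 + 4 * s / real DIM('a))" if "\<bar>z\<bar> \<le> w" for z
    using that C(1) s by (intro order_trans[OF C(2)] add_mono mult_left_mono powr_mono2) auto
  have key: "\<bar>G y - G x\<bar> \<le> \<bar>y - x\<bar> * (C * w + w powr (1 + 4 * s / real DIM('a)))" if xy: "x < y" "\<bar>x\<bar> \<le> w" "\<bar>y\<bar> \<le> w" for x y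
  proof -
    obtain z where z: "x < z" "z < y" "G y - G x = (y - x) * g z" using MVT2[OF xy(1), of G g] G by blast
    have "\<bar>z\<bar> \<le> w" using z xy by linarith
    then show ?thesis unfolding z(3) abs_mult by (intro mult_left_mono gb) auto
  qed
  consider "a = b" | "a < b" | "b < a" by linarith
  then show ?thesis
  proof cases
    case 3
    then show ?thesis using key[OF 3 ab(2) ab(1)] by (simp add: abs_minus_commute)
  qed (use key[of a b] ab in auto)
qed

text \<open>Difference quotients along a null sequence are dominated by
  \<open>C * w\<^sup>2 + w powr q\<close>, where \<open>w\<close> bounds
  \<open>\<bar>u\<bar>\<close>, \<open>\<bar>\<phi>\<bar>\<close> and all the perturbed functions at
  once.\<close>

lemma P_directional_derivative:
  assumes u: "hsp s (u :: 'a \<Rightarrow> real)" and f: "hsp s \<phi>"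
  shows "((\<lambda>t. P (\<lambda>x. u x + t * \<phi> x)) has_real_derivative (LBINT x. g (u x) * \<phi> x)) (at 0)"
proof -
  let ?p = "1 + 4 * s / real DIM('a)" and ?q = "2 + 4 * s / real DIM('a)"
  have um[measurable]: "u \<in> borel_measurable borel" and fm[measurable]: "\<phi> \<in> borel_measurable borel"
    using u f by (auto simp: hsp_def)
  obtain C where C: "C \<ge> 0" "\<And>t. \<bar>g t\<bar> \<le> C * \<bar>t\<bar> + \<bar>t\<bar> powr ?p"
    using g_growth[OF zero_less_one] by auto
  have "((\<lambda>t. (P (\<lambda>x. u x + t * \<phi> x) - P u) / t) \<longlongrightarrow> (LBINT x. g (u x) * \<phi> x)) (at 0)"
    unfolding tendsto_at_iff_sequentially
  proof (intro allI impI)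
    fix X :: "nat \<Rightarrow> real" assume X: "\<forall>i. X i \<in> UNIV - {0}" "X \<longlonglongrightarrow> 0"
    obtain B where B: "B > 0" "\<And>n. \<bar>X n\<bar> \<le> B"
      using convergent_imp_Bseq[OF convergentI[OF X(2)]] unfolding Bseq_def by auto
    \<comment> \<open>\<open>b \<ge> \<bar>X n\<bar>\<close> gives
      \<open>\<bar>u + X n * \<phi>\<bar> \<le> w\<close>, and \<open>b \<ge> 1\<close> gives
      \<open>\<bar>\<phi>\<bar> \<le> w\<close>.\<close>
    define b where "b = B + 1"
    have b: "b \<ge> 1" "\<bar>X n\<bar> \<le> b" for n using B(1) B(2)[of n] by (auto simp: b_def)
    define w where "w x = \<bar>u x\<bar> + b * \<bar>\<phi> x\<bar>" for x
    define W where "W x = C * (w x)\<^sup>2 + w x powr ?q" for x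
    have w0: "w x \<ge> 0" for x using b by (simp add: w_def)
    \<comment> \<open>As a maximum of \<open>\<bar>u + b * \<phi>\<bar>\<close> and
      \<open>\<bar>u - b * \<phi>\<bar>\<close>, \<open>w\<close> has integrable powers because
      those two functions are in H^s; no new integrability argument arises.\<close>
    have wm: "w x = max \<bar>u x + b * \<phi> x\<bar> \<bar>u x + (- b) * \<phi> x\<bar>" for x
    proof -
      have "b * \<bar>\<phi> x\<bar> = \<bar>b * \<phi> x\<bar>" using b by (simp add: abs_mult)
      then show ?thesis unfolding w_def by (simp add: max_def abs_if split: if_splits)
    qed
    let ?h1 = "\<lambda>x. u x + b * \<phi> x" and ?h2 = "\<lambda>x. u x + (- b) * \<phi> x"
    have h: "hsp s ?h1" "hsp s ?h2" by (rule hsp_lincomb[OF u f])+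
    have wmm[measurable]: "w \<in> borel_measurable borel" unfolding w_def[abs_def] by measurable
    have w2: "(w x)\<^sup>2 \<le> (?h1 x)\<^sup>2 + (?h2 x)\<^sup>2" for x unfolding wm by (simp add: max_def)
    have wq: "w x powr ?q \<le> \<bar>?h1 x\<bar> powr ?q + \<bar>?h2 x\<bar> powr ?q" for x unfolding wm by (simp add: max_def)
    have W: "integrable lborel W"
      unfolding W_def[abs_def]
    proof (intro Bochner_Integration.integrable_add integrable_mult_right)
      show "integrable lborel (\<lambda>x. (w x)\<^sup>2)"
        by (rule Bochner_Integration.integrable_bound[OF Bochner_Integration.integrable_add[OF square_integrable[OF h(1)] square_integrable[OF h(2)]]])
          (use w2 in auto)
      show "integrable lborel (\<lambda>x. w x powr ?q)"
      proof (rule Bochner_Integration.integrable_bound[OF Bochner_Integration.integrable_add[OF Lq_integrable[OF h(1)] Lq_integrable[OF h(2)]]])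
        show "AE x in lborel. norm (w x powr ?q) \<le> norm (\<bar>?h1 x\<bar> powr ?q + \<bar>?h2 x\<bar> powr ?q)"
        proof (rule AE_I2)
          fix x
          have "norm (w x powr ?q) = w x powr ?q" by simp
          also have "\<dots> \<le> \<bar>?h1 x\<bar> powr ?q + \<bar>?h2 x\<bar> powr ?q" by (rule wq)
          also have "\<dots> \<le> norm (\<bar>?h1 x\<bar> powr ?q + \<bar>?h2 x\<bar> powr ?q)" by simp
          finally show "norm (w x powr ?q) \<le> norm (\<bar>?h1 x\<bar> powr ?q + \<bar>?h2 x\<bar> powr ?q)" .
        qed
      qed measurable
    qed
    have eq: "(P (\<lambda>x. u x + X n * \<phi> x) - P u) / X n = (LBINT x. (G (u x + X n * \<phi> x) - G (u x)) / X n)" for n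
      unfolding P_def using G_integrable[OF hsp_lincomb[OF u f, of "X n"]] G_integrable[OF u]
      by (simp add: Bochner_Integration.integral_diff)
    have "(\<lambda>n. LBINT x. (G (u x + X n * \<phi> x) - G (u x)) / X n) \<longlonglongrightarrow> (LBINT x. g (u x) * \<phi> x)"
    proof (rule integral_dominated_convergence[where w = W])
      show "AE x in lborel. norm ((G (u x + X n * \<phi> x) - G (u x)) / X n) \<le> W x" for n
      proof (rule AE_I2)
        fix x :: 'a
        have Xn: "X n \<noteq> 0" using X(1) by simp
        have Xf: "\<bar>X n * \<phi> x\<bar> \<le> b * \<bar>\<phi> x\<bar>" unfolding abs_mult using b(2)[of n] by (intro mult_right_mono) auto
        have "0 \<le> b * \<bar>\<phi> x\<bar>" using b(1) by simp
        then have uw: "\<bar>u x\<bar> \<le> w x" "\<bar>u x + X n * \<phi> x\<bar> \<le> w x" unfolding w_def using Xf by linarith+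
        have fw: "\<bar>\<phi> x\<bar> \<le> w x" unfolding w_def using mult_right_mono[OF b(1), of "\<bar>\<phi> x\<bar>"] by simp
        have "\<bar>G (u x + X n * \<phi> x) - G (u x)\<bar> \<le> \<bar>X n * \<phi> x\<bar> * (C * w x + w x powr ?p)"
          using G_increment_bound[OF C uw] by simp
        also have "\<dots> = \<bar>X n\<bar> * (\<bar>\<phi> x\<bar> * (C * w x + w x powr ?p))" by (simp add: abs_mult)
        also have "\<dots> \<le> \<bar>X n\<bar> * (w x * (C * w x + w x powr ?p))"
          using fw w0[of x] C(1) by (intro mult_left_mono mult_right_mono) auto
        also have "w x * (C * w x + w x powr ?p) = W x"
        proof (cases "w x = 0")
          case False
          then have "w x * w x powr ?p = w x powr ?q" using w0[of x] by (simp add: powr_mult_base)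
          then show ?thesis by (simp add: W_def distrib_left power2_eq_square)
        qed (simp add: W_def)
        finally show "norm ((G (u x + X n * \<phi> x) - G (u x)) / X n) \<le> W x"
          using Xn by (simp add: abs_divide divide_le_eq mult.commute)
      qed
      show "AE x in lborel. (\<lambda>n. (G (u x + X n * \<phi> x) - G (u x)) / X n) \<longlonglongrightarrow> g (u x) * \<phi> x"
      proof (rule AE_I2)
        fix x :: 'a
        have "((\<lambda>t. G (u x + t * \<phi> x)) has_real_derivative g (u x + 0 * \<phi> x) * \<phi> x) (at 0)"
          by (rule DERIV_chain'[OF _ G]) (auto intro!: derivative_eq_intros)
        then have "((\<lambda>t. (G (u x + t * \<phi> x) - G (u x)) / t) \<longlongrightarrow> g (u x) * \<phi> x) (at 0)"
          by (simp add: DERIV_def)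
        then have "((\<lambda>t. (G (u x + t * \<phi> x) - G (u x)) / t) \<circ> X) \<longlonglongrightarrow> g (u x) * \<phi> x"
          unfolding tendsto_at_iff_sequentially using X by blast
        then show "(\<lambda>n. (G (u x + X n * \<phi> x) - G (u x)) / X n) \<longlonglongrightarrow> g (u x) * \<phi> x" by (simp add: comp_def)
      qed
    qed (use W in measurable)
    then show "((\<lambda>t. (P (\<lambda>x. u x + t * \<phi> x) - P u) / t) \<circ> X) \<longlonglongrightarrow> (LBINT x. g (u x) * \<phi> x)"
      unfolding comp_def eq .
  qed
  then show ?thesis by (simp add: DERIV_def)
qed

text \<open>No abstract multiplier theorem is used. \<open>F t\<close> is the energy of
  \<open>u + t * \<phi>\<close> dilated back to mass \<open>m\<close>, an explicit real function
  with a local minimum at 0. Its derivative there contains the derivative of \<theta>, a multiple of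
  the integral of \<open>u * \<phi>\<close>, and this is where the multiplier originates.\<close>

theorem euler_lagrange:
  assumes u: "u \<in> admissible m" and min: "\<And>w. w \<in> admissible m \<Longrightarrow> J u \<le> J w" and m: "m > 0"
    and f: "hsp s \<phi>" "ae_radial \<phi>"
  shows "(LBINT x. fdiff s u x * fdiff s \<phi> x) + 2 / m * (s / real DIM('a) * kinr s u - J u) * (LBINT x. u x * \<phi> x) = (LBINT x. g (u x) * \<phi> x)"
proof -
  let ?N = "real DIM('a)"
  define \<alpha> where "\<alpha> = 1 - 2 * s / ?N"
  have uH: "hsp s u" "ae_radial u" and um: "(LBINT x. (u x)\<^sup>2) = m" using u by (auto simp: admissible_def)
  define b c K L B D where "b = (LBINT x. u x * \<phi> x)" and "c = (LBINT x. (\<phi> x)\<^sup>2)" and "K = kinr s u" and "L = kinr s \<phi>"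
    and "B = (LBINT x. fdiff s u x * fdiff s \<phi> x)" and "D = (LBINT x. g (u x) * \<phi> x)"
  define M where "M t = m + 2 * t * b + t\<^sup>2 * c" for t
  have Mt: "(LBINT x. (u x + t * \<phi> x)\<^sup>2) = M t" for t
  proof -
    have i: "integrable lborel (\<lambda>x. u x * \<phi> x)"
      using uH(1) f(1) by (intro real_L2_mult_integrable) (auto simp: hsp_def)
    have "(LBINT x. (u x + t * \<phi> x)\<^sup>2) = (LBINT x. (u x)\<^sup>2 + (2 * t) * (u x * \<phi> x) + t\<^sup>2 * (\<phi> x)\<^sup>2)"
      by (intro Bochner_Integration.integral_cong refl) (simp add: power2_sum power_mult_distrib algebra_simps)
    also have "\<dots> = M t" using i square_integrable[OF uH(1)] square_integrable[OF f(1)] by (simp add: M_def b_def c_def um)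
    finally show ?thesis .
  qed
  define \<theta> where "\<theta> t = m / M t" for t
  define F where "F t = \<theta> t powr \<alpha> * (K + 2 * t * B + t\<^sup>2 * L) / 2 - \<theta> t * P (\<lambda>x. u x + t * \<phi> x)" for t
  have M0: "M 0 = m" "\<theta> 0 = 1" using m by (auto simp: M_def \<theta>_def)
  have F0: "F 0 = J u" by (simp add: F_def M0 J_def K_def)
  have Fmin: "F 0 \<le> F t" if "M t > 0" for t
  proof -
    have th: "\<theta> t > 0" "m / \<theta> t = M t" using that m by (auto simp: \<theta>_def)
    note H = hsp_lincomb[OF uH(1) f(1), of t] ae_radial_lincomb[OF uH(2) f(2), of t]
    have M': "(LBINT x. (u x + t * \<phi> x)\<^sup>2) = m / \<theta> t" unfolding Mt th(2) ..
    have "J u \<le> \<theta> t powr (1 - 2 * s / ?N) * kinr s (\<lambda>x. u x + t * \<phi> x) / 2 - \<theta> t * P (\<lambda>x. u x + t * \<phi> x)"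
      using min[OF dilate_admissible(1)[OF H th(1) M']] unfolding dilate_admissible(2)[OF H th(1) M'] .
    then have "J u \<le> F t" unfolding F_def kinr_lincomb[OF uH(1) f(1)] \<alpha>_def K_def B_def L_def .
    then show ?thesis unfolding F0 .
  qed
  have dM: "(M has_real_derivative 2 * b) (at 0)"
    unfolding M_def[abs_def] by (auto intro!: derivative_eq_intros)
  have dth: "(\<theta> has_real_derivative - 2 * b / m) (at 0)"
    unfolding \<theta>_def[abs_def] using m M0(1)
    by (auto intro!: derivative_eq_intros dM simp: power2_eq_square)
  have dF: "(F has_real_derivative (\<alpha> * (- 2 * b / m) * K + 2 * B) / 2 - ((- 2 * b / m) * P u + D)) (at 0)"
  proof -
    have p: "((\<lambda>t. \<theta> t powr \<alpha>) has_real_derivative \<alpha> * (- 2 * b / m)) (at 0)"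
      using DERIV_powr[OF dth _ DERIV_const[of \<alpha>]] M0(2) by (simp add: mult_ac)
    have k: "((\<lambda>t. K + 2 * t * B + t\<^sup>2 * L) has_real_derivative 2 * B) (at 0)"
      by (auto intro!: derivative_eq_intros)
    have "((\<lambda>t. \<theta> t powr \<alpha> * (K + 2 * t * B + t\<^sup>2 * L) / 2 - \<theta> t * P (\<lambda>x. u x + t * \<phi> x)) has_real_derivative
      ((\<alpha> * (- 2 * b / m)) * (K + 2 * 0 * B + 0\<^sup>2 * L) + (2 * B) * (\<theta> 0 powr \<alpha>)) / 2
       - ((- 2 * b / m) * P (\<lambda>x. u x + 0 * \<phi> x) + D * \<theta> 0)) (at 0)"
      unfolding D_def
      by (intro DERIV_diff DERIV_cdivide DERIV_mult p k dth P_directional_derivative uH f)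
    then show ?thesis unfolding F_def[abs_def] M0(2) by simp
  qed
  obtain d where d: "d > 0" "\<And>t. \<bar>t\<bar> < d \<Longrightarrow> M t > 0"
  proof -
    have "isCont M 0" using dM by (rule DERIV_isCont)
    then have "(M \<longlongrightarrow> m) (at 0)" by (simp add: isCont_def M0)
    then have "\<forall>\<^sub>F t in at 0. M t > 0" using m by (rule order_tendstoD(1))
    then obtain d where "d > 0" "\<And>t. t \<noteq> 0 \<Longrightarrow> \<bar>t\<bar> < d \<Longrightarrow> M t > 0"
      unfolding eventually_at by (auto simp: dist_norm)
    then show thesis using that[of d] M0(1) m by metis
  qed
  have h1: "(\<alpha> * (- 2 * b / m) * K + 2 * B) / 2 - ((- 2 * b / m) * P u + D) = 0"
    by (rule DERIV_local_min[OF dF d(1)]) (use Fmin d(2) in auto)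
  \<comment> \<open>With \<open>\<alpha> = 1 - 2 * s / N\<close>, the factor
    \<open>\<alpha> * K / 2 - P u\<close> of the derivative of \<theta> equals
    \<open>J u - s / N * K\<close>; multiplied by \<open>- 2 * b / m\<close> this is the stated
    multiplier term.\<close>
  have h2: "2 / m * (s / ?N * K - J u) * b = (\<alpha> * (- 2 * b / m) * K) / 2 - (- 2 * b / m) * P u"
    unfolding J_def K_def[symmetric] \<alpha>_def using m by (simp add: field_simps)
  have "B + (X / 2 - Y) = D" if "(X + 2 * B) / 2 - (Y + D) = 0" for X Y
    using that by (simp add: add_divide_distrib)
  from this[OF h1] show ?thesis unfolding B_def[symmetric] D_def[symmetric] K_def[symmetric] b_def[symmetric] h2 .
qed

end

section \<open>Existence of normalised solutions\<close>

lemma lebesgue_real_borel_version: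
  fixes w :: "'a::euclidean_space \<Rightarrow> real"
  assumes "w \<in> borel_measurable lebesgue"
  obtains u where "u \<in> borel_measurable borel" "AE x in lebesgue. w x = u x"
  using completion_ex_borel_measurable_real[OF assms] by (auto simp: AE_completion_iff)

lemma Hs_r_borel_version:
  fixes w :: "'a::euclidean_space \<Rightarrow> real"
  assumes w: "w \<in> Hs_r s"
  obtains u where "hsp s u" "ae_radial u" "AE x in lebesgue. w x = u x"
proof -
  have wH: "w \<in> Hs s" and wr: "\<forall>x y. norm x = norm y \<longrightarrow> w x = w y" using w unfolding Hs_r_def by blast+
  have wm: "w \<in> borel_measurable lebesgue" using wH by (simp add: Hs_def)
  obtain u where u: "u \<in> borel_measurable borel" "AE x in lebesgue. w x = u x"
    using lebesgue_real_borel_version[OF wm] by blast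
  have um: "u \<in> borel_measurable lebesgue" using u(1) by (simp add: measurable_completion)
  have "hsp s u" using Hs_cong_AE[OF u(2) wm um] wH borel_Hs_iff[OF u(1)] by blast
  moreover have "AE x in lebesgue. u x = w x" using u(2) by eventually_elim simp
  then have "ae_radial u" unfolding ae_radial_def using wm wr by blast
  ultimately show thesis using that u(2) by blast
qed

lemma lebesgue_integral_cong_borel:
  fixes f h :: "'a::euclidean_space \<Rightarrow> real"
  assumes "AE x in lebesgue. f x = h x" "h \<in> borel_measurable borel"
  shows "(LINT x|lebesgue. f x) = (LBINT x. h x)"
proof -
  have hm: "h \<in> borel_measurable lebesgue" using assms(2) by (simp add: measurable_completion)
  have "AE x in lebesgue. h x = f x" using assms(1) by eventually_elim simp
  then have "f \<in> borel_measurable lebesgue" by (rule borel_measurable_AE[OF hm])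
  then have "(LINT x|lebesgue. f x) = (LINT x|lebesgue. h x)" using hm assms(1) by (rule integral_cong_AE)
  also have "\<dots> = (LBINT x. h x)" using assms(2) by (intro integral_completion) simp
  finally show ?thesis .
qed

context mass_problem
begin

theorem exists_solution:
  assumes m: "m > 0"
  shows "\<exists>\<mu>>0. \<exists>u :: 'a \<Rightarrow> real. solves_Pm s g m \<mu> u"
proof -
  obtain u where u: "u \<in> admissible m" "J u < 0" "\<And>w. w \<in> admissible m \<Longrightarrow> J u \<le> J w"
    using exists_minimiser[OF m] by blast
  have uH: "hsp s u" "ae_radial u" and um: "(LBINT x. (u x)\<^sup>2) = m" using u(1) by (auto simp: admissible_def)
  have ub[measurable]: "u \<in> borel_measurable borel" using uH by (simp add: hsp_def)
  \<comment> \<open>\<open>Hs_r\<close> asks for radiality at every point, which the Borel minimiser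
    has only up to a null set. The solution is this representative, and all integrals are
    unchanged.\<close>
  obtain w where w: "w \<in> borel_measurable lebesgue" "\<forall>x y. norm x = norm y \<longrightarrow> w x = w y" "AE x in lebesgue. u x = w x"
    using uH(2) unfolding ae_radial_def by blast
  have ul: "u \<in> borel_measurable lebesgue" using ub by (simp add: measurable_completion)
  have "w \<in> Hs s" using Hs_cong_AE[OF w(3) ul w(1)] borel_Hs_iff[OF ub] uH(1) by blast
  then have wHr: "w \<in> Hs_r s" unfolding Hs_r_def using w(2) by blast
  define \<mu> where "\<mu> = 2 / m * (s / real DIM('a) * kinr s u - J u)"
  have "s / real DIM('a) * kinr s u \<ge> 0" using s kinr_nonneg[of s u] by simp
  then have mu: "\<mu> > 0" unfolding \<mu>_def using m u(2) by (intro mult_pos_pos) auto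
  have "solves_Pm s g m \<mu> w"
    unfolding solves_Pm_def
  proof (intro conjI ballI)
    show "w \<in> Hs_r s" by (rule wHr)
    show "(LINT x|lebesgue. (w x)\<^sup>2) = m"
      unfolding um[symmetric] by (rule lebesgue_integral_cong_borel) (use w(3) in \<open>auto elim!: eventually_mono\<close>)
    fix \<psi> :: "'a \<Rightarrow> real" assume p: "\<psi> \<in> Hs_r s"
    then obtain \<phi> where f: "hsp s \<phi>" "ae_radial \<phi>" "AE x in lebesgue. \<psi> x = \<phi> x"
      by (rule Hs_r_borel_version)
    have fb[measurable]: "\<phi> \<in> borel_measurable borel" using f by (simp add: hsp_def)
    have fl: "\<phi> \<in> borel_measurable lebesgue" using fb by (simp add: measurable_completion)
    have pl: "\<psi> \<in> borel_measurable lebesgue" using p by (simp add: Hs_r_def Hs_def)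
    note [measurable] = measurable_fdiff[OF uH(1)] measurable_fdiff[OF f(1)]
    have eqw: "frac_lap_half s w = frac_lap_half s u" using frac_lap_half_cong_AE[OF w(3) ul w(1)] by simp
    have eqp: "frac_lap_half s \<psi> = frac_lap_half s \<phi>" by (rule frac_lap_half_cong_AE[OF f(3) pl fl])
    have "(LINT x|lebesgue. frac_lap_half s w x * frac_lap_half s \<psi> x + \<mu> * w x * \<psi> x)
      = (LBINT x. fdiff s u x * fdiff s \<phi> x + \<mu> * (u x * \<phi> x))"
    proof (rule lebesgue_integral_cong_borel)
      show "AE x in lebesgue. frac_lap_half s w x * frac_lap_half s \<psi> x + \<mu> * w x * \<psi> x = fdiff s u x * fdiff s \<phi> x + \<mu> * (u x * \<phi> x)"
        unfolding eqw eqp using frac_lap_half_AE[OF uH(1)] frac_lap_half_AE[OF f(1)] w(3) f(3)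
        by eventually_elim simp
    qed measurable
    also have "\<dots> = (LBINT x. fdiff s u x * fdiff s \<phi> x) + \<mu> * (LBINT x. u x * \<phi> x)"
    proof -
      have "integrable lborel (\<lambda>x. fdiff s u x * fdiff s \<phi> x)"
        using uH(1) f(1) n2_fdiff[OF uH(1)] n2_fdiff[OF f(1)] by (intro real_L2_mult_integrable) (auto simp: hsp_def)
      moreover have "integrable lborel (\<lambda>x. u x * \<phi> x)"
        using uH(1) f(1) by (intro real_L2_mult_integrable) (auto simp: hsp_def)
      ultimately show ?thesis by simp
    qed
    also have "\<dots> = (LBINT x. g (u x) * \<phi> x)"
      unfolding \<mu>_def by (rule euler_lagrange[OF u(1) u(3) m f(1,2)])
    also have "\<dots> = (LINT x|lebesgue. g (w x) * \<psi> x)"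
      by (rule lebesgue_integral_cong_borel[symmetric]) (use w(3) f(3) in \<open>auto elim: eventually_elim2\<close>)
    finally show "(LINT x|lebesgue. frac_lap_half s w x * frac_lap_half s \<psi> x + \<mu> * w x * \<psi> x) = (LINT x|lebesgue. g (w x) * \<psi> x)" .
  qed
  then show ?thesis using mu by blast
qed

end

lemma continuous_has_antiderivative:
  fixes g :: "real \<Rightarrow> real"
  assumes "continuous_on UNIV g"
  shows "\<exists>G. G 0 = 0 \<and> (\<forall>t. (G has_real_derivative g t) (at t))"
proof -
  define G where "G t = (LBINT y=ereal 0..ereal t. g y)" for t
  have "(G has_real_derivative g t) (at t)" for t
  proof -
    \<comment> \<open>An interval around 0 with \<open>t\<close> in its interior, so that the
      derivative within it is the two-sided one, also for negative \<open>t\<close>.\<close>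
    define a where "a = \<bar>t\<bar> + 1"
    have "(G has_vector_derivative g t) (at t within {- a..a})"
      unfolding G_def[abs_def]
      by (rule interval_integral_FTC2) (use assms in \<open>auto simp: a_def intro: continuous_on_subset\<close>)
    then show ?thesis
      by (simp add: has_real_derivative_iff_has_vector_derivative at_within_Icc_at a_def)
  qed
  then show ?thesis by (intro exI[of _ G]) (simp add: G_def)
qed

theorem theorem1p2:
  fixes g :: "real \<Rightarrow> real" and s m :: real
  assumes N2: "DIM('a::euclidean_space) \<ge> 2"
    and s: "0 < s" "s < 1"
    and g1: "continuous_on UNIV g" "((\<lambda>t. g t / t) \<longlongrightarrow> 0) (at 0)"
    and g2: "((\<lambda>t. g t / \<bar>t\<bar> powr (1 + 4 * s / real DIM('a))) \<longlongrightarrow> 0) at_infinity"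
    and g3: "\<exists>t0>0. integral {0..t0} g > 0"
    and g4: "filterlim (\<lambda>t. g t / (\<bar>t\<bar> powr (4 * s / real DIM('a)) * t)) at_top (at 0)"
    and m: "m > 0"
  shows "\<exists>\<mu> > 0. \<exists>u :: 'a \<Rightarrow> real. solves_Pm s g m \<mu> u"
proof -
  obtain G where G: "G 0 = 0" "\<And>t. (G has_real_derivative g t) (at t)"
    using continuous_has_antiderivative[OF g1(1)] by blast
  interpret mass_problem g G s "TYPE('a)"
    by unfold_locales (use N2 s g1 g2 g4 G in simp_all)
  show ?thesis by (rule exists_solution[OF m])
qed

end
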